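(* Let $N \geq 2$ and let $\Omega \subset \mathbb{R}^N$ be a radially symmetric bounded domain. Let $p>1$ and let $k \geq 1$ be an integer. Then the following inequalities are satisfied: $$\lambda_2(p;\Omega) \leq \dots \leq \lambda_{N+1}(p;\Omega) \leq \tau_1(p;\Omega);$$ $$\lambda_{2k}(p;\Omega) \leq \lambda_{2k+1}(p;\Omega) \leq \tau_k(p;\Omega).$$
   Context: Let $p>1$. For a bounded open set $U\subset\mathbb{R}^N$, the first eigenvalue of the Dirichlet $p$-Laplacian is $$\lambda_1(p;U)=\min\Big\{\int_U|\nabla u|^p\,dx \,:\, u\in W^{1,p}_0(U),\ \|u\|_{L^p(U)}=1\Big\}.$$ Variational eigenvalues. Let $\mathcal{S}_p=\{u\in W^{1,p}_0(\Omega): \|u\|_{L^p(\Omega)}=1\}$. A set $\mathcal{A}\subset W^{1,p}_0(\Omega)$ is symmetric if $u\in\mathcal{A}$ implies $-u\in\mathcal{A}$. Its Krasnosel'skii genus is $$\gamma(\mathcal{A})=\inf\{k\in\mathbb{N} : \text{there exists a continuous odd map } f:\mathcal{A}\to S^{k-1}\},$$ with $\gamma(\mathcal{A})=+\infty$ if no such $k$ exists; here $S^{k-1}$ is the $(k-1)$-dimensional sphere and $\mathbb{N}=\{1,2,\dots\}$. Let $\Gamma_k(p)$ be the collection of all $\mathcal{A}\subset\mathcal{S}_p$ that are symmetric, compact (in $W_0^{1,p}(\Omega)$) and satisfy $\gamma(\mathcal{A})\geq k$. Define $$\lambda_k(p;\Omega)=\inf_{\mathcal{A}\in\Gamma_k(p)}\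 \max_{u\in\mathcal{A}}\int_\Omega|\nabla u|^p\,dx,\qquad k\in\mathbb{N}.$$ Symmetric eigenvalues. Use spherical coordinates in $\mathbb{R}^N$: $x_1=r\cos\theta_1$, $x_2=r\sin\theta_1\cos\theta_2$, ..., $x_{N-1}=r\sin\theta_1\cdots\sin\theta_{N-2}\cos\theta_{N-1}$, $x_N=r\sin\theta_1\cdots\sin\theta_{N-2}\sin\theta_{N-1}$, with $r\in[0,+\infty)$, $(\theta_1,\dots,\theta_{N-2})\in[0,\pi]^{N-2}$, $\theta_{N-1}\in[0,2\pi)$. For $k\in\mathbb{N}$ let $$\mathcal{W}_1(k)=\Big\{x\in\Omega : 0<\theta_{N-1}<\frac{\pi}{k}\Big\},\qquad \tau_k(p;\Omega)=\lambda_1(p;\mathcal{W}_1(k)).$$ *)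

theory Defs
  imports "HOL-Analysis.Analysis"
begin

section \<open>Smooth functions with compact support\<close>

definition partial_deriv :: "'n \<Rightarrow> (real^'n \<Rightarrow> real) \<Rightarrow> real^'n \<Rightarrow> real" where
  "partial_deriv i f x = frechet_derivative f (at x) (axis i 1)"

primrec C_k :: "nat \<Rightarrow> (real^'n \<Rightarrow> real) \<Rightarrow> bool" where
  "C_k 0 f \<longleftrightarrow> continuous_on UNIV f"
| "C_k (Suc m) f \<longleftrightarrow> (\<forall>x. f differentiable (at x)) \<and> (\<forall>i. C_k m (partial_deriv i f))"

text \<open>Functions in \<open>C\<^sub>c\<^sup>\<infinity>(U)\<close> are represented by their extension by zero to the whole space.\<close>

definition test_function :: "(real^'n) set \<Rightarrow> (real^'n \<Rightarrow> real) \<Rightarrow> bool" where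
  "test_function U \<phi> \<longleftrightarrow>
     (\<forall>m. C_k m \<phi>) \<and> compact (closure {x. \<phi> x \<noteq> 0}) \<and> closure {x. \<phi> x \<noteq> 0} \<subseteq> U"


section \<open>Lebesgue and Sobolev spaces\<close>

definition in_Lp :: "real \<Rightarrow> 'a measure \<Rightarrow> ('a \<Rightarrow> 'b::euclidean_space) \<Rightarrow> bool" where
  "in_Lp p M f \<longleftrightarrow> f \<in> borel_measurable M \<and> integrable M (\<lambda>x. norm (f x) powr p)"

definition Lp_norm :: "real \<Rightarrow> 'a measure \<Rightarrow> ('a \<Rightarrow> 'b::euclidean_space) \<Rightarrow> real" where
  "Lp_norm p M f = (\<integral>x. norm (f x) powr p \<partial>M) powr (1 / p)"

text \<open>A function on \<open>U\<close> is represented by a function on the whole space whose values outside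
  \<open>U\<close> are irrelevant, because only the measure \<open>lebesgue_on U\<close> is used.\<close>

definition weak_gradient ::
  "(real^'n) set \<Rightarrow> (real^'n \<Rightarrow> real) \<Rightarrow> (real^'n \<Rightarrow> real^'n) \<Rightarrow> bool" where
  "weak_gradient U u g \<longleftrightarrow>
     (\<forall>\<phi> i. test_function U \<phi> \<longrightarrow>
        (\<integral>x. u x * partial_deriv i \<phi> x \<partial>lebesgue_on U) = - (\<integral>x. g x $ i * \<phi> x \<partial>lebesgue_on U))"

definition sobolev :: "real \<Rightarrow> (real^'n) set \<Rightarrow> (real^'n \<Rightarrow> real) \<Rightarrow> bool" where
  "sobolev p U u \<longleftrightarrow>
     in_Lp p (lebesgue_on U) u \<and> (\<exists>g. in_Lp p (lebesgue_on U) g \<and> weak_gradient U u g)"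

text \<open>The weak gradient is determined almost everywhere on \<open>U\<close>; one version of it is selected.\<close>

definition wgrad :: "real \<Rightarrow> (real^'n) set \<Rightarrow> (real^'n \<Rightarrow> real) \<Rightarrow> real^'n \<Rightarrow> real^'n" where
  "wgrad p U u = (SOME g. in_Lp p (lebesgue_on U) g \<and> weak_gradient U u g)"

definition sobolev_norm :: "real \<Rightarrow> (real^'n) set \<Rightarrow> (real^'n \<Rightarrow> real) \<Rightarrow> real" where
  "sobolev_norm p U u = Lp_norm p (lebesgue_on U) u + Lp_norm p (lebesgue_on U) (wgrad p U u)"

definition sobolev0 :: "real \<Rightarrow> (real^'n) set \<Rightarrow> (real^'n \<Rightarrow> real) \<Rightarrow> bool" where
  "sobolev0 p U u \<longleftrightarrow>
     sobolev p U u \<and>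
     (\<exists>\<phi>. (\<forall>n. test_function U (\<phi> n)) \<and>
          (\<lambda>n. sobolev_norm p U (\<lambda>x. u x - \<phi> n x)) \<longlonglongrightarrow> 0)"

text \<open>As usual, the elements of the space \<open>W\<^sub>0\<^sup>1\<^sup>,\<^sup>p(U)\<close> are classes of functions that agree almost
  everywhere on \<open>U\<close>. Such a class is a set of functions, and \<open>rep\<close> picks one of them.\<close>

definition ae_class :: "(real^'n) set \<Rightarrow> (real^'n \<Rightarrow> real) \<Rightarrow> (real^'n \<Rightarrow> real) set" where
  "ae_class U u = {v \<in> borel_measurable (lebesgue_on U). AE x in lebesgue_on U. v x = u x}"

definition rep :: "(real^'n \<Rightarrow> real) set \<Rightarrow> real^'n \<Rightarrow> real" where
  "rep C = (SOME u. u \<in> C)"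

definition neg_class :: "(real^'n \<Rightarrow> real) set \<Rightarrow> (real^'n \<Rightarrow> real) set" where
  "neg_class C = (\<lambda>u x. - u x) ` C"

definition W0 :: "real \<Rightarrow> (real^'n) set \<Rightarrow> (real^'n \<Rightarrow> real) set set" where
  "W0 p U = {ae_class U u | u. sobolev0 p U u}"

definition W0_dist ::
  "real \<Rightarrow> (real^'n) set \<Rightarrow> (real^'n \<Rightarrow> real) set \<Rightarrow> (real^'n \<Rightarrow> real) set \<Rightarrow> real" where
  "W0_dist p U C D = sobolev_norm p U (\<lambda>x. rep C x - rep D x)"

definition W0_topology :: "real \<Rightarrow> (real^'n) set \<Rightarrow> (real^'n \<Rightarrow> real) set topology" where
  "W0_topology p U = Metric_space.mtopology (W0 p U) (W0_dist p U)"

definition energy :: "real \<Rightarrow> (real^'n) set \<Rightarrow> (real^'n \<Rightarrow> real) set \<Rightarrow> real" where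
  "energy p U C = (\<integral>x. norm (wgrad p U (rep C) x) powr p \<partial>lebesgue_on U)"

definition Lp_sphere :: "real \<Rightarrow> (real^'n) set \<Rightarrow> (real^'n \<Rightarrow> real) set set" where
  "Lp_sphere p U = {C \<in> W0 p U. Lp_norm p (lebesgue_on U) (rep C) = 1}"


section \<open>Eigenvalues\<close>

text \<open>Infima and suprema are taken in the extended reals, so an infimum over the empty set is
  \<open>\<infinity>\<close>. The minimum in the definition of the first eigenvalue and the maximum over a compact
  set in that of the variational eigenvalues are attained, and equal the \<open>INF\<close> and \<open>SUP\<close> below.\<close>

definition first_eigenvalue :: "real \<Rightarrow> (real^'n) set \<Rightarrow> ereal" where
  "first_eigenvalue p U = (INF C \<in> Lp_sphere p U. ereal (energy p U C))"

text \<open>\<open>nsphere (k - 1)\<close> is the unit sphere of \<open>\<real>\<^sup>k\<close>, whose points are functions on \<open>nat\<close> that vanish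
  from \<open>k\<close> onwards. \<open>Inf {} = \<infinity>\<close> in \<^typ>\<open>enat\<close>.\<close>

definition genus :: "real \<Rightarrow> (real^'n) set \<Rightarrow> (real^'n \<Rightarrow> real) set set \<Rightarrow> enat" where
  "genus p U A = Inf {enat k | k. k \<ge> 1 \<and>
     (\<exists>f. continuous_map (subtopology (W0_topology p U) A) (nsphere (k - 1)) f \<and>
          (\<forall>C\<in>A. f (neg_class C) = (\<lambda>i. - f C i)))}"

text \<open>The empty set has genus 1 and no maximum of the energy, so it is excluded; this only
  matters for \<open>k \<le> 1\<close>.\<close>

definition genus_family :: "real \<Rightarrow> (real^'n) set \<Rightarrow> nat \<Rightarrow> (real^'n \<Rightarrow> real) set set set" where
  "genus_family p U k =
     {A. A \<noteq> {} \<and> A \<subseteq> Lp_sphere p U \<and> (\<forall>C\<in>A. neg_class C \<in> A) \<and>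
         compactin (W0_topology p U) A \<and> genus p U A \<ge> enat k}"

definition variational_eigenvalue :: "real \<Rightarrow> (real^'n) set \<Rightarrow> nat \<Rightarrow> ereal" where
  "variational_eigenvalue p U k =
     (INF A \<in> genus_family p U k. SUP C \<in> A. ereal (energy p U C))"


section \<open>Spherical coordinates and symmetric eigenvalues\<close>

definition radially_symmetric :: "(real^'n) set \<Rightarrow> bool" where
  "radially_symmetric S \<longleftrightarrow> (\<forall>x y. x \<in> S \<longrightarrow> norm y = norm x \<longrightarrow> y \<in> S)"

text \<open>The bijection \<open>e\<close> from \<open>{1..N}\<close> to the index type numbers the coordinates: the coordinate
  \<open>x\<^sub>j\<close> is \<open>x $ e j\<close>.\<close>

definition spherical_coords :: "(nat \<Rightarrow> 'n) \<Rightarrow> real \<Rightarrow> (nat \<Rightarrow> real) \<Rightarrow> real^'n \<Rightarrow> bool" where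
  "spherical_coords e r \<theta> x \<longleftrightarrow>
     0 \<le> r \<and> (\<forall>j\<in>{1..CARD('n) - 2}. \<theta> j \<in> {0..pi}) \<and> \<theta> (CARD('n) - 1) \<in> {0..<2 * pi} \<and>
     (\<forall>j\<in>{1..CARD('n) - 1}. x $ e j = r * (\<Prod>i = 1..<j. sin (\<theta> i)) * cos (\<theta> j)) \<and>
     x $ e (CARD('n)) = r * (\<Prod>i = 1..CARD('n) - 1. sin (\<theta> i))"

text \<open>The angle \<open>\<theta>\<^sub>N\<^sub>-\<^sub>1\<close> is determined by \<open>x\<close> exactly when \<open>x\<^sub>N\<^sub>-\<^sub>1\<close> and \<open>x\<^sub>N\<close> do not both vanish.
  Points where they do have every value of this angle, and do not belong to the (open) wedge.\<close>

definition wedge :: "(nat \<Rightarrow> 'n) \<Rightarrow> (real^'n) set \<Rightarrow> nat \<Rightarrow> (real^'n) set" where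
  "wedge e \<Omega> k =
     {x \<in> \<Omega>. (x $ e (CARD('n) - 1), x $ e (CARD('n))) \<noteq> (0, 0) \<and>
        (\<exists>r \<theta>. spherical_coords e r \<theta> x \<and> 0 < \<theta> (CARD('n) - 1) \<and> \<theta> (CARD('n) - 1) < pi / real k)}"

definition symmetric_eigenvalue :: "(nat \<Rightarrow> 'n) \<Rightarrow> real \<Rightarrow> (real^'n) set \<Rightarrow> nat \<Rightarrow> ereal" where
  "symmetric_eigenvalue e p \<Omega> k = first_eigenvalue p (wedge e \<Omega> k)"

end

theory Submission
  imports Defs "HOL-Homology.Homology"
begin

text \<open>
  No minimizers are needed. If \<open>\<mu>\<close> exceeds the energy of an element of the \<open>L\<^sup>p\<close> sphere of the
  wedge, there is a test function \<open>\<phi>\<close> on the wedge with Rayleigh quotient below \<open>\<mu>\<close>. Disjointly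
  supported copies of \<open>\<phi>\<close>, placed according to a parameter \<open>\<theta> \<in> \<Theta>\<close> and combined with coefficients
  from \<open>S\<^sup>m\<close>, form a compact symmetric set on which the energy is at most \<open>\<mu>\<close>. Its genus is at least
  \<open>n + 2\<close> unless some map \<open>F : S\<^sup>m \<times> \<Theta> \<rightarrow> S\<^sup>n\<close>, odd in the first argument, factors through it.

  For \<open>\<tau>\<^sub>k\<close> the copies are the rotations of \<open>\<phi>\<close> by the angles \<open>\<theta> + j \<pi> / k\<close> with \<open>j < 2 k\<close> and
  \<open>\<theta> \<in> [0, \<pi> / k]\<close>. Passing from \<open>\<theta> = 0\<close> to \<open>\<theta> = \<pi> / k\<close> shifts the coefficients cyclically, so
  \<open>F\<close> would be a homotopy between an odd self-map of \<open>S\<^sup>2\<^sup>k\<^sup>-\<^sup>1\<close> and its composition with the shift.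
  The former has odd degree by Borsuk's theorem, and the shift has degree \<open>-1\<close>.

  For \<open>\<tau>\<^sub>1\<close> and \<open>\<lambda>\<^sub>N\<^sub>+\<^sub>1\<close> one first makes \<open>\<phi>\<close> axially symmetric, by averaging over its slices through the
  axis. The copies then occupy the half-spaces \<open>x \<bullet> \<nu> > 0\<close> and \<open>x \<bullet> \<nu> < 0\<close> with \<open>\<nu> \<in> S\<^sup>N\<^sup>-\<^sup>1\<close>. Replacing
  \<open>\<nu>\<close> by \<open>-\<nu>\<close> exchanges the coefficients, so \<open>F\<close> is even in \<open>\<nu>\<close> for equal coefficients and odd in \<open>\<nu>\<close>
  for opposite ones. An even and an odd self-map of \<open>S\<^sup>N\<^sup>-\<^sup>1\<close> would be homotopic, but the degree of the
  former is even.
\<close>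

section \<open>Odd and even maps of spheres\<close>

text \<open>The axial symmetrization is forced by topology. A copy of \<open>\<phi>\<close> in the
  half-space of \<open>\<nu>\<close> needs an orthogonal map \<open>R\<close> that sends
  \<open>\<nu>\<close> to the axis, and in general no such \<open>R\<close> can be chosen
  continuously over the whole sphere. For an axially symmetric function the copy depends on
  \<open>\<nu>\<close> alone. A slice need not extend smoothly across the axis, so the distance
  \<open>r\<close> to the axis is replaced by \<open>sqrt (r^2 + \<delta>^2)\<close>; the resulting
  map is smooth and its derivative has norm at most one, which keeps the energy under control. The
  coefficients are rescaled to the unit sphere of l^p, where disjoint supports make the p-th powers
  of both norms weighted averages over the copies. The degree arguments compare a map with its
  restriction to an equator, which must be mapped into itself. To push a merely continuous map there
  without losing its parity, a line is needed that the cone over the image of the equator misses.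
  Lipschitz approximation provides it: a Lipschitz image of a bounded set of dimension n cannot fill
  a cube of dimension n + 1.\<close>

definition sph :: "nat \<Rightarrow> (nat \<Rightarrow> real) set" where
  "sph n = {x. (\<Sum>i\<le>n. (x i)\<^sup>2) = 1 \<and> (\<forall>i>n. x i = 0)}"

lemma nsphere_sph: "nsphere n = top_of_set (sph n)"
  by (simp add: nsphere sph_def euclidean_product_topology)

lemma topspace_nsphere_sph: "topspace (nsphere n) = sph n"
  by (simp add: nsphere_sph)

lemma sph_neg: "(\<lambda>i. - x i) \<in> sph n \<longleftrightarrow> x \<in> sph n"
  by (simp add: sph_def)

lemma sph_abs_le_1:
  assumes "x \<in> sph n" shows "\<bar>x i\<bar> \<le> 1"
proof (cases "i \<le> n")
  case True
  have "(x i)\<^sup>2 \<le> (\<Sum>i\<le>n. (x i)\<^sup>2)" using True by (intro member_le_sum) auto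
  then show ?thesis using assms by (simp add: sph_def abs_square_le_1)
qed (use assms in \<open>auto simp: sph_def\<close>)

lemma compact_sph: "compact (sph n)"
proof -
  have "compactin (product_topology (\<lambda>_. euclidean) UNIV) (PiE UNIV (\<lambda>_::nat. {-1..1::real}))"
    by (simp add: compactin_PiE)
  then have 1: "compact (PiE UNIV (\<lambda>_::nat. {-1..1::real}))"
    by (simp add: euclidean_product_topology)
  have 2: "closed (sph n)"
  proof -
    have c: "continuous_on UNIV (\<lambda>x::nat\<Rightarrow>real. x i)" for i
      by (rule continuous_on_product_coordinates)
    have "closed {x::nat\<Rightarrow>real. (\<Sum>i\<le>n. (x i)\<^sup>2) = 1}"
      by (intro closed_Collect_eq continuous_intros c)
    moreover have "closed {x::nat\<Rightarrow>real. \<forall>i>n. x i = 0}"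
      by (intro closed_Collect_all closed_Collect_imp closed_Collect_eq continuous_intros c) auto
    ultimately show ?thesis unfolding sph_def using closed_Int[of "{x. _ x}" "{x. _ x}"] by (simp add: Collect_conj_eq closed_Int)
  qed
  have "sph n \<subseteq> PiE UNIV (\<lambda>_::nat. {-1..1::real})"
    using sph_abs_le_1 by (fastforce simp: PiE_def Pi_def abs_le_iff)
  then show ?thesis using 1 2 by (metis compact_Int_closed inf.absorb_iff2)
qed

text \<open>Radial projection onto \<open>sph n\<close>. Homotopies are written down linearly in the
  ambient space and then projected, so that only the absence of common zeros has to be
  checked.\<close>

definition nrm :: "nat \<Rightarrow> (nat \<Rightarrow> real) \<Rightarrow> nat \<Rightarrow> real" where
  "nrm n v = (\<lambda>i. v i / sqrt (\<Sum>j\<le>n. (v j)\<^sup>2))"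

lemma sum_squares_pos:
  fixes v :: "nat \<Rightarrow> real"
  assumes "i \<le> n" "v i \<noteq> 0" shows "(\<Sum>j\<le>n. (v j)\<^sup>2) > 0"
  using assms by (intro sum_pos2[of _ i]) auto

lemma nrm_in_sph:
  assumes "\<exists>i\<le>n. v i \<noteq> 0" "\<And>i. i > n \<Longrightarrow> v i = 0"
  shows "nrm n v \<in> sph n"
proof -
  have "(\<Sum>j\<le>n. (v j)\<^sup>2) > 0" using assms(1) sum_squares_pos by blast
  then have "(\<Sum>i\<le>n. (v i / sqrt (\<Sum>j\<le>n. (v j)\<^sup>2))\<^sup>2) = 1"
    by (simp add: power_divide flip: sum_divide_distrib)
  with assms(2) show ?thesis by (simp add: sph_def nrm_def)
qed

lemma nrm_sph: "x \<in> sph n \<Longrightarrow> nrm n x = x"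
  by (simp add: sph_def nrm_def)

lemma nrm_scale: "\<sigma> \<in> {1,-1} \<Longrightarrow> nrm n (\<lambda>i. \<sigma> * v i) = (\<lambda>i. \<sigma> * nrm n v i)"
  by (auto simp: nrm_def)

lemma homotopic_nrm:
  assumes K: "\<And>i. continuous_on ({0..1::real} \<times> sph m) (\<lambda>(t,x). K t x i)"
    and nz: "\<And>t x. t \<in> {0..1} \<Longrightarrow> x \<in> sph m \<Longrightarrow> \<exists>i\<le>n. K t x i \<noteq> 0"
    and z: "\<And>t x i. t \<in> {0..1} \<Longrightarrow> x \<in> sph m \<Longrightarrow> i > n \<Longrightarrow> K t x i = 0"
  shows "homotopic_with (\<lambda>_. True) (nsphere m) (nsphere n) (\<lambda>x. nrm n (K 0 x)) (\<lambda>x. nrm n (K 1 x))"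
proof -
  have "homotopic_with_canon (\<lambda>_. True) (sph m) (sph n) (\<lambda>x. nrm n (K 0 x)) (\<lambda>x. nrm n (K 1 x))"
    unfolding homotopic_with_def
  proof (intro exI conjI allI ballI impI)
    let ?h = "\<lambda>p. nrm n (K (fst p) (snd p))"
    have "continuous_on ({0..1} \<times> sph m) ?h"
    proof (rule continuous_on_coordinatewise_then_product)
      fix i
      have c: "continuous_on ({0..1} \<times> sph m) (\<lambda>p. K (fst p) (snd p) j)" for j
        using K[of j] by (simp add: case_prod_unfold)
      have "(\<Sum>j\<le>n. (K (fst p) (snd p) j)\<^sup>2) \<noteq> 0" if "p \<in> {0..1} \<times> sph m" for p
        using nz[of "fst p" "snd p"] that sum_squares_pos[of _ n "K (fst p) (snd p)"] by force
      then show "continuous_on ({0..1} \<times> sph m) (\<lambda>p. nrm n (K (fst p) (snd p)) i)"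
        unfolding nrm_def by (intro continuous_intros c) auto
    qed
    moreover have "?h \<in> {0..1} \<times> sph m \<rightarrow> sph n"
      using nz z by (auto intro!: nrm_in_sph)
    ultimately show "continuous_map (prod_topology (top_of_set {0..1}) (top_of_set (sph m))) (top_of_set (sph n)) ?h"
      by (simp add: prod_topology_subtopology_eu)
  qed auto
  then show ?thesis by (simp add: nsphere_sph)
qed

text \<open>A Lipschitz image of a bounded subset of R^n is too thin to fill the cube
  \<open>[1,2]^(n+1)\<close>, even together with its reflection. Here \<open>Y a\<close> is the
  position in R^n and \<open>G a\<close> the image. The proof is a pigeonhole count of grid points
  in the cube.\<close>

lemma lipschitz_family_misses_point:
  fixes Y :: "'a \<Rightarrow> nat \<Rightarrow> real" and G :: "'a \<Rightarrow> nat \<Rightarrow> real"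
  assumes R: "\<And>a j. a \<in> A \<Longrightarrow> j < n \<Longrightarrow> \<bar>Y a j\<bar> \<le> R"
    and lip: "\<And>a b i. a \<in> A \<Longrightarrow> b \<in> A \<Longrightarrow> i \<le> n \<Longrightarrow> \<bar>G a i - G b i\<bar> \<le> L * (\<Sum>j<n. \<bar>Y a j - Y b j\<bar>)"
  obtains z where "\<And>i. i \<le> n \<Longrightarrow> z i \<in> {1..2}"
    "\<And>a s. a \<in> A \<Longrightarrow> s \<in> {1,-1} \<Longrightarrow> \<exists>i\<le>n. z i \<noteq> s * G a i"
proof -
  have "\<exists>z. (\<forall>i\<le>n. z i \<in> {1..2}) \<and> (\<forall>a\<in>A. \<forall>s\<in>{1,-1::real}. \<exists>i\<le>n. z i \<noteq> s * G a i)"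
  proof (rule ccontr)
    assume "\<not> ?thesis"
    then have hit: "\<exists>a s. a \<in> A \<and> s \<in> {1,-1::real} \<and> (\<forall>i\<le>n. z i = s * G a i)" if "\<forall>i\<le>n. z i \<in> {1..2}" for z
      using that by blast
    obtain Rn :: nat where Rn: "R \<le> real Rn" using real_arch_simple by blast
    \<comment> \<open>Two positions in one cell of side \<open>1 / (D * M)\<close> have images
      closer than the grid width \<open>1 / M\<close>.\<close>
    obtain D :: nat where D: "2 * \<bar>L\<bar> * (n+1) < real D" using reals_Archimedean2 by blast
    then have Dpos: "D > 0" by (smt (verit) mult_nonneg_nonneg of_nat_0_le_iff of_nat_0_less_iff)
    define C where "C = 2 * Rn * D + 1"
    \<comment> \<open>There are \<open>(M + 1) ^ (n + 1)\<close> grid points, but at most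
      \<open>2 * (C * M) ^ n\<close> pairs of a sign and a cell. This \<open>M\<close> makes the
      first number larger.\<close>
    define M where "M = 2 * C ^ n + 1"
    have Mpos: "M > 0" by (simp add: M_def)
    define z where "z k = (\<lambda>i. 1 + real (k i) / real M)" for k :: "nat \<Rightarrow> nat"
    define P where "P = (PiE {..n} (\<lambda>_. {..M}))"
    have "\<forall>i\<le>n. z k i \<in> {1..2}" if "k \<in> P" for k
      using that Mpos unfolding P_def z_def by (auto simp: PiE_iff field_simps)
    then have *: "\<forall>k\<in>P. \<exists>q. fst q \<in> A \<and> snd q \<in> {1,-1::real} \<and> (\<forall>i\<le>n. z k i = snd q * G (fst q) i)"
      using hit by (metis fst_conv snd_conv)
    obtain q where q: "\<forall>k\<in>P. fst (q k) \<in> A \<and> snd (q k) \<in> {1,-1::real} \<and>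
        (\<forall>i\<le>n. z k i = snd (q k) * G (fst (q k)) i)"
      using bchoice[OF *] by blast
    define a where "a k = fst (q k)" for k
    define s where "s k = snd (q k)" for k
    have a: "a k \<in> A" and s: "s k \<in> {1,-1}" if "k \<in> P" for k
      using q that unfolding a_def s_def by blast+
    have zk: "z k i = s k * G (a k) i" if "k \<in> P" "i \<le> n" for k i
      using q that unfolding a_def s_def by blast
    define c where "c k = (\<lambda>j\<in>{..<n}. \<lfloor>Y (a k) j * real (D * M)\<rfloor>)" for k
    define Q where "Q = {1,-1::real} \<times> (PiE {..<n} (\<lambda>_. {- int (Rn * D * M)..int (Rn * D * M)}))"
    \<comment> \<open>Each grid point equals its signed image. Two of them with the same sign and
      the same cell therefore differ by less than the grid width in every coordinate and
      coincide.\<close>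
    have "inj_on (\<lambda>k. (s k, c k)) P"
    proof (rule inj_onI)
      fix k l assume k: "k \<in> P" and l: "l \<in> P" and eq: "(s k, c k) = (s l, c l)"
      have d: "\<bar>Y (a k) j - Y (a l) j\<bar> \<le> 1 / (real D * real M)" if "j < n" for j
      proof -
        have "\<lfloor>Y (a k) j * real (D * M)\<rfloor> = \<lfloor>Y (a l) j * real (D * M)\<rfloor>"
proof -
          have "c k j = c l j" using eq by simp
          then show ?thesis using that by (simp add: c_def)
        qed
        then have "\<bar>Y (a k) j * real (D * M) - Y (a l) j * real (D * M)\<bar> \<le> 1" by linarith
        then have "\<bar>(Y (a k) j - Y (a l) j) * real (D * M)\<bar> \<le> 1"
          unfolding left_diff_distrib .
        then have "\<bar>Y (a k) j - Y (a l) j\<bar> * real (D * M) \<le> 1"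
          unfolding abs_mult by simp
        then show ?thesis using Dpos Mpos by (simp add: field_simps)
      qed
      have "k i = l i" if i: "i \<le> n" for i
      proof -
        have "\<bar>z k i - z l i\<bar> = \<bar>G (a k) i - G (a l) i\<bar>"
          using zk[OF k i] zk[OF l i] eq s[OF k] by (auto simp: abs_minus_commute)
        also have "\<dots> \<le> L * (\<Sum>j<n. \<bar>Y (a k) j - Y (a l) j\<bar>)"
          using lip a k l i by blast
        also have "\<dots> \<le> \<bar>L\<bar> * (\<Sum>j<n. 1 / (real D * real M))"
          by (intro mult_mono sum_mono) (use d in \<open>auto intro: sum_nonneg\<close>)
        also have "\<dots> < 1 / real M"
          using D Dpos Mpos by (simp add: field_simps)
        finally have "\<bar>real (k i) - real (l i)\<bar> < 1"
          using Mpos by (simp add: z_def field_simps flip: diff_divide_distrib)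
        then show ?thesis by linarith
      qed
      then show "k = l" using k l unfolding P_def by (metis PiE_ext atMost_iff)
    qed
    moreover have "(\<lambda>k. (s k, c k)) ` P \<subseteq> Q"
    proof clarify
      fix k assume k: "k \<in> P"
      have "\<lfloor>Y (a k) j * real (D * M)\<rfloor> \<in> {- int (Rn * D * M)..int (Rn * D * M)}" if "j < n" for j
      proof -
        have "\<bar>Y (a k) j\<bar> \<le> real Rn" using R[OF a[OF k] that] Rn by linarith
        then have "\<bar>Y (a k) j * real (D * M)\<bar> \<le> real Rn * real (D * M)"
          by (simp add: abs_mult mult_right_mono)
        then have "\<bar>Y (a k) j * real (D * M)\<bar> \<le> real_of_int (int (Rn * D * M))" by (simp add: algebra_simps)
        then have "- real_of_int (int (Rn * D * M)) \<le> Y (a k) j * real (D * M)"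
          "Y (a k) j * real (D * M) \<le> real_of_int (int (Rn * D * M))" by linarith+
        then show ?thesis
          unfolding atLeastAtMost_iff le_floor_iff floor_le_iff of_int_minus by linarith
      qed
      then show "(s k, c k) \<in> Q" using s[OF k] by (simp add: Q_def c_def)
    qed
    moreover have fQ: "finite Q" by (auto simp: Q_def intro!: finite_PiE)
    ultimately have "card P \<le> card Q" by (meson card_inj_on_le)
    moreover have "card P = (M+1)^(n+1)" by (simp add: P_def card_PiE)
    moreover have "card Q = 2 * (2 * Rn * D * M + 1) ^ n"
    proof -
      have "card {- int (Rn * D * M)..int (Rn * D * M)} = 2 * Rn * D * M + 1"
        unfolding card_atLeastAtMost_int by (simp add: nat_eq_iff)
      then show ?thesis unfolding Q_def by (simp add: card_cartesian_product card_PiE)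
    qed
    ultimately have "(M+1)^(n+1) \<le> 2 * (2 * Rn * D * M + 1) ^ n" by simp
    also have "\<dots> \<le> 2 * (C * M) ^ n"
      using Mpos by (intro mult_left_mono power_mono) (auto simp: C_def algebra_simps)
    also have "\<dots> = (2 * C ^ n) * M ^ n" by (simp add: power_mult_distrib)
    also have "\<dots> < M * M ^ n" using Mpos by (simp add: M_def)
    also have "\<dots> \<le> (M+1)^(n+1)" using power_mono[of M "M+1" "n+1"] by simp
    finally show False by simp
  qed
  then show ?thesis using that by blast
qed

section \<open>Coordinates and Lipschitz approximation on spheres\<close>

lemma continuous_on_coordinate: "continuous_on S (\<lambda>x::nat \<Rightarrow> real. x j)"
  by (rule continuous_on_subset[OF continuous_on_product_coordinates]) simp

lemma base_in_sph: "(\<lambda>i. if i = 0 then 1 else 0) \<in> sph n"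
  using in_topspace_nsphere by (simp add: topspace_nsphere_sph)

lemma sph_mono: "m \<le> n \<Longrightarrow> sph m \<subseteq> sph n"
proof
  fix x assume mn: "m \<le> n" and x: "x \<in> sph m"
  have "(\<Sum>i\<le>m. (x i)\<^sup>2) = (\<Sum>i\<le>n. (x i)\<^sup>2)"
    using mn x by (intro sum.mono_neutral_left) (auto simp: sph_def)
  then show "x \<in> sph n" using x mn by (auto simp: sph_def)
qed

lemma sph_nonzero_coordinate:
  assumes "x \<in> sph n" shows "\<exists>i\<le>n. \<bar>x i\<bar> \<ge> 1 / (real n + 1)"
proof (rule ccontr)
    assume "\<not> ?thesis"
    then have lt: "\<bar>x i\<bar> < 1 / (real n + 1)" if "i \<le> n" for i using that by force
    have "(x i)\<^sup>2 < 1 / (real n + 1)" if "i \<le> n" for i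
    proof -
      have "(x i)\<^sup>2 = \<bar>x i\<bar> * \<bar>x i\<bar>" by (simp add: power2_eq_square)
      also have "\<dots> \<le> \<bar>x i\<bar> * 1" using sph_abs_le_1[OF assms] by (intro mult_left_mono) auto
      finally show ?thesis using lt[OF that] by simp
    qed
    then have "(\<Sum>i\<le>n. (x i)\<^sup>2) < (\<Sum>i\<le>n. 1 / (real n + 1))"
      by (intro sum_strict_mono) auto
    also have "\<dots> = 1" by simp
    finally show False using assms by (simp add: sph_def)
qed

text \<open>Lipschitz functions on the compact sphere form an algebra that contains the coordinates
  and so separates points; Stone-Weierstrass applies. Products stay Lipschitz because the factors
  are bounded.\<close>

lemma lipschitz_approximation:
  assumes f: "continuous_on (sph n) f" and e: "e > 0"
  obtains g :: "(nat \<Rightarrow> real) \<Rightarrow> real" and L where "L \<ge> 0"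
    "\<And>x y. x \<in> sph n \<Longrightarrow> y \<in> sph n \<Longrightarrow> \<bar>g x - g y\<bar> \<le> L * (\<Sum>j\<le>n. \<bar>x j - y j\<bar>)"
    "\<And>x. x \<in> sph n \<Longrightarrow> \<bar>f x - g x\<bar> < e"
proof -
  let ?d = "\<lambda>x y::nat\<Rightarrow>real. \<Sum>j\<le>n. \<bar>x j - y j\<bar>"
  define R where "R = {g. \<exists>L\<ge>0. \<forall>x\<in>sph n. \<forall>y\<in>sph n. \<bar>g x - g y\<bar> \<le> L * ?d x y}"
  have R_E: thesis if "g \<in> R" and *: "\<And>L. L \<ge> 0 \<Longrightarrow>
    (\<And>x y. x \<in> sph n \<Longrightarrow> y \<in> sph n \<Longrightarrow> \<bar>g x - g y\<bar> \<le> L * ?d x y) \<Longrightarrow> thesis" for g thesis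
  proof -
    obtain L where "L \<ge> 0 \<and> (\<forall>x\<in>sph n. \<forall>y\<in>sph n. \<bar>g x - g y\<bar> \<le> L * ?d x y)"
      using \<open>g \<in> R\<close> unfolding R_def mem_Collect_eq by blast
    then show thesis by (intro *[of L]) auto
  qed
  have cont: "continuous_on (sph n) g" if gR: "g \<in> R" for g
  proof -
    obtain L where L: "\<And>x y. x \<in> sph n \<Longrightarrow> y \<in> sph n \<Longrightarrow> \<bar>g x - g y\<bar> \<le> L * ?d x y"
      using R_E[OF gR] by blast
    show ?thesis unfolding continuous_on_def
    proof
      fix x assume x: "x \<in> sph n"
      have c: "((\<lambda>y. y j) \<longlongrightarrow> x j) (at x within sph n)" for j
        using continuous_on_coordinate[of "sph n" j] x by (simp add: continuous_on_def)
      have "((\<lambda>y. L * ?d y x) \<longlongrightarrow> L * ?d x x) (at x within sph n)"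
        by (intro tendsto_intros c)
      then have "((\<lambda>y. L * ?d y x) \<longlongrightarrow> 0) (at x within sph n)" by simp
      then have "((\<lambda>y. g y - g x) \<longlongrightarrow> 0) (at x within sph n)"
        by (rule Lim_null_comparison[rotated]) (use L x in \<open>auto simp: eventually_at_filter\<close>)
      then show "(g \<longlongrightarrow> g x) (at x within sph n)" by (simp add: LIM_zero_iff)
    qed
  qed
  interpret function_ring_on R "sph n"
  proof
    show "compact (sph n)" by (rule compact_sph)
    show "continuous_on (sph n) g" if "g \<in> R" for g using cont that .
    show "(\<lambda>x. g x + h x) \<in> R" if gR: "g \<in> R" "h \<in> R" for g h
    proof -
      obtain L where L: "L \<ge> 0" "\<And>x y. x \<in> sph n \<Longrightarrow> y \<in> sph n \<Longrightarrow> \<bar>g x - g y\<bar> \<le> L * ?d x y"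
        using R_E[OF gR(1)] by blast
      obtain K where K: "K \<ge> 0" "\<And>x y. x \<in> sph n \<Longrightarrow> y \<in> sph n \<Longrightarrow> \<bar>h x - h y\<bar> \<le> K * ?d x y"
        using R_E[OF gR(2)] by blast
      have "\<bar>(g x + h x) - (g y + h y)\<bar> \<le> (L + K) * ?d x y" if "x \<in> sph n" "y \<in> sph n" for x y
        using L(2)[OF that] K(2)[OF that] unfolding distrib_right by linarith
      then show ?thesis using L(1) K(1) unfolding R_def by (intro CollectI exI[of _ "L+K"]) auto
    qed
    show "(\<lambda>x. g x * h x) \<in> R" if gR: "g \<in> R" "h \<in> R" for g h
    proof -
      obtain L where L: "L \<ge> 0" "\<And>x y. x \<in> sph n \<Longrightarrow> y \<in> sph n \<Longrightarrow> \<bar>g x - g y\<bar> \<le> L * ?d x y"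
        using R_E[OF gR(1)] by blast
      obtain K where K: "K \<ge> 0" "\<And>x y. x \<in> sph n \<Longrightarrow> y \<in> sph n \<Longrightarrow> \<bar>h x - h y\<bar> \<le> K * ?d x y"
        using R_E[OF gR(2)] by blast
      have "bounded (g ` sph n)" "bounded (h ` sph n)"
        using cont[OF gR(1)] cont[OF gR(2)] compact_sph by (auto intro!: compact_imp_bounded compact_continuous_image)
      then obtain B D where B: "\<And>x. x \<in> sph n \<Longrightarrow> \<bar>g x\<bar> \<le> B" and D: "\<And>x. x \<in> sph n \<Longrightarrow> \<bar>h x\<bar> \<le> D"
        unfolding bounded_iff by auto
      have BD: "B \<ge> 0" "D \<ge> 0" using B[OF base_in_sph] D[OF base_in_sph] by auto
      have "\<bar>g x * h x - g y * h y\<bar> \<le> (B * K + D * L) * ?d x y" if xy: "x \<in> sph n" "y \<in> sph n" for x y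
      proof -
        have "g x * h x - g y * h y = g x * (h x - h y) + h y * (g x - g y)" by (simp add: algebra_simps)
        also have "\<bar>\<dots>\<bar> \<le> \<bar>g x\<bar> * \<bar>h x - h y\<bar> + \<bar>h y\<bar> * \<bar>g x - g y\<bar>"
          by (metis abs_mult abs_triangle_ineq)
        also have "\<dots> \<le> B * (K * ?d x y) + D * (L * ?d x y)"
          using B[OF xy(1)] D[OF xy(2)] L(2)[OF xy] K(2)[OF xy] BD by (intro add_mono mult_mono) auto
        finally show ?thesis by (simp add: algebra_simps)
      qed
      then show ?thesis using L(1) K(1) BD unfolding R_def by (intro CollectI exI[of _ "B*K+D*L"]) auto
    qed
    show "(\<lambda>_. c) \<in> R" for c by (auto simp: R_def intro!: exI[of _ 0])
    show "\<exists>g\<in>R. g x \<noteq> g y" if xy: "x \<in> sph n" "y \<in> sph n" "x \<noteq> y" for x y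
    proof -
      obtain j where j: "x j \<noteq> y j" using xy(3) by auto
      then have jn: "j \<le> n" using xy by (force simp: sph_def not_le)
      have "(\<lambda>x. x j) \<in> R" unfolding R_def
        by (intro CollectI exI[of _ 1]) (use jn in \<open>auto intro!: member_le_sum[of j "{..n}" "\<lambda>j. \<bar>_ j - _ j\<bar>"]\<close>)
      then show ?thesis using j by (intro bexI[of _ "\<lambda>x. x j"])
    qed
  qed
  obtain g where g: "g \<in> R" "\<forall>x\<in>sph n. \<bar>f x - g x\<bar> < e" using Stone_Weierstrass_basic[OF f e] by blast
  show ?thesis
  proof (rule R_E[OF g(1)])
    fix L assume "L \<ge> 0" "\<And>x y. x \<in> sph n \<Longrightarrow> y \<in> sph n \<Longrightarrow> \<bar>g x - g y\<bar> \<le> L * ?d x y"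
    then show ?thesis using that[of L g] g(2) by auto
  qed
qed

text \<open>The cone over the image of S^m is parametrized by the points \<open>r * x\<close> of
  R^(m+1) but lies in R^(m+2), so it misses a point of the cube. The lower bound \<open>c\<close>
  makes only radii up to \<open>2 / c\<close> relevant, and negative radii are covered by the
  sign.\<close>

lemma lipschitz_cone_misses_direction:
  fixes g :: "(nat \<Rightarrow> real) \<Rightarrow> nat \<Rightarrow> real"
  assumes L: "L \<ge> 0"
    and lip: "\<And>x y i. x \<in> sph m \<Longrightarrow> y \<in> sph m \<Longrightarrow> i \<le> Suc m \<Longrightarrow> \<bar>g x i - g y i\<bar> \<le> L * (\<Sum>j\<le>m. \<bar>x j - y j\<bar>)"
    and c: "c > 0" "\<And>x. x \<in> sph m \<Longrightarrow> \<exists>i\<le>Suc m. \<bar>g x i\<bar> \<ge> c"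
  obtains q where "\<And>i. i \<le> Suc m \<Longrightarrow> q i \<in> {1..2}"
    "\<And>x r. x \<in> sph m \<Longrightarrow> \<exists>i\<le>Suc m. q i \<noteq> r * g x i"
proof -
  define e0 :: "nat \<Rightarrow> real" where "e0 = (\<lambda>i. if i = 0 then 1 else 0)"
  have e0: "e0 \<in> sph m" unfolding e0_def by (rule base_in_sph)
  define B where "B = (\<Sum>i\<le>Suc m. \<bar>g e0 i\<bar>) + L * (2 * (real m + 1))"
  have B: "\<bar>g x i\<bar> \<le> B" if "x \<in> sph m" "i \<le> Suc m" for x i
  proof -
    have "(\<Sum>j\<le>m. \<bar>x j - e0 j\<bar>) \<le> (\<Sum>j\<le>m. 2)"
      by (intro sum_mono) (use sph_abs_le_1[OF that(1)] sph_abs_le_1[OF e0] in \<open>smt (verit)\<close>)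
    then have "L * (\<Sum>j\<le>m. \<bar>x j - e0 j\<bar>) \<le> L * (2 * (real m + 1))"
      using L by (intro mult_left_mono) (auto simp: algebra_simps)
    moreover have "\<bar>g e0 i\<bar> \<le> (\<Sum>i\<le>Suc m. \<bar>g e0 i\<bar>)"
      by (rule member_le_sum) (use that in auto)
    ultimately show ?thesis using lip[OF that(1) e0 that(2)] unfolding B_def by linarith
  qed
  have B0: "B \<ge> 0" using B[OF e0, of 0] by auto
  define A where "A = sph m \<times> {0..2/c}"
  define Y where "Y a j = snd a * fst a j" for a :: "(nat\<Rightarrow>real)\<times>real" and j :: nat
  define G where "G a i = snd a * g (fst a) i" for a i
  \<comment> \<open>A Lipschitz constant of \<open>r * g x\<close> as a function of
    \<open>r * x\<close>: the first term accounts for the change of \<open>g\<close>, and the bound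
    \<open>B\<close> of \<open>g\<close> for the change of the radius.\<close>
  define K where "K = L * (1 + (real m + 1)) + B"
  obtain z where z: "\<And>i. i \<le> Suc m \<Longrightarrow> z i \<in> {1..2}"
    and za: "\<And>a s. a \<in> A \<Longrightarrow> s \<in> {1,-1} \<Longrightarrow> \<exists>i\<le>Suc m. z i \<noteq> s * G a i"
  proof (rule lipschitz_family_misses_point[of A "Suc m" Y "2/c" G K])
    fix a j assume a: "a \<in> A"
    show "\<bar>Y a j\<bar> \<le> 2 / c"
    proof -
      have "\<bar>Y a j\<bar> = snd a * \<bar>fst a j\<bar>" using a by (auto simp: Y_def A_def abs_mult)
      also have "\<dots> \<le> snd a * 1" using a sph_abs_le_1 by (intro mult_left_mono) (auto simp: A_def)
      finally show ?thesis using a by (auto simp: A_def)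
    qed
  next
    fix a b i assume a: "a \<in> A" and b: "b \<in> A" and i: "i \<le> Suc m"
    obtain x r y s where ab: "a = (x,r)" "b = (y,s)" by fastforce
    have xy: "x \<in> sph m" "y \<in> sph m" and rs: "0 \<le> r" "0 \<le> s" using a b ab by (auto simp: A_def)
    define S where "S = (\<Sum>j\<le>m. \<bar>r * x j - s * y j\<bar>)"
    have L2: "L2_set (\<lambda>j. t * w j) {..m} = t" if "w \<in> sph m" "t \<ge> 0" for t and w :: "nat \<Rightarrow> real"
      using that by (simp add: L2_set_def power_mult_distrib sph_def flip: sum_distrib_left)
    have d: "L2_set (\<lambda>j. r * x j - s * y j) {..m} \<le> S"
      unfolding S_def by (rule L2_set_le_sum_abs)
    have d': "L2_set (\<lambda>j. s * y j - r * x j) {..m} \<le> S"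
      unfolding S_def using L2_set_le_sum_abs[of "\<lambda>j. s * y j - r * x j" "{..m}"] by (simp add: abs_minus_commute)
    have "r \<le> L2_set (\<lambda>j. r * x j - s * y j) {..m} + s"
      using L2_set_triangle_ineq[of "\<lambda>j. r * x j - s * y j" "\<lambda>j. s * y j" "{..m}"] L2 xy rs by simp
    moreover have "s \<le> L2_set (\<lambda>j. s * y j - r * x j) {..m} + r"
      using L2_set_triangle_ineq[of "\<lambda>j. s * y j - r * x j" "\<lambda>j. r * x j" "{..m}"] L2 xy rs by simp
    \<comment> \<open>The radius is the Euclidean norm of \<open>r * x\<close>, so it changes by at
      most the distance of the two points.\<close>
    ultimately have rs_S: "\<bar>r - s\<bar> \<le> S" using d d' by linarith
    have "r * (\<Sum>j\<le>m. \<bar>x j - y j\<bar>) = (\<Sum>j\<le>m. \<bar>r * x j - r * y j\<bar>)"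
      using rs by (simp add: sum_distrib_left abs_mult flip: right_diff_distrib)
    also have "\<dots> \<le> (\<Sum>j\<le>m. \<bar>r * x j - s * y j\<bar> + \<bar>r - s\<bar>)"
    proof (rule sum_mono)
      fix j
      have "\<bar>s * y j - r * y j\<bar> = \<bar>r - s\<bar> * \<bar>y j\<bar>" by (simp add: abs_minus_commute[of r s] flip: left_diff_distrib abs_mult)
      also have "\<dots> \<le> \<bar>r - s\<bar> * 1" by (rule mult_left_mono) (use sph_abs_le_1[OF xy(2)] in auto)
      finally have "\<bar>s * y j - r * y j\<bar> \<le> \<bar>r - s\<bar>" by simp
      then show "\<bar>r * x j - r * y j\<bar> \<le> \<bar>r * x j - s * y j\<bar> + \<bar>r - s\<bar>"
        using abs_triangle_ineq[of "r * x j - s * y j" "s * y j - r * y j"] by simp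
    qed
    also have "\<dots> = S + (real m + 1) * \<bar>r - s\<bar>" by (simp add: sum.distrib S_def algebra_simps)
    also have "\<dots> \<le> S + (real m + 1) * S" using rs_S by (intro add_left_mono mult_left_mono) auto
    finally have 1: "r * (\<Sum>j\<le>m. \<bar>x j - y j\<bar>) \<le> (1 + (real m + 1)) * S" by (simp add: algebra_simps)
    have "r * g x i - s * g y i = r * (g x i - g y i) + (r - s) * g y i" by (simp add: algebra_simps)
    also have "\<bar>\<dots>\<bar> \<le> r * \<bar>g x i - g y i\<bar> + \<bar>r - s\<bar> * \<bar>g y i\<bar>"
      using abs_triangle_ineq[of "r * (g x i - g y i)" "(r - s) * g y i"] rs by (simp add: abs_mult)
    also have "\<dots> \<le> r * (L * (\<Sum>j\<le>m. \<bar>x j - y j\<bar>)) + S * B"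
      using lip[OF xy i] rs rs_S B[OF xy(2) i] by (intro add_mono mult_mono) auto
    also have "\<dots> = L * (r * (\<Sum>j\<le>m. \<bar>x j - y j\<bar>)) + S * B" by (simp add: algebra_simps)
    also have "\<dots> \<le> L * ((1 + (real m + 1)) * S) + S * B" using 1 L by (intro add_right_mono mult_left_mono)
    also have "\<dots> = K * S" by (simp add: K_def algebra_simps)
    finally have "\<bar>r * g x i - s * g y i\<bar> \<le> K * S" .
    then show "\<bar>G a i - G b i\<bar> \<le> K * (\<Sum>j<Suc m. \<bar>Y a j - Y b j\<bar>)"
      by (simp add: G_def Y_def ab S_def lessThan_Suc_atMost)
  qed (rule that; assumption)
  show ?thesis
  proof (rule that[of z])
    fix x r assume x: "x \<in> sph m"
    show "\<exists>i\<le>Suc m. z i \<noteq> r * g x i"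
    proof (rule ccontr)
      assume "\<not> ?thesis"
      then have eq: "z i = r * g x i" if "i \<le> Suc m" for i using that by blast
      obtain i where i: "i \<le> Suc m" "\<bar>g x i\<bar> \<ge> c" using c(2)[OF x] by blast
      have "\<bar>r\<bar> * c \<le> \<bar>r\<bar> * \<bar>g x i\<bar>" using i by (intro mult_left_mono) auto
      also have "\<dots> = \<bar>z i\<bar>" using eq[OF i(1)] by (simp add: abs_mult)
      also have "\<dots> \<le> 2" using z[OF i(1)] by auto
      finally have "\<bar>r\<bar> \<le> 2 / c" using c by (simp add: field_simps)
      then have "(x, \<bar>r\<bar>) \<in> A" using x by (auto simp: A_def)
      moreover have "z i = (if r \<ge> 0 then 1 else -1) * G (x, \<bar>r\<bar>) i" if "i \<le> Suc m" for i
        using eq[OF that] by (auto simp: G_def)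
      ultimately show False using za[of "(x,\<bar>r\<bar>)" "if r \<ge> 0 then 1 else -1"] by fastforce
    qed
  qed (use z in auto)
qed

text \<open>After approximation by a Lipschitz map, the cone over the image of the equator misses some
  direction up to sign, and \<open>f\<close> can be pushed away from it into the equator.\<close>

lemma equator_preserving_deformation:
  assumes cf: "continuous_map (nsphere (Suc m)) (nsphere (Suc m)) f" and \<sigma>: "\<sigma> \<in> {1,-1::real}"
    and par: "\<And>x. x \<in> sph (Suc m) \<Longrightarrow> f (\<lambda>i. - x i) = (\<lambda>i. \<sigma> * f x i)"
  obtains f' where "continuous_map (nsphere (Suc m)) (nsphere (Suc m)) f'"
    "\<And>x. x \<in> sph (Suc m) \<Longrightarrow> f' (\<lambda>i. - x i) = (\<lambda>i. \<sigma> * f' x i)"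
    "homotopic_with (\<lambda>_. True) (nsphere (Suc m)) (nsphere (Suc m)) f f'"
    "f' \<in> sph m \<rightarrow> sph m"
proof -
  define n where "n = Suc m"
  have f_in: "f x \<in> sph n" if "x \<in> sph n" for x
    using cf that by (auto simp: n_def nsphere_sph)
  have f_cont: "continuous_on (sph n) (\<lambda>x. f x i)" for i
    using cf by (auto simp: n_def nsphere_sph intro: continuous_on_product_then_coordinatewise)
  \<comment> \<open>Some coordinate of \<open>f x\<close> has modulus at least \<open>2 * e\<close>,
    so an approximation with error below \<open>e\<close> keeps that coordinate away from
    zero.\<close>
  define e where "e = 1 / (2 * (real n + 1))"
  have e: "e > 0" by (simp add: e_def)
  have "\<forall>i. \<exists>g L. L \<ge> 0 \<and> (\<forall>x\<in>sph n. \<forall>y\<in>sph n. \<bar>g x - g y\<bar> \<le> L * (\<Sum>j\<le>n. \<bar>x j - y j\<bar>))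
     \<and> (\<forall>x\<in>sph n. \<bar>f x i - g x\<bar> < e)"
  proof
    fix i
    show "\<exists>g L. L \<ge> 0 \<and> (\<forall>x\<in>sph n. \<forall>y\<in>sph n. \<bar>g x - g y\<bar> \<le> L * (\<Sum>j\<le>n. \<bar>x j - y j\<bar>))
     \<and> (\<forall>x\<in>sph n. \<bar>f x i - g x\<bar> < e)"
      by (rule lipschitz_approximation[OF f_cont e, of i]) blast
  qed
  from choice[OF this] obtain g0 where "\<forall>i. \<exists>L. L \<ge> 0 \<and>
      (\<forall>x\<in>sph n. \<forall>y\<in>sph n. \<bar>g0 i x - g0 i y\<bar> \<le> L * (\<Sum>j\<le>n. \<bar>x j - y j\<bar>))
     \<and> (\<forall>x\<in>sph n. \<bar>f x i - g0 i x\<bar> < e)" ..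
  from choice[OF this] obtain L0 where gL: "\<forall>i. L0 i \<ge> 0 \<and>
      (\<forall>x\<in>sph n. \<forall>y\<in>sph n. \<bar>g0 i x - g0 i y\<bar> \<le> L0 i * (\<Sum>j\<le>n. \<bar>x j - y j\<bar>))
     \<and> (\<forall>x\<in>sph n. \<bar>f x i - g0 i x\<bar> < e)" ..
  then have L0: "L0 i \<ge> 0"
    and g0l: "x \<in> sph n \<Longrightarrow> y \<in> sph n \<Longrightarrow> \<bar>g0 i x - g0 i y\<bar> \<le> L0 i * (\<Sum>j\<le>n. \<bar>x j - y j\<bar>)"
    and g0e: "x \<in> sph n \<Longrightarrow> \<bar>f x i - g0 i x\<bar> < e" for i x y
    by blast+
  define L where "L = (\<Sum>i\<le>n. L0 i)"
  have L_ge: "L0 i \<le> L" if "i \<le> n" for i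
    unfolding L_def using that L0 by (intro member_le_sum) auto
  have Lpos: "L \<ge> 0" unfolding L_def using L0 by (intro sum_nonneg) auto
  \<comment> \<open>Averaging over antipodal pairs restores the parity \<open>\<sigma>\<close> of
    \<open>f\<close> and spoils neither the error nor the Lipschitz bound.\<close>
  define g where "g x i = (if i \<le> n then (g0 i x + \<sigma> * g0 i (\<lambda>j. - x j)) / 2 else 0)" for x i
  have g_par: "g (\<lambda>i. - x i) = (\<lambda>i. \<sigma> * g x i)" for x
    using \<sigma> by (auto simp: g_def field_simps)
  have neg: "(\<lambda>i. - x i) \<in> sph n" if "x \<in> sph n" for x using that by (simp add: sph_neg)
  have g_close: "\<bar>f x i - g x i\<bar> < e" if x: "x \<in> sph n" for x i
  proof (cases "i \<le> n")
    case True
    have "f (\<lambda>j. - x j) i = \<sigma> * f x i" using par x by (simp add: n_def)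
    then have "f x i = (f x i + \<sigma> * f (\<lambda>j. - x j) i) / 2" using \<sigma> by auto
    then have "f x i - g x i = ((f x i - g0 i x) + \<sigma> * (f (\<lambda>j. - x j) i - g0 i (\<lambda>j. - x j))) / 2"
      using True by (simp add: g_def algebra_simps)
    moreover have "\<bar>\<sigma> * (f (\<lambda>j. - x j) i - g0 i (\<lambda>j. - x j))\<bar> < e"
      using g0e[OF neg[OF x], of i] \<sigma> by (auto simp: abs_mult)
    ultimately show ?thesis
      using g0e[OF x, of i] abs_triangle_ineq[of "f x i - g0 i x" "\<sigma> * (f (\<lambda>j. - x j) i - g0 i (\<lambda>j. - x j))"]
      by simp
  next
    case False
    then show ?thesis using f_in[OF x] e by (simp add: g_def sph_def)
  qed
  have g_lip: "\<bar>g x i - g y i\<bar> \<le> L * (\<Sum>j\<le>n. \<bar>x j - y j\<bar>)" if xy: "x \<in> sph n" "y \<in> sph n" for x y i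
  proof (cases "i \<le> n")
    case True
    let ?d = "\<Sum>j\<le>n. \<bar>x j - y j\<bar>"
    have d0: "?d \<ge> 0" by (intro sum_nonneg) auto
    have "\<bar>g0 i (\<lambda>j. - x j) - g0 i (\<lambda>j. - y j)\<bar> \<le> L0 i * ?d"
      using g0l[OF neg neg, OF xy, of i] by (simp add: abs_minus_commute)
    then have "\<bar>\<sigma> * (g0 i (\<lambda>j. - x j) - g0 i (\<lambda>j. - y j))\<bar> \<le> L0 i * ?d" using \<sigma> by (auto simp: abs_mult)
    moreover have "g x i - g y i = ((g0 i x - g0 i y) + \<sigma> * (g0 i (\<lambda>j. - x j) - g0 i (\<lambda>j. - y j))) / 2"
      using True by (simp add: g_def right_diff_distrib add_divide_distrib diff_divide_distrib)
    ultimately have "\<bar>g x i - g y i\<bar> \<le> L0 i * ?d"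
      using g0l[OF xy, of i] abs_triangle_ineq[of "g0 i x - g0 i y" "\<sigma> * (g0 i (\<lambda>j. - x j) - g0 i (\<lambda>j. - y j))"]
      by simp
    also have "\<dots> \<le> L * ?d" using L_ge[OF True] d0 by (rule mult_right_mono)
    finally show ?thesis .
  next
    case False
    then show ?thesis using Lpos by (auto simp: g_def intro!: mult_nonneg_nonneg sum_nonneg)
  qed
  have g_cont: "continuous_on (sph n) (\<lambda>x. g x i)" for i
    unfolding continuous_on_def
  proof
    fix x assume x: "x \<in> sph n"
    have c: "((\<lambda>y. y j) \<longlongrightarrow> x j) (at x within sph n)" for j
      using continuous_on_coordinate[of "sph n" j] x by (simp add: continuous_on_def)
    have "((\<lambda>y. L * (\<Sum>j\<le>n. \<bar>y j - x j\<bar>)) \<longlongrightarrow> L * (\<Sum>j\<le>n. \<bar>x j - x j\<bar>)) (at x within sph n)"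
      by (intro tendsto_intros c)
    then have "((\<lambda>y. L * (\<Sum>j\<le>n. \<bar>y j - x j\<bar>)) \<longlongrightarrow> 0) (at x within sph n)" by simp
    then have "((\<lambda>y. g y i - g x i) \<longlongrightarrow> 0) (at x within sph n)"
      by (rule Lim_null_comparison[rotated]) (use g_lip x in \<open>auto simp: eventually_at_filter\<close>)
    then show "((\<lambda>y. g y i) \<longlongrightarrow> g x i) (at x within sph n)" by (simp add: LIM_zero_iff)
  qed
  have big: "\<exists>i\<le>n. \<bar>f x i\<bar> \<ge> 2 * e" if "x \<in> sph n" for x
  proof -
    have "2 * e = 1 / (real n + 1)" by (simp add: e_def field_simps)
    then show ?thesis using sph_nonzero_coordinate[OF f_in[OF that]] by simp
  qed
  have g_big: "\<exists>i\<le>n. \<bar>g x i\<bar> \<ge> e" if x: "x \<in> sph n" for x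
  proof -
    obtain i where "i \<le> n" "\<bar>f x i\<bar> \<ge> 2 * e" using big[OF x] by blast
    then show ?thesis using g_close[OF x, of i] by (intro exI[of _ i]) linarith
  qed
  have mn: "sph m \<subseteq> sph n" unfolding n_def by (rule sph_mono) simp
  have lip: "\<bar>g x i - g y i\<bar> \<le> L * (\<Sum>j\<le>m. \<bar>x j - y j\<bar>)" if xy: "x \<in> sph m" "y \<in> sph m" for x y i
  proof -
    have "(\<Sum>j\<le>n. \<bar>x j - y j\<bar>) = (\<Sum>j\<le>m. \<bar>x j - y j\<bar>)"
      using xy by (simp add: n_def sph_def)
    then show ?thesis using g_lip[of x y i] mn xy by auto
  qed
  have big_m: "\<exists>i\<le>Suc m. e \<le> \<bar>g x i\<bar>" if "x \<in> sph m" for x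
    using g_big[of x] mn that by (auto simp: n_def)
  obtain q where q: "\<And>i. i \<le> n \<Longrightarrow> q i \<in> {1..2::real}"
    and qm: "\<And>x r. x \<in> sph m \<Longrightarrow> \<exists>i\<le>n. q i \<noteq> r * g x i"
    unfolding n_def
  proof (rule lipschitz_cone_misses_direction[of L m g e])
    show "L \<ge> 0" "e > 0" by (rule Lpos e)+
    show "\<bar>g x i - g y i\<bar> \<le> L * (\<Sum>j\<le>m. \<bar>x j - y j\<bar>)" if "x \<in> sph m" "y \<in> sph m" for x y i
      using that by (rule lip)
    show "\<exists>i\<le>Suc m. e \<le> \<bar>g x i\<bar>" if "x \<in> sph m" for x
      using that by (rule big_m)
  qed (rule that[unfolded n_def]; assumption)
  have qn: "q n > 0" using q[of n] by auto
  \<comment> \<open>\<open>K1\<close> passes from \<open>f\<close> to \<open>g\<close>.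
    \<open>K2\<close> is a shear after which the line of \<open>q\<close> is the polar axis.
    \<open>K3\<close> multiplies the polar coordinate by \<open>|x n|\<close>, which kills it on the
    equator; this factor is even and so respects the parity.\<close>
  define K1 where "K1 t x i = f x i + t * (g x i - f x i)" for t :: real and x i
  define K2 where "K2 t x i = (if i < n then g x i - t * (q i / q n) * g x n else g x i)" for t :: real and x i
  define K3 where "K3 t x i = (if i = n then (1 - t + t * \<bar>x n\<bar>) * K2 1 x n else K2 1 x i)" for t :: real and x i
  let ?H = "homotopic_with (\<lambda>_. True) (nsphere n) (nsphere n)"
  have csnd: "continuous_on ({0..1} \<times> sph n) (\<lambda>p. h (snd p))" if "continuous_on (sph n) h" for h :: "(nat \<Rightarrow> real) \<Rightarrow> real"
    by (rule continuous_on_compose2[OF that]) (auto intro: continuous_intros)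
  note cfs = csnd[OF f_cont] and cgs = csnd[OF g_cont]
  have cxs: "continuous_on ({0..1} \<times> sph n) (\<lambda>p. snd p i)" for i
    by (rule csnd[OF continuous_on_coordinate])
  have H1: "?H (\<lambda>x. nrm n (K1 0 x)) (\<lambda>x. nrm n (K1 1 x))"
  proof (rule homotopic_nrm)
    show "continuous_on ({0..1} \<times> sph n) (\<lambda>(t, x). K1 t x i)" for i
      unfolding K1_def case_prod_unfold by (intro continuous_intros cfs cgs)
    fix t :: real and x assume t: "t \<in> {0..1}" and x: "x \<in> sph n"
    obtain i where i: "i \<le> n" "\<bar>f x i\<bar> \<ge> 2 * e" using big[OF x] by blast
    have "\<bar>t * (g x i - f x i)\<bar> \<le> 1 * \<bar>g x i - f x i\<bar>" unfolding abs_mult using t by (intro mult_right_mono) auto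
    then have "K1 t x i \<noteq> 0" using i g_close[OF x, of i] e unfolding K1_def by (smt (verit))
    then show "\<exists>i\<le>n. K1 t x i \<noteq> 0" using i by blast
    show "K1 t x i = 0" if "i > n" for i using f_in[OF x] that by (simp add: K1_def g_def sph_def)
  qed
  have K2_nz: "\<exists>i\<le>n. K2 t x i \<noteq> 0" if x: "x \<in> sph n" for t x
  proof (cases "g x n = 0")
    case True
    obtain i where "i \<le> n" "\<bar>g x i\<bar> \<ge> e" using g_big[OF x] by blast
    then show ?thesis using True e by (intro exI[of _ i]) (auto simp: K2_def)
  next
    case False
    then show ?thesis by (intro exI[of _ n]) (auto simp: K2_def)
  qed
  have K2_z: "K2 t x i = 0" if "i > n" for t x i using that by (simp add: K2_def g_def)
  have H2: "?H (\<lambda>x. nrm n (K2 0 x)) (\<lambda>x. nrm n (K2 1 x))"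
  proof (rule homotopic_nrm)
    show "continuous_on ({0..1} \<times> sph n) (\<lambda>(t, x). K2 t x i)" for i
      unfolding K2_def case_prod_unfold by (cases "i < n") (auto intro!: continuous_intros cgs simp: less_imp_neq[OF qn, symmetric])
  qed (use K2_nz K2_z in auto)
  have K3_nz: "\<exists>i\<le>n. K3 t x i \<noteq> 0" if t: "t \<in> {0..1}" and x: "x \<in> sph n" for t x
  proof (cases "\<exists>i<n. K2 1 x i \<noteq> 0")
    case True
    then show ?thesis by (auto simp: K3_def intro: less_imp_le)
  next
    case False
    then have z: "K2 1 x i = 0" if "i < n" for i using that by blast
    obtain i where "i \<le> n" "K2 1 x i \<noteq> 0" using K2_nz[OF x] by blast
    with z have gn: "K2 1 x n \<noteq> 0" by (metis le_neq_implies_less)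
    then have gn0: "g x n \<noteq> 0" by (simp add: K2_def)
    \<comment> \<open>The factor can vanish only for \<open>t = 1\<close> on the equator. There a
      zero of \<open>K3\<close> would put \<open>g x\<close> on the line of \<open>q\<close>, which
      was chosen to avoid it.\<close>
    have "1 - t + t * \<bar>x n\<bar> \<noteq> 0"
    proof
      assume "1 - t + t * \<bar>x n\<bar> = 0"
      moreover have "t * \<bar>x n\<bar> \<ge> 0" using t by auto
      ultimately have "t = 1" using t by auto
      with \<open>1 - t + t * \<bar>x n\<bar> = 0\<close> have "x n = 0" by simp
      then have xm: "x \<in> sph m"
        using topspace_nsphere_minus1[of x n] x by (simp add: n_def topspace_nsphere_sph)
      have "q i = (q n / g x n) * g x i" if "i \<le> n" for i
      proof (cases "i = n")
        case False
        then have "g x i = (q i / q n) * g x n" using z[of i] that by (simp add: K2_def)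
        then show ?thesis using gn0 qn by (simp add: field_simps)
      qed (use gn0 in auto)
      then show False using qm[OF xm] by blast
    qed
    then show ?thesis using gn by (intro exI[of _ n]) (simp add: K3_def)
  qed
  have K3_z: "K3 t x i = 0" if "i > n" for t x i using that K2_z by (simp add: K3_def)
  have H3: "?H (\<lambda>x. nrm n (K3 0 x)) (\<lambda>x. nrm n (K3 1 x))"
  proof (rule homotopic_nrm)
    have "continuous_on ({0..1} \<times> sph n) (\<lambda>p. K2 1 (snd p) i)" for i
      unfolding K2_def by (cases "i < n") (auto intro!: continuous_intros cgs simp: less_imp_neq[OF qn, symmetric])
    then show "continuous_on ({0..1} \<times> sph n) (\<lambda>(t, x). K3 t x i)" for i
      unfolding K3_def case_prod_unfold by (cases "i = n") (auto intro!: continuous_intros cxs)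
  qed (use K3_nz K3_z in auto)
  define f' where "f' x = nrm n (K3 1 x)" for x
  have e12: "K1 1 = K2 0" and e23: "K2 1 = K3 0" by (auto simp: K1_def K2_def K3_def fun_eq_iff)
  have "?H (\<lambda>x. nrm n (K1 0 x)) f'"
    using homotopic_with_trans[OF homotopic_with_trans[OF H1 H2[folded e12]] H3[folded e23]] by (simp add: f'_def[abs_def])
  then have ff': "?H f f'"
  proof (rule homotopic_with_eq)
    have "K1 0 x = f x" for x by (auto simp: K1_def fun_eq_iff)
    then show "f x = nrm n (K1 0 x)" if "x \<in> topspace (nsphere n)" for x
      using that by (simp add: topspace_nsphere_sph nrm_sph f_in)
  qed auto
  show ?thesis
  proof (rule that)
    show "homotopic_with (\<lambda>_. True) (nsphere (Suc m)) (nsphere (Suc m)) f f'" using ff' by (simp add: n_def)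
    then show "continuous_map (nsphere (Suc m)) (nsphere (Suc m)) f'"
      by (rule homotopic_with_imp_continuous_maps[THEN conjunct2])
    fix x assume "x \<in> sph (Suc m)"
    have "K3 1 (\<lambda>i. - x i) = (\<lambda>i. \<sigma> * K3 1 x i)"
      by (auto simp: K3_def K2_def g_par algebra_simps fun_eq_iff)
    then show "f' (\<lambda>i. - x i) = (\<lambda>i. \<sigma> * f' x i)" using nrm_scale[OF \<sigma>] by (simp add: f'_def)
  next
    show "f' \<in> sph m \<rightarrow> sph m"
    proof
      fix x assume x: "x \<in> sph m"
      then have xn: "x n = 0" by (simp add: sph_def n_def)
      have "f' x \<in> sph n" unfolding f'_def
        by (rule nrm_in_sph) (use K3_nz[of 1 x] K3_z x mn in auto)
      moreover have "f' x n = 0" using xn by (simp add: f'_def nrm_def K3_def)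
      ultimately show "f' x \<in> sph m"
        using topspace_nsphere_minus1[of "f' x" n] by (simp add: n_def topspace_nsphere_sph)
    qed
  qed
qed

text \<open>Induction on the dimension. The deformed map restricts to the equator, and its degrees
  on the sphere and on the equator have the same parity. On S^0 an odd map is the identity or the
  reflection, of degree 1 or -1.\<close>

theorem Borsuk_odd_degree:
  assumes "continuous_map (nsphere n) (nsphere n) f"
    and "\<And>x. x \<in> sph n \<Longrightarrow> f (\<lambda>i. - x i) = (\<lambda>i. - f x i)"
  shows "odd (Brouwer_degree2 n f)"
  using assms
proof (induction n arbitrary: f)
  case 0
  define e0 :: "nat \<Rightarrow> real" where "e0 = (\<lambda>i. if i = 0 then 1 else 0)"
  have two: "x = e0 \<or> x = (\<lambda>i. - e0 i)" if "x \<in> sph 0" for x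
  proof -
    have "x 0 = 1 \<or> x 0 = -1" using that by (simp add: sph_def power2_eq_1_iff)
    moreover have "x i = 0" if "i \<noteq> 0" for i using \<open>x \<in> sph 0\<close> that by (simp add: sph_def)
    ultimately show ?thesis by (auto simp: e0_def fun_eq_iff) 
  qed
  have e0: "e0 \<in> sph 0" unfolding e0_def by (rule base_in_sph)
  then have "f e0 \<in> sph 0" using 0(1) by (auto simp: nsphere_sph)
  then consider "f e0 = e0" | "f e0 = (\<lambda>i. - e0 i)" using two by blast
  then show ?case
  proof cases
    case 1
    then have "Brouwer_degree2 0 f = Brouwer_degree2 0 id"
      using two 0(2)[OF e0] by (intro Brouwer_degree2_eq) (fastforce simp: topspace_nsphere_sph)
    then show ?thesis by simp
  next
    case 2
    have "Brouwer_degree2 0 f = Brouwer_degree2 0 (\<lambda>x i. if i = 0 then - x i else x i)"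
    proof (rule Brouwer_degree2_eq)
      fix x assume "x \<in> topspace (nsphere 0)"
      then have x: "x = e0 \<or> x = (\<lambda>i. - e0 i)" using two by (auto simp: topspace_nsphere_sph)
      then have "f x = (\<lambda>i. - x i)" using 2 0(2)[OF e0] by auto
      also have "\<dots> = (\<lambda>i. if i = 0 then - x i else x i)" using x by (auto simp: e0_def fun_eq_iff)
      finally show "f x = (\<lambda>i. if i = 0 then - x i else x i)" .
    qed
    then show ?thesis by (simp add: Brouwer_degree2_reflection)
  qed
next
  case (Suc m)
  obtain f' where f': "continuous_map (nsphere (Suc m)) (nsphere (Suc m)) f'"
    and odd': "\<And>x. x \<in> sph (Suc m) \<Longrightarrow> f' (\<lambda>i. - x i) = (\<lambda>i. - 1 * f' x i)"
    and hom: "homotopic_with (\<lambda>_. True) (nsphere (Suc m)) (nsphere (Suc m)) f f'"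
    and im: "f' \<in> sph m \<rightarrow> sph m"
    by (rule equator_preserving_deformation[of m f "-1"]) (use Suc.prems in auto)
  have sub: "sph m \<subseteq> sph (Suc m)" by (rule sph_mono) simp
  have "even (Brouwer_degree2 (Suc m) f' - Brouwer_degree2 (Suc m - Suc 0) f')"
    by (rule Borsuk_odd_mapping_degree_step[OF f']) (use odd' im in \<open>auto simp: topspace_nsphere_sph\<close>)
  moreover have "odd (Brouwer_degree2 m f')"
  proof (rule Suc.IH)
    show "continuous_map (nsphere m) (nsphere m) f'"
      using f' im sub by (auto simp: nsphere_sph intro: continuous_on_subset)
  qed (use odd' sub in auto)
  ultimately show ?case using Brouwer_degree2_homotopic[OF hom] by simp
qed

text \<open>On the sphere the top class splits into the classes of the two hemispheres relative to the
  equator, and these are exchanged by the antipodal map up to sign. An even map therefore sends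
  both to the same class up to sign.\<close>

lemma even_map_degree_equator:
  assumes cG: "continuous_map (nsphere (Suc m)) (nsphere (Suc m)) G"
    and ev: "\<And>x. x \<in> sph (Suc m) \<Longrightarrow> G (\<lambda>i. - x i) = G x"
    and eq: "G \<in> sph m \<rightarrow> sph m"
  shows "even (Brouwer_degree2 (Suc m) G)"
proof -
  define n where "n = Suc m"
  let ?S = "nsphere n"
  define E where "E = {x::nat\<Rightarrow>real. x n = 0}"
  define U where "U = {x::nat\<Rightarrow>real. x n \<ge> 0}"
  define Lo where "Lo = {x::nat\<Rightarrow>real. x n \<le> 0}"
  define LS where "LS = subtopology ?S Lo"
  define US where "US = subtopology ?S U"
  define neg where "neg = (\<lambda>x::nat\<Rightarrow>real. \<lambda>i. - x i)"
  let ?H = "reduced_homology_group (int n) ?S"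
  let ?RE = "relative_homology_group (int n) ?S E"
  let ?RU = "relative_homology_group (int n) ?S U"
  let ?RL = "relative_homology_group (int n) ?S Lo"
  let ?A = "relative_homology_group (int n) LS E"
  let ?B = "relative_homology_group (int n) US E"
  let ?h = "reduced_homology_group (int m) (nsphere m)"
  let ?iL = "hom_induced (int n) LS E ?S E id"
  let ?iU = "hom_induced (int n) US E ?S E id"
  have sub: "E \<subseteq> U" "E \<subseteq> Lo" by (auto simp: E_def U_def Lo_def)
  have nm: "int n = 1 + int m" "int n - 1 = int m" by (auto simp: n_def)
  have subE: "subtopology ?S E = nsphere m" "subtopology LS E = nsphere m" "subtopology US E = nsphere m"
    using subtopology_nsphere_equator[of m] sub
    by (auto simp: E_def n_def LS_def US_def subtopology_subtopology Int_absorb1 inf.absorb2)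
  have topS: "topspace ?S = sph n" by (rule topspace_nsphere_sph)
  have cG': "continuous_map ?S ?S G" using cG by (simp add: n_def)
  have sphE: "sph n \<inter> E = sph m"
    using subE(1) by (metis topS topspace_nsphere_sph topspace_subtopology)
  have cneg: "continuous_map (nsphere k) (nsphere k) neg" for k
    unfolding nsphere_sph neg_def
    by (auto simp: sph_neg intro!: continuous_on_coordinatewise_then_product continuous_intros
          continuous_on_subset[OF continuous_on_product_coordinates])
  have cnegLU: "continuous_map LS US neg"
    unfolding LS_def US_def
    by (auto simp: continuous_map_in_subtopology Lo_def U_def intro: continuous_map_from_subtopology[OF cneg])
       (simp add: neg_def)
  have negE: "neg \<in> E \<rightarrow> E" by (auto simp: neg_def E_def)
  have cid: "continuous_map LS ?S id" "continuous_map US ?S id"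
    by (auto simp: LS_def US_def continuous_map_from_subtopology)
  interpret RE: comm_group ?RE by simp
  interpret RU: comm_group ?RU by simp
  interpret A: comm_group ?A by simp
  interpret B: comm_group ?B by simp
  interpret h: group ?h by simp
  interpret hm: group "homology_group (int m) (nsphere m)" by simp

  \<comment> \<open>Each hemisphere relative to the equator has the homology of the sphere relative
    to the other hemisphere. The exact sequences of the two triples then split the homology of the
    sphere relative to the equator into a direct sum.\<close>
  have sum_iso: "(\<lambda>(x, y). ?iL x \<otimes>\<^bsub>?RE\<^esub> ?iU y) \<in> Group.iso (?A \<times>\<times> ?B) ?RE"
  proof (rule conjunct1 [OF exact_sequence_sum_lemma [OF abelian_relative_homology_group]])
    show "hom_induced (int n) LS E ?S U id \<in> Group.iso ?A ?RU"
      unfolding LS_def E_def Lo_def U_def by (rule iso_relative_homology_group_lower_hemisphere)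
    show "hom_induced (int n) US E ?S Lo id \<in> Group.iso ?B ?RL"
      unfolding US_def E_def Lo_def U_def by (rule iso_relative_homology_group_upper_hemisphere)
    show "exact_seq ([?RL, ?RE, ?A], [hom_induced (int n) ?S E ?S Lo id, ?iL])"
      unfolding LS_def by (rule homology_exactness_triple_3[OF sub(2)])
    show "exact_seq ([?RU, ?RE, ?B], [hom_induced (int n) ?S E ?S U id, ?iU])"
      unfolding US_def by (rule homology_exactness_triple_3[OF sub(1)])
    show "hom_induced (int n) ?S E ?S U id (?iL x) = hom_induced (int n) LS E ?S U id x" for x
      using sub by (subst hom_induced_compose') (auto simp: cid)
    show "hom_induced (int n) ?S E ?S Lo id (?iU x) = hom_induced (int n) US E ?S Lo id x" for x
      using sub by (subst hom_induced_compose') (auto simp: cid)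
  qed
  have isoA: "hom_boundary (int n) LS E \<in> Group.iso ?A ?h"
    using iso_lower_hemisphere_reduced_homology_group[of "int m" m] by (simp add: LS_def Lo_def E_def n_def)
  have isoB: "hom_boundary (int n) US E \<in> Group.iso ?B ?h"
    using iso_upper_hemisphere_reduced_homology_group[of "int m" m] by (simp add: US_def U_def E_def n_def)
  interpret bA: group_hom ?A ?h "hom_boundary (int n) LS E"
    using isoA by (simp add: group_hom_def group_hom_axioms_def iso_def)
  interpret bB: group_hom ?B ?h "hom_boundary (int n) US E"
    using isoB by (simp add: group_hom_def group_hom_axioms_def iso_def)
  have injB: "inj_on (hom_boundary (int n) US E) (carrier ?B)"
    using isoB by (simp add: iso_iff)
  \<comment> \<open>The antipodal map of the equator is a homeomorphism, so its degree is 1 or -1.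
    Both values lead to a square below, and which one occurs is left open.\<close>
  define \<epsilon> where "\<epsilon> = Brouwer_degree2 m neg"
  have "homeomorphic_map (nsphere m) (nsphere m) neg"
    unfolding homeomorphic_map_maps homeomorphic_maps_def by (rule exI[of _ neg]) (simp add: cneg, simp add: neg_def)
  then have \<epsilon>: "\<epsilon> = 1 \<or> \<epsilon> = -1"
    using Brouwer_degree2_homeomorphic_map[of m neg] unfolding \<epsilon>_def by linarith

  \<comment> \<open>As \<open>?H\<close> is infinite cyclic, this says that \<open>G\<close> acts on
    it as an even integer.\<close>
  have square: "\<exists>w\<in>carrier ?H. hom_induced (int n) ?S {} ?S {} G v = w \<otimes>\<^bsub>?H\<^esub> w" if v: "v \<in> carrier ?H" for v
  proof -
    have vH: "v \<in> carrier (homology_group (int n) ?S)"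
      using v carrier_reduced_homology_group_subset by blast
    define jv where "jv = hom_induced (int n) ?S {} ?S E id v"
    have jv: "jv \<in> carrier ?RE" by (simp add: jv_def hom_induced_carrier)
    then obtain a b where a: "a \<in> carrier ?A" and b: "b \<in> carrier ?B" and jab: "jv = ?iL a \<otimes>\<^bsub>?RE\<^esub> ?iU b"
    proof -
      have "jv \<in> (\<lambda>(x, y). ?iL x \<otimes>\<^bsub>?RE\<^esub> ?iU y) ` carrier (?A \<times>\<times> ?B)"
        using sum_iso jv by (simp add: iso_iff)
      then show ?thesis using that by auto
    qed
    have ia: "?iL a \<in> carrier ?RE" and ib: "?iU b \<in> carrier ?RE" by (auto simp: hom_induced_carrier)
    let ?bd = "hom_boundary (int n) ?S E"
    have bd_hom: "?bd \<in> hom ?RE (homology_group (int m) (nsphere m))"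
      using hom_boundary_hom[of "int n" ?S E] by (simp add: subE nm)
    have "?bd jv = \<one>\<^bsub>homology_group (int m) (nsphere m)\<^esub>"
      using homology_exactness_axiom_1[of "int n" ?S E] vH
      by (auto simp: jv_def subE nm kernel_def)
    \<comment> \<open>\<open>jv\<close> comes from the absolute group, so its boundary is trivial
      and the hemisphere parts \<open>a\<close> and \<open>b\<close> have opposite boundaries on the
      equator.\<close>
    then have 1: "?bd (?iL a) \<otimes>\<^bsub>homology_group (int m) (nsphere m)\<^esub> ?bd (?iU b) = \<one>\<^bsub>homology_group (int m) (nsphere m)\<^esub>"
      using hom_mult[OF bd_hom ia ib] by (simp add: jab)
    have 2: "?bd (?iL a) = hom_boundary (int n) LS E a"
    proof -
      have "?bd (?iL a) = hom_induced (int n - 1) (subtopology LS E) {} (subtopology ?S E) {} id (hom_boundary (int n) LS E a)"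
        using naturality_hom_induced[OF cid(1), of E E "int n"] by (simp add: fun_eq_iff)
      also have "\<dots> = hom_boundary (int n) LS E a"
        using hom_boundary_carrier[of "int n" LS E a] by (simp add: subE hom_induced_id nm)
      finally show ?thesis .
    qed
    have 3: "?bd (?iU b) = hom_boundary (int n) US E b"
    proof -
      have "?bd (?iU b) = hom_induced (int n - 1) (subtopology US E) {} (subtopology ?S E) {} id (hom_boundary (int n) US E b)"
        using naturality_hom_induced[OF cid(2), of E E "int n"] by (simp add: fun_eq_iff)
      also have "\<dots> = hom_boundary (int n) US E b"
        using hom_boundary_carrier[of "int n" US E b] by (simp add: subE hom_induced_id nm)
      finally show ?thesis .
    qed
    let ?da = "hom_boundary (int n) LS E a"
    let ?db = "hom_boundary (int n) US E b"
    have da: "?da \<in> carrier ?h" and db: "?db \<in> carrier ?h" using a b by auto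
    have mult_h: "x \<otimes>\<^bsub>homology_group (int m) (nsphere m)\<^esub> y = x \<otimes>\<^bsub>?h\<^esub> y" for x y
      by (simp add: reduced_homology_group_def)
    have "?da \<otimes>\<^bsub>?h\<^esub> ?db = \<one>\<^bsub>?h\<^esub>"
      using 1 by (simp add: 2 3 mult_h one_reduced_homology_group)
    then have db_inv: "?db = inv\<^bsub>?h\<^esub> ?da"
      using da db by (metis h.inv_char h.inv_inv h.inv_comm h.inv_equality)
    \<comment> \<open>\<open>N\<close> is the antipodal image of \<open>a\<close> in the upper
      hemisphere. Its boundary is \<open>\<epsilon>\<close> times that of \<open>a\<close>, and that
      of \<open>b\<close> is inverse to that of \<open>a\<close>; injectivity of the boundary map
      expresses \<open>b\<close> by \<open>N\<close>.\<close>
    define N where "N = hom_induced (int n) LS E US E neg a"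
    have N: "N \<in> carrier ?B" by (simp add: N_def hom_induced_carrier)
    have dN: "hom_boundary (int n) US E N = ?da [^]\<^bsub>?h\<^esub> \<epsilon>"
    proof -
      have "hom_boundary (int n) US E N = hom_induced (int n - 1) (nsphere m) {} (nsphere m) {} neg ?da"
        using naturality_hom_induced[OF cnegLU negE, of "int n"] by (simp add: fun_eq_iff N_def subE)
      also have "\<dots> = ?da [^]\<^bsub>?h\<^esub> \<epsilon>"
        using Brouwer_degree2[OF da, of neg] by (simp add: \<epsilon>_def nm)
      finally show ?thesis .
    qed
    have "b = N [^]\<^bsub>?B\<^esub> (-\<epsilon>)"
    proof (rule inj_onD[OF injB])
      have "hom_boundary (int n) US E (N [^]\<^bsub>?B\<^esub> (-\<epsilon>)) = (?da [^]\<^bsub>?h\<^esub> \<epsilon>) [^]\<^bsub>?h\<^esub> (-\<epsilon>)"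
        using bB.hom_int_pow[OF N, of "-\<epsilon>"] dN by simp
      also have "\<dots> = ?da [^]\<^bsub>?h\<^esub> (-1::int)" using da \<epsilon> by (auto simp: h.int_pow_pow)
      also have "\<dots> = inv\<^bsub>?h\<^esub> ?da" using da by (simp add: h.int_pow_neg h.int_pow_1)
      finally show "?db = hom_boundary (int n) US E (N [^]\<^bsub>?B\<^esub> (-\<epsilon>))" by (simp add: db_inv)
    qed (use b N in \<open>auto intro: B.int_pow_closed\<close>)
    note bN = this
    let ?g = "hom_induced (int n) ?S E ?S U G"
    have GE: "G \<in> (sph n \<inter> E) \<rightarrow> U"
      using eq sphE sub by (auto simp: Pi_iff)
    \<comment> \<open>\<open>E\<close> is a whole hyperplane of functions, but \<open>G\<close> is
      controlled on the sphere only. Relative homology sees just the part of \<open>E\<close> inside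
      the space.\<close>
    have restr: "?g = hom_induced (int n) ?S (topspace ?S \<inter> E) ?S U G"
      using hom_induced_restrict[of "int n" ?S E ?S U] hom_induced_restrict[of "int n" ?S "topspace ?S \<inter> E" ?S U]
      by (simp add: fun_eq_iff)
    have restrX': "hom_induced (int n) X E ?S T k = hom_induced (int n) X (topspace X \<inter> E) ?S T k" for X T k
      using hom_induced_restrict[of "int n" X E ?S T] hom_induced_restrict[of "int n" X "topspace X \<inter> E" ?S T]
      by (simp add: fun_eq_iff)
    have tLS: "topspace LS \<inter> E \<subseteq> topspace ?S \<inter> E" "topspace US \<inter> E \<subseteq> topspace ?S \<inter> E"
      by (auto simp: LS_def US_def)
    have gL: "?g (?iL a) = hom_induced (int n) LS E ?S U G a"
    proof -
      have "?g (?iL a) = hom_induced (int n) ?S (topspace ?S \<inter> E) ?S U G (hom_induced (int n) LS (topspace LS \<inter> E) ?S (topspace ?S \<inter> E) id a)"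
        unfolding restr by simp
      also have "\<dots> = hom_induced (int n) LS (topspace LS \<inter> E) ?S U (G \<circ> id) a"
        by (rule hom_induced_compose') (use cid cG' GE tLS topS in auto)
      finally show ?thesis using restrX'[of LS U G] by simp
    qed
    define y where "y = hom_induced (int n) LS E ?S U G a"
    have y: "y \<in> carrier ?RU" by (simp add: y_def hom_induced_carrier)
    have gU: "?g (?iU N) = y"
    proof -
      have "?g (?iU N) = hom_induced (int n) ?S (topspace ?S \<inter> E) ?S U G (hom_induced (int n) US (topspace US \<inter> E) ?S (topspace ?S \<inter> E) id N)"
        unfolding restr by simp
      also have "\<dots> = hom_induced (int n) US (topspace US \<inter> E) ?S U (G \<circ> id) N"
        by (rule hom_induced_compose') (use cid cG' GE tLS topS in auto)
      also have "\<dots> = hom_induced (int n) US (topspace US \<inter> E) ?S U G (hom_induced (int n) LS (topspace LS \<inter> E) US (topspace US \<inter> E) neg a)"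
        unfolding N_def by simp
      also have "\<dots> = hom_induced (int n) LS (topspace LS \<inter> E) ?S U (G \<circ> neg) a"
      proof (rule hom_induced_compose'[OF cnegLU])
        show "neg \<in> topspace LS \<inter> E \<rightarrow> topspace US \<inter> E"
          using cnegLU negE by (auto simp: continuous_map_def)
        show "continuous_map US ?S G" unfolding US_def using cG' by (rule continuous_map_from_subtopology)
        show "G \<in> topspace US \<inter> E \<rightarrow> U" using GE tLS topS by auto
      qed
      also have "\<dots> = hom_induced (int n) LS E ?S U (G \<circ> neg) a" using restrX'[of LS U "G \<circ> neg"] by simp
      \<comment> \<open>Evenness enters here: \<open>G\<close> composed with \<open>neg\<close>
        agrees with \<open>G\<close> on the lower hemisphere, so both hemisphere classes have the
        same image.\<close>
      also have "\<dots> = y" unfolding y_def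
        by (rule arg_cong[where f = "\<lambda>h. h a"], rule hom_induced_eq) (auto simp: LS_def topspace_nsphere_sph neg_def ev n_def)
      finally show ?thesis .
    qed
    interpret g: group_hom ?RE ?RU ?g
      by (simp add: group_hom_axioms_def group_hom_def hom_induced_hom)
    interpret iU: group_hom ?B ?RE ?iU
      by (simp add: group_hom_axioms_def group_hom_def hom_induced_hom)
    have iN: "?iU N \<in> carrier ?RE" by (simp add: hom_induced_carrier)
    have "?g (?iU b) = y [^]\<^bsub>?RU\<^esub> (-\<epsilon>)"
      unfolding bN iU.hom_int_pow[OF N] g.hom_int_pow[OF iN] gU ..
    then have gj: "?g jv = y \<otimes>\<^bsub>?RU\<^esub> y [^]\<^bsub>?RU\<^esub> (-\<epsilon>)"
      using ia ib gL by (simp add: jab y_def)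
    \<comment> \<open>The total exponent of \<open>y\<close> is \<open>1 - \<epsilon>\<close>, that
      is 0 or 2.\<close>
    have "\<exists>u\<in>carrier ?RU. ?g jv = u \<otimes>\<^bsub>?RU\<^esub> u"
      using \<epsilon>
    proof
      assume "\<epsilon> = 1"
      then have "?g jv = \<one>\<^bsub>?RU\<^esub> \<otimes>\<^bsub>?RU\<^esub> \<one>\<^bsub>?RU\<^esub>"
        using gj y by (simp add: RU.int_pow_neg RU.int_pow_1 RU.r_inv del: one_relative_homology_group)
      then show ?thesis using RU.one_closed by blast
    next
      assume "\<epsilon> = -1"
      then show ?thesis using gj y by (auto simp: RU.int_pow_1)
    qed
    then obtain u where u: "u \<in> carrier ?RU" "?g jv = u \<otimes>\<^bsub>?RU\<^esub> u" by blast
    \<comment> \<open>Passing to the sphere relative to a hemisphere is an isomorphism on reduced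
      homology, so the square can be pulled back to \<open>?H\<close>.\<close>
    let ?\<rho> = "hom_induced (int n) ?S {} ?S U id"
    have rho: "?\<rho> \<in> Group.iso ?H ?RU"
      using iso_reduced_homology_group_upper_hemisphere[of n n "int n"] by (simp add: U_def)
    have Gv: "hom_induced (int n) ?S {} ?S {} G v \<in> carrier ?H"
      using v hom_induced_reduced by blast
    have "?\<rho> (hom_induced (int n) ?S {} ?S {} G v) = hom_induced (int n) ?S {} ?S U (id \<circ> G) v"
      by (rule hom_induced_compose'[OF cG']) auto
    also have "\<dots> = hom_induced (int n) ?S (topspace ?S \<inter> E) ?S U G (hom_induced (int n) ?S {} ?S (topspace ?S \<inter> E) id v)"
      by (subst hom_induced_compose') (use cG' GE topS in auto)
    also have "\<dots> = ?g jv"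
      using hom_induced_restrict[of "int n" ?S "{}" ?S E] hom_induced_restrict[of "int n" ?S "{}" ?S "topspace ?S \<inter> E"]
      by (simp add: restr jv_def fun_eq_iff)
    finally have r1: "?\<rho> (hom_induced (int n) ?S {} ?S {} G v) = u \<otimes>\<^bsub>?RU\<^esub> u" using u by simp
    obtain w where w: "w \<in> carrier ?H" "?\<rho> w = u" 
    proof -
      have "u \<in> ?\<rho> ` carrier ?H" using rho u(1) by (simp add: iso_iff)
      then show ?thesis using that by auto
    qed
    interpret rho: group_hom ?H ?RU ?\<rho>
      using rho by (simp add: group_hom_def group_hom_axioms_def iso_def)
    have rw: "?\<rho> (w \<otimes>\<^bsub>?H\<^esub> w) = u \<otimes>\<^bsub>?RU\<^esub> u" using w by simp
    have "hom_induced (int n) ?S {} ?S {} G v = w \<otimes>\<^bsub>?H\<^esub> w"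
    proof -
      have inj: "inj_on ?\<rho> (carrier ?H)" using rho by (simp add: iso_iff)
      show ?thesis
        by (rule inj_onD[OF inj _ Gv rho.G.m_closed[OF w(1) w(1)]]) (simp only: r1 rw)
    qed
    then show ?thesis using w by blast
  qed

  obtain \<phi> where \<phi>: "\<phi> \<in> Group.iso ?H integer_group"
    using reduced_homology_group_nsphere(1)[of n] by (auto simp: is_iso_def)
  interpret \<phi>: group_hom ?H integer_group \<phi>
    using \<phi> by (simp add: group_hom_def group_hom_axioms_def iso_def)
  obtain v where v: "v \<in> carrier ?H" "\<phi> v = 1"
  proof -
    have "(1::int) \<in> \<phi> ` carrier ?H" using \<phi> by (simp add: iso_iff)
    then show ?thesis using that by auto
  qed
  obtain w where w: "w \<in> carrier ?H" "hom_induced (int n) ?S {} ?S {} G v = w \<otimes>\<^bsub>?H\<^esub> w"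
    using square[OF v(1)] by blast
  have "v [^]\<^bsub>?H\<^esub> Brouwer_degree2 n G = w \<otimes>\<^bsub>?H\<^esub> w"
    using Brouwer_degree2[OF v(1), of G] w(2) by simp
  then have "\<phi> v [^]\<^bsub>integer_group\<^esub> Brouwer_degree2 n G = \<phi> w + \<phi> w"
    using \<phi>.hom_int_pow[OF v(1), of "Brouwer_degree2 n G"] \<phi>.hom_mult[OF w(1) w(1)] by simp
  then have "Brouwer_degree2 n G = 2 * \<phi> w" using v(2) by simp
  then show ?thesis by (simp add: n_def)
qed

section \<open>Equivariant maps excluded by the parity of their degree\<close>

lemma continuous_on_snd_coordinate: "continuous_on S (\<lambda>p::'a::topological_space \<times> (nat \<Rightarrow> real). snd p j)"
  by (rule continuous_on_product_then_coordinatewise) (intro continuous_intros)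

lemma homotopic_with_nsphere_path:
  assumes G: "continuous_on ({0..1::real} \<times> sph m) (\<lambda>(t,x). G t x)"
    and im: "\<And>t x. t \<in> {0..1} \<Longrightarrow> x \<in> sph m \<Longrightarrow> G t x \<in> sph n"
  shows "homotopic_with (\<lambda>_. True) (nsphere m) (nsphere n) (G 0) (G 1)"
proof -
  have "homotopic_with_canon (\<lambda>_. True) (sph m) (sph n) (G 0) (G 1)"
    unfolding homotopic_with_def
  proof (intro exI conjI allI ballI impI)
    show "continuous_map (prod_topology (top_of_set {0..1}) (top_of_set (sph m))) (top_of_set (sph n)) (\<lambda>p. G (fst p) (snd p))"
      using G im by (auto simp: prod_topology_subtopology_eu case_prod_unfold)
  qed auto
  then show ?thesis by (simp add: nsphere_sph)
qed

theorem even_map_even_degree: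
  assumes "continuous_map (nsphere (Suc m)) (nsphere (Suc m)) G"
    and "\<And>x. x \<in> sph (Suc m) \<Longrightarrow> G (\<lambda>i. - x i) = G x"
  shows "even (Brouwer_degree2 (Suc m) G)"
proof -
  obtain G' where "continuous_map (nsphere (Suc m)) (nsphere (Suc m)) G'"
    "\<And>x. x \<in> sph (Suc m) \<Longrightarrow> G' (\<lambda>i. - x i) = (\<lambda>i. 1 * G' x i)"
    and hom: "homotopic_with (\<lambda>_. True) (nsphere (Suc m)) (nsphere (Suc m)) G G'"
    and "G' \<in> sph m \<rightarrow> sph m"
    by (rule equator_preserving_deformation[of m G 1]) (use assms in auto)
  then have "even (Brouwer_degree2 (Suc m) G')" by (intro even_map_degree_equator) auto
  then show ?thesis using Brouwer_degree2_homotopic[OF hom] by simp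
qed

definition cyc :: "nat \<Rightarrow> (nat \<Rightarrow> real) \<Rightarrow> nat \<Rightarrow> real" where
  "cyc n c = (\<lambda>i. if i = 0 then c n else if i \<le> n then c (i - 1) else 0)"

lemma cyc_in_sph: assumes "c \<in> sph n" shows "cyc n c \<in> sph n"
proof (cases n)
  case 0
  then show ?thesis using assms by (auto simp: sph_def cyc_def)
next
  case (Suc m)
  have "(\<Sum>i\<le>Suc m. (cyc n c i)\<^sup>2) = (c n)\<^sup>2 + (\<Sum>i\<le>m. (cyc n c (Suc i))\<^sup>2)"
    by (subst sum.atMost_Suc_shift) (simp add: cyc_def)
  also have "(\<Sum>i\<le>m. (cyc n c (Suc i))\<^sup>2) = (\<Sum>i\<le>m. (c i)\<^sup>2)"
    by (intro sum.cong) (auto simp: cyc_def Suc)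
  finally show ?thesis using assms by (simp add: sph_def Suc cyc_def)
qed

text \<open>With \<open>r\<close> the reflection of the first coordinate, \<open>cyc\<close> composed with \<open>r\<close> has characteristic
  polynomial \<open>z ^ (n + 1) + 1\<close>, which has no negative roots for odd \<open>n\<close>, so the segment from
  \<open>cyc\<close> to \<open>r\<close> consists of invertible maps.\<close>

lemma Brouwer_degree2_cyc:
  assumes n: "odd n" shows "Brouwer_degree2 n (cyc n) = -1"
proof -
  define r where "r = (\<lambda>x::nat\<Rightarrow>real. \<lambda>i. if i = 0 then - x i else x i)"
  define K where "K t x i = (1 - t) * cyc n x i + t * r x i" for t x i
  have rs: "r x \<in> sph n" if "x \<in> sph n" for x
  proof -
    have "(\<Sum>i\<le>n. (r x i)\<^sup>2) = (\<Sum>i\<le>n. (x i)\<^sup>2)" by (intro sum.cong) (auto simp: r_def)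
    then show ?thesis using that by (auto simp: sph_def r_def)
  qed
  have "homotopic_with (\<lambda>_. True) (nsphere n) (nsphere n) (\<lambda>x. nrm n (K 0 x)) (\<lambda>x. nrm n (K 1 x))"
  proof (rule homotopic_nrm)
    have c: "continuous_on ({0..1} \<times> sph n) (\<lambda>p. snd p j)" for j
      by (rule continuous_on_compose2[OF continuous_on_coordinate[of UNIV]]) (auto intro: continuous_intros)
    show "continuous_on ({0..1} \<times> sph n) (\<lambda>(t, x). K t x i)" for i
      unfolding K_def case_prod_unfold cyc_def r_def
      by (cases "i = 0"; cases "i \<le> n") (auto intro!: continuous_intros c)
    fix t :: real and x assume t: "t \<in> {0..1}" and x: "x \<in> sph n"
    show "K t x i = 0" if "i > n" for i using that x by (simp add: K_def cyc_def r_def sph_def)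
    show "\<exists>i\<le>n. K t x i \<noteq> 0"
    proof (rule ccontr)
      assume "\<not> ?thesis"
      then have z: "K t x i = 0" if "i \<le> n" for i using that by blast
      have z0: "(1 - t) * x n = t * x 0" using z[of 0] by (simp add: K_def cyc_def r_def)
      have zS: "(1 - t) * x i = - t * x (Suc i)" if "i < n" for i
        using z[of "Suc i"] that by (simp add: K_def cyc_def r_def)
      have "x i = 0" if "i \<le> n" for i
      proof (cases "t = 0")
        case True
        then show ?thesis using z0 zS[of i] that by (cases "i = n") auto
      next
        case False
        \<comment> \<open>At a common zero the coordinates form a geometric progression of ratio
          \<open>- s\<close>. Once around the cycle this gives
          \<open>x 0 = - (s ^ (n + 1)) * x 0\<close>, where the sign comes from \<open>n\<close>
          being odd.\<close>
        define s where "s = (1 - t) / t"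
        have s: "s \<ge> 0" using t False by (simp add: s_def)
        have 1: "x (Suc i) = - s * x i" if "i < n" for i using zS[OF that] False by (simp add: s_def field_simps)
        have 2: "x i = (- s) ^ i * x 0" if "i \<le> n" for i
          using that by (induction i) (auto simp: 1)
        have "x 0 = s * x n" using z0 False by (simp add: s_def field_simps)
        also have "\<dots> = - (s ^ (n + 1)) * x 0" using 2[of n] n by (simp add: power_minus_odd)
        finally have "(1 + s ^ (n + 1)) * x 0 = 0" by (simp add: algebra_simps)
        moreover have "1 + s ^ (n + 1) > 0" using s by (simp add: add_pos_nonneg)
        ultimately have "x 0 = 0" by auto
        then show ?thesis using 2[OF that] by simp
      qed
      then have "(\<Sum>i\<le>n. (x i)\<^sup>2) = 0" by simp
      then show False using x by (simp add: sph_def)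
    qed
  qed
  then have "homotopic_with (\<lambda>_. True) (nsphere n) (nsphere n) (cyc n) r"
  proof (rule homotopic_with_eq)
    have "K 0 x = cyc n x" "K 1 x = r x" for x by (auto simp: K_def fun_eq_iff)
    then show "cyc n x = nrm n (K 0 x)" "r x = nrm n (K 1 x)" if "x \<in> topspace (nsphere n)" for x
      using that by (auto simp: topspace_nsphere_sph nrm_sph cyc_in_sph rs)
  qed auto
  then have "Brouwer_degree2 n (cyc n) = Brouwer_degree2 n r" by (rule Brouwer_degree2_homotopic)
  then show ?thesis using Brouwer_degree2_reflection[of n] by (simp add: r_def)
qed

lemma continuous_map_cyc: "continuous_map (nsphere n) (nsphere n) (cyc n)"
proof -
  have "continuous_on (sph n) (cyc n)"
    unfolding cyc_def
  proof (rule continuous_on_coordinatewise_then_product)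
    fix i
    show "continuous_on (sph n) (\<lambda>x. if i = 0 then x n else if i \<le> n then x (i - 1) else 0)"
      by (cases "i = 0"; cases "i \<le> n") (auto intro: continuous_on_coordinate)
  qed
  then show ?thesis by (auto simp: nsphere_sph cyc_in_sph)
qed

theorem no_odd_map_with_cyclic_shift:
  fixes F :: "(nat \<Rightarrow> real) \<Rightarrow> real \<Rightarrow> nat \<Rightarrow> real"
  assumes n: "odd n" and T: "T \<ge> 0"
    and cont: "continuous_on (sph n \<times> {0..T}) (\<lambda>(c,\<theta>). F c \<theta>)"
    and im: "\<And>c \<theta>. c \<in> sph n \<Longrightarrow> \<theta> \<in> {0..T} \<Longrightarrow> F c \<theta> \<in> sph n"
    and odd: "\<And>c \<theta>. c \<in> sph n \<Longrightarrow> \<theta> \<in> {0..T} \<Longrightarrow> F (\<lambda>i. - c i) \<theta> = (\<lambda>i. - F c \<theta> i)"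
    and shift: "\<And>c. c \<in> sph n \<Longrightarrow> F c T = F (cyc n c) 0"
  shows False
proof -
  let ?G = "\<lambda>t c. F c (t * T)"
  have tT: "t * T \<in> {0..T}" if "t \<in> {0..1}" for t using that T by (auto simp: mult_left_le_one_le)
  have "homotopic_with (\<lambda>_. True) (nsphere n) (nsphere n) (?G 0) (?G 1)"
  proof (rule homotopic_with_nsphere_path)
    have "continuous_on ({0..1} \<times> sph n) ((\<lambda>(c,\<theta>). F c \<theta>) \<circ> (\<lambda>p. (snd p, fst p * T)))"
      by (rule continuous_on_compose) (auto intro!: continuous_intros continuous_on_subset[OF cont] tT continuous_on_snd_coordinate)
    then show "continuous_on ({0..1} \<times> sph n) (\<lambda>(t, c). F c (t * T))" by (simp add: o_def case_prod_unfold)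
  qed (use im tT in auto)
  then have 1: "Brouwer_degree2 n (\<lambda>c. F c 0) = Brouwer_degree2 n (\<lambda>c. F c T)"
    and c0: "continuous_map (nsphere n) (nsphere n) (\<lambda>c. F c 0)"
    using Brouwer_degree2_homotopic homotopic_with_imp_continuous_maps by fastforce+
  have "Brouwer_degree2 n (\<lambda>c. F c T) = Brouwer_degree2 n ((\<lambda>c. F c 0) \<circ> cyc n)"
    by (rule Brouwer_degree2_eq) (simp add: shift topspace_nsphere_sph)
  also have "\<dots> = Brouwer_degree2 n (\<lambda>c. F c 0) * Brouwer_degree2 n (cyc n)"
    by (rule Brouwer_degree2_compose[OF continuous_map_cyc c0])
  \<comment> \<open>The homotopy and the composition with the shift make the degree equal to its own
    negative.\<close>
  finally have "Brouwer_degree2 n (\<lambda>c. F c 0) = 0" using 1 Brouwer_degree2_cyc[OF n] by simp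
  moreover have "odd (Brouwer_degree2 n (\<lambda>c. F c 0))"
    by (rule Borsuk_odd_degree[OF c0]) (use odd T in auto)
  ultimately show False by simp
qed

theorem no_odd_map_with_antipodal_swap:
  fixes F :: "(nat \<Rightarrow> real) \<Rightarrow> (nat \<Rightarrow> real) \<Rightarrow> nat \<Rightarrow> real"
  assumes cont: "continuous_on (sph 1 \<times> sph (Suc m)) (\<lambda>(a,x). F a x)"
    and im: "\<And>a x. a \<in> sph 1 \<Longrightarrow> x \<in> sph (Suc m) \<Longrightarrow> F a x \<in> sph (Suc m)"
    and odd: "\<And>a x. a \<in> sph 1 \<Longrightarrow> x \<in> sph (Suc m) \<Longrightarrow> F (\<lambda>i. - a i) x = (\<lambda>i. - F a x i)"
    and swap: "\<And>a x. a \<in> sph 1 \<Longrightarrow> x \<in> sph (Suc m) \<Longrightarrow> F (cyc 1 a) (\<lambda>i. - x i) = F a x"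
  shows False
proof -
  \<comment> \<open>An arc of the circle from angle \<open>- pi / 4\<close> to
    \<open>pi / 4\<close>. At its start the coefficients are opposite, and the swap negates them; at
    its end they are equal, and the swap fixes them.\<close>
  define \<gamma> :: "real \<Rightarrow> nat \<Rightarrow> real" where
    "\<gamma> t = (\<lambda>i. if i = 0 then cos (pi / 2 * t - pi / 4) else if i = 1 then sin (pi / 2 * t - pi / 4) else 0)" for t
  have \<gamma>: "\<gamma> t \<in> sph 1" for t by (simp add: \<gamma>_def sph_def)
  have c\<gamma>: "continuous_on UNIV \<gamma>"
    unfolding \<gamma>_def
  proof (rule continuous_on_coordinatewise_then_product)
    fix i :: nat
    show "continuous_on UNIV (\<lambda>t::real. if i = 0 then cos (pi / 2 * t - pi / 4) else if i = 1 then sin (pi / 2 * t - pi / 4) else 0)"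
      by (cases "i = 0"; cases "i = 1") (auto intro!: continuous_intros)
  qed
  let ?G = "\<lambda>t x. F (\<gamma> t) x"
  have "homotopic_with (\<lambda>_. True) (nsphere (Suc m)) (nsphere (Suc m)) (?G 0) (?G 1)"
  proof (rule homotopic_with_nsphere_path)
    have c1: "continuous_on ({0..1} \<times> sph (Suc m)) (\<lambda>p. \<gamma> (fst p))"
      by (rule continuous_on_compose2[OF c\<gamma>]) (auto intro: continuous_intros)
    have "continuous_on ({0..1} \<times> sph (Suc m)) ((\<lambda>(c,\<theta>). F c \<theta>) \<circ> (\<lambda>p. (\<gamma> (fst p), snd p)))"
      by (rule continuous_on_compose) (auto intro!: continuous_intros c1 continuous_on_subset[OF cont] \<gamma> continuous_on_snd_coordinate continuous_on_product_then_coordinatewise[OF c1])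
    then show "continuous_on ({0..1} \<times> sph (Suc m)) (\<lambda>(t, x). F (\<gamma> t) x)" by (simp add: o_def case_prod_unfold)
  qed (use im \<gamma> in auto)
  then have deg: "Brouwer_degree2 (Suc m) (?G 0) = Brouwer_degree2 (Suc m) (?G 1)"
    and c0: "continuous_map (nsphere (Suc m)) (nsphere (Suc m)) (?G 0)"
    and c1: "continuous_map (nsphere (Suc m)) (nsphere (Suc m)) (?G 1)"
    using Brouwer_degree2_homotopic homotopic_with_imp_continuous_maps by fastforce+
  have g0: "cyc 1 (\<gamma> 0) = (\<lambda>i. - \<gamma> 0 i)" and g1: "cyc 1 (\<gamma> 1) = \<gamma> 1"
    by (auto simp: cyc_def \<gamma>_def fun_eq_iff cos_45 sin_45)
  have neg: "(\<lambda>i. - x i) \<in> sph (Suc m)" if "x \<in> sph (Suc m)" for x using that by (simp add: sph_neg)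
  have "odd (Brouwer_degree2 (Suc m) (?G 0))"
  proof (rule Borsuk_odd_degree[OF c0])
    fix x assume x: "x \<in> sph (Suc m)"
    have "F (\<gamma> 0) x = (\<lambda>i. - F (\<gamma> 0) (\<lambda>i. - x i) i)"
      using swap[OF \<gamma>[of 0] x, unfolded g0] odd[OF \<gamma>[of 0] neg[OF x]] by simp
    then show "F (\<gamma> 0) (\<lambda>i. - x i) = (\<lambda>i. - F (\<gamma> 0) x i)" by (simp add: fun_eq_iff)
  qed
  moreover have "even (Brouwer_degree2 (Suc m) (?G 1))"
  proof (rule even_map_even_degree[OF c1])
    fix x assume "x \<in> sph (Suc m)"
    then show "F (\<gamma> 1) (\<lambda>i. - x i) = F (\<gamma> 1) x" using swap[OF \<gamma>[of 1], unfolded g1] by simp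
  qed
  ultimately show False using deg by simp
qed

section \<open>Calculus of test functions\<close>

lemma partial_deriv_has_derivative:
  "(f has_derivative f') (at x) \<Longrightarrow> partial_deriv i f x = f' (axis i 1)"
  unfolding partial_deriv_def using frechet_derivative_at by metis

lemma has_derivative_partials:
  assumes "f differentiable (at x)"
  shows "(f has_derivative (\<lambda>h. \<Sum>l\<in>UNIV. partial_deriv l f x * h $ l)) (at x)"
proof -
  let ?D = "frechet_derivative f (at x)"
  have D: "(f has_derivative ?D) (at x)" using assms by (simp add: frechet_derivative_works)
  then interpret D: linear ?D by (rule has_derivative_linear)
  have "?D h = (\<Sum>l\<in>UNIV. partial_deriv l f x * h $ l)" for h
  proof -
    have "?D h = ?D (\<Sum>l\<in>UNIV. h $ l *\<^sub>R axis l 1)" by (simp add: basis_expansion flip: scalar_mult_eq_scaleR)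
    also have "\<dots> = (\<Sum>l\<in>UNIV. h $ l * partial_deriv l f x)" by (simp add: D.sum D.scaleR partial_deriv_def)
    finally show ?thesis by (simp add: mult.commute)
  qed
  then have "?D = (\<lambda>h. \<Sum>l\<in>UNIV. partial_deriv l f x * h $ l)" by blast
  with D show ?thesis by simp
qed

lemma C_k_Suc_imp: "C_k (Suc m) f \<Longrightarrow> C_k m f"
proof (induction m arbitrary: f)
  case 0
  then show ?case by (auto intro!: differentiable_imp_continuous_on simp: differentiable_on_def differentiable_at_withinI)
next
  case (Suc m)
  have "f differentiable (at x)" for x using Suc.prems by simp
  moreover have "C_k m (partial_deriv i f)" for i using Suc.prems by (intro Suc.IH) simp
  ultimately show ?case by simp
qed

lemma C_k_continuous: "C_k m f \<Longrightarrow> continuous_on UNIV f"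
  by (induction m) (auto dest: C_k_Suc_imp simp del: C_k.simps(2))

lemma C_k_const: "C_k m (\<lambda>_::real^'n. c)"
proof (induction m arbitrary: c)
  case (Suc m)
  have "partial_deriv i (\<lambda>_::real^'n. c) = (\<lambda>_. 0)" for i
    by (rule ext) (simp add: partial_deriv_has_derivative[OF has_derivative_const])
  then show ?case using Suc by simp
qed simp

lemma C_k_coordinate: "C_k m (\<lambda>x. x $ l)"
proof (cases m)
  case (Suc k)
  have d: "((\<lambda>x::real^'a. x $ l) has_derivative (\<lambda>h. h $ l)) (at x)" for x
    by (rule bounded_linear_imp_has_derivative[OF bounded_linear_vec_nth])
  have "partial_deriv i (\<lambda>x. x $ l) = (\<lambda>_. axis i 1 $ l)" for i
    by (rule ext) (rule partial_deriv_has_derivative[OF d])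
  then show ?thesis using d unfolding Suc by (auto simp: C_k_const differentiable_def)
qed (auto intro: continuous_intros)

lemma C_k_add: "C_k m f \<Longrightarrow> C_k m g \<Longrightarrow> C_k m (\<lambda>x. f x + g x)"
proof (induction m arbitrary: f g)
  case 0 then show ?case by (auto intro: continuous_intros)
next
  case (Suc m)
  have "partial_deriv i (\<lambda>x. f x + g x) = (\<lambda>x. partial_deriv i f x + partial_deriv i g x)" for i
  proof
    fix x
    have "((\<lambda>x. f x + g x) has_derivative (\<lambda>h. frechet_derivative f (at x) h + frechet_derivative g (at x) h)) (at x)"
      using Suc.prems by (intro has_derivative_add) (auto simp flip: frechet_derivative_works)
    from partial_deriv_has_derivative[OF this] show "partial_deriv i (\<lambda>x. f x + g x) x = partial_deriv i f x + partial_deriv i g x"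
      by (simp add: partial_deriv_def)
  qed
  then show ?case using Suc by (auto intro: differentiable_add)
qed

lemma C_k_mult: "C_k m f \<Longrightarrow> C_k m g \<Longrightarrow> C_k m (\<lambda>x. f x * g x)"
proof (induction m arbitrary: f g)
  case 0 then show ?case by (auto intro: continuous_intros)
next
  case (Suc m)
  have p: "partial_deriv i (\<lambda>x. f x * g x) = (\<lambda>x. f x * partial_deriv i g x + partial_deriv i f x * g x)" for i
  proof
    fix x
    have "((\<lambda>x. f x * g x) has_derivative (\<lambda>h. f x * frechet_derivative g (at x) h + frechet_derivative f (at x) h * g x)) (at x)"
      using Suc.prems by (intro has_derivative_mult) (auto simp flip: frechet_derivative_works)
    from partial_deriv_has_derivative[OF this]
    show "partial_deriv i (\<lambda>x. f x * g x) x = f x * partial_deriv i g x + partial_deriv i f x * g x"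
      by (simp add: partial_deriv_def)
  qed
  have "C_k m f" "C_k m g" using Suc.prems by (auto dest: C_k_Suc_imp simp del: C_k.simps)
  then have "C_k m (\<lambda>x. f x * partial_deriv i g x + partial_deriv i f x * g x)" for i
    using Suc by (intro C_k_add Suc.IH) auto
  then show ?case using Suc.prems by (auto simp: p intro: differentiable_mult)
qed

lemma C_k_scale: "C_k m f \<Longrightarrow> C_k m (\<lambda>x. c * f x)"
  by (rule C_k_mult[OF C_k_const])

lemma C_k_diff: "C_k m f \<Longrightarrow> C_k m g \<Longrightarrow> C_k m (\<lambda>x. f x - g x)"
  using C_k_add[of m f "\<lambda>x. (-1) * g x"] C_k_scale[of m g "-1"] by simp

lemma C_k_sum: "(\<And>l. l \<in> A \<Longrightarrow> C_k m (f l)) \<Longrightarrow> C_k m (\<lambda>x. \<Sum>l\<in>A. f l x)"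
  by (induction A rule: infinite_finite_induct) (auto intro: C_k_const C_k_add)

lemma C_k_prod: "(\<And>l. l \<in> A \<Longrightarrow> C_k m (f l)) \<Longrightarrow> C_k m (\<lambda>x. \<Prod>l\<in>A. f l x)"
  by (induction A rule: infinite_finite_induct) (auto intro: C_k_const C_k_mult)

lemma has_derivative_vec_components:
  fixes Q :: "real^'n \<Rightarrow> real^'m"
  assumes "\<And>l. ((\<lambda>x. Q x $ l) has_derivative (\<lambda>h. D h $ l)) (at x)"
  shows "(Q has_derivative D) (at x)"
  by (subst has_derivative_componentwise_within) (use assms in \<open>auto simp: Basis_vec_def inner_axis\<close>)

lemma partial_deriv_compose:
  fixes Q :: "real^'n \<Rightarrow> real^'m"
  assumes "\<phi> differentiable (at (Q x))" and Q: "(Q has_derivative D) (at x)"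
  shows "((\<lambda>x. \<phi> (Q x)) has_derivative (\<lambda>h. \<Sum>l\<in>UNIV. partial_deriv l \<phi> (Q x) * D h $ l)) (at x)"
    and "partial_deriv i (\<lambda>x. \<phi> (Q x)) x = (\<Sum>l\<in>UNIV. partial_deriv l \<phi> (Q x) * D (axis i 1) $ l)"
proof -
  show *: "((\<lambda>x. \<phi> (Q x)) has_derivative (\<lambda>h. \<Sum>l\<in>UNIV. partial_deriv l \<phi> (Q x) * D h $ l)) (at x)"
    by (rule has_derivative_compose[OF Q has_derivative_partials[OF assms(1)]])
  show "partial_deriv i (\<lambda>x. \<phi> (Q x)) x = (\<Sum>l\<in>UNIV. partial_deriv l \<phi> (Q x) * D (axis i 1) $ l)"
    by (rule partial_deriv_has_derivative[OF *])
qed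

text \<open>Induction on the order with \<open>\<phi>\<close> arbitrary: by the chain rule each
  partial derivative is a sum of products in which a partial derivative of \<open>\<phi>\<close> is
  composed with the same \<open>Q\<close>.\<close>

lemma C_k_compose:
  fixes Q :: "real^'n \<Rightarrow> real^'m"
  assumes "\<And>l. C_k m (\<lambda>x. Q x $ l)" "C_k m \<phi>"
  shows "C_k m (\<lambda>x. \<phi> (Q x))"
  using assms
proof (induction m arbitrary: \<phi>)
  case 0
  have "continuous_on UNIV Q" using 0(1) by (subst continuous_on_componentwise) (auto simp: Basis_vec_def inner_axis)
  then show ?case using 0(2) by (auto intro: continuous_on_compose2)
next
  case (Suc m)
  have D: "(Q has_derivative (\<lambda>h. \<chi> l. \<Sum>j\<in>UNIV. partial_deriv j (\<lambda>x. Q x $ l) x * h $ j)) (at x)" for x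
    by (rule has_derivative_vec_components) (use Suc.prems(1) in \<open>auto intro!: has_derivative_partials\<close>)
  have \<phi>: "\<phi> differentiable (at y)" for y using Suc.prems by simp
  have p: "partial_deriv i (\<lambda>x. \<phi> (Q x)) = (\<lambda>x. \<Sum>l\<in>UNIV. partial_deriv l \<phi> (Q x) * partial_deriv i (\<lambda>x. Q x $ l) x)" for i
    by (rule ext) (simp add: partial_deriv_compose(2)[OF \<phi> D] axis_def if_distrib cong: if_cong)
  have Qm: "C_k m (\<lambda>x. Q x $ l)" for l using Suc.prems(1)[of l] by (rule C_k_Suc_imp)
  have "C_k m (\<lambda>x. partial_deriv l \<phi> (Q x))" for l
    by (rule Suc.IH[of "partial_deriv l \<phi>"]) (use Suc.prems(2) Qm in simp_all)
  then have "C_k m (partial_deriv i (\<lambda>x. \<phi> (Q x)))" for i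
    unfolding p using Suc.prems(1) by (intro C_k_sum C_k_mult) auto
  moreover have "(\<lambda>x. \<phi> (Q x)) differentiable (at x)" for x
    using partial_deriv_compose(1)[OF \<phi> D] by (auto simp: differentiable_def)
  ultimately show ?case by simp
qed

text \<open>The exponent varies in the induction, since differentiation lowers it by one. Exponent
  1/2 gives the smoothness of the regularized distance to the axis.\<close>

lemma C_k_powr:
  assumes "\<And>m. C_k m q" "\<And>x. q x > 0"
  shows "C_k m (\<lambda>x. q x powr r)"
proof (induction m arbitrary: r)
  case 0
  then show ?case using C_k_continuous[OF assms(1)] assms(2) by (auto intro!: continuous_intros simp: less_imp_neq[symmetric])
next
  case (Suc m)
  have d: "((\<lambda>x. q x powr r) has_derivative (\<lambda>h. r * q x powr (r - 1) * frechet_derivative q (at x) h)) (at x)" for x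
  proof -
    have "(q has_derivative frechet_derivative q (at x)) (at x)"
      using assms(1)[of 1] by (simp flip: frechet_derivative_works)
    moreover have "((\<lambda>t. t powr r) has_derivative (\<lambda>h. r * q x powr (r - 1) * h)) (at (q x))"
      using has_real_derivative_powr[OF assms(2), of r x] by (simp add: has_field_derivative_def)
    ultimately show ?thesis by (rule has_derivative_compose)
  qed
  have "partial_deriv i (\<lambda>x. q x powr r) = (\<lambda>x. r * q x powr (r - 1) * partial_deriv i q x)" for i
    by (rule ext) (simp add: partial_deriv_has_derivative[OF d] partial_deriv_def)
  moreover have "C_k m (\<lambda>x. r * q x powr (r - 1) * partial_deriv i q x)" for i
    using assms(1)[of "Suc m"] by (intro C_k_mult C_k_const Suc.IH) auto
  ultimately show ?case using d by (auto simp: differentiable_def)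
qed

text \<open>For \<open>j = 0\<close> this is the usual flat function \<open>exp (- 1 / t)\<close>.
  The powers of \<open>1 / t\<close> are carried along because the span of the family is closed
  under differentiation.\<close>

definition flat_exp :: "nat \<Rightarrow> real \<Rightarrow> real" where
  "flat_exp j t = (if t > 0 then exp (- inverse t) * inverse t ^ j else 0)"

lemma flat_exp_tendsto_0: "(flat_exp j \<longlongrightarrow> 0) (at 0)"
proof -
  have "((\<lambda>t::real. t ^ j / exp t) \<longlongrightarrow> 0) at_top" by (rule tendsto_power_div_exp_0)
  then have "((\<lambda>t::real. (inverse t) ^ j / exp (inverse t)) \<longlongrightarrow> 0) (at_right 0)"
    by (rule filterlim_compose) (rule filterlim_inverse_at_top_right)
  then have "(flat_exp j \<longlongrightarrow> 0) (at_right 0)"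
    by (rule Lim_transform_eventually) (auto simp: eventually_at_filter flat_exp_def exp_minus divide_inverse mult.commute)
  moreover have "(flat_exp j \<longlongrightarrow> 0) (at_left 0)"
    by (rule tendsto_eventually) (auto simp: eventually_at_filter flat_exp_def)
  ultimately show ?thesis by (simp add: filterlim_at_split)
qed

lemma flat_exp_derivative:
  "(flat_exp j has_real_derivative (flat_exp (j + 2) t - real j * flat_exp (j + 1) t)) (at t)"
proof (cases t "0::real" rule: linorder_cases)
  case less
  have "((\<lambda>_. 0) has_real_derivative 0) (at t)" by simp
  then have "(flat_exp j has_real_derivative 0) (at t)"
    by (rule has_field_derivative_transform_within_open[of _ _ _ "{..<0}"]) (use less in \<open>auto simp: flat_exp_def\<close>)
  then show ?thesis using less by (simp add: flat_exp_def)
next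
  case equal
  \<comment> \<open>The difference quotient of \<open>flat_exp j\<close> at 0 is
    \<open>flat_exp (Suc j)\<close> itself.\<close>
  have "((\<lambda>h. flat_exp (Suc j) h) \<longlongrightarrow> 0) (at 0)" by (rule flat_exp_tendsto_0)
  then have "((\<lambda>h. (flat_exp j (0 + h) - flat_exp j 0) / h) \<longlongrightarrow> 0) (at 0)"
    by (rule Lim_transform_eventually) (auto simp: eventually_at_filter flat_exp_def divide_inverse)
  then show ?thesis by (simp add: equal DERIV_def flat_exp_def)
next
  case greater
  have i: "(inverse has_real_derivative - (inverse t ^ 2)) (at t)"
    using DERIV_inverse[of t UNIV] greater by (simp add: numeral_2_eq_2)
  have "((\<lambda>t. exp (- inverse t)) has_real_derivative (exp (- inverse t) * inverse t ^ 2)) (at t)"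
    using DERIV_chain2[OF DERIV_exp DERIV_minus[OF i]] by simp
  moreover have "((\<lambda>t. inverse t ^ j) has_real_derivative (real j * inverse t ^ (j - 1) * - (inverse t ^ 2))) (at t)"
    using DERIV_chain2[OF DERIV_pow i, of j] by simp
  ultimately have "((\<lambda>t. exp (- inverse t) * inverse t ^ j) has_real_derivative
      (exp (- inverse t) * inverse t ^ 2 * inverse t ^ j + real j * inverse t ^ (j - 1) * - (inverse t ^ 2) * exp (- inverse t))) (at t)"
    by (rule DERIV_mult)
  also have "exp (- inverse t) * inverse t ^ 2 * inverse t ^ j + real j * inverse t ^ (j - 1) * - (inverse t ^ 2) * exp (- inverse t)
      = flat_exp (j + 2) t - real j * flat_exp (j + 1) t"
    using greater by (cases j) (simp_all add: flat_exp_def power_add power2_eq_square algebra_simps)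
  finally show ?thesis
    by (rule has_field_derivative_transform_within_open[of _ _ _ "{0<..}"]) (use greater in \<open>auto simp: flat_exp_def\<close>)
qed

lemma has_derivative_flat_exp_coordinate:
  "((\<lambda>x::real^'n. flat_exp j (a * x $ l + b)) has_derivative
    (\<lambda>h. (flat_exp (j + 2) (a * x $ l + b) - real j * flat_exp (j + 1) (a * x $ l + b)) * (a * h $ l))) (at x)"
proof -
  have "((\<lambda>x::real^'n. x $ l) has_derivative (\<lambda>h. h $ l)) (at x)"
    by (rule bounded_linear_imp_has_derivative[OF bounded_linear_vec_nth])
  then have 1: "((\<lambda>x::real^'n. a * x $ l + b) has_derivative (\<lambda>h. a * h $ l)) (at x)"
    by (auto intro!: derivative_eq_intros)
  have 2: "(flat_exp j has_derivative (\<lambda>h. (flat_exp (j + 2) (a * x $ l + b) - real j * flat_exp (j + 1) (a * x $ l + b)) * h))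
      (at (a * x $ l + b))"
    using flat_exp_derivative by (simp add: has_field_derivative_def)
  show ?thesis by (rule has_derivative_compose[OF 1 2])
qed

lemma C_k_flat_exp: "C_k m (\<lambda>x::real^'n. flat_exp j (a * x $ l + b))"
proof (induction m arbitrary: j)
  case 0
  show ?case unfolding C_k.simps
    by (intro continuous_at_imp_continuous_on ballI) (rule has_derivative_continuous[OF has_derivative_flat_exp_coordinate])
next
  case (Suc m)
  have "partial_deriv i (\<lambda>x. flat_exp j (a * x $ l + b)) =
     (\<lambda>x. (flat_exp (j + 2) (a * x $ l + b) - real j * flat_exp (j + 1) (a * x $ l + b)) * (a * axis i 1 $ l))" for i :: 'n
    by (rule ext) (rule partial_deriv_has_derivative[OF has_derivative_flat_exp_coordinate])
  moreover have "C_k m (\<lambda>x. (flat_exp (j + 2) (a * x $ l + b) - real j * flat_exp (j + 1) (a * x $ l + b)) * (a * axis i 1 $ l))" for i :: 'n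
    by (intro C_k_mult C_k_diff C_k_const Suc.IH)
  moreover have "(\<lambda>x::real^'n. flat_exp j (a * x $ l + b)) differentiable (at x)" for x
    using has_derivative_flat_exp_coordinate differentiableI by blast
  ultimately show ?case by simp
qed

section \<open>Test functions and their classical gradients\<close>

lemma test_functionI:
  assumes "\<And>m. C_k m \<phi>" "\<And>x. x \<notin> K \<Longrightarrow> \<phi> x = 0" "compact K" "K \<subseteq> U"
  shows "test_function U \<phi>"
proof -
  have sub: "closure {x. \<phi> x \<noteq> 0} \<subseteq> K"
    using assms(2) by (intro closure_minimal compact_imp_closed[OF assms(3)]) blast
  have "compact (K \<inter> closure {x. \<phi> x \<noteq> 0})" by (rule compact_Int_closed[OF assms(3) closed_closure])
  then have "compact (closure {x. \<phi> x \<noteq> 0})" using sub by (simp add: Int_absorb1)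
  then show ?thesis using sub assms(1,4) unfolding test_function_def by blast
qed

lemma test_function_support:
  assumes "test_function U \<phi>"
  shows "\<exists>K. compact K \<and> K \<subseteq> U \<and> (\<forall>x. x \<notin> K \<longrightarrow> \<phi> x = 0)"
proof (intro exI conjI allI impI)
  show "compact (closure {x. \<phi> x \<noteq> 0})" "closure {x. \<phi> x \<noteq> 0} \<subseteq> U"
    using assms by (auto simp: test_function_def)
  show "x \<notin> closure {x. \<phi> x \<noteq> 0} \<Longrightarrow> \<phi> x = 0" for x
    using closure_subset[of "{x. \<phi> x \<noteq> 0}"] by auto
qed

lemma test_function_C_k: "test_function U \<phi> \<Longrightarrow> C_k m \<phi>"
  by (simp add: test_function_def)

lemma test_function_differentiable: "test_function U \<phi> \<Longrightarrow> \<phi> differentiable (at x)"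
  using test_function_C_k[of U \<phi> 1] by simp

lemma test_function_continuous: "test_function U \<phi> \<Longrightarrow> continuous_on S \<phi>"
  using test_function_C_k[of U \<phi> 0] continuous_on_subset by auto

lemma test_function_continuous_partial: "test_function U \<phi> \<Longrightarrow> continuous_on S (partial_deriv i \<phi>)"
  by (rule continuous_on_subset[of UNIV]) (use test_function_C_k[of U \<phi> 1] in auto)

lemma partial_deriv_zero:
  assumes "open S" "x \<in> S" "\<And>y. y \<in> S \<Longrightarrow> f y = 0"
  shows "partial_deriv i f x = 0"
proof -
  have "(f has_derivative (\<lambda>_. 0)) (at x)"
    by (rule has_derivative_transform_within_open[OF has_derivative_const[of 0] assms(1,2)]) (simp add: assms(3))
  from partial_deriv_has_derivative[OF this] show ?thesis by simp
qed

lemma test_function_mono: "test_function U \<phi> \<Longrightarrow> U \<subseteq> V \<Longrightarrow> test_function V \<phi>"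
  by (auto simp: test_function_def)

lemma test_function_scale:
  assumes "test_function U \<phi>" shows "test_function U (\<lambda>x. c * \<phi> x)"
proof -
  obtain K where K: "compact K" "K \<subseteq> U" "\<forall>x. x \<notin> K \<longrightarrow> \<phi> x = 0"
    using test_function_support[OF assms] by blast
  show ?thesis
    by (rule test_functionI[OF C_k_scale[OF test_function_C_k[OF assms]] _ K(1,2)]) (use K in simp)
qed

lemma test_function_add:
  assumes "test_function U \<phi>" "test_function U \<psi>" shows "test_function U (\<lambda>x. \<phi> x + \<psi> x)"
proof -
  obtain K where K: "compact K" "K \<subseteq> U" "\<forall>x. x \<notin> K \<longrightarrow> \<phi> x = 0"
    using test_function_support[OF assms(1)] by blast
  obtain L where L: "compact L" "L \<subseteq> U" "\<forall>x. x \<notin> L \<longrightarrow> \<psi> x = 0"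
    using test_function_support[OF assms(2)] by blast
  show ?thesis
    by (rule test_functionI[OF C_k_add[OF test_function_C_k[OF assms(1)] test_function_C_k[OF assms(2)]], of "K \<union> L"])
       (use K L in \<open>auto intro: compact_Un\<close>)
qed

lemma test_function_diff:
  assumes "test_function U \<phi>" "test_function U \<psi>" shows "test_function U (\<lambda>x. \<phi> x - \<psi> x)"
  using test_function_add[OF assms(1) test_function_scale[OF assms(2), of "-1"]] by simp

lemma test_function_zero: "test_function U (\<lambda>_. 0)"
  by (rule test_functionI[of _ "{}"]) (auto intro: C_k_const)

lemma test_function_sum: "(\<And>l. l \<in> A \<Longrightarrow> test_function U (f l)) \<Longrightarrow> test_function U (\<lambda>x. \<Sum>l\<in>A. f l x)"
  by (induction A rule: infinite_finite_induct) (auto intro: test_function_zero test_function_add)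

definition grad :: "(real^'n \<Rightarrow> real) \<Rightarrow> real^'n \<Rightarrow> real^'n" where
  "grad f x = (\<chi> i. partial_deriv i f x)"

lemma continuous_on_grad: "test_function U \<phi> \<Longrightarrow> continuous_on S (grad \<phi>)"
  unfolding grad_def by (intro continuous_on_vec_lambda test_function_continuous_partial)

lemma grad_zero_outside: "compact K \<Longrightarrow> (\<And>x. x \<notin> K \<Longrightarrow> \<phi> x = 0) \<Longrightarrow> x \<notin> K \<Longrightarrow> grad \<phi> x = 0"
  unfolding grad_def
  by (subst vec_eq_iff) (auto intro!: partial_deriv_zero[of "- K"] simp: compact_imp_closed)

lemma partial_deriv_add:
  "f differentiable (at x) \<Longrightarrow> g differentiable (at x) \<Longrightarrow>
   partial_deriv i (\<lambda>x. f x + g x) x = partial_deriv i f x + partial_deriv i g x"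
  using partial_deriv_has_derivative[OF has_derivative_add[of f "frechet_derivative f (at x)" "at x" g "frechet_derivative g (at x)"]]
  by (simp add: partial_deriv_def frechet_derivative_works)

lemma partial_deriv_scale:
  "f differentiable (at x) \<Longrightarrow> partial_deriv i (\<lambda>x. c * f x) x = c * partial_deriv i f x"
  using partial_deriv_has_derivative[OF has_derivative_mult_right[of f "frechet_derivative f (at x)" "at x" c]]
  by (simp add: partial_deriv_def frechet_derivative_works)

lemma grad_scale: "f differentiable (at x) \<Longrightarrow> grad (\<lambda>x. c * f x) x = c *\<^sub>R grad f x"
  by (simp add: grad_def vec_eq_iff partial_deriv_scale)

lemma grad_add:
  "f differentiable (at x) \<Longrightarrow> g differentiable (at x) \<Longrightarrow> grad (\<lambda>x. f x + g x) x = grad f x + grad g x"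
  by (simp add: grad_def vec_eq_iff partial_deriv_add)

lemma grad_diff:
  "f differentiable (at x) \<Longrightarrow> g differentiable (at x) \<Longrightarrow> grad (\<lambda>x. f x - g x) x = grad f x - grad g x"
  using grad_add[of f x "\<lambda>x. (-1) * g x"] grad_scale[of g x "-1"] by (simp add: differentiable_minus)

lemma grad_sum:
  "finite A \<Longrightarrow> (\<And>l. l \<in> A \<Longrightarrow> f l differentiable (at x)) \<Longrightarrow> grad (\<lambda>x. \<Sum>l\<in>A. f l x) x = (\<Sum>l\<in>A. grad (f l) x)"
proof (induction A rule: finite_induct)
  case empty
  then show ?case by (simp add: grad_def vec_eq_iff partial_deriv_has_derivative[OF has_derivative_const])
next
  case (insert a A)
  then show ?case by (simp add: grad_add differentiable_sum)
qed

section \<open>Fundamental lemma of the calculus of variations\<close>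

lemma integrable_continuous_compact_support:
  fixes f :: "'a::euclidean_space \<Rightarrow> 'b::{banach, second_countable_topology}"
  assumes "continuous_on UNIV f" "compact K" "\<And>x. x \<notin> K \<Longrightarrow> f x = 0"
  shows "integrable lborel f"
proof -
  have "integrable lborel (\<lambda>x. indicator K x *\<^sub>R f x)"
    by (rule borel_integrable_compact[OF assms(2) continuous_on_subset[OF assms(1) subset_UNIV]])
  moreover have "(\<lambda>x. indicator K x *\<^sub>R f x) = f" using assms(3) by (auto simp: indicator_def fun_eq_iff)
  ultimately show ?thesis by simp
qed

text \<open>The definitions integrate over \<open>lebesgue_on U\<close>, whereas translations,
  Fubini and linear substitutions are carried out for \<open>lborel\<close>. This lemma moves
  between the two for functions supported in \<open>U\<close>.\<close>

lemma lebesgue_on_eq_lborel: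
  fixes f :: "'a::euclidean_space \<Rightarrow> 'b::{banach, second_countable_topology}"
  assumes U: "U \<in> sets lebesgue" and f: "f \<in> borel_measurable borel" and z: "\<And>x. x \<notin> U \<Longrightarrow> f x = 0"
  shows "integral\<^sup>L (lebesgue_on U) f = integral\<^sup>L lborel f"
    and "integrable (lebesgue_on U) f \<longleftrightarrow> integrable lborel f"
proof -
  have *: "(\<lambda>x. indicator U x *\<^sub>R f x) = f" using z by (auto simp: indicator_def fun_eq_iff)
  have f': "f \<in> borel_measurable lborel" using f by simp
  show "integral\<^sup>L (lebesgue_on U) f = integral\<^sup>L lborel f"
    using U by (simp add: integral_restrict_space * integral_completion[OF f'])
  show "integrable (lebesgue_on U) f \<longleftrightarrow> integrable lborel f"
    using U by (simp add: integrable_restrict_space * integrable_completion[OF f'])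
qed

lemma borel_measurable_lebesgue_on:
  "f \<in> borel_measurable borel \<Longrightarrow> f \<in> borel_measurable (lebesgue_on U)"
  by (intro measurable_restrict_space1 measurable_completion) simp

lemma integrable_indicator_mult:
  fixes f :: "'a \<Rightarrow> real"
  shows "A \<in> sets M \<Longrightarrow> integrable M f \<Longrightarrow> integrable M (\<lambda>x. indicator A x * f x)"
  using integrable_mult_indicator[of A M f] by simp

lemma integral_lborel_translate:
  fixes f :: "'a::euclidean_space \<Rightarrow> 'b::{banach, second_countable_topology}"
  assumes "f \<in> borel_measurable borel"
  shows "integral\<^sup>L lborel (\<lambda>x. f (x + c)) = integral\<^sup>L lborel f"
proof -
  have "integral\<^sup>L (distr lborel borel ((+) c)) f = integral\<^sup>L lborel (\<lambda>x. f (c + x))"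
    using assms by (intro integral_distr) auto
  then show ?thesis by (simp add: lborel_distr_plus add.commute)
qed

lemma DERIV_along_axis:
  fixes f :: "real^'n \<Rightarrow> real"
  assumes "f differentiable (at (x + t *\<^sub>R axis i 1))"
  shows "((\<lambda>t. f (x + t *\<^sub>R axis i 1)) has_real_derivative partial_deriv i f (x + t *\<^sub>R axis i 1)) (at t)"
proof -
  let ?y = "x + t *\<^sub>R axis i 1"
  have f: "(f has_derivative frechet_derivative f (at ?y)) (at ?y)"
    using assms by (simp flip: frechet_derivative_works)
  have "((\<lambda>t. x + t *\<^sub>R axis i 1) has_derivative (\<lambda>h. h *\<^sub>R axis i 1)) (at t)"
    by (auto intro!: derivative_eq_intros)
  from has_derivative_compose[OF this f]
  have "((\<lambda>t. f (x + t *\<^sub>R axis i 1)) has_derivative (\<lambda>h. frechet_derivative f (at ?y) (h *\<^sub>R axis i 1))) (at t)" .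
  moreover have "frechet_derivative f (at ?y) (h *\<^sub>R axis i 1) = partial_deriv i f ?y * h" for h
    using linear_cmul[OF linear_frechet_derivative[OF assms]] by (simp add: partial_deriv_def)
  ultimately show ?thesis by (simp add: has_field_derivative_def)
qed

text \<open>The difference quotients of \<open>f\<close> have integral zero by translation invariance.\<close>

lemma integral_partial_deriv_zero:
  fixes f :: "real^'n \<Rightarrow> real"
  assumes d: "\<And>x. f differentiable (at x)" and c: "continuous_on UNIV (partial_deriv i f)"
    and K: "compact K" and z: "\<And>x. x \<notin> K \<Longrightarrow> f x = 0"
  shows "integral\<^sup>L lborel (partial_deriv i f) = 0"
proof -
  have cf: "continuous_on UNIV f"
    using d by (intro differentiable_imp_continuous_on) (auto simp: differentiable_on_def intro: differentiable_at_withinI)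
  have pz: "partial_deriv i f x = 0" if "x \<notin> K" for x
    by (rule partial_deriv_zero[of "- K"]) (simp_all add: open_Compl compact_imp_closed[OF K] that z)
  have "bounded (partial_deriv i f ` K)"
    by (intro compact_imp_bounded compact_continuous_image K continuous_on_subset[OF c subset_UNIV])
  then obtain B0 where B0: "\<forall>x\<in>K. \<bar>partial_deriv i f x\<bar> \<le> B0" by (auto simp: bounded_iff)
  define B where "B = max B0 0"
  have B_nonneg: "B \<ge> 0" by (simp add: B_def)
  have B: "\<bar>partial_deriv i f x\<bar> \<le> B" for x using B0 pz[of x] by (cases "x \<in> K") (auto simp: B_def)
  obtain R where R: "\<forall>x\<in>K. norm x \<le> R" using compact_imp_bounded[OF K] by (auto simp: bounded_iff)
  define s where "s m x = real (Suc m) * (f (x + (1 / real (Suc m)) *\<^sub>R axis i 1) - f x)" for m x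
  have int: "integrable lborel f" by (rule integrable_continuous_compact_support[OF cf K z])
  have mf: "f \<in> borel_measurable borel" using cf by (rule borel_measurable_continuous_onI)
  have int': "integrable lborel (\<lambda>x. f (x + c))" for c
  proof (rule integrable_continuous_compact_support)
    show "continuous_on UNIV (\<lambda>x. f (x + c))" by (rule continuous_on_compose2[OF cf]) (auto intro: continuous_intros)
    show "compact ((\<lambda>x. x - c) ` K)" using K by (intro compact_continuous_image continuous_intros)
    fix x assume "x \<notin> (\<lambda>x. x - c) ` K"
    then have "x + c \<notin> K" by (metis add_diff_cancel_right' image_eqI)
    then show "f (x + c) = 0" by (rule z)
  qed
  have "(\<lambda>m. integral\<^sup>L lborel (s m)) \<longlonglongrightarrow> integral\<^sup>L lborel (partial_deriv i f)"
  \<comment> \<open>Steps of length at most 1 keep the difference quotients supported in the ball of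
    radius \<open>R + 1\<close>, and the mean value theorem bounds them by \<open>B\<close>.\<close>
  proof (rule integral_dominated_convergence[where w = "\<lambda>x. indicator (cball 0 (R + 1)) x * B"])
    show "partial_deriv i f \<in> borel_measurable lborel" using borel_measurable_continuous_onI[OF c] by simp
    show "s m \<in> borel_measurable lborel" for m
      unfolding s_def using int int'[of "(1 / real (Suc m)) *\<^sub>R axis i 1"] by (auto dest!: borel_measurable_integrable)
    have "integrable lborel (\<lambda>x. indicator (cball 0 (R + 1)) x *\<^sub>R B)"
      by (rule borel_integrable_compact) auto
    then show "integrable lborel (\<lambda>x::real^'n. indicator (cball 0 (R + 1)) x * B)" by simp
    show "AE x in lborel. (\<lambda>m. s m x) \<longlonglongrightarrow> partial_deriv i f x"
    proof (rule AE_I2)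
      fix x
      have "((\<lambda>t. f (x + t *\<^sub>R axis i 1)) has_real_derivative partial_deriv i f x) (at 0)"
        using DERIV_along_axis[of f x 0 i] d by simp
      then have "((\<lambda>h. (f (x + h *\<^sub>R axis i 1) - f x) / h) \<longlongrightarrow> partial_deriv i f x) (at 0)"
        by (simp add: DERIV_def)
      moreover have "filterlim (\<lambda>m. 1 / real (Suc m)) (at 0) sequentially"
        by (rule filterlim_atI[OF LIMSEQ_Suc[OF lim_1_over_n]]) auto
      ultimately have "(\<lambda>m. (f (x + (1 / real (Suc m)) *\<^sub>R axis i 1) - f x) / (1 / real (Suc m))) \<longlonglongrightarrow> partial_deriv i f x"
        by (rule filterlim_compose)
      then show "(\<lambda>m. s m x) \<longlonglongrightarrow> partial_deriv i f x" by (simp add: s_def mult.commute)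
    qed
    show "AE x in lborel. norm (s m x) \<le> indicator (cball 0 (R + 1)) x * B" for m
    proof (rule AE_I2)
      fix x
      define h where "h = 1 / real (Suc m)"
      have h: "0 < h" "h \<le> 1" by (auto simp: h_def)
      show "norm (s m x) \<le> indicator (cball 0 (R + 1)) x * B"
      proof (cases "x \<in> cball 0 (R + 1)")
        case True
        have "\<exists>z>0. z < h \<and> f (x + h *\<^sub>R axis i 1) - f (x + 0 *\<^sub>R axis i 1) = (h - 0) * partial_deriv i f (x + z *\<^sub>R axis i 1)"
          by (rule MVT2) (use h d in \<open>auto intro: DERIV_along_axis\<close>)
        then obtain z where zz: "f (x + h *\<^sub>R axis i 1) - f x = h * partial_deriv i f (x + z *\<^sub>R axis i 1)" by auto
        have "s m x = partial_deriv i f (x + z *\<^sub>R axis i 1)" unfolding s_def h_def[symmetric] zz by (simp add: h_def)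
        then show ?thesis using B True by simp
      next
        case False
        then have x: "norm x > R + 1" by simp
        have "norm (x + h *\<^sub>R axis i 1) > R"
        proof -
          have "norm x \<le> norm (x + h *\<^sub>R axis i 1) + norm (h *\<^sub>R (axis i 1 :: real^'n))"
            using norm_triangle_ineq4[of "x + h *\<^sub>R axis i 1" "h *\<^sub>R axis i 1"] by simp
          then show ?thesis using x h by (simp add: norm_axis_1)
        qed
        then have "x \<notin> K" "x + h *\<^sub>R axis i 1 \<notin> K" using R x by force+
        then show ?thesis using z B_nonneg by (simp add: s_def h_def)
      qed
    qed
  qed
  moreover have "integral\<^sup>L lborel (s m) = 0" for m
    unfolding s_def using int int'[of "(1 / real (Suc m)) *\<^sub>R axis i 1"]
    by (simp add: integral_lborel_translate[OF mf])
  ultimately have "(\<lambda>m. 0) \<longlonglongrightarrow> integral\<^sup>L lborel (partial_deriv i f)" by simp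
  then show ?thesis by (simp add: LIMSEQ_const_iff)
qed

text \<open>By the product rule this is the vanishing of the integral of a partial derivative of
  \<open>u x * \<phi> x\<close>. The cutoff inside \<open>U\<close> is supplied by
  \<open>\<phi>\<close>, so \<open>u\<close> may have its support in any set
  \<open>V\<close>.\<close>

lemma weak_gradient_grad:
  fixes u :: "real^'n \<Rightarrow> real"
  assumes U: "open U" and u: "test_function V u"
  shows "weak_gradient U u (grad u)"
  unfolding weak_gradient_def
proof (intro allI impI)
  fix \<phi> i assume phi: "test_function U \<phi>"
  obtain K where K: "compact K" "K \<subseteq> U" "\<forall>x. x \<notin> K \<longrightarrow> \<phi> x = 0" using test_function_support[OF phi] by blast
  have pz: "partial_deriv i \<phi> x = 0" if "x \<notin> K" for x
    by (rule partial_deriv_zero[of "- K"]) (simp_all add: open_Compl compact_imp_closed[OF K(1)] that K(3))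
  note cs = test_function_continuous[OF u] test_function_continuous_partial[OF u]
    test_function_continuous[OF phi] test_function_continuous_partial[OF phi]
  have c1: "continuous_on UNIV (\<lambda>x. u x * partial_deriv i \<phi> x)" and c2: "continuous_on UNIV (\<lambda>x. partial_deriv i u x * \<phi> x)"
    by (intro continuous_intros cs)+
  have i1: "integrable lborel (\<lambda>x. u x * partial_deriv i \<phi> x)"
    by (rule integrable_continuous_compact_support[OF c1 K(1)]) (simp add: pz)
  have i2: "integrable lborel (\<lambda>x. partial_deriv i u x * \<phi> x)"
    by (rule integrable_continuous_compact_support[OF c2 K(1)]) (use K in simp)
  have Ul: "U \<in> sets lebesgue" using U by simp
  have eq: "partial_deriv i (\<lambda>x. u x * \<phi> x) = (\<lambda>x. u x * partial_deriv i \<phi> x + partial_deriv i u x * \<phi> x)"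
  proof
    fix x
    have "((\<lambda>x. u x * \<phi> x) has_derivative (\<lambda>h. u x * frechet_derivative \<phi> (at x) h + frechet_derivative u (at x) h * \<phi> x)) (at x)"
      using test_function_differentiable[OF u] test_function_differentiable[OF phi]
      by (intro has_derivative_mult) (auto simp flip: frechet_derivative_works)
    from partial_deriv_has_derivative[OF this]
    show "partial_deriv i (\<lambda>x. u x * \<phi> x) x = u x * partial_deriv i \<phi> x + partial_deriv i u x * \<phi> x"
      by (simp add: partial_deriv_def)
  qed
  have "integral\<^sup>L lborel (partial_deriv i (\<lambda>x. u x * \<phi> x)) = 0"
  proof (rule integral_partial_deriv_zero[OF _ _ K(1)])
    show "(\<lambda>x. u x * \<phi> x) differentiable (at x)" for x
      using test_function_differentiable[OF u] test_function_differentiable[OF phi] by simp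
    show "continuous_on UNIV (partial_deriv i (\<lambda>x. u x * \<phi> x))" unfolding eq by (intro continuous_intros c1 c2)
  qed (use K in simp)
  then have "integral\<^sup>L lborel (\<lambda>x. u x * partial_deriv i \<phi> x) + integral\<^sup>L lborel (\<lambda>x. partial_deriv i u x * \<phi> x) = 0"
    unfolding eq using i1 i2 by simp
  moreover have "integral\<^sup>L (lebesgue_on U) (\<lambda>x. u x * partial_deriv i \<phi> x) = integral\<^sup>L lborel (\<lambda>x. u x * partial_deriv i \<phi> x)"
    by (rule lebesgue_on_eq_lborel(1)[OF Ul borel_measurable_continuous_onI[OF c1]]) (use pz K in auto)
  moreover have "integral\<^sup>L (lebesgue_on U) (\<lambda>x. partial_deriv i u x * \<phi> x) = integral\<^sup>L lborel (\<lambda>x. partial_deriv i u x * \<phi> x)"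
    by (rule lebesgue_on_eq_lborel(1)[OF Ul borel_measurable_continuous_onI[OF c2]]) (use K in auto)
  ultimately show "integral\<^sup>L (lebesgue_on U) (\<lambda>x. u x * partial_deriv i \<phi> x) = - integral\<^sup>L (lebesgue_on U) (\<lambda>x. grad u x $ i * \<phi> x)"
    by (simp add: grad_def)
qed

lemma flat_exp_0_bounds: "0 \<le> flat_exp 0 t" "flat_exp 0 t \<le> 1"
  by (auto simp: flat_exp_def)

lemma flat_exp_0_limit:
  "(\<lambda>m. flat_exp 0 (real (Suc m) * t)) \<longlonglongrightarrow> (if t > 0 then 1 else 0)"
proof (cases "t > 0")
  case True
  have "(\<lambda>m. exp (- (inverse (real (Suc m)) * inverse t))) \<longlonglongrightarrow> exp (- (0 * inverse t))"
    by (intro tendsto_intros LIMSEQ_inverse_real_of_nat)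
  then show ?thesis using True by (simp add: flat_exp_def)
next
  case False
  then have "\<not> 0 < real (Suc m) * t" for m by (simp add: zero_less_mult_iff del: of_nat_Suc)
  then have "flat_exp 0 (real (Suc m) * t) = 0" for m by (simp add: flat_exp_def del: of_nat_Suc)
  then show ?thesis using False by simp
qed

text \<open>Products of flat functions vanish off the closed box and converge pointwise to the
  indicator of the open box; dominated convergence carries orthogonality over to the limit.\<close>

lemma integral_box_zero:
  fixes g :: "real^'n \<Rightarrow> real"
  assumes U: "open U" and g: "integrable (lebesgue_on U) g"
    and orth: "\<And>\<phi>. test_function U \<phi> \<Longrightarrow> integral\<^sup>L (lebesgue_on U) (\<lambda>x. g x * \<phi> x) = 0"
    and ab: "cbox a b \<subseteq> U"
  shows "integral\<^sup>L (lebesgue_on U) (\<lambda>x. indicator (box a b) x * g x) = 0"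
proof -
  define \<phi> where "\<phi> m x = (\<Prod>l\<in>UNIV. flat_exp 0 (real (Suc m) * x $ l + - (real (Suc m) * a $ l)) *
      flat_exp 0 (- real (Suc m) * x $ l + real (Suc m) * b $ l))" for m and x :: "real^'n"
  have alt: "\<phi> m x = (\<Prod>l\<in>UNIV. flat_exp 0 (real (Suc m) * (x $ l - a $ l)) * flat_exp 0 (real (Suc m) * (b $ l - x $ l)))" for m x
    unfolding \<phi>_def by (intro prod.cong refl) (simp add: algebra_simps)
  have z: "\<phi> m x = 0" if "x \<notin> cbox a b" for m x
  proof -
    obtain l where "x $ l < a $ l \<or> b $ l < x $ l" using \<open>x \<notin> cbox a b\<close> by (auto simp: mem_box_cart not_le)
    then have "\<not> 0 < real (Suc m) * (x $ l - a $ l) \<or> \<not> 0 < real (Suc m) * (b $ l - x $ l)"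
      by (auto simp: zero_less_mult_iff)
    then have "flat_exp 0 (real (Suc m) * (x $ l - a $ l)) * flat_exp 0 (real (Suc m) * (b $ l - x $ l)) = 0"
      by (auto simp: flat_exp_def simp del: of_nat_Suc)
    then show ?thesis unfolding alt by (intro prod_zero) auto
  qed
  have "C_k k (\<phi> m)" for k m
    unfolding \<phi>_def[abs_def] by (intro C_k_prod C_k_mult C_k_flat_exp)
  then have tf: "test_function U (\<phi> m)" for m
    by (rule test_functionI[OF _ z compact_cbox ab])
  have b: "\<bar>\<phi> m x\<bar> \<le> 1" for m x
    unfolding alt abs_prod by (intro prod_le_1) (auto simp: abs_mult flat_exp_0_bounds intro!: mult_le_one)
  have lim: "(\<lambda>m. \<phi> m x) \<longlonglongrightarrow> indicator (box a b) x" for x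
  proof -
    have "(\<lambda>m. \<phi> m x) \<longlonglongrightarrow> (\<Prod>l\<in>UNIV. (if x $ l - a $ l > 0 then 1 else 0) * (if b $ l - x $ l > 0 then 1 else 0))"
      unfolding alt by (intro tendsto_prod tendsto_mult flat_exp_0_limit)
    also have "(\<Prod>l\<in>UNIV. (if x $ l - a $ l > 0 then 1 else 0) * (if b $ l - x $ l > 0 then 1 else 0)) = (indicator (box a b) x :: real)"
    proof (cases "x \<in> box a b")
      case True
      then show ?thesis by (auto simp: mem_box_cart)
    next
      case False
      then obtain l where "x $ l \<le> a $ l \<or> b $ l \<le> x $ l" by (auto simp: mem_box_cart not_less)
      then show ?thesis using False by (simp add: prod_zero_iff) (metis diff_gt_0_iff_gt not_less)
    qed
    finally show ?thesis .
  qed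
  have "(\<lambda>m. integral\<^sup>L (lebesgue_on U) (\<lambda>x. g x * \<phi> m x)) \<longlonglongrightarrow> integral\<^sup>L (lebesgue_on U) (\<lambda>x. indicator (box a b) x * g x)"
  proof (rule integral_dominated_convergence[where w = "\<lambda>x. \<bar>g x\<bar>"])
    have mg: "g \<in> borel_measurable (lebesgue_on U)" using g by auto
    have mp: "\<phi> m \<in> borel_measurable (lebesgue_on U)" for m
      by (rule borel_measurable_lebesgue_on[OF borel_measurable_continuous_onI[OF test_function_continuous[OF tf]]])
    show "(\<lambda>x. g x * \<phi> m x) \<in> borel_measurable (lebesgue_on U)" for m using mg mp by measurable
    have "(indicator (box a b) :: _ \<Rightarrow> real) \<in> borel_measurable (lebesgue_on U)"
      by (intro borel_measurable_lebesgue_on borel_measurable_indicator) simp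
    then show "(\<lambda>x. indicator (box a b) x * g x) \<in> borel_measurable (lebesgue_on U)" using mg by measurable
    show "AE x in lebesgue_on U. (\<lambda>m. g x * \<phi> m x) \<longlonglongrightarrow> indicator (box a b) x * g x"
      by (rule AE_I2) (use tendsto_mult[OF tendsto_const lim] in \<open>simp add: mult.commute\<close>)
    show "AE x in lebesgue_on U. norm (g x * \<phi> m x) \<le> \<bar>g x\<bar>" for m
      by (rule AE_I2) (use b in \<open>auto simp: abs_mult intro: mult_left_le\<close>)
  qed (use g in auto)
  then show ?thesis using orth[OF tf] by (simp add: LIMSEQ_const_iff)
qed

text \<open>The positive and negative parts of \<open>h\<close> are densities of two finite measures
  that agree on open boxes, an intersection-stable generator of the Borel sets. The measures are
  equal, hence so are the densities almost everywhere.\<close>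

lemma AE_zero_if_box_integrals_zero:
  fixes h :: "'a::euclidean_space \<Rightarrow> real"
  assumes h: "integrable lborel h"
    and z: "\<And>a b. integral\<^sup>L lborel (\<lambda>x. indicator (box a b) x * h x) = 0"
  shows "AE x in lborel. h x = 0"
proof -
  have hm[measurable]: "h \<in> borel_measurable lborel" using h by auto
  define P where "P = density lborel (\<lambda>x. ennreal (max 0 (h x)))"
  define N where "N = density lborel (\<lambda>x. ennreal (max 0 (- h x)))"
  have ip: "integrable lborel (\<lambda>x. max 0 (h x))" "integrable lborel (\<lambda>x. max 0 (- h x))"
    using h by (auto intro: integrable_max)
  have eq: "emeasure P (box a b) = emeasure N (box a b)" for a b :: 'a
  proof -
    have i1: "integrable lborel (\<lambda>x. indicator (box a b) x * max 0 (h x))"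
      using ip(1) by (intro integrable_indicator_mult) auto
    have i2: "integrable lborel (\<lambda>x. indicator (box a b) x * max 0 (- h x))"
      using ip(2) by (intro integrable_indicator_mult) auto
    have "integral\<^sup>L lborel (\<lambda>x. indicator (box a b) x * max 0 (h x)) - integral\<^sup>L lborel (\<lambda>x. indicator (box a b) x * max 0 (- h x))
       = integral\<^sup>L lborel (\<lambda>x. indicator (box a b) x * max 0 (h x) - indicator (box a b) x * max 0 (- h x))"
      using i1 i2 by simp
    also have "\<dots> = integral\<^sup>L lborel (\<lambda>x. indicator (box a b) x * h x)"
      by (intro Bochner_Integration.integral_cong refl) (auto simp: indicator_def max_def)
    finally have e: "integral\<^sup>L lborel (\<lambda>x. indicator (box a b) x * max 0 (h x)) = integral\<^sup>L lborel (\<lambda>x. indicator (box a b) x * max 0 (- h x))"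
      using z by simp
    have "emeasure P (box a b) = (\<integral>\<^sup>+x. ennreal (indicator (box a b) x * max 0 (h x)) \<partial>lborel)"
      unfolding P_def by (subst emeasure_density) (auto intro!: nn_integral_cong simp: indicator_def)
    also have "\<dots> = ennreal (integral\<^sup>L lborel (\<lambda>x. indicator (box a b) x * max 0 (h x)))"
      by (rule nn_integral_eq_integral[OF i1]) (auto simp: indicator_def)
    also have "\<dots> = (\<integral>\<^sup>+x. ennreal (indicator (box a b) x * max 0 (- h x)) \<partial>lborel)"
      unfolding e by (rule nn_integral_eq_integral[OF i2, symmetric]) (auto simp: indicator_def)
    also have "\<dots> = emeasure N (box a b)"
      unfolding N_def by (subst emeasure_density) (auto intro!: nn_integral_cong simp: indicator_def)
    finally show ?thesis .
  qed
  let ?E = "range (\<lambda>(a, b). box a b :: 'a set)"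
  have fin: "emeasure P A < \<infinity>" for A
  proof -
    have "emeasure P A \<le> emeasure P (space P)" by (rule emeasure_space)
    also have "\<dots> = (\<integral>\<^sup>+x. ennreal (max 0 (h x)) \<partial>lborel)" unfolding P_def by (subst emeasure_density) auto
    also have "\<dots> = ennreal (integral\<^sup>L lborel (\<lambda>x. max 0 (h x)))" by (rule nn_integral_eq_integral[OF ip(1)]) auto
    also have "\<dots> < \<infinity>" by simp
    finally show ?thesis .
  qed
  have "P = N"
  proof (rule measure_eqI_generator_eq)
    show "Int_stable ?E"
    proof (rule Int_stableI)
      fix X Y assume "X \<in> ?E" "Y \<in> ?E"
      then obtain a b c d where "X = box a b" "Y = box c d" by auto
      then have "X \<inter> Y = (\<lambda>(a, b). box a b) (\<Sum>i\<in>Basis. max (a \<bullet> i) (c \<bullet> i) *\<^sub>R i, \<Sum>i\<in>Basis. min (b \<bullet> i) (d \<bullet> i) *\<^sub>R i)"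
        by (simp add: box_Int_box)
      then show "X \<inter> Y \<in> ?E" by (rule range_eqI)
    qed
    show "?E \<subseteq> Pow UNIV" "range (\<lambda>i. box (- real i *\<^sub>R One) (real i *\<^sub>R One)) \<subseteq> ?E" by auto
    show "(\<Union>i. box (- real i *\<^sub>R One) (real i *\<^sub>R One :: 'a)) = UNIV" using UN_box_eq_UNIV by (simp add: scaleR_minus_left)
    show "sets P = sigma_sets UNIV ?E" "sets N = sigma_sets UNIV ?E"
      by (simp_all add: P_def N_def borel_eq_box)
    show "X \<in> ?E \<Longrightarrow> emeasure P X = emeasure N X" for X using eq by auto
    show "emeasure P (box (- real i *\<^sub>R One) (real i *\<^sub>R One)) \<noteq> \<infinity>" for i using fin by (simp add: less_top[symmetric])
  qed
  then have "AE x in lborel. ennreal (max 0 (h x)) = ennreal (max 0 (- h x))"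
    unfolding P_def N_def
    by (subst (asm) finite_density_unique) (use fin[of UNIV] in \<open>auto simp: P_def emeasure_density less_top[symmetric]\<close>)
  then show ?thesis by eventually_elim (auto simp: max_def ennreal_eq_0_iff split: if_splits)
qed

theorem AE_zero_if_orthogonal_to_test_functions:
  fixes g :: "real^'n \<Rightarrow> real"
  assumes U: "open U" and g: "integrable (lebesgue_on U) g"
    and orth: "\<And>\<phi>. test_function U \<phi> \<Longrightarrow> integral\<^sup>L (lebesgue_on U) (\<lambda>x. g x * \<phi> x) = 0"
  shows "AE x in lebesgue_on U. g x = 0"
proof -
  have Ul: "U \<in> sets lebesgue" using U by simp
  have iG: "integrable lebesgue (\<lambda>x. indicator U x * g x)"
    using g Ul by (simp add: integrable_restrict_space)
  \<comment> \<open>A Borel version of the extension of \<open>g\<close> by zero, to which the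
    criterion for \<open>lborel\<close> applies.\<close>
  then obtain h where hm[measurable]: "h \<in> borel_measurable lborel" and hg: "AE x in lborel. indicator U x * g x = h x"
    using completion_ex_borel_measurable_real[of "\<lambda>x. indicator U x * g x" lborel] by auto
  have hg': "AE x in lebesgue. indicator U x * g x = h x" using hg by (rule AE_completion)
  have ih: "integrable lborel h"
  proof -
    have "integrable lebesgue h"
      by (rule integrable_cong_AE_imp[OF iG measurable_completion[OF hm] hg'])
    then show ?thesis using integrable_completion[OF hm] by simp
  qed
  \<comment> \<open>The indicator of a box inside \<open>U\<close> localizes the problem: every
    further box meets it in a box again, and \<open>g\<close> has integral zero over boxes inside
    \<open>U\<close>.\<close>
  have box0: "AE x in lborel. x \<in> box a b \<longrightarrow> h x = 0" if ab: "cbox a b \<subseteq> U" for a b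
  proof -
    let ?k = "\<lambda>x. indicator (box a b) x * h x"
    have ik: "integrable lborel ?k" using ih by (intro integrable_indicator_mult) auto
    have "AE x in lborel. ?k x = 0"
    proof (rule AE_zero_if_box_integrals_zero[OF ik])
      fix c d :: "real^'n"
      have "\<exists>a' b'. box c d \<inter> box a b = box a' b'" by (rule exI, rule exI, rule box_Int_box)
      then obtain a' b' where ab': "box c d \<inter> box a b = box a' b'" by blast
      show "integral\<^sup>L lborel (\<lambda>x. indicator (box c d) x * ?k x) = 0"
      proof (cases "box a' b' = {}")
        case True
        then have "(\<lambda>x. indicator (box c d) x * ?k x) = (\<lambda>x. 0)"
          using ab' by (auto simp: indicator_def fun_eq_iff)
        then show ?thesis by (simp only: Bochner_Integration.integral_zero)
      next
        case False
        have "closure (box a' b') \<subseteq> cbox a b"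
          using ab' box_subset_cbox[of a b] by (intro closure_minimal) auto
        then have "cbox a' b' \<subseteq> cbox a b" using False by simp
        then have sub: "cbox a' b' \<subseteq> U" using ab by blast
        have 0: "integral\<^sup>L (lebesgue_on U) (\<lambda>x. indicator (box a' b') x * g x) = 0"
          by (rule integral_box_zero[OF U g _ sub]) (rule orth)
        have "integral\<^sup>L lborel (\<lambda>x. indicator (box c d) x * ?k x) = integral\<^sup>L lborel (\<lambda>x. indicator (box a' b') x * h x)"
          by (intro Bochner_Integration.integral_cong refl) (auto simp: indicator_def simp flip: ab')
        also have "\<dots> = integral\<^sup>L lebesgue (\<lambda>x. indicator (box a' b') x * h x)"
          by (rule integral_completion[symmetric]) measurable
        also have "\<dots> = integral\<^sup>L lebesgue (\<lambda>x. indicator (box a' b') x * (indicator U x * g x))"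
        proof (rule integral_cong_AE)
          show "(\<lambda>x. indicator (box a' b') x * h x) \<in> borel_measurable lebesgue"
            by (intro borel_measurable_times measurable_completion) auto
          show "(\<lambda>x. indicator (box a' b') x * (indicator U x * g x)) \<in> borel_measurable lebesgue"
            by (intro borel_measurable_times[OF _ borel_measurable_integrable[OF iG]] measurable_completion) auto
        qed (use hg' in eventually_elim, auto)
        also have "\<dots> = integral\<^sup>L (lebesgue_on U) (\<lambda>x. indicator (box a' b') x * g x)"
          using Ul by (simp add: integral_restrict_space mult.left_commute)
        finally show ?thesis using 0 by simp
      qed
    qed
    then show ?thesis by eventually_elim (auto simp: indicator_def)
  qed
  obtain D where D: "countable D" "D \<subseteq> Pow U" "\<And>X. X \<in> D \<Longrightarrow> \<exists>a b. X = cbox a b" "\<Union>D = U"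
    by (rule open_countable_Union_open_cbox[OF U]) (rule that; assumption)
  have "\<forall>X\<in>D. AE x in lborel. x \<in> X \<longrightarrow> h x = 0"
  proof
    fix X assume X: "X \<in> D"
    obtain a b where ab: "X = cbox a b" using D(3)[OF X] by blast
    \<comment> \<open>The countable cover consists of closed boxes, whereas \<open>box0\<close>
      speaks of open ones; the faces are a null set.\<close>
    have "cbox a b - box a b \<in> null_sets lborel"
      using negligible_frontier_interval[of a b] by (simp add: negligible_iff_null_sets null_sets_completion_iff)
    then have "AE x in lborel. x \<notin> cbox a b - box a b" by (rule AE_not_in)
    moreover have "AE x in lborel. x \<in> box a b \<longrightarrow> h x = 0" by (rule box0) (use D(2) X ab in auto)
    ultimately show "AE x in lborel. x \<in> X \<longrightarrow> h x = 0" unfolding ab by eventually_elim auto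
  qed
  then have "AE x in lborel. \<forall>X\<in>D. x \<in> X \<longrightarrow> h x = 0" unfolding AE_ball_countable[OF D(1)] .
  then have "AE x in lborel. x \<in> U \<longrightarrow> g x = 0"
    using hg by eventually_elim (use D(4) in \<open>auto simp: indicator_def\<close>)
  then have "AE x in lebesgue. x \<in> U \<longrightarrow> g x = 0" by (rule AE_completion)
  then show ?thesis using Ul by (simp add: AE_restrict_space_iff)
qed

section \<open>Sobolev spaces\<close>

lemma powr_convex_nonneg:
  fixes x y p t :: real
  assumes p: "p \<ge> 1" and xy: "x \<ge> 0" "y \<ge> 0" and t: "0 \<le> t" "t \<le> 1"
  shows "(t * x + (1 - t) * y) powr p \<le> t * x powr p + (1 - t) * y powr p"
proof -
  \<comment> \<open>Covers a vanishing argument, where convexity on the open half-line does not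
    apply; it rests on \<open>s powr p \<le> s\<close>.\<close>
  have *: "(s * z) powr p \<le> s * z powr p" if "0 \<le> s" "s \<le> 1" "z \<ge> 0" for s z :: real
  proof -
    have "s powr p \<le> s powr 1" using that p by (intro powr_mono') auto
    then have "s powr p \<le> s" using that by simp
    then show ?thesis using that by (simp add: powr_mult mult_right_mono)
  qed
  consider "x = 0" | "y = 0" | "x > 0" "y > 0" using xy by linarith
  then show ?thesis
  proof cases
    case 3
    have "(\<lambda>x. x powr p) ((1 - t) *\<^sub>R y + t *\<^sub>R x) \<le> (1 - t) * (y powr p) + t * (x powr p)"
      by (rule convex_onD[OF powr_convex[OF p]]) (use 3 t in auto)
    then show ?thesis by (simp add: algebra_simps)
  qed (use *[of t x] *[of "1-t" y] t xy p in auto)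
qed

lemma in_Lp_add:
  fixes f g :: "'a \<Rightarrow> 'b::euclidean_space"
  assumes p: "p \<ge> 1" and f: "in_Lp p M f" and g: "in_Lp p M g"
  shows "in_Lp p M (\<lambda>x. f x + g x)"
  unfolding in_Lp_def
proof
  have fm[measurable]: "f \<in> borel_measurable M" and gm[measurable]: "g \<in> borel_measurable M"
    using f g by (auto simp: in_Lp_def)
  show "(\<lambda>x. f x + g x) \<in> borel_measurable M" by measurable
  show "integrable M (\<lambda>x. norm (f x + g x) powr p)"
  proof (rule Bochner_Integration.integrable_bound)
    show "integrable M (\<lambda>x. 2 powr p * (norm (f x) powr p + norm (g x) powr p))"
      using f g by (auto simp: in_Lp_def)
    show "(\<lambda>x. norm (f x + g x) powr p) \<in> borel_measurable M" by measurable
    have "norm (f x + g x) powr p \<le> 2 powr p * (norm (f x) powr p + norm (g x) powr p)" for x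
    proof -
      have "norm (f x + g x) powr p \<le> (2 * (1/2 * norm (f x) + (1 - 1/2) * norm (g x))) powr p"
        using p norm_triangle_ineq[of "f x" "g x"] by (intro powr_mono2) auto
      also have "\<dots> = 2 powr p * (1/2 * norm (f x) + (1 - 1/2) * norm (g x)) powr p"
        by (rule powr_mult) 
      also have "\<dots> \<le> 2 powr p * (1/2 * norm (f x) powr p + (1 - 1/2) * norm (g x) powr p)"
        by (intro mult_left_mono powr_convex_nonneg p) auto
      also have "\<dots> \<le> 2 powr p * (norm (f x) powr p + norm (g x) powr p)"
        by (intro mult_left_mono add_mono) auto
      finally show ?thesis .
    qed
    then show "AE x in M. norm (norm (f x + g x) powr p) \<le> norm (2 powr p * (norm (f x) powr p + norm (g x) powr p))"
      by (intro AE_I2) auto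
  qed
qed

lemma Lp_norm_nonneg: "Lp_norm p M f \<ge> 0"
  by (simp add: Lp_norm_def)

lemma Lp_norm_powr: "p > 0 \<Longrightarrow> Lp_norm p M f powr p = (\<integral>x. norm (f x) powr p \<partial>M)"
  by (simp add: Lp_norm_def powr_powr integral_nonneg_AE)

lemma Lp_norm_AE_cong:
  assumes "f \<in> borel_measurable M" "g \<in> borel_measurable M" "AE x in M. f x = g x"
  shows "Lp_norm p M f = Lp_norm p M g"
proof -
  have "(\<integral>x. norm (f x) powr p \<partial>M) = (\<integral>x. norm (g x) powr p \<partial>M)"
    by (rule integral_cong_AE) (use assms in \<open>auto elim!: eventually_mono\<close>)
  then show ?thesis by (simp add: Lp_norm_def)
qed

lemma Lp_norm_eq_0_iff:
  assumes "in_Lp p M f" "p > 0"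
  shows "Lp_norm p M f = 0 \<longleftrightarrow> (AE x in M. f x = 0)"
proof -
  have "Lp_norm p M f = 0 \<longleftrightarrow> (\<integral>x. norm (f x) powr p \<partial>M) = 0" by (simp add: Lp_norm_def)
  also have "\<dots> \<longleftrightarrow> (AE x in M. norm (f x) powr p = 0)"
    using assms by (intro integral_nonneg_eq_0_iff_AE) (auto simp: in_Lp_def)
  finally show ?thesis using assms by simp
qed

lemma in_Lp_AE_cong:
  assumes "in_Lp p M f" "g \<in> borel_measurable M" "AE x in M. f x = g x"
  shows "in_Lp p M g"
  unfolding in_Lp_def
proof
  show "integrable M (\<lambda>x. norm (g x) powr p)"
    by (rule integrable_cong_AE_imp[of _ "\<lambda>x. norm (f x) powr p"])
       (use assms in \<open>auto simp: in_Lp_def elim!: eventually_mono\<close>)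
qed (rule assms)

theorem Lp_norm_triangle:
  fixes f g :: "'a \<Rightarrow> 'b::euclidean_space"
  assumes p: "p \<ge> 1" and f: "in_Lp p M f" and g: "in_Lp p M g"
  shows "Lp_norm p M (\<lambda>x. f x + g x) \<le> Lp_norm p M f + Lp_norm p M g"
proof -
  define a where "a = Lp_norm p M f"
  define b where "b = Lp_norm p M g"
  have fm: "f \<in> borel_measurable M" and gm: "g \<in> borel_measurable M"
    using f g by (auto simp: in_Lp_def)
  have sm: "(\<lambda>x. f x + g x) \<in> borel_measurable M" using fm gm by measurable
  have p0: "p > 0" using p by simp
  consider "a = 0" | "b = 0" | "a > 0" "b > 0" using Lp_norm_nonneg[of p M f] Lp_norm_nonneg[of p M g]
    unfolding a_def b_def by linarith
  then show ?thesis
  proof cases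
    case 1
    then have "AE x in M. f x = 0" using Lp_norm_eq_0_iff[OF f p0] by (simp add: a_def)
    then have "AE x in M. f x + g x = g x" by eventually_elim simp
    from Lp_norm_AE_cong[OF sm gm this] show ?thesis using Lp_norm_nonneg[of p M f] by simp
  next
    case 2
    then have "AE x in M. g x = 0" using Lp_norm_eq_0_iff[OF g p0] by (simp add: b_def)
    then have "AE x in M. f x + g x = f x" by eventually_elim simp
    from Lp_norm_AE_cong[OF sm fm this] show ?thesis using Lp_norm_nonneg[of p M g] by simp
  next
    case 3
    \<comment> \<open>With this weight the sum of the norms is \<open>a + b\<close> times a convex
      combination of the normalized values \<open>norm (f x) / a\<close> and
      \<open>norm (g x) / b\<close>. Convexity of the power and integration then give the
      inequality.\<close>
    define t where "t = a / (a + b)"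
    have t: "0 \<le> t" "t \<le> 1" "1 - t = b / (a + b)" using 3 by (auto simp: t_def field_simps)
    define c where "c = (a + b) powr p"
    have bound: "norm (f x + g x) powr p \<le> c * (t * (norm (f x) powr p / a powr p) + (1 - t) * (norm (g x) powr p / b powr p))" for x
    proof -
      have "norm (f x) + norm (g x) = (a + b) * (t * (norm (f x) / a) + (1 - t) * (norm (g x) / b))"
      proof -
        have "(a + b) * (t * (x / a)) = x" "(a + b) * ((1 - t) * (x / b)) = x" for x
          unfolding t(3) using 3 by (auto simp: t_def)
        then show ?thesis by (simp only: distrib_left)
      qed
      then have "norm (f x + g x) powr p \<le> ((a + b) * (t * (norm (f x) / a) + (1 - t) * (norm (g x) / b))) powr p"
        using p norm_triangle_ineq[of "f x" "g x"] by (intro powr_mono2) auto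
      also have "\<dots> = c * (t * (norm (f x) / a) + (1 - t) * (norm (g x) / b)) powr p"
        unfolding c_def by (rule powr_mult) 
      also have "\<dots> \<le> c * (t * (norm (f x) / a) powr p + (1 - t) * (norm (g x) / b) powr p)"
        using 3 t by (intro mult_left_mono powr_convex_nonneg p) (auto simp: c_def)
      finally show ?thesis using 3 by (simp add: powr_divide)
    qed
    have "(\<integral>x. norm (f x + g x) powr p \<partial>M) \<le> (\<integral>x. c * (t * (norm (f x) powr p / a powr p) + (1 - t) * (norm (g x) powr p / b powr p)) \<partial>M)"
      using in_Lp_add[OF p f g] f g bound by (intro integral_mono) (auto simp: in_Lp_def)
    also have "\<dots> = c * (t * ((\<integral>x. norm (f x) powr p \<partial>M) / a powr p) + (1 - t) * ((\<integral>x. norm (g x) powr p \<partial>M) / b powr p))"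
      using f g by (simp add: in_Lp_def)
    also have "\<dots> = c" using 3 unfolding a_def b_def Lp_norm_powr[OF p0, symmetric] by simp
    finally have "Lp_norm p M (\<lambda>x. f x + g x) \<le> c powr (1 / p)"
      unfolding Lp_norm_def using p0 by (intro powr_mono2) (auto intro: integral_nonneg_AE)
    also have "\<dots> = a + b" using 3 p0 by (simp add: c_def powr_powr)
    finally show ?thesis by (simp add: a_def b_def)
  qed
qed

lemma in_Lp_scale:
  assumes "in_Lp p M f" shows "in_Lp p M (\<lambda>x. c *\<^sub>R f x)"
  using assms by (auto simp: in_Lp_def powr_mult)

lemma Lp_norm_scale:
  assumes "p > 0" shows "Lp_norm p M (\<lambda>x. c *\<^sub>R f x) = \<bar>c\<bar> * Lp_norm p M f"
proof -
  have "(\<integral>x. norm (c *\<^sub>R f x) powr p \<partial>M) = \<bar>c\<bar> powr p * (\<integral>x. norm (f x) powr p \<partial>M)"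
    by (simp add: powr_mult)
  then show ?thesis using assms by (simp add: Lp_norm_def powr_mult powr_powr integral_nonneg_AE)
qed

lemma test_function_bounded:
  assumes "test_function U \<phi>"
  obtains B where "\<And>x. \<bar>\<phi> x\<bar> \<le> B" "\<And>i x. \<bar>partial_deriv i \<phi> x\<bar> \<le> B"
proof -
  obtain K where K: "compact K" "K \<subseteq> U" "\<forall>x. x \<notin> K \<longrightarrow> \<phi> x = 0"
    using test_function_support[OF assms] by blast
  have "bounded (\<phi> ` K)"
    by (intro compact_imp_bounded compact_continuous_image K test_function_continuous[OF assms])
  then obtain B0 where B0: "\<forall>x\<in>K. \<bar>\<phi> x\<bar> \<le> B0" by (auto simp: bounded_iff)
  have "bounded (partial_deriv i \<phi> ` K)" for i
    by (intro compact_imp_bounded compact_continuous_image K test_function_continuous_partial[OF assms])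
  then have "\<forall>i. \<exists>b. \<forall>x\<in>K. \<bar>partial_deriv i \<phi> x\<bar> \<le> b" by (simp add: bounded_iff)
  from choice[OF this] obtain b where b: "\<forall>i. \<forall>x\<in>K. \<bar>partial_deriv i \<phi> x\<bar> \<le> b i" ..
  define B where "B = \<bar>B0\<bar> + (\<Sum>i\<in>UNIV. \<bar>b i\<bar>)"
  have s0: "(\<Sum>i\<in>UNIV. \<bar>b i\<bar>) \<ge> 0" by (intro sum_nonneg) auto
  have bi: "\<bar>b i\<bar> \<le> (\<Sum>i\<in>UNIV. \<bar>b i\<bar>)" for i by (rule member_le_sum) auto
  have pz: "partial_deriv i \<phi> x = 0" if "x \<notin> K" for x i
    by (rule partial_deriv_zero[of "- K"]) (simp_all add: open_Compl compact_imp_closed[OF K(1)] that K(3))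
  show ?thesis
  proof (rule that[of B])
    show "\<bar>\<phi> x\<bar> \<le> B" for x
    proof (cases "x \<in> K")
      case True
      then have "\<bar>\<phi> x\<bar> \<le> B0" using B0 by blast
      then show ?thesis using s0 unfolding B_def by linarith
    qed (use K s0 in \<open>simp add: B_def\<close>)
    show "\<bar>partial_deriv i \<phi> x\<bar> \<le> B" for i x
    proof (cases "x \<in> K")
      case True
      then have "\<bar>partial_deriv i \<phi> x\<bar> \<le> b i" using b by blast
      then show ?thesis using bi[of i] unfolding B_def by linarith
    qed (use pz s0 in \<open>simp add: B_def\<close>)
  qed
qed

lemma integrable_mult_bounded:
  fixes f g :: "'a \<Rightarrow> real"
  assumes f: "integrable M f" and g: "g \<in> borel_measurable M" and B: "\<And>x. \<bar>g x\<bar> \<le> B"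
  shows "integrable M (\<lambda>x. f x * g x)"
proof (rule Bochner_Integration.integrable_bound)
  show "integrable M (\<lambda>x. B * f x)" using f by simp
  show "(\<lambda>x. f x * g x) \<in> borel_measurable M" using f g by measurable
  show "AE x in M. norm (f x * g x) \<le> norm (B * f x)"
  proof (rule AE_I2)
    fix x
    have "\<bar>f x\<bar> * \<bar>g x\<bar> \<le> \<bar>f x\<bar> * \<bar>B\<bar>" using B[of x] by (intro mult_left_mono) auto
    then show "norm (f x * g x) \<le> norm (B * f x)" by (simp add: abs_mult mult.commute)
  qed
qed

lemma in_Lp_component: "in_Lp p M g \<Longrightarrow> p \<ge> 0 \<Longrightarrow> in_Lp p M (\<lambda>x. g x $ i)"
  for g :: "'a \<Rightarrow> real^'n"
  unfolding in_Lp_def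
proof (elim conjE, intro conjI)
  assume p: "p \<ge> 0" and g: "g \<in> borel_measurable M" and i: "integrable M (\<lambda>x. norm (g x) powr p)"
  show m: "(\<lambda>x. g x $ i) \<in> borel_measurable M"
    by (rule borel_measurable_continuous_on[OF _ g]) (intro continuous_intros)
  show "integrable M (\<lambda>x. norm (g x $ i) powr p)"
    by (rule Bochner_Integration.integrable_bound[OF i])
       (use m p in \<open>auto intro!: AE_I2 powr_mono2 simp: component_le_norm_cart\<close>)
qed

locale sobolev_domain =
  fixes U :: "(real^'n) set" and p :: real
  assumes open_U: "open U" and bounded_U: "bounded U" and p_gt_1: "p > 1"
begin

abbreviation "M \<equiv> lebesgue_on U"

lemma p_ge_1: "p \<ge> 1" and p_pos: "p > 0" using p_gt_1 by auto

lemma sets_U: "U \<in> sets lebesgue" using open_U by simp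

lemma finite_measure_M: "finite_measure M"
  by (rule finite_measure_lebesgue_on) (rule lmeasurable_open[OF bounded_U open_U])

text \<open>A bounded domain has finite measure, and \<open>|t| \<le> 1 + |t| powr p\<close>. This
  makes the pairings with test functions integrable.\<close>

lemma in_Lp_integrable:
  fixes f :: "real^'n \<Rightarrow> real"
  assumes "in_Lp p M f" shows "integrable M f"
proof (rule Bochner_Integration.integrable_bound)
  show "integrable M (\<lambda>x. 1 + norm (f x) powr p)"
    using assms finite_measure.integrable_const[OF finite_measure_M, of "1::real"] by (auto simp: in_Lp_def)
  show "f \<in> borel_measurable M" using assms by (simp add: in_Lp_def)
  have "\<bar>t\<bar> \<le> 1 + \<bar>t\<bar> powr p" for t :: real
  proof (cases "\<bar>t\<bar> \<le> 1")
    case False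
    then have "\<bar>t\<bar> powr 1 \<le> \<bar>t\<bar> powr p" using p_ge_1 by (intro powr_mono) auto
    then show ?thesis using False by simp
  qed (simp add: add_increasing2)
  then show "AE x in M. norm (f x) \<le> norm (1 + norm (f x) powr p)" by (intro AE_I2) (simp add: add_increasing)
qed

lemma measurable_test: "test_function V \<phi> \<Longrightarrow> \<phi> \<in> borel_measurable M"
  and measurable_partial: "test_function V \<phi> \<Longrightarrow> partial_deriv i \<phi> \<in> borel_measurable M"
  by (intro borel_measurable_lebesgue_on borel_measurable_continuous_onI test_function_continuous
      test_function_continuous_partial; assumption)+

lemma integrable_mult_test:
  assumes f: "in_Lp p M f" and phi: "test_function V \<phi>"
  shows "integrable M (\<lambda>x. f x * \<phi> x)" "integrable M (\<lambda>x. f x * partial_deriv i \<phi> x)"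
proof -
  obtain B where B: "\<And>x. \<bar>\<phi> x\<bar> \<le> B" "\<And>i x. \<bar>partial_deriv i \<phi> x\<bar> \<le> B"
    by (rule test_function_bounded[OF phi]) (rule that; assumption)
  show "integrable M (\<lambda>x. f x * \<phi> x)"
    by (rule integrable_mult_bounded[OF in_Lp_integrable[OF f] measurable_test[OF phi] B(1)])
  show "integrable M (\<lambda>x. f x * partial_deriv i \<phi> x)"
    by (rule integrable_mult_bounded[OF in_Lp_integrable[OF f] measurable_partial[OF phi] B(2)])
qed

text \<open>Makes \<open>wgrad\<close>, which is picked by \<open>SOME\<close>, comparable with
  explicit gradients. The fundamental lemma is applied to each component of the difference.\<close>

theorem weak_gradient_unique:
  assumes g: "in_Lp p M g" and h: "in_Lp p M h"
    and wg: "weak_gradient U u g" and wh: "weak_gradient U u h"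
  shows "AE x in M. g x = h x"
proof -
  have "AE x in M. g x $ i - h x $ i = 0" for i
  proof (rule AE_zero_if_orthogonal_to_test_functions[OF open_U])
    have gi: "in_Lp p M (\<lambda>x. g x $ i)" and hi: "in_Lp p M (\<lambda>x. h x $ i)"
      using g h p_pos by (auto intro!: in_Lp_component)
    show "integrable M (\<lambda>x. g x $ i - h x $ i)"
      using in_Lp_integrable[OF gi] in_Lp_integrable[OF hi] by simp
    fix \<phi> assume phi: "test_function U \<phi>"
    have "(\<integral>x. g x $ i * \<phi> x \<partial>M) = (\<integral>x. h x $ i * \<phi> x \<partial>M)"
    proof -
      have "(\<integral>x. u x * partial_deriv i \<phi> x \<partial>M) = - (\<integral>x. g x $ i * \<phi> x \<partial>M)"
        "(\<integral>x. u x * partial_deriv i \<phi> x \<partial>M) = - (\<integral>x. h x $ i * \<phi> x \<partial>M)"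
        using wg wh phi by (auto simp: weak_gradient_def)
      then show ?thesis by simp
    qed
    then show "(\<integral>x. (g x $ i - h x $ i) * \<phi> x \<partial>M) = 0"
      using integrable_mult_test(1)[OF gi phi] integrable_mult_test(1)[OF hi phi] by (simp add: left_diff_distrib)
  qed
  then have "AE x in M. \<forall>i. g x $ i - h x $ i = 0" by (simp add: AE_all_countable)
  then show ?thesis by eventually_elim (simp add: vec_eq_iff)
qed

section \<open>Linear operations on weak gradients, and the Sobolev norm\<close>

lemma wgrad:
  assumes "sobolev p U u"
  shows "in_Lp p M (wgrad p U u)" "weak_gradient U u (wgrad p U u)"
  using someI_ex[of "\<lambda>g. in_Lp p M g \<and> weak_gradient U u g"] assms unfolding sobolev_def wgrad_def by auto

lemma Lp_norm_wgrad:
  assumes "in_Lp p M u" "in_Lp p M g" "weak_gradient U u g"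
  shows "Lp_norm p M (wgrad p U u) = Lp_norm p M g" "AE x in M. wgrad p U u x = g x" "sobolev p U u"
proof -
  show s: "sobolev p U u" using assms by (auto simp: sobolev_def)
  show ae: "AE x in M. wgrad p U u x = g x"
    by (rule weak_gradient_unique[OF wgrad(1)[OF s] assms(2) wgrad(2)[OF s] assms(3)])
  show "Lp_norm p M (wgrad p U u) = Lp_norm p M g"
    by (rule Lp_norm_AE_cong[OF _ _ ae]) (use wgrad(1)[OF s] assms(2) in \<open>auto simp: in_Lp_def\<close>)
qed

lemma sobolev_in_Lp: "sobolev p U u \<Longrightarrow> in_Lp p M u"
  by (simp add: sobolev_def)

lemma weak_gradient_add:
  assumes "in_Lp p M u" "in_Lp p M v" "in_Lp p M g" "in_Lp p M h"
    and "weak_gradient U u g" "weak_gradient U v h"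
  shows "weak_gradient U (\<lambda>x. u x + v x) (\<lambda>x. g x + h x)"
  unfolding weak_gradient_def
proof (intro allI impI)
  fix \<phi> i assume phi: "test_function U \<phi>"
  have gi: "in_Lp p M (\<lambda>x. g x $ i)" and hi: "in_Lp p M (\<lambda>x. h x $ i)"
    using assms p_pos by (auto intro!: in_Lp_component)
  have "(\<integral>x. u x * partial_deriv i \<phi> x \<partial>M) = - (\<integral>x. g x $ i * \<phi> x \<partial>M)"
    "(\<integral>x. v x * partial_deriv i \<phi> x \<partial>M) = - (\<integral>x. h x $ i * \<phi> x \<partial>M)"
    using assms phi by (auto simp: weak_gradient_def)
  then show "(\<integral>x. (u x + v x) * partial_deriv i \<phi> x \<partial>M) = - (\<integral>x. (g x + h x) $ i * \<phi> x \<partial>M)"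
    using integrable_mult_test[OF assms(1) phi] integrable_mult_test[OF assms(2) phi]
      integrable_mult_test[OF gi phi] integrable_mult_test[OF hi phi]
    by (simp add: distrib_right)
qed

lemma weak_gradient_scale:
  "weak_gradient U u g \<Longrightarrow> weak_gradient U (\<lambda>x. c * u x) (\<lambda>x. c *\<^sub>R g x)"
  by (simp add: weak_gradient_def mult.assoc)

lemma sobolev_add:
  assumes u: "sobolev p U u" and v: "sobolev p U v"
  shows "sobolev p U (\<lambda>x. u x + v x)"
    and "Lp_norm p M (wgrad p U (\<lambda>x. u x + v x)) \<le> Lp_norm p M (wgrad p U u) + Lp_norm p M (wgrad p U v)"
    and "sobolev_norm p U (\<lambda>x. u x + v x) \<le> sobolev_norm p U u + sobolev_norm p U v"
proof -
  note Lu = sobolev_in_Lp[OF u] and Lv = sobolev_in_Lp[OF v]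
  note w = weak_gradient_add[OF Lu Lv wgrad(1)[OF u] wgrad(1)[OF v] wgrad(2)[OF u] wgrad(2)[OF v]]
  note a = in_Lp_add[OF p_ge_1 Lu Lv] in_Lp_add[OF p_ge_1 wgrad(1)[OF u] wgrad(1)[OF v]]
  show "sobolev p U (\<lambda>x. u x + v x)" by (rule Lp_norm_wgrad(3)[OF a w])
  show g: "Lp_norm p M (wgrad p U (\<lambda>x. u x + v x)) \<le> Lp_norm p M (wgrad p U u) + Lp_norm p M (wgrad p U v)"
    unfolding Lp_norm_wgrad(1)[OF a w] by (rule Lp_norm_triangle[OF p_ge_1 wgrad(1)[OF u] wgrad(1)[OF v]])
  show "sobolev_norm p U (\<lambda>x. u x + v x) \<le> sobolev_norm p U u + sobolev_norm p U v"
    using g Lp_norm_triangle[OF p_ge_1 Lu Lv] unfolding sobolev_norm_def by linarith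
qed

lemma sobolev_scale:
  assumes u: "sobolev p U u"
  shows "sobolev p U (\<lambda>x. c * u x)"
    and "Lp_norm p M (wgrad p U (\<lambda>x. c * u x)) = \<bar>c\<bar> * Lp_norm p M (wgrad p U u)"
proof -
  have a: "in_Lp p M (\<lambda>x. c * u x)" using in_Lp_scale[OF sobolev_in_Lp[OF u], of c] by simp
  note L = Lp_norm_wgrad[OF a in_Lp_scale[OF wgrad(1)[OF u], of c] weak_gradient_scale[OF wgrad(2)[OF u]]]
  show "sobolev p U (\<lambda>x. c * u x)" by (rule L(3))
  show "Lp_norm p M (wgrad p U (\<lambda>x. c * u x)) = \<bar>c\<bar> * Lp_norm p M (wgrad p U u)"
    unfolding L(1) by (rule Lp_norm_scale[OF p_pos])
qed

lemma sobolev_diff: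
  assumes u: "sobolev p U u" and v: "sobolev p U v"
  shows "sobolev p U (\<lambda>x. u x - v x)"
  using sobolev_add(1)[OF u sobolev_scale(1)[OF v, of "-1"]] by simp

lemma weak_gradient_AE_cong:
  assumes "u \<in> borel_measurable M" "v \<in> borel_measurable M" "AE x in M. u x = v x" "weak_gradient U u g"
  shows "weak_gradient U v g"
  unfolding weak_gradient_def
proof (intro allI impI)
  fix \<phi> i assume phi: "test_function U \<phi>"
  have "(\<integral>x. v x * partial_deriv i \<phi> x \<partial>M) = (\<integral>x. u x * partial_deriv i \<phi> x \<partial>M)"
  proof (rule integral_cong_AE)
    show "AE x in M. v x * partial_deriv i \<phi> x = u x * partial_deriv i \<phi> x"
      using assms(3) by eventually_elim simp
  qed (use assms measurable_partial[OF phi] in measurable)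
  also have "\<dots> = - (\<integral>x. g x $ i * \<phi> x \<partial>M)" using assms(4) phi by (simp add: weak_gradient_def)
  finally show "(\<integral>x. v x * partial_deriv i \<phi> x \<partial>M) = - (\<integral>x. g x $ i * \<phi> x \<partial>M)" .
qed

lemma sobolev_AE_cong:
  assumes u: "sobolev p U u" and v: "v \<in> borel_measurable M" and ae: "AE x in M. u x = v x"
  shows "sobolev p U v" "AE x in M. wgrad p U v x = wgrad p U u x" "sobolev_norm p U v = sobolev_norm p U u"
proof -
  have um: "u \<in> borel_measurable M" using sobolev_in_Lp[OF u] by (simp add: in_Lp_def)
  note L = Lp_norm_wgrad[OF in_Lp_AE_cong[OF sobolev_in_Lp[OF u] v ae] wgrad(1)[OF u]
      weak_gradient_AE_cong[OF um v ae wgrad(2)[OF u]]]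
  show "sobolev p U v" by (rule L(3))
  show "AE x in M. wgrad p U v x = wgrad p U u x" by (rule L(2))
  show "sobolev_norm p U v = sobolev_norm p U u"
    unfolding sobolev_norm_def L(1) Lp_norm_AE_cong[OF um v ae] ..
qed

text \<open>No regularity of \<open>u\<close> is assumed here because a \<open>Metric_space\<close> is symmetric on the whole type.\<close>

lemma sobolev_norm_minus: "sobolev_norm p U (\<lambda>x. - u x) = sobolev_norm p U u"
proof -
  have wiff: "weak_gradient U (\<lambda>x. - u x) g \<longleftrightarrow> weak_gradient U u (\<lambda>x. - g x)" for u and g :: "real^'n \<Rightarrow> real^'n"
    by (auto simp: weak_gradient_def)
  have Liff: "in_Lp p M (\<lambda>x. - g x) \<longleftrightarrow> in_Lp p M g" for g :: "real^'n \<Rightarrow> real^'n"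
    by (auto simp: in_Lp_def)
  let ?P = "\<lambda>u g. in_Lp p M g \<and> weak_gradient U u g"
  have "Lp_norm p M (wgrad p U (\<lambda>x. - u x)) = Lp_norm p M (wgrad p U u)"
  proof (cases "\<exists>g. ?P u g")
    case True
    then have 1: "?P u (wgrad p U u)" unfolding wgrad_def by (rule someI_ex)
    obtain g where "?P u g" using True by blast
    then have "?P (\<lambda>x. - u x) (\<lambda>x. - g x)" by (simp add: wiff Liff)
    then have "?P (\<lambda>x. - u x) (wgrad p U (\<lambda>x. - u x))"
      unfolding wgrad_def by (rule someI[of "?P (\<lambda>x. - u x)"])
    then have 2: "?P u (\<lambda>x. - wgrad p U (\<lambda>x. - u x) x)" by (simp add: wiff Liff)
    have ae: "AE x in M. wgrad p U u x = - wgrad p U (\<lambda>x. - u x) x"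
      by (rule weak_gradient_unique[OF conjunct1[OF 1] conjunct1[OF 2] conjunct2[OF 1] conjunct2[OF 2]])
    have "Lp_norm p M (wgrad p U u) = Lp_norm p M (\<lambda>x. - wgrad p U (\<lambda>x. - u x) x)"
      by (rule Lp_norm_AE_cong[OF _ _ ae]) (use 1 2 in \<open>auto simp: in_Lp_def\<close>)
    then show ?thesis by (simp add: Lp_norm_def)
  next
    \<comment> \<open>Without an L^p weak gradient both defining predicates are identically false,
      so \<open>SOME\<close> selects the same function for \<open>u\<close> and its
      negative.\<close>
    case False
    then have "\<not> ?P (\<lambda>x. - u x) g" for g by (simp add: wiff flip: Liff[of g])
    then have "?P (\<lambda>x. - u x) = ?P u" using False by (intro ext) blast
    then show ?thesis unfolding wgrad_def by simp
  qed
  then show ?thesis by (simp add: sobolev_norm_def Lp_norm_def)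
qed

lemma sobolev_norm_nonneg: "sobolev_norm p U u \<ge> 0"
  by (simp add: sobolev_norm_def Lp_norm_nonneg)

lemma sobolev_norm_zero_iff:
  assumes "sobolev p U u" shows "sobolev_norm p U u = 0 \<longleftrightarrow> (AE x in M. u x = 0)"
proof
  assume "sobolev_norm p U u = 0"
  then have "Lp_norm p M u = 0"
    using Lp_norm_nonneg[of p M u] Lp_norm_nonneg[of p M "wgrad p U u"] unfolding sobolev_norm_def by linarith
  then show "AE x in M. u x = 0" using Lp_norm_eq_0_iff[OF sobolev_in_Lp[OF assms] p_pos] by simp
next
  assume ae: "AE x in M. u x = 0"
  have "weak_gradient U (\<lambda>_. 0) (\<lambda>_. 0)" by (simp add: weak_gradient_def)
  moreover have "in_Lp p M (\<lambda>_. 0)" for z :: real by (simp add: in_Lp_def)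
  moreover have "in_Lp p M (\<lambda>_. 0 :: real^'n)" by (simp add: in_Lp_def)
  ultimately have L: "Lp_norm p M (wgrad p U (\<lambda>_. 0)) = Lp_norm p M (\<lambda>_. 0 :: real^'n)"
    by (intro Lp_norm_wgrad(1))
  have "sobolev_norm p U (\<lambda>_. 0) = sobolev_norm p U u"
    by (rule sobolev_AE_cong(3)[OF assms _ ae]) simp
  then show "sobolev_norm p U u = 0" using L by (simp add: sobolev_norm_def Lp_norm_def)
qed

section \<open>The metric space of almost-everywhere classes\<close>

lemma ae_class_self: "u \<in> borel_measurable M \<Longrightarrow> u \<in> ae_class U u"
  by (simp add: ae_class_def)

lemma rep_ae_class:
  assumes "u \<in> borel_measurable M"
  shows "rep (ae_class U u) \<in> borel_measurable M" "AE x in M. rep (ae_class U u) x = u x"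
  using someI[of "\<lambda>v. v \<in> ae_class U u", OF ae_class_self[OF assms]] by (auto simp: rep_def ae_class_def)

lemma ae_class_eq_iff:
  assumes "u \<in> borel_measurable M" "v \<in> borel_measurable M"
  shows "ae_class U u = ae_class U v \<longleftrightarrow> (AE x in M. u x = v x)"
proof
  assume "ae_class U u = ae_class U v"
  then have "u \<in> ae_class U v" using ae_class_self[OF assms(1)] by simp
  then show "AE x in M. u x = v x" by (simp add: ae_class_def)
next
  assume ae: "AE x in M. u x = v x"
  have "(AE x in M. w x = u x) \<longleftrightarrow> (AE x in M. w x = v x)" for w
  proof
    assume "AE x in M. w x = u x"
    then show "AE x in M. w x = v x" using ae by eventually_elim simp
  next
    assume "AE x in M. w x = v x"
    then show "AE x in M. w x = u x" using ae by eventually_elim simp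
  qed
  then show "ae_class U u = ae_class U v" by (simp add: ae_class_def)
qed

lemma sobolev_measurable: "sobolev p U u \<Longrightarrow> u \<in> borel_measurable M"
  by (simp add: sobolev_def in_Lp_def)

lemma W0_rep:
  assumes "C \<in> W0 p U"
  shows "sobolev p U (rep C)" "ae_class U (rep C) = C"
proof -
  obtain u where u: "sobolev0 p U u" "C = ae_class U u" using assms by (auto simp: W0_def)
  have s: "sobolev p U u" using u by (simp add: sobolev0_def)
  note r = rep_ae_class[OF sobolev_measurable[OF s], folded u(2)]
  have ae: "AE x in M. u x = rep C x" using r(2) by eventually_elim simp
  show "sobolev p U (rep C)" by (rule sobolev_AE_cong(1)[OF s r(1) ae])
  show "ae_class U (rep C) = C"
    unfolding u(2) ae_class_eq_iff[OF r(1)[unfolded u(2)] sobolev_measurable[OF s]] by (rule r(2)[unfolded u(2)])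
qed

sublocale W0: Metric_space "W0 p U" "W0_dist p U"
proof
  show "0 \<le> W0_dist p U C D" for C D by (simp add: W0_dist_def sobolev_norm_nonneg)
  show "W0_dist p U C D = W0_dist p U D C" for C D
    unfolding W0_dist_def using sobolev_norm_minus[of "\<lambda>x. rep C x - rep D x"] by simp
  show "W0_dist p U C D = 0 \<longleftrightarrow> C = D" if C: "C \<in> W0 p U" and D: "D \<in> W0 p U" for C D
  proof -
    have "W0_dist p U C D = 0 \<longleftrightarrow> (AE x in M. rep C x - rep D x = 0)"
      unfolding W0_dist_def by (rule sobolev_norm_zero_iff[OF sobolev_diff[OF W0_rep(1)[OF C] W0_rep(1)[OF D]]])
    also have "\<dots> \<longleftrightarrow> ae_class U (rep C) = ae_class U (rep D)"
      using ae_class_eq_iff[OF sobolev_measurable[OF W0_rep(1)[OF C]] sobolev_measurable[OF W0_rep(1)[OF D]]] by simp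
    finally show ?thesis by (simp add: W0_rep(2) C D)
  qed
  show "W0_dist p U C E \<le> W0_dist p U C D + W0_dist p U D E"
    if C: "C \<in> W0 p U" and D: "D \<in> W0 p U" and E: "E \<in> W0 p U" for C D E
    using sobolev_add(3)[OF sobolev_diff[OF W0_rep(1)[OF C] W0_rep(1)[OF D]] sobolev_diff[OF W0_rep(1)[OF D] W0_rep(1)[OF E]]]
    by (simp add: W0_dist_def)
qed

section \<open>Test functions as elements of the Sobolev space\<close>

lemma in_Lp_continuous_compact_support:
  fixes f :: "real^'n \<Rightarrow> 'b::euclidean_space"
  assumes "continuous_on UNIV f" "compact K" "\<And>x. x \<notin> K \<Longrightarrow> f x = 0"
  shows "in_Lp p M f"
  unfolding in_Lp_def
proof
  show "f \<in> borel_measurable M" by (intro borel_measurable_lebesgue_on borel_measurable_continuous_onI assms)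
  have c: "continuous_on UNIV (\<lambda>x. norm (f x) powr p)"
    using p_pos by (intro continuous_on_powr' continuous_intros assms) auto
  have "integrable lborel (\<lambda>x. norm (f x) powr p)"
    by (rule integrable_continuous_compact_support[OF c assms(2)]) (simp add: assms(3))
  then have "integrable lebesgue (\<lambda>x. norm (f x) powr p)"
    using integrable_completion[of "\<lambda>x. norm (f x) powr p" lborel] borel_measurable_continuous_onI[OF c] by simp
  then have "integrable lebesgue (\<lambda>x. indicator U x *\<^sub>R (norm (f x) powr p))"
    by (rule integrable_mult_indicator[OF sets_U])
  then show "integrable M (\<lambda>x. norm (f x) powr p)"
    using sets_U by (simp add: integrable_restrict_space)
qed

lemma test_in_Lp: "test_function V \<phi> \<Longrightarrow> in_Lp p M \<phi>" "test_function V \<phi> \<Longrightarrow> in_Lp p M (grad \<phi>)"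
proof -
  assume phi: "test_function V \<phi>"
  obtain K where K: "compact K" "K \<subseteq> V" "\<forall>x. x \<notin> K \<longrightarrow> \<phi> x = 0"
    using test_function_support[OF phi] by blast
  show "in_Lp p M \<phi>"
    by (rule in_Lp_continuous_compact_support[OF test_function_continuous[OF phi] K(1)]) (use K in simp)
  show "in_Lp p M (grad \<phi>)"
    by (rule in_Lp_continuous_compact_support[OF continuous_on_grad[OF phi] K(1)]) (use K grad_zero_outside in blast)
qed

lemma sobolev_test:
  assumes "test_function V \<phi>"
  shows "sobolev p U \<phi>" "Lp_norm p M (wgrad p U \<phi>) = Lp_norm p M (grad \<phi>)" "AE x in M. wgrad p U \<phi> x = grad \<phi> x"
  using Lp_norm_wgrad[OF test_in_Lp[OF assms] weak_gradient_grad[OF open_U assms]] by auto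

lemma sobolev0_test: assumes "test_function U \<phi>" shows "sobolev0 p U \<phi>"
  unfolding sobolev0_def
proof (intro conjI exI[of _ "\<lambda>_. \<phi>"] allI)
  have "sobolev_norm p U (\<lambda>x. \<phi> x - \<phi> x) = 0"
    by (subst sobolev_norm_zero_iff) (rule sobolev_diff[OF sobolev_test(1) sobolev_test(1)], rule assms, rule assms, simp)
  then show "(\<lambda>n. sobolev_norm p U (\<lambda>x. \<phi> x - \<phi> x)) \<longlonglongrightarrow> 0" by simp
qed (use assms sobolev_test in auto)

text \<open>The strict inequality leaves room for an error: a test function close in the Sobolev
  norm has nearly the same norm and nearly the same gradient norm.\<close>

lemma Lp_sphere_approximation:
  assumes C: "C \<in> Lp_sphere p U" and e: "energy p U C < \<mu>"
  obtains \<phi> where "test_function U \<phi>"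
    "(\<integral>x. norm (grad \<phi> x) powr p \<partial>M) < \<mu> * (\<integral>x. norm (\<phi> x) powr p \<partial>M)"
proof -
  have CW: "C \<in> W0 p U" and n1: "Lp_norm p M (rep C) = 1" using C by (auto simp: Lp_sphere_def)
  obtain u where u: "sobolev0 p U u" "C = ae_class U u" using CW by (auto simp: W0_def)
  have su: "sobolev p U u" using u by (simp add: sobolev0_def)
  note sv = W0_rep(1)[OF CW]
  have ae: "AE x in M. rep C x = u x" using rep_ae_class(2)[OF sobolev_measurable[OF su]] u by simp
  obtain \<phi> where phi: "\<And>n. test_function U (\<phi> n)" and lim: "(\<lambda>n. sobolev_norm p U (\<lambda>x. u x - \<phi> n x)) \<longlonglongrightarrow> 0"
    using u(1) by (auto simp: sobolev0_def)
  define d where "d n = sobolev_norm p U (\<lambda>x. rep C x - \<phi> n x)" for n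
  have sd: "sobolev p U (\<lambda>x. rep C x - \<phi> n x)" for n by (rule sobolev_diff[OF sv sobolev_test(1)[OF phi]])
  have "d n = sobolev_norm p U (\<lambda>x. u x - \<phi> n x)" for n
    unfolding d_def
  proof (rule sobolev_AE_cong(3)[symmetric, THEN sym])
    show "sobolev p U (\<lambda>x. u x - \<phi> n x)" by (rule sobolev_diff[OF su sobolev_test(1)[OF phi]])
    show "(\<lambda>x. rep C x - \<phi> n x) \<in> borel_measurable M" by (rule sobolev_measurable[OF sd])
    show "AE x in M. u x - \<phi> n x = rep C x - \<phi> n x" using ae by eventually_elim simp
  qed
  then have "d = (\<lambda>n. sobolev_norm p U (\<lambda>x. u x - \<phi> n x))" by (rule ext)
  then have limd: "d \<longlonglongrightarrow> 0" using lim by simp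
  define c where "c = Lp_norm p M (wgrad p U (rep C))"
  have c: "c \<ge> 0" "c powr p = energy p U C"
    unfolding c_def energy_def by (rule Lp_norm_nonneg, rule Lp_norm_powr[OF p_pos])
  have mu: "\<mu> > 0" using e c(2) by (metis le_less_trans powr_ge_zero)
  define l where "l = \<mu> powr (1 / p)"
  have l: "l > 0" "l powr p = \<mu>" using mu p_pos by (auto simp: l_def powr_powr)
  have cl: "c < l"
  proof (rule ccontr)
    assume "\<not> c < l"
    then have "l powr p \<le> c powr p" using l p_pos by (intro powr_mono2) auto
    then show False using e c l by simp
  qed
  \<comment> \<open>Chosen so that \<open>\<delta> * (1 + l) < l - c\<close>: a gradient norm of at
    most \<open>c + \<delta>\<close> then stays below \<open>l\<close> times a norm of at least
    \<open>1 - \<delta>\<close>.\<close>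
  define \<delta> where "\<delta> = min (1/2) ((l - c) / (2 * (1 + l)))"
  have \<delta>: "\<delta> > 0" "\<delta> < 1" using cl l by (auto simp: \<delta>_def)
  have "\<delta> * (1 + l) \<le> (l - c) / (2 * (1 + l)) * (1 + l)" using l by (intro mult_right_mono) (auto simp: \<delta>_def)
  also have "\<dots> = (l - c) / 2" using l by (simp add: field_simps)
  also have "\<dots> < l - c" using cl by simp
  finally have key: "c + \<delta> < l * (1 - \<delta>)" by (simp add: algebra_simps)
  have "eventually (\<lambda>n. d n < \<delta>) sequentially" using limd \<delta>(1) by (rule order_tendstoD(2))
  then obtain n where dn: "d n < \<delta>" using eventually_happens by force
  have parts: "Lp_norm p M (\<lambda>x. rep C x - \<phi> n x) \<le> d n" "Lp_norm p M (wgrad p U (\<lambda>x. rep C x - \<phi> n x)) \<le> d n"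
    using Lp_norm_nonneg[of p M "\<lambda>x. rep C x - \<phi> n x"] Lp_norm_nonneg[of p M "wgrad p U (\<lambda>x. rep C x - \<phi> n x)"]
    unfolding d_def sobolev_norm_def by linarith+
  have "Lp_norm p M (\<lambda>x. \<phi> n x + (rep C x - \<phi> n x)) \<le> Lp_norm p M (\<phi> n) + Lp_norm p M (\<lambda>x. rep C x - \<phi> n x)"
    by (rule Lp_norm_triangle[OF p_ge_1 test_in_Lp(1)[OF phi] sobolev_in_Lp[OF sd]])
  then have b: "1 - \<delta> \<le> Lp_norm p M (\<phi> n)" using n1 parts dn by simp
  have "Lp_norm p M (wgrad p U (\<lambda>x. rep C x + (-1) * (rep C x - \<phi> n x)))
      \<le> Lp_norm p M (wgrad p U (rep C)) + Lp_norm p M (wgrad p U (\<lambda>x. (-1) * (rep C x - \<phi> n x)))"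
    by (rule sobolev_add(2)[OF sv sobolev_scale(1)[OF sd]])
  then have a: "Lp_norm p M (grad (\<phi> n)) \<le> c + \<delta>"
    using parts dn sobolev_scale(2)[OF sd[of n], of "-1"] sobolev_test(2)[OF phi, of n] by (simp add: c_def)
  have "Lp_norm p M (grad (\<phi> n)) < l * Lp_norm p M (\<phi> n)"
    using a key mult_left_mono[OF b less_imp_le[OF l(1)]] by linarith
  then have "Lp_norm p M (grad (\<phi> n)) powr p < (l * Lp_norm p M (\<phi> n)) powr p"
    using p_pos Lp_norm_nonneg by (intro powr_less_mono2) auto
  then have "(\<integral>x. norm (grad (\<phi> n) x) powr p \<partial>M) < \<mu> * (\<integral>x. norm (\<phi> n x) powr p \<partial>M)"
    unfolding powr_mult Lp_norm_powr[OF p_pos] l(2) .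
  then show ?thesis by (rule that[OF phi])
qed

section \<open>Upper bounds for variational eigenvalues\<close>

text \<open>\<open>rep\<close> picks an arbitrary member of the class, so each property of
  \<open>\<phi>\<close> is carried over along almost-everywhere equality.\<close>

lemma rep_test:
  assumes phi: "test_function U \<phi>"
  shows "AE x in M. rep (ae_class U \<phi>) x = \<phi> x" "rep (ae_class U \<phi>) \<in> borel_measurable M"
    "in_Lp p M (rep (ae_class U \<phi>))" "weak_gradient U (rep (ae_class U \<phi>)) (grad \<phi>)"
    "Lp_norm p M (rep (ae_class U \<phi>)) = Lp_norm p M \<phi>" "ae_class U \<phi> \<in> W0 p U"
proof -
  note m = measurable_test[OF phi]
  show r: "AE x in M. rep (ae_class U \<phi>) x = \<phi> x" "rep (ae_class U \<phi>) \<in> borel_measurable M"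
    using rep_ae_class[OF m] by auto
  have r': "AE x in M. \<phi> x = rep (ae_class U \<phi>) x" using r(1) by eventually_elim simp
  show "in_Lp p M (rep (ae_class U \<phi>))" by (rule in_Lp_AE_cong[OF test_in_Lp(1)[OF phi] r(2) r'])
  show "weak_gradient U (rep (ae_class U \<phi>)) (grad \<phi>)"
    by (rule weak_gradient_AE_cong[OF m r(2) r' weak_gradient_grad[OF open_U phi]])
  show "Lp_norm p M (rep (ae_class U \<phi>)) = Lp_norm p M \<phi>" by (rule Lp_norm_AE_cong[OF r(2) m r(1)])
  show "ae_class U \<phi> \<in> W0 p U" using sobolev0_test[OF phi] by (auto simp: W0_def)
qed

lemma energy_test:
  assumes phi: "test_function U \<phi>"
  shows "energy p U (ae_class U \<phi>) = (\<integral>x. norm (grad \<phi> x) powr p \<partial>M)"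
  unfolding energy_def
proof (rule integral_cong_AE)
  note L = Lp_norm_wgrad[OF rep_test(3)[OF phi] test_in_Lp(2)[OF phi] rep_test(4)[OF phi]]
  have "wgrad p U (rep (ae_class U \<phi>)) \<in> borel_measurable M" "grad \<phi> \<in> borel_measurable M"
    using wgrad(1)[OF L(3)] test_in_Lp(2)[OF phi] by (auto simp: in_Lp_def)
  then show "(\<lambda>x. norm (wgrad p U (rep (ae_class U \<phi>)) x) powr p) \<in> borel_measurable M"
    "(\<lambda>x. norm (grad \<phi> x) powr p) \<in> borel_measurable M" by measurable
  show "AE x in M. norm (wgrad p U (rep (ae_class U \<phi>)) x) powr p = norm (grad \<phi> x) powr p"
    using L(2) by eventually_elim simp
qed

lemma neg_class_ae_class:
  assumes "u \<in> borel_measurable M"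
  shows "neg_class (ae_class U u) = ae_class U (\<lambda>x. - u x)"
proof (intro equalityI subsetI)
  fix v assume "v \<in> neg_class (ae_class U u)"
  then obtain w where w: "w \<in> borel_measurable M" "AE x in M. w x = u x" "v = (\<lambda>x. - w x)"
    by (auto simp: neg_class_def ae_class_def)
  then show "v \<in> ae_class U (\<lambda>x. - u x)" by (simp add: ae_class_def)
next
  fix v assume "v \<in> ae_class U (\<lambda>x. - u x)"
  then have v: "v \<in> borel_measurable M" "AE x in M. v x = - u x" by (auto simp: ae_class_def)
  have "AE x in M. - v x = u x" using v(2) by eventually_elim simp
  then have "(\<lambda>x. - v x) \<in> ae_class U u" using v(1) by (simp add: ae_class_def)
  then show "v \<in> neg_class (ae_class U u)" unfolding neg_class_def by (rule image_eqI[rotated]) simp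
qed

lemma W0_dist_test:
  assumes phi: "test_function U \<phi>" and psi: "test_function U \<psi>"
  shows "W0_dist p U (ae_class U \<phi>) (ae_class U \<psi>) =
    Lp_norm p M (\<lambda>x. \<phi> x - \<psi> x) + Lp_norm p M (\<lambda>x. grad \<phi> x - grad \<psi> x)"
proof -
  note d = test_function_diff[OF phi psi]
  have "AE x in M. \<phi> x - \<psi> x = rep (ae_class U \<phi>) x - rep (ae_class U \<psi>) x"
    using rep_test(1)[OF phi] rep_test(1)[OF psi] by eventually_elim simp
  then have "W0_dist p U (ae_class U \<phi>) (ae_class U \<psi>) = sobolev_norm p U (\<lambda>x. \<phi> x - \<psi> x)"
    unfolding W0_dist_def
    by (intro sobolev_AE_cong(3)[OF sobolev_test(1)[OF d]] borel_measurable_diff rep_test(2) phi psi)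
  also have "\<dots> = Lp_norm p M (\<lambda>x. \<phi> x - \<psi> x) + Lp_norm p M (grad (\<lambda>x. \<phi> x - \<psi> x))"
    by (simp add: sobolev_norm_def sobolev_test(2)[OF d])
  also have "grad (\<lambda>x. \<phi> x - \<psi> x) = (\<lambda>x. grad \<phi> x - grad \<psi> x)"
    by (rule ext) (rule grad_diff[OF test_function_differentiable[OF phi] test_function_differentiable[OF psi]])
  finally show ?thesis .
qed

lemma Lp_norm_le_sup:
  fixes f :: "real^'n \<Rightarrow> 'b::euclidean_space"
  assumes f: "in_Lp p M f" and b: "\<And>x. x \<in> U \<Longrightarrow> norm (f x) \<le> B" and B: "B \<ge> 0"
  shows "Lp_norm p M f \<le> measure M U powr (1 / p) * B"
proof -
  have "(\<integral>x. norm (f x) powr p \<partial>M) \<le> (\<integral>x. B powr p \<partial>M)"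
  proof (rule integral_mono)
    show "integrable M (\<lambda>x. B powr p)" by (rule finite_measure.integrable_const[OF finite_measure_M])
    fix x assume "x \<in> space M"
    then show "norm (f x) powr p \<le> B powr p" using b[of x] p_pos by (intro powr_mono2) (auto simp: space_restrict_space)
  qed (use f in \<open>simp add: in_Lp_def\<close>)
  also have "\<dots> = measure M U * B powr p" by (simp add: space_restrict_space)
  finally have "Lp_norm p M f \<le> (measure M U * B powr p) powr (1 / p)"
    unfolding Lp_norm_def using p_pos by (intro powr_mono2) (auto intro: integral_nonneg_AE)
  also have "\<dots> = measure M U powr (1 / p) * B" using B p_pos by (simp add: powr_mult powr_powr)
  finally show ?thesis .
qed

text \<open>On the compact closure of \<open>U\<close>, joint continuity yields uniform closeness of
  values and gradients. As \<open>U\<close> has finite measure, this controls the Sobolev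
  norm.\<close>

lemma continuous_map_W0:
  fixes h :: "'b::topological_space \<Rightarrow> real^'n \<Rightarrow> real"
  assumes tf: "\<And>s. s \<in> S \<Longrightarrow> test_function U (h s)"
    and c0: "continuous_on (S \<times> UNIV) (\<lambda>(s,x). h s x)"
    and c1: "continuous_on (S \<times> UNIV) (\<lambda>(s,x). grad (h s) x)"
  shows "continuous_map (top_of_set S) (W0_topology p U) (\<lambda>s. ae_class U (h s))"
  unfolding W0_topology_def W0.continuous_map_to_metric
proof (intro ballI allI impI)
  fix s0 and \<epsilon> :: real assume "s0 \<in> topspace (top_of_set S)" and \<epsilon>: "\<epsilon> > 0"
  then have s0: "s0 \<in> S" by simp
  define V where "V = measure M U powr (1 / p)"
  have V: "V \<ge> 0" by (simp add: V_def)
  \<comment> \<open>Each of the two parts of the norm costs at most \<open>V * \<eta>\<close>; the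
    summand 1 avoids a division by zero when \<open>V = 0\<close>.\<close>
  define \<eta> where "\<eta> = \<epsilon> / (2 * V + 1) / 2"
  have \<eta>: "\<eta> > 0" using \<epsilon> V by (simp add: \<eta>_def)
  have "2 * (V * \<eta>) < \<epsilon>"
  proof -
    have "2 * (V * \<eta>) = \<epsilon> * (V / (2 * V + 1))" using V by (simp add: \<eta>_def field_simps)
    also have "\<dots> < \<epsilon> * 1" using \<epsilon> V by (intro mult_strict_left_mono) (auto simp: field_simps)
    finally show ?thesis by simp
  qed
  note small = this
  have K: "compact (closure U)" using bounded_U by (simp add: compact_closure)
  have c0': "continuous_on (S \<times> closure U) (\<lambda>(s,x). h s x)" and c1': "continuous_on (S \<times> closure U) (\<lambda>(s,x). grad (h s) x)"
    by (rule continuous_on_subset[OF c0], auto) (rule continuous_on_subset[OF c1], auto)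
  obtain X0 where X0: "s0 \<in> X0" "open X0" "\<forall>s\<in>X0 \<inter> S. \<forall>x\<in>closure U. dist ((\<lambda>(s,x). h s x) (s, x)) ((\<lambda>(s,x). h s x) (s0, x)) \<le> \<eta>"
    by (rule continuous_on_prod_compactE[OF c0' K s0 \<eta>]) (rule that; assumption)
  obtain X1 where X1: "s0 \<in> X1" "open X1" "\<forall>s\<in>X1 \<inter> S. \<forall>x\<in>closure U. dist ((\<lambda>(s,x). grad (h s) x) (s, x)) ((\<lambda>(s,x). grad (h s) x) (s0, x)) \<le> \<eta>"
    by (rule continuous_on_prod_compactE[OF c1' K s0 \<eta>]) (rule that; assumption)
  show "\<exists>W. openin (top_of_set S) W \<and> s0 \<in> W \<and> (\<forall>s\<in>W. ae_class U (h s) \<in> W0.mball (ae_class U (h s0)) \<epsilon>)"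
  proof (intro exI[of _ "S \<inter> (X0 \<inter> X1)"] conjI ballI)
    show "openin (top_of_set S) (S \<inter> (X0 \<inter> X1))" using X0 X1 by (intro openin_open_Int open_Int)
    show "s0 \<in> S \<inter> (X0 \<inter> X1)" using s0 X0 X1 by simp
    fix s assume s: "s \<in> S \<inter> (X0 \<inter> X1)"
    have b0: "norm (h s0 x - h s x) \<le> \<eta>" and b1: "norm (grad (h s0) x - grad (h s) x) \<le> \<eta>" if "x \<in> U" for x
    proof -
      have x: "x \<in> closure U" using that closure_subset by blast
      have "dist (h s x) (h s0 x) \<le> \<eta>" "dist (grad (h s) x) (grad (h s0) x) \<le> \<eta>"
        using X0(3) X1(3) s x by auto
      then show "norm (h s0 x - h s x) \<le> \<eta>" "norm (grad (h s0) x - grad (h s) x) \<le> \<eta>"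
        by (auto simp: dist_norm norm_minus_commute)
    qed
    have ts: "test_function U (h s)" and ts0: "test_function U (h s0)" using tf s s0 by auto
    have "Lp_norm p M (\<lambda>x. h s0 x - h s x) \<le> V * \<eta>"
      unfolding V_def by (rule Lp_norm_le_sup[OF test_in_Lp(1)[OF test_function_diff[OF ts0 ts]]]) (use b0 \<eta> in auto)
    moreover have "in_Lp p M (\<lambda>x. grad (h s0) x - grad (h s) x)"
      using in_Lp_add[OF p_ge_1 test_in_Lp(2)[OF ts0] in_Lp_scale[OF test_in_Lp(2)[OF ts], of "-1"]] by simp
    then have "Lp_norm p M (\<lambda>x. grad (h s0) x - grad (h s) x) \<le> V * \<eta>"
      unfolding V_def by (rule Lp_norm_le_sup) (use b1 \<eta> in auto)
    ultimately have "W0_dist p U (ae_class U (h s0)) (ae_class U (h s)) < \<epsilon>"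
      unfolding W0_dist_test[OF ts0 ts] using small by linarith
    then show "ae_class U (h s) \<in> W0.mball (ae_class U (h s0)) \<epsilon>"
      using rep_test(6)[OF ts] rep_test(6)[OF ts0] by (simp add: W0.in_mball)
  qed
qed

text \<open>Moves the genus to the parameter space. An odd map from the image of \<open>S\<close> to
  a sphere pulls back to a map \<open>F\<close> on \<open>S\<close> as in \<open>no_odd\<close>; the
  last two premises there record that \<open>F\<close> factors through \<open>h\<close> and respects
  signs.\<close>

lemma variational_eigenvalue_le_family:
  fixes h :: "'b::topological_space \<Rightarrow> real^'n \<Rightarrow> real"
  assumes S: "compact S" "S \<noteq> {}"
    and tf: "\<And>s. s \<in> S \<Longrightarrow> test_function U (h s)"
    and c0: "continuous_on (S \<times> UNIV) (\<lambda>(s,x). h s x)"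
    and c1: "continuous_on (S \<times> UNIV) (\<lambda>(s,x). grad (h s) x)"
    and unit: "\<And>s. s \<in> S \<Longrightarrow> (\<integral>x. norm (h s x) powr p \<partial>M) = 1"
    and en: "\<And>s. s \<in> S \<Longrightarrow> (\<integral>x. norm (grad (h s) x) powr p \<partial>M) \<le> \<mu>"
    and neg: "\<And>s. s \<in> S \<Longrightarrow> \<exists>s'\<in>S. h s' = (\<lambda>x. - h s x)"
    and no_odd: "\<And>F. continuous_on S F \<Longrightarrow> (\<And>s. s \<in> S \<Longrightarrow> F s \<in> sph n) \<Longrightarrow>
      (\<And>s s'. s \<in> S \<Longrightarrow> s' \<in> S \<Longrightarrow> h s = h s' \<Longrightarrow> F s = F s') \<Longrightarrow>
      (\<And>s s'. s \<in> S \<Longrightarrow> s' \<in> S \<Longrightarrow> h s' = (\<lambda>x. - h s x) \<Longrightarrow> F s' = (\<lambda>i. - F s i)) \<Longrightarrow> False"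
  shows "variational_eigenvalue p U (n + 2) \<le> ereal \<mu>"
proof -
  define cls where "cls s = ae_class U (h s)" for s
  define A where "A = cls ` S"
  have cont: "continuous_map (top_of_set S) (W0_topology p U) cls"
    unfolding cls_def by (rule continuous_map_W0[OF tf c0 c1])
  have neg_cls: "neg_class (cls s) = cls s'" if "s \<in> S" "h s' = (\<lambda>x. - h s x)" for s s'
    unfolding cls_def that(2) by (rule neg_class_ae_class[OF measurable_test[OF tf[OF that(1)]]])
  have sphere: "cls s \<in> Lp_sphere p U" if s: "s \<in> S" for s
    using rep_test(5,6)[OF tf[OF s]] unit[OF s] by (simp add: Lp_sphere_def cls_def Lp_norm_def)
  have "A \<in> genus_family p U (n + 2)"
    unfolding genus_family_def
  proof (intro CollectI conjI ballI)
    show "A \<noteq> {}" "A \<subseteq> Lp_sphere p U" using S sphere by (auto simp: A_def)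
    show "neg_class C \<in> A" if CA: "C \<in> A" for C
    proof -
      obtain s where s: "s \<in> S" "C = cls s" using CA by (auto simp: A_def)
      obtain s' where "s' \<in> S" "h s' = (\<lambda>x. - h s x)" using neg[OF s(1)] by blast
      then show ?thesis using neg_cls[OF s(1)] s by (auto simp: A_def)
    qed
    have "compactin (top_of_set S) S" using S(1) by (simp add: compactin_subtopology)
    then show "compactin (W0_topology p U) A" unfolding A_def by (rule image_compactin[OF _ cont])
    show "enat (n + 2) \<le> genus p U A"
      unfolding genus_def
    proof (rule Inf_greatest)
      fix e assume "e \<in> {enat k |k. k \<ge> 1 \<and> (\<exists>f. continuous_map (subtopology (W0_topology p U) A) (nsphere (k - 1)) f \<and>
          (\<forall>C\<in>A. f (neg_class C) = (\<lambda>i. - f C i)))}"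
      then obtain k f where e: "e = enat k" and k: "k \<ge> 1"
        and f: "continuous_map (subtopology (W0_topology p U) A) (nsphere (k - 1)) f"
        and odd: "\<forall>C\<in>A. f (neg_class C) = (\<lambda>i. - f C i)" by blast
      show "enat (n + 2) \<le> e"
      proof (rule ccontr)
        assume "\<not> enat (n + 2) \<le> e"
        \<comment> \<open>Genus \<open>k\<close> refers to maps into the sphere of dimension
          \<open>k - 1\<close>. Too small a genus gives dimension at most \<open>n\<close>, and
          smaller spheres lie in \<open>sph n\<close> with further coordinates zero.\<close>
        then have kn: "k - 1 \<le> n" using e k by simp
        have "continuous_map (top_of_set S) (subtopology (W0_topology p U) A) cls"
          using cont by (auto simp: continuous_map_in_subtopology A_def)
        from continuous_map_compose[OF this f]
        have "continuous_map (top_of_set S) (top_of_set (sph (k - 1))) (f \<circ> cls)" by (simp add: nsphere_sph)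
        then have F: "continuous_on S (f \<circ> cls)" "(f \<circ> cls) \<in> S \<rightarrow> sph (k - 1)" by auto
        show False
        proof (rule no_odd[OF F(1)])
          show "(f \<circ> cls) s \<in> sph n" if "s \<in> S" for s
            using F(2) that sph_mono[OF kn] by auto
          show "(f \<circ> cls) s = (f \<circ> cls) s'" if "h s = h s'" for s s'
            using that by (simp add: cls_def)
          show "(f \<circ> cls) s' = (\<lambda>i. - (f \<circ> cls) s i)" if "s \<in> S" "h s' = (\<lambda>x. - h s x)" for s s'
            using odd neg_cls[OF that] that(1) by (auto simp: A_def)
        qed
      qed
    qed
  qed
  then have "variational_eigenvalue p U (n + 2) \<le> (SUP C\<in>A. ereal (energy p U C))"
    unfolding variational_eigenvalue_def by (rule INF_lower)
  also have "\<dots> \<le> ereal \<mu>"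
  proof (rule SUP_least)
    fix C assume "C \<in> A"
    then obtain s where s: "s \<in> S" "C = cls s" by (auto simp: A_def)
    show "ereal (energy p U C) \<le> ereal \<mu>"
      using en[OF s(1)] energy_test[OF tf[OF s(1)]] by (simp add: s(2) cls_def)
  qed
  finally show ?thesis .
qed

end

section \<open>Combinations of functions with disjoint supports\<close>

lemma powr_norm_sum_single:
  fixes v :: "'i \<Rightarrow> 'b::real_normed_vector"
  assumes fin: "finite I" and one: "\<And>i j. i \<in> I \<Longrightarrow> j \<in> I \<Longrightarrow> i \<noteq> j \<Longrightarrow> v i = 0 \<or> v j = 0" and p: "p > 0"
  shows "norm (\<Sum>i\<in>I. a i *\<^sub>R v i) powr p = (\<Sum>i\<in>I. \<bar>a i\<bar> powr p * norm (v i) powr p)"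
proof (cases "\<exists>i\<in>I. v i \<noteq> 0")
  case False
  then show ?thesis using p by simp
next
  case True
  then obtain k where k: "k \<in> I" "v k \<noteq> 0" by blast
  have z: "v i = 0" if "i \<in> I - {k}" for i using one[of i k] that k by auto
  have "(\<Sum>i\<in>I. a i *\<^sub>R v i) = a k *\<^sub>R v k"
    by (subst sum.remove[OF fin k(1)]) (simp add: z)
  moreover have "(\<Sum>i\<in>I. \<bar>a i\<bar> powr p * norm (v i) powr p) = \<bar>a k\<bar> powr p * norm (v k) powr p"
    by (subst sum.remove[OF fin k(1)]) (simp add: z)
  ultimately show ?thesis by (simp add: powr_mult)
qed

text \<open>Radial projection of S^m to the unit sphere of l^p. The degree arguments live on the
  round sphere, while the L^p norm of a disjoint combination of unit functions is the l^p norm of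
  its coefficients.\<close>

definition lp_coord :: "real \<Rightarrow> nat \<Rightarrow> (nat \<Rightarrow> real) \<Rightarrow> nat \<Rightarrow> real" where
  "lp_coord p m c j = c j / (\<Sum>i\<le>m. \<bar>c i\<bar> powr p) powr (1 / p)"

lemma sum_powr_pos:
  assumes "c \<in> sph m" shows "(\<Sum>i\<le>m. \<bar>c i\<bar> powr p) > 0"
proof -
  obtain i where i: "i \<le> m" "\<bar>c i\<bar> \<ge> 1 / (real m + 1)" using sph_nonzero_coordinate[OF assms] by blast
  have "1 / (real m + 1) > 0" by simp
  then have "\<bar>c i\<bar> > 0" using i by linarith
  then show ?thesis using i by (intro sum_pos2[of _ i]) auto
qed

lemma sum_lp_coord:
  assumes "c \<in> sph m" "p > 0" shows "(\<Sum>j\<le>m. \<bar>lp_coord p m c j\<bar> powr p) = 1"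
proof -
  let ?s = "\<Sum>i\<le>m. \<bar>c i\<bar> powr p"
  have s: "?s > 0" by (rule sum_powr_pos[OF assms(1)])
  have "(\<Sum>j\<le>m. \<bar>lp_coord p m c j\<bar> powr p) = (\<Sum>j\<le>m. \<bar>c j\<bar> powr p / ?s)"
    using s assms(2) by (intro sum.cong refl) (simp add: lp_coord_def powr_divide powr_powr)
  also have "\<dots> = 1" using s by (simp flip: sum_divide_distrib)
  finally show ?thesis .
qed

lemma lp_coord_minus: "lp_coord p m (\<lambda>i. - c i) j = - lp_coord p m c j"
  by (simp add: lp_coord_def)

lemma continuous_on_lp_coord:
  assumes "p > 0" shows "continuous_on (sph m) (\<lambda>c. lp_coord p m c j)"
proof -
  have "continuous_on (sph m) (\<lambda>c. \<Sum>i\<le>m. \<bar>c i\<bar> powr p)"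
    by (intro continuous_on_sum continuous_on_powr' continuous_on_rabs continuous_on_coordinate continuous_on_const ballI)
       (use assms in auto)
  then have "continuous_on (sph m) (\<lambda>c. (\<Sum>i\<le>m. \<bar>c i\<bar> powr p) powr (1 / p))"
    by (rule continuous_on_powr[OF _ continuous_on_const]) (use sum_powr_pos[of _ m p] in force)
  moreover have "(\<Sum>i\<le>m. \<bar>c i\<bar> powr p) powr (1 / p) \<noteq> 0" if "c \<in> sph m" for c
    using sum_powr_pos[OF that, of p] by simp
  ultimately show ?thesis unfolding lp_coord_def by (intro continuous_on_divide continuous_on_coordinate) auto
qed

context sobolev_domain
begin

text \<open>At each point at most one summand contributes, so the p-th powers of norm and gradient
  norm split into sums with weights \<open>|lp_coord p m c j| powr p\<close>. These add up to 1: the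
  norm is exactly 1 and the energy is bounded by an average of numbers at most
  \<open>\<mu>\<close>.\<close>

theorem variational_eigenvalue_le_disjoint:
  fixes w :: "nat \<Rightarrow> 'b::topological_space \<Rightarrow> real^'n \<Rightarrow> real" and m :: nat
  defines "h \<equiv> \<lambda>s x. \<Sum>j\<le>m. lp_coord p m (fst s) j * w j (snd s) x"
  assumes \<Theta>: "compact \<Theta>" "\<Theta> \<noteq> {}"
    and tf: "\<And>j \<theta>. j \<le> m \<Longrightarrow> \<theta> \<in> \<Theta> \<Longrightarrow> test_function (V j \<theta>) (w j \<theta>)"
    and VU: "\<And>j \<theta>. j \<le> m \<Longrightarrow> \<theta> \<in> \<Theta> \<Longrightarrow> V j \<theta> \<subseteq> U"
    and disj: "\<And>i j \<theta>. i \<le> m \<Longrightarrow> j \<le> m \<Longrightarrow> i \<noteq> j \<Longrightarrow> \<theta> \<in> \<Theta> \<Longrightarrow> V i \<theta> \<inter> V j \<theta> = {}"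
    and c0: "\<And>j. j \<le> m \<Longrightarrow> continuous_on (\<Theta> \<times> UNIV) (\<lambda>(\<theta>,x). w j \<theta> x)"
    and c1: "\<And>j. j \<le> m \<Longrightarrow> continuous_on (\<Theta> \<times> UNIV) (\<lambda>(\<theta>,x). grad (w j \<theta>) x)"
    and unit: "\<And>j \<theta>. j \<le> m \<Longrightarrow> \<theta> \<in> \<Theta> \<Longrightarrow> (\<integral>x. norm (w j \<theta> x) powr p \<partial>M) = 1"
    and en: "\<And>j \<theta>. j \<le> m \<Longrightarrow> \<theta> \<in> \<Theta> \<Longrightarrow> (\<integral>x. norm (grad (w j \<theta>) x) powr p \<partial>M) \<le> \<mu>"
    and no_odd: "\<And>F. continuous_on (sph m \<times> \<Theta>) F \<Longrightarrow> (\<And>c \<theta>. c \<in> sph m \<Longrightarrow> \<theta> \<in> \<Theta> \<Longrightarrow> F (c, \<theta>) \<in> sph n) \<Longrightarrow>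
      (\<And>c \<theta> c' \<theta>'. c \<in> sph m \<Longrightarrow> \<theta> \<in> \<Theta> \<Longrightarrow> c' \<in> sph m \<Longrightarrow> \<theta>' \<in> \<Theta> \<Longrightarrow> h (c, \<theta>) = h (c', \<theta>') \<Longrightarrow> F (c, \<theta>) = F (c', \<theta>')) \<Longrightarrow>
      (\<And>c \<theta>. c \<in> sph m \<Longrightarrow> \<theta> \<in> \<Theta> \<Longrightarrow> F (\<lambda>i. - c i, \<theta>) = (\<lambda>i. - F (c, \<theta>) i)) \<Longrightarrow> False"
  shows "variational_eigenvalue p U (n + 2) \<le> ereal \<mu>"
proof (rule variational_eigenvalue_le_family[of "sph m \<times> \<Theta>" h])
  have tfU: "test_function U (w j \<theta>)" if "j \<le> m" "\<theta> \<in> \<Theta>" for j \<theta>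
    using test_function_mono[OF tf VU] that by blast
  have gh: "grad (h s) x = (\<Sum>j\<le>m. lp_coord p m (fst s) j *\<^sub>R grad (w j (snd s)) x)" if "snd s \<in> \<Theta>" for s x
    unfolding h_def using test_function_differentiable[OF tfU[OF _ that]]
    by (subst grad_sum) (auto intro!: sum.cong grad_scale)
  show "compact (sph m \<times> \<Theta>)" by (rule compact_Times[OF compact_sph \<Theta>(1)])
  show "sph m \<times> \<Theta> \<noteq> {}" using base_in_sph \<Theta>(2) by blast
  show "test_function U (h s)" if "s \<in> sph m \<times> \<Theta>" for s
    unfolding h_def using that by (intro test_function_sum test_function_scale tfU) auto
  have cl: "continuous_on ((sph m \<times> \<Theta>) \<times> (UNIV::(real^'n) set)) (\<lambda>q. lp_coord p m (fst (fst q)) j)" for j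
    by (rule continuous_on_compose2[OF continuous_on_lp_coord[OF p_pos] continuous_on_fst[OF continuous_on_fst[OF continuous_on_id]]]) auto
  have cq: "continuous_on ((sph m \<times> \<Theta>) \<times> UNIV) (\<lambda>q::((nat \<Rightarrow> real) \<times> 'b) \<times> (real^'n). (snd (fst q), snd q))"
    by (intro continuous_on_Pair continuous_on_fst continuous_on_snd continuous_on_id)
  have im: "(\<lambda>q::((nat \<Rightarrow> real) \<times> 'b) \<times> (real^'n). (snd (fst q), snd q)) ` ((sph m \<times> \<Theta>) \<times> UNIV) \<subseteq> \<Theta> \<times> UNIV"
    by auto
  have cw: "continuous_on ((sph m \<times> \<Theta>) \<times> UNIV) (\<lambda>q. w j (snd (fst q)) (snd q))" if "j \<le> m" for j
    using continuous_on_compose2[OF c0[OF that] cq im] by (simp add: case_prod_unfold)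
  have cg: "continuous_on ((sph m \<times> \<Theta>) \<times> UNIV) (\<lambda>q. grad (w j (snd (fst q))) (snd q))" if "j \<le> m" for j
    using continuous_on_compose2[OF c1[OF that] cq im] by (simp add: case_prod_unfold)
  show "continuous_on ((sph m \<times> \<Theta>) \<times> UNIV) (\<lambda>(s,x). h s x)"
    unfolding h_def case_prod_unfold by (intro continuous_on_sum continuous_on_mult cl cw) auto
  have "continuous_on ((sph m \<times> \<Theta>) \<times> UNIV) (\<lambda>q. \<Sum>j\<le>m. lp_coord p m (fst (fst q)) j *\<^sub>R grad (w j (snd (fst q))) (snd q))"
    by (intro continuous_on_sum continuous_on_scaleR cl cg) auto
  then show "continuous_on ((sph m \<times> \<Theta>) \<times> UNIV) (\<lambda>(s,x). grad (h s) x)"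
    by (rule continuous_on_eq) (auto simp: gh)
  \<comment> \<open>Every point lies outside one of two disjoint compact supports. The complement of
    a compact set is open, so the gradient vanishes there together with the function.\<close>
  have one: "(w i \<theta> x = 0 \<and> grad (w i \<theta>) x = 0) \<or> (w j \<theta> x = 0 \<and> grad (w j \<theta>) x = 0)"
    if ij: "i \<le> m" "j \<le> m" "i \<noteq> j" and th: "\<theta> \<in> \<Theta>" for i j \<theta> x
  proof -
    obtain K where K: "compact K" "K \<subseteq> V i \<theta>" "\<forall>x. x \<notin> K \<longrightarrow> w i \<theta> x = 0"
      using test_function_support[OF tf[OF ij(1) th]] by blast
    obtain L where L: "compact L" "L \<subseteq> V j \<theta>" "\<forall>x. x \<notin> L \<longrightarrow> w j \<theta> x = 0"
      using test_function_support[OF tf[OF ij(2) th]] by blast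
    have "x \<notin> K \<or> x \<notin> L" using K(2) L(2) disj[OF ij th] by blast
    then show ?thesis
    proof
      assume x: "x \<notin> K"
      have "grad (w i \<theta>) x = 0" by (rule grad_zero_outside[OF K(1) _ x]) (use K(3) in simp)
      then show ?thesis using K(3) x by simp
    next
      assume x: "x \<notin> L"
      have "grad (w j \<theta>) x = 0" by (rule grad_zero_outside[OF L(1) _ x]) (use L(3) in simp)
      then show ?thesis using L(3) x by simp
    qed
  qed
  have intw: "integrable M (\<lambda>x. norm (w j \<theta> x) powr p)" and intg: "integrable M (\<lambda>x. norm (grad (w j \<theta>) x) powr p)"
    if "j \<le> m" "\<theta> \<in> \<Theta>" for j \<theta>
    using test_in_Lp[OF tfU[OF that]] by (auto simp: in_Lp_def)
  show "(\<integral>x. norm (h s x) powr p \<partial>M) = 1" if sS: "s \<in> sph m \<times> \<Theta>" for s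
  proof -
    obtain c \<theta> where s: "s = (c, \<theta>)" "c \<in> sph m" "\<theta> \<in> \<Theta>" using sS by auto
    have "norm (h s x) powr p = (\<Sum>j\<le>m. \<bar>lp_coord p m c j\<bar> powr p * norm (w j \<theta> x) powr p)" for x
      using powr_norm_sum_single[of "{..m}" "\<lambda>j. w j \<theta> x" p "lp_coord p m c"] one[OF _ _ _ s(3), of _ _ x] p_pos
      by (auto simp: h_def s(1))
    then have "(\<integral>x. norm (h s x) powr p \<partial>M) = (\<integral>x. (\<Sum>j\<le>m. \<bar>lp_coord p m c j\<bar> powr p * norm (w j \<theta> x) powr p) \<partial>M)"
      by presburger
    also have "\<dots> = (\<Sum>j\<le>m. \<bar>lp_coord p m c j\<bar> powr p * (\<integral>x. norm (w j \<theta> x) powr p \<partial>M))"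
      using intw[OF _ s(3)] by (subst Bochner_Integration.integral_sum) auto
    also have "\<dots> = (\<Sum>j\<le>m. \<bar>lp_coord p m c j\<bar> powr p)" using unit[OF _ s(3)] by simp
    also have "\<dots> = 1" by (rule sum_lp_coord[OF s(2) p_pos])
    finally show ?thesis .
  qed
  show "(\<integral>x. norm (grad (h s) x) powr p \<partial>M) \<le> \<mu>" if sS: "s \<in> sph m \<times> \<Theta>" for s
  proof -
    obtain c \<theta> where s: "s = (c, \<theta>)" "c \<in> sph m" "\<theta> \<in> \<Theta>" using sS by auto
    have "norm (grad (h s) x) powr p = (\<Sum>j\<le>m. \<bar>lp_coord p m c j\<bar> powr p * norm (grad (w j \<theta>) x) powr p)" for x
      using powr_norm_sum_single[of "{..m}" "\<lambda>j. grad (w j \<theta>) x" p "lp_coord p m c"] one[OF _ _ _ s(3), of _ _ x] p_pos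
      by (auto simp: gh s(1,3))
    then have "(\<integral>x. norm (grad (h s) x) powr p \<partial>M) = (\<integral>x. (\<Sum>j\<le>m. \<bar>lp_coord p m c j\<bar> powr p * norm (grad (w j \<theta>) x) powr p) \<partial>M)"
      by presburger
    also have "\<dots> = (\<Sum>j\<le>m. \<bar>lp_coord p m c j\<bar> powr p * (\<integral>x. norm (grad (w j \<theta>) x) powr p \<partial>M))"
      using intg[OF _ s(3)] by (subst Bochner_Integration.integral_sum) auto
    also have "\<dots> \<le> (\<Sum>j\<le>m. \<bar>lp_coord p m c j\<bar> powr p * \<mu>)"
      using en[OF _ s(3)] by (intro sum_mono mult_left_mono) auto
    also have "\<dots> = \<mu>" using sum_lp_coord[OF s(2) p_pos] by (simp flip: sum_distrib_right)
    finally show ?thesis .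
  qed
  have hneg: "h (\<lambda>i. - c i, \<theta>) = (\<lambda>x. - h (c, \<theta>) x)" for c \<theta>
    by (simp add: h_def lp_coord_minus sum_negf)
  show "\<exists>s'\<in>sph m \<times> \<Theta>. h s' = (\<lambda>x. - h s x)" if "s \<in> sph m \<times> \<Theta>" for s
    using that hneg[of "fst s" "snd s"] by (intro bexI[of _ "(\<lambda>i. - fst s i, snd s)"]) (auto simp: sph_neg)
  fix F assume F: "continuous_on (sph m \<times> \<Theta>) F" "\<And>s. s \<in> sph m \<times> \<Theta> \<Longrightarrow> F s \<in> sph n"
    and Feq: "\<And>s s'. s \<in> sph m \<times> \<Theta> \<Longrightarrow> s' \<in> sph m \<times> \<Theta> \<Longrightarrow> h s = h s' \<Longrightarrow> F s = F s'"
    and Fneg: "\<And>s s'. s \<in> sph m \<times> \<Theta> \<Longrightarrow> s' \<in> sph m \<times> \<Theta> \<Longrightarrow> h s' = (\<lambda>x. - h s x) \<Longrightarrow> F s' = (\<lambda>i. - F s i)"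
  show False
  proof (rule no_odd[OF F(1)])
    show "F (c, \<theta>) \<in> sph n" if "c \<in> sph m" "\<theta> \<in> \<Theta>" for c \<theta> using F(2) that by simp
    show "F (c, \<theta>) = F (c', \<theta>')" if "c \<in> sph m" "\<theta> \<in> \<Theta>" "c' \<in> sph m" "\<theta>' \<in> \<Theta>" "h (c, \<theta>) = h (c', \<theta>')" for c \<theta> c' \<theta>'
      using Feq that by simp
    show "F (\<lambda>i. - c i, \<theta>) = (\<lambda>i. - F (c, \<theta>) i)" if "c \<in> sph m" "\<theta> \<in> \<Theta>" for c \<theta>
      using Fneg[of "(c, \<theta>)" "(\<lambda>i. - c i, \<theta>)"] that hneg by (simp add: sph_neg)
  qed
qed

end

section \<open>Axial symmetrization\<close>

lemma nn_integral_lborel_translate: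
  fixes g :: "'a::euclidean_space \<Rightarrow> ennreal"
  assumes "g \<in> borel_measurable borel"
  shows "(\<integral>\<^sup>+x. g (c + x) \<partial>lborel) = (\<integral>\<^sup>+x. g x \<partial>lborel)"
proof -
  have "(\<integral>\<^sup>+x. g x \<partial>distr lborel borel ((+) c)) = (\<integral>\<^sup>+x. g (c + x) \<partial>lborel)"
    using assms by (intro nn_integral_distr) auto
  then show ?thesis by (simp add: lborel_distr_plus)
qed

text \<open>Both sides times the volume of the unit ball are \<open>\<integral>\<integral> 1\<^bsub>|x|<1\<^esub> g (R x + y) dx dy\<close>.\<close>

theorem nn_integral_orthogonal_transformation:
  fixes R :: "'a::euclidean_space \<Rightarrow> 'a"
  assumes R: "orthogonal_transformation R" and g[measurable]: "g \<in> borel_measurable borel"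
  shows "(\<integral>\<^sup>+x. g (R x) \<partial>lborel) = (\<integral>\<^sup>+x. g x \<partial>lborel)"
proof -
  have lin: "linear R" and nR: "norm (R x) = norm x" for x
    using R by (auto simp: orthogonal_transformation_linear orthogonal_transformation_norm)
  have cR: "continuous_on UNIV R" using lin by (simp add: linear_continuous_on linear_linear)
  have [measurable]: "R \<in> borel_measurable borel" using cR by (rule borel_measurable_continuous_onI)
  have bR: "bij R" using R by (rule orthogonal_transformation_bij)
  define S where "S = inv_into UNIV R"
  have RS: "R (S y) = y" for y using bR by (simp add: S_def bij_is_surj surj_f_inv_f)
  have oS: "orthogonal_transformation S" unfolding S_def by (rule orthogonal_transformation_inv[OF R])
  have cS: "continuous_on UNIV S" using oS by (simp add: orthogonal_transformation_linear linear_continuous_on linear_linear)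
  have [measurable]: "S \<in> borel_measurable borel" using cS by (rule borel_measurable_continuous_onI)
  \<comment> \<open>The unit ball serves as weight because its indicator is invariant under
    \<open>R\<close>; its volume is positive and finite and is cancelled at the end.\<close>
  define \<beta> :: "'a \<Rightarrow> ennreal" where "\<beta> x = (if norm x < 1 then 1 else 0)" for x
  have [measurable]: "\<beta> \<in> borel_measurable borel" unfolding \<beta>_def by measurable
  define b where "b = (\<integral>\<^sup>+x. \<beta> x \<partial>lborel)"
  have "b = (\<integral>\<^sup>+x. indicator (ball (0::'a) 1) x \<partial>lborel)"
    unfolding b_def by (intro nn_integral_cong) (simp add: \<beta>_def indicator_def)
  then have b_eq: "b = emeasure lborel (ball (0::'a) 1)" by simp
  have b: "b \<noteq> 0" "b \<noteq> \<infinity>"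
  proof -
    show "b \<noteq> \<infinity>" using emeasure_lborel_ball_finite[of "0::'a" 1] by (simp add: b_eq less_top)
    have "ball (0::'a) 1 \<notin> null_sets lborel"
      using open_not_negligible[of "ball (0::'a) 1"] by (simp add: negligible_iff_null_sets null_sets_completion_iff)
    then show "b \<noteq> 0" by (simp add: b_eq null_sets_def)
  qed
  have trans: "(\<integral>\<^sup>+y. \<beta> (z - y) \<partial>lborel) = b" for z :: 'a
  proof -
    have "(\<integral>\<^sup>+y. \<beta> (z - y) \<partial>lborel) = (\<integral>\<^sup>+y. \<beta> (- z + y) \<partial>lborel)"
      by (intro nn_integral_cong) (simp add: \<beta>_def norm_minus_commute)
    also have "\<dots> = b" unfolding b_def by (rule nn_integral_lborel_translate) measurable
    finally show ?thesis .
  qed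
  have "b * (\<integral>\<^sup>+x. g x \<partial>lborel) = (\<integral>\<^sup>+x. \<beta> x * (\<integral>\<^sup>+y. g y \<partial>lborel) \<partial>lborel)"
    unfolding b_def by (rule nn_integral_multc[symmetric]) measurable
  also have "\<dots> = (\<integral>\<^sup>+x. (\<integral>\<^sup>+y. \<beta> x * g (R x + y) \<partial>lborel) \<partial>lborel)"
  proof (rule nn_integral_cong)
    fix x :: 'a
    have "(\<integral>\<^sup>+y. \<beta> x * g (R x + y) \<partial>lborel) = \<beta> x * (\<integral>\<^sup>+y. g (R x + y) \<partial>lborel)"
      by (rule nn_integral_cmult) measurable
    then show "\<beta> x * (\<integral>\<^sup>+y. g y \<partial>lborel) = (\<integral>\<^sup>+y. \<beta> x * g (R x + y) \<partial>lborel)"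
      by (simp add: nn_integral_lborel_translate[OF g])
  qed
  also have "\<dots> = (\<integral>\<^sup>+y. (\<integral>\<^sup>+x. \<beta> x * g (R x + y) \<partial>lborel) \<partial>lborel)"
    by (rule lborel_pair.Fubini'[symmetric]) measurable
  also have "\<dots> = (\<integral>\<^sup>+y. (\<integral>\<^sup>+x. \<beta> (R x - y) * g (R x) \<partial>lborel) \<partial>lborel)"
  proof (rule nn_integral_cong)
    \<comment> \<open>Shifting \<open>x\<close> by \<open>- S y\<close>, with \<open>S\<close> the
      inverse of \<open>R\<close>, turns \<open>R x + y\<close> into \<open>R x\<close>. The weight
      becomes a function of \<open>R x - y\<close>, whose integral over \<open>y\<close> is again
      the volume of the ball.\<close>
    fix y :: 'a
    have "(\<integral>\<^sup>+x. \<beta> x * g (R x + y) \<partial>lborel) = (\<integral>\<^sup>+x. \<beta> (- S y + x) * g (R (- S y + x) + y) \<partial>lborel)"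
      by (rule nn_integral_lborel_translate[symmetric]) measurable
    also have "\<dots> = (\<integral>\<^sup>+x. \<beta> (R x - y) * g (R x) \<partial>lborel)"
    proof (rule nn_integral_cong)
      fix x :: 'a
      have "R (- S y + x) = R (- S y) + R x" by (rule linear_add[OF lin])
      also have "R (- S y) = - y" using linear_neg[OF lin, of "S y"] by (simp add: RS)
      finally have e: "R (- S y + x) = R x - y" by simp
      have "norm (- S y + x) = norm (R x - y)" using nR[of "- S y + x"] by (simp only: e)
      then show "\<beta> (- S y + x) * g (R (- S y + x) + y) = \<beta> (R x - y) * g (R x)"
        unfolding e \<beta>_def by simp
    qed
    finally show "(\<integral>\<^sup>+x. \<beta> x * g (R x + y) \<partial>lborel) = (\<integral>\<^sup>+x. \<beta> (R x - y) * g (R x) \<partial>lborel)" .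
  qed
  also have "\<dots> = (\<integral>\<^sup>+x. (\<integral>\<^sup>+y. \<beta> (R x - y) * g (R x) \<partial>lborel) \<partial>lborel)"
    by (rule lborel_pair.Fubini') measurable
  also have "\<dots> = (\<integral>\<^sup>+x. b * g (R x) \<partial>lborel)"
  proof (rule nn_integral_cong)
    fix x :: 'a
    have "(\<integral>\<^sup>+y. \<beta> (R x - y) * g (R x) \<partial>lborel) = (\<integral>\<^sup>+y. \<beta> (R x - y) \<partial>lborel) * g (R x)"
      by (rule nn_integral_multc) measurable
    then show "(\<integral>\<^sup>+y. \<beta> (R x - y) * g (R x) \<partial>lborel) = b * g (R x)" by (simp only: trans)
  qed
  also have "\<dots> = b * (\<integral>\<^sup>+x. g (R x) \<partial>lborel)" by (rule nn_integral_cmult) measurable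
  finally show ?thesis using b by (simp add: ennreal_mult_cancel_left)
qed

corollary integral_orthogonal_transformation:
  fixes R :: "'a::euclidean_space \<Rightarrow> 'a" and g :: "'a \<Rightarrow> 'b::{banach, second_countable_topology}"
  assumes R: "orthogonal_transformation R" and g: "g \<in> borel_measurable borel"
  shows "(\<integral>x. g (R x) \<partial>lborel) = (\<integral>x. g x \<partial>lborel)"
proof -
  have cR: "continuous_on UNIV R"
    using R by (simp add: orthogonal_transformation_linear linear_continuous_on linear_linear)
  have m: "R \<in> borel_measurable borel" using cR by (rule borel_measurable_continuous_onI)
  have "distr lborel borel R = (lborel :: 'a measure)"
  proof (rule measure_eqI)
    fix A assume "A \<in> sets (distr lborel borel R)"
    then have A: "A \<in> sets borel" by simp
    have "emeasure (distr lborel borel R) A = (\<integral>\<^sup>+x. indicator A x \<partial>distr lborel borel R)" using A by simp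
    also have "\<dots> = (\<integral>\<^sup>+x. indicator A (R x) \<partial>lborel)" using A m by (intro nn_integral_distr) auto
    also have "\<dots> = emeasure lborel A" using A nn_integral_orthogonal_transformation[OF R, of "indicator A"] by simp
    finally show "emeasure (distr lborel borel R) A = emeasure lborel A" .
  qed simp
  then show ?thesis using integral_distr[of R lborel borel g] m g by simp
qed

section \<open>Coordinates along and across the axis, and averaging over slices\<close>

definition perp :: "'n \<Rightarrow> real^'n \<Rightarrow> real^'n" where
  "perp a x = x - x $ a *\<^sub>R axis a 1"

lemma perp_component: "perp a x $ i = (if i = a then 0 else x $ i)"
  by (simp add: perp_def axis_def)

lemma perp_combination: "perp a (t *\<^sub>R perp a x + s *\<^sub>R axis a 1) = t *\<^sub>R perp a x"
  "(t *\<^sub>R perp a x + s *\<^sub>R axis a 1) $ a = s"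
  by (simp_all add: vec_eq_iff perp_component axis_def)

lemma perp_plus_axis: "perp a x + x $ a *\<^sub>R axis a 1 = x"
  by (simp add: perp_def)

lemma norm_perp_axis: "(norm (perp a x + s *\<^sub>R axis a 1))\<^sup>2 = (norm (perp a x))\<^sup>2 + s\<^sup>2"
proof -
  have "orthogonal (perp a x) (s *\<^sub>R axis a 1)" by (simp add: orthogonal_def inner_axis perp_component)
  from norm_add_Pythagorean[OF this] show ?thesis by (simp add: norm_axis_1)
qed

lemma continuous_on_perp: "continuous_on S f \<Longrightarrow> continuous_on S (\<lambda>x. perp a (f x))"
  unfolding perp_def by (intro continuous_intros)

lemma measurable_perp[measurable]: "perp a \<in> borel_measurable borel"
  by (rule borel_measurable_continuous_onI) (rule continuous_on_perp[OF continuous_on_id])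

lemma measurable_nth[measurable]: "(\<lambda>x::real^'n. x $ a) \<in> borel_measurable borel"
  by (rule borel_measurable_continuous_onI) (intro continuous_intros)

text \<open>The substitution is diagonal up to a shift. Scaling the \<open>N - 1\<close> coordinates
  across the axis by \<open>t\<close> produces the Jacobian; shifting or reflecting the axial
  coordinate costs nothing.\<close>

lemma nn_integral_perp_affine:
  fixes a :: "'n::finite" and g :: "real^'n \<Rightarrow> ennreal"
  assumes t: "t > 0" and \<sigma>: "\<sigma> \<in> {1,-1}" and g[measurable]: "g \<in> borel_measurable borel"
  shows "(\<integral>\<^sup>+x. g x \<partial>lborel) = (\<integral>\<^sup>+x. ennreal (t ^ (CARD('n) - 1)) * g (t *\<^sub>R perp a x + (s + \<sigma> * x $ a) *\<^sub>R axis a 1) \<partial>lborel)"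
proof -
  define c where "c j = (if j = (axis a 1 :: real^'n) then \<sigma> else t)" for j
  define T where "T x = s *\<^sub>R axis a 1 + (\<Sum>j\<in>Basis. (c j * (x \<bullet> j)) *\<^sub>R j)" for x :: "real^'n"
  have B: "(Basis :: (real^'n) set) = (\<lambda>i. axis i 1) ` UNIV" by (auto simp: Basis_vec_def)
  have inj: "inj (\<lambda>i. axis i 1 :: real^'n)" by (auto simp: inj_on_def axis_eq_axis)
  have c: "c (axis i 1) = (if i = a then \<sigma> else t)" for i by (simp add: c_def axis_eq_axis)
  have "T x = t *\<^sub>R perp a x + (s + \<sigma> * x $ a) *\<^sub>R axis a 1" for x
  proof -
    have "T x = s *\<^sub>R axis a 1 + (\<Sum>i\<in>UNIV. ((if i = a then \<sigma> else t) * x $ i) *\<^sub>R axis i 1)"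
      unfolding T_def B sum.reindex[OF inj] o_def c by (simp add: inner_axis)
    moreover have "(\<Sum>i\<in>UNIV. ((if i = a then \<sigma> else t) * x $ i) *\<^sub>R axis i 1) $ k = (if k = a then \<sigma> else t) * x $ k" for k
    proof -
      have "(\<Sum>i\<in>UNIV. ((if i = a then \<sigma> else t) * x $ i) *\<^sub>R axis i 1) $ k
          = (\<Sum>i\<in>UNIV. if i = k then (if i = a then \<sigma> else t) * x $ i else 0)"
        unfolding sum_component by (intro sum.cong refl) (simp add: axis_def)
      then show ?thesis by simp
    qed
    ultimately show ?thesis by (simp add: vec_eq_iff perp_component) (simp add: axis_def)
  qed
  then have T: "T = (\<lambda>x. t *\<^sub>R perp a x + (s + \<sigma> * x $ a) *\<^sub>R axis a 1)" by (rule ext)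
  have "(\<Prod>j\<in>Basis. \<bar>c j\<bar>) = (\<Prod>i\<in>UNIV. \<bar>if i = a then \<sigma> else t\<bar>)"
    unfolding B by (simp add: prod.reindex[OF inj] c)
  also have "\<dots> = \<bar>\<sigma>\<bar> * (\<Prod>i\<in>UNIV - {a}. t)"
    using t by (subst prod.remove[of UNIV a]) (auto intro!: prod.cong)
  also have "\<dots> = t ^ (CARD('n) - 1)" using \<sigma> by (auto simp: card_Diff_singleton)
  finally have P: "(\<Prod>j\<in>Basis. \<bar>c j\<bar>) = t ^ (CARD('n) - 1)" .
  have "(lborel :: (real^'n) measure) = density (distr lborel borel T) (\<lambda>_. (\<Prod>j\<in>Basis. \<bar>c j\<bar>))"
    unfolding T_def by (rule lborel_affine_euclidean) (use t \<sigma> in \<open>auto simp: c_def\<close>)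
  then have L: "(lborel :: (real^'n) measure) = density (distr lborel borel T) (\<lambda>_. ennreal (t ^ (CARD('n) - 1)))"
    unfolding P .
  have Tm[measurable]: "T \<in> borel_measurable borel" unfolding T by measurable
  have "(\<integral>\<^sup>+x. g x \<partial>lborel) = (\<integral>\<^sup>+x. ennreal (t ^ (CARD('n) - 1)) * g x \<partial>distr lborel borel T)"
    by (subst L) (simp add: nn_integral_density)
  also have "\<dots> = (\<integral>\<^sup>+x. ennreal (t ^ (CARD('n) - 1)) * g (T x) \<partial>lborel)"
    by (rule nn_integral_distr) measurable
  finally show ?thesis by (simp add: T)
qed

text \<open>The chain of substitutions replaces
  polar coordinates in the orthogonal complement: \<open>y' = z' / |x'|\<close>, \<open>x' = |z'| w'\<close>,
  \<open>z' = v' / |w'|\<close>, where the primes denote orthogonal parts.\<close>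

lemma nn_integral_slices:
  fixes a :: "'n::finite" and f :: "real^'n \<Rightarrow> ennreal"
  assumes N: "CARD('n) \<ge> 2" and f[measurable]: "f \<in> borel_measurable borel"
  defines "m \<equiv> CARD('n) - 1"
  defines "c \<equiv> (\<integral>\<^sup>+u. (if 1 < norm (perp a u) \<and> 0 < u $ a \<and> u $ a < 1
      then ennreal ((1 / norm (perp a u)) ^ m) * ennreal ((1 / norm (perp a u)) ^ m) else 0) \<partial>lborel)"
  shows "(\<integral>\<^sup>+y. (\<integral>\<^sup>+x. (if perp a y \<noteq> 0 \<and> norm (perp a y) < 1 \<and> 0 < y $ a \<and> y $ a < 1
      then f ((norm (perp a x) / norm (perp a y)) *\<^sub>R perp a y + x $ a *\<^sub>R axis a 1) else 0) \<partial>lborel) \<partial>lborel)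
    = c * (\<integral>\<^sup>+x. f x \<partial>lborel)"
proof -
  let ?P = "perp a"
  \<comment> \<open>A second coordinate exists because the dimension is at least 2. The axis lies in
    the hyperplane where it vanishes and is therefore a null set.\<close>
  obtain b where ba: "b \<noteq> a"
  proof -
    have "\<exists>b. b \<noteq> a"
    proof (rule ccontr)
      assume "\<nexists>b. b \<noteq> a"
      then have "(UNIV :: 'n set) = {a}" by auto
      then have "CARD('n) = card {a}" by simp
      then show False using N by simp
    qed
    then show ?thesis using that by blast
  qed
  have nz: "AE x in lborel. ?P x \<noteq> 0"
  proof -
    have "negligible {x::real^'n. axis b 1 \<bullet> x = 0}" by (rule negligible_hyperplane) simp
    then have "{x::real^'n. axis b 1 \<bullet> x = 0} \<in> null_sets lebesgue" by (simp add: negligible_iff_null_sets)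
    moreover have "{x::real^'n. axis b 1 \<bullet> x = 0} \<in> sets borel" by measurable
    ultimately have "{x::real^'n. axis b 1 \<bullet> x = 0} \<in> null_sets lborel" by (simp add: null_sets_completion_iff)
    then have "AE x in lborel. x \<notin> {x::real^'n. axis b 1 \<bullet> x = 0}" by (rule AE_not_in)
    then show ?thesis
    proof eventually_elim
      case (elim x)
      then have "?P x $ b \<noteq> 0" using ba by (simp add: perp_component inner_axis')
      then show ?case by auto
    qed
  qed
  \<comment> \<open>\<open>G1\<close> to \<open>G6\<close> are the integrands after the successive
    substitutions. Besides the radial ones, \<open>w $ a\<close> is shifted by \<open>z $ a\<close>
    and later reflected; this makes the argument of \<open>f\<close> equal to \<open>v\<close> and
    moves the axial bounds to \<open>u\<close>, so that \<open>G6\<close> is a product.\<close>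
  define G1 where "G1 x y = (if ?P x \<noteq> 0 \<and> ?P y \<noteq> 0 \<and> norm (?P y) < 1 \<and> 0 < y $ a \<and> y $ a < 1
      then f ((norm (?P x) / norm (?P y)) *\<^sub>R ?P y + x $ a *\<^sub>R axis a 1) else 0)" for x y :: "real^'n"
  define G2 where "G2 x z = (if ?P x \<noteq> 0 \<and> ?P z \<noteq> 0 \<and> norm (?P z) < norm (?P x) \<and> 0 < z $ a \<and> z $ a < 1
      then ennreal ((1 / norm (?P x)) ^ m) * f ((norm (?P x) / norm (?P z)) *\<^sub>R ?P z + x $ a *\<^sub>R axis a 1) else 0)" for x z :: "real^'n"
  define G3 where "G3 w z = (if ?P z \<noteq> 0 \<and> 1 < norm (?P w) \<and> 0 < z $ a \<and> z $ a < 1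
      then ennreal ((1 / norm (?P w)) ^ m) * f (norm (?P w) *\<^sub>R ?P z + w $ a *\<^sub>R axis a 1) else 0)" for w z :: "real^'n"
  define G4 where "G4 w z = (if ?P z \<noteq> 0 \<and> 1 < norm (?P w) \<and> 0 < z $ a \<and> z $ a < 1
      then ennreal ((1 / norm (?P w)) ^ m) * f (norm (?P w) *\<^sub>R ?P z + (z $ a + w $ a) *\<^sub>R axis a 1) else 0)" for w z :: "real^'n"
  define G5 where "G5 w v = (if ?P v \<noteq> 0 \<and> 1 < norm (?P w) \<and> 0 < v $ a - w $ a \<and> v $ a - w $ a < 1
      then ennreal ((1 / norm (?P w)) ^ m) * ennreal ((1 / norm (?P w)) ^ m) * f v else 0)" for w v :: "real^'n"
  define G6 where "G6 u v = (if ?P v \<noteq> 0 \<and> 1 < norm (?P u) \<and> 0 < u $ a \<and> u $ a < 1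
      then ennreal ((1 / norm (?P u)) ^ m) * ennreal ((1 / norm (?P u)) ^ m) * f v else 0)" for u v :: "real^'n"
  have M1: "case_prod G1 \<in> borel_measurable (lborel \<Otimes>\<^sub>M lborel)" unfolding G1_def case_prod_unfold by measurable
  have M2: "case_prod G2 \<in> borel_measurable (lborel \<Otimes>\<^sub>M lborel)" unfolding G2_def case_prod_unfold by measurable
  have M4: "case_prod G4 \<in> borel_measurable (lborel \<Otimes>\<^sub>M lborel)" unfolding G4_def case_prod_unfold by measurable
  have M5: "case_prod G5 \<in> borel_measurable (lborel \<Otimes>\<^sub>M lborel)" unfolding G5_def case_prod_unfold by measurable
  have S1: "(\<integral>\<^sup>+y. G1 x y \<partial>lborel) = (\<integral>\<^sup>+z. G2 x z \<partial>lborel)" for x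
  proof (cases "?P x = 0")
    case True
    then show ?thesis by (simp add: G1_def G2_def)
  next
    case False
    have "(\<integral>\<^sup>+y. G1 x y \<partial>lborel) = (\<integral>\<^sup>+z. ennreal ((1 / norm (?P x)) ^ m) *
        G1 x ((1 / norm (?P x)) *\<^sub>R ?P z + (0 + 1 * z $ a) *\<^sub>R axis a 1) \<partial>lborel)"
      unfolding m_def by (rule nn_integral_perp_affine) (use False in \<open>auto simp: G1_def\<close>)
    also have "\<dots> = (\<integral>\<^sup>+z. G2 x z \<partial>lborel)"
    proof (rule nn_integral_cong)
      fix z
      define k where "k = norm (?P x)"
      have k: "k > 0" using False by (simp add: k_def)
      have vec: "(k / (norm (?P z) / k)) *\<^sub>R ((1 / k) *\<^sub>R ?P z) = (k / norm (?P z)) *\<^sub>R ?P z" if "?P z \<noteq> 0"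
        using k that by simp
      define y where "y = (1 / k) *\<^sub>R ?P z + (0 + 1 * z $ a) *\<^sub>R axis a 1"
      have y: "?P y = (1 / k) *\<^sub>R ?P z" "y $ a = z $ a"
        unfolding y_def perp_combination by simp_all
      have ny: "norm (?P y) = norm (?P z) / k" "norm (?P y) < 1 \<longleftrightarrow> norm (?P z) < k" "?P y = 0 \<longleftrightarrow> ?P z = 0"
        unfolding y(1) using k by (auto simp: divide_less_eq)
      show "ennreal ((1 / norm (?P x)) ^ m) * G1 x ((1 / norm (?P x)) *\<^sub>R ?P z + (0 + 1 * z $ a) *\<^sub>R axis a 1) = G2 x z"
        using False vec unfolding k_def[symmetric] y_def[symmetric] G1_def G2_def ny(2,3) ny(1) y using k by (auto simp: abs_of_pos[OF k] divide_less_eq)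
    qed
    finally show ?thesis .
  qed
  have S2: "(\<integral>\<^sup>+x. G2 x z \<partial>lborel) = (\<integral>\<^sup>+w. G3 w z \<partial>lborel)" for z
  proof (cases "?P z = 0")
    case True
    then show ?thesis by (simp add: G2_def G3_def)
  next
    case False
    have "(\<integral>\<^sup>+x. G2 x z \<partial>lborel) = (\<integral>\<^sup>+w. ennreal (norm (?P z) ^ m) *
        G2 (norm (?P z) *\<^sub>R ?P w + (0 + 1 * w $ a) *\<^sub>R axis a 1) z \<partial>lborel)"
      unfolding m_def by (rule nn_integral_perp_affine) (use False in \<open>auto simp: G2_def\<close>)
    also have "\<dots> = (\<integral>\<^sup>+w. G3 w z \<partial>lborel)"
    proof (intro nn_integral_cong)
      fix w
      have e: "ennreal (norm (?P z) ^ m) * (ennreal ((1 / (norm (?P z) * norm (?P w))) ^ m) * q) = ennreal ((1 / norm (?P w)) ^ m) * q"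
        for q
      proof -
        have "ennreal (norm (?P z) ^ m) * ennreal ((1 / (norm (?P z) * norm (?P w))) ^ m)
            = ennreal (norm (?P z) ^ m * (1 / (norm (?P z) * norm (?P w))) ^ m)"
          by (simp add: ennreal_mult'')
        also have "norm (?P z) ^ m * (1 / (norm (?P z) * norm (?P w))) ^ m = (1 / norm (?P w)) ^ m"
          using False by (simp flip: power_mult_distrib)
        finally show ?thesis by (simp add: mult.assoc[symmetric])
      qed
      have "?P w \<noteq> 0" if "1 < norm (?P w)" using that by auto
      then show "ennreal (norm (?P z) ^ m) * G2 (norm (?P z) *\<^sub>R ?P w + (0 + 1 * w $ a) *\<^sub>R axis a 1) z = G3 w z"
        using False by (auto simp: G2_def G3_def perp_combination perp_component e)
    qed
    finally show ?thesis .
  qed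
  have S3: "(\<integral>\<^sup>+w. G3 w z \<partial>lborel) = (\<integral>\<^sup>+w. G4 w z \<partial>lborel)" for z
  proof -
    have "(\<integral>\<^sup>+w. G3 w z \<partial>lborel) = (\<integral>\<^sup>+w. ennreal (1 ^ m) * G3 (1 *\<^sub>R ?P w + (z $ a + 1 * w $ a) *\<^sub>R axis a 1) z \<partial>lborel)"
      unfolding m_def by (rule nn_integral_perp_affine) (auto simp: G3_def)
    also have "\<dots> = (\<integral>\<^sup>+w. G4 w z \<partial>lborel)"
      by (intro nn_integral_cong) (use perp_combination[where a = a and t = 1] in \<open>auto simp: G3_def G4_def\<close>)
    finally show ?thesis .
  qed
  have S4: "(\<integral>\<^sup>+z. G4 w z \<partial>lborel) = (\<integral>\<^sup>+v. G5 w v \<partial>lborel)" for w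
  proof (cases "1 < norm (?P w)")
    case False
    then show ?thesis by (simp add: G4_def G5_def)
  next
    case True
    then have w0: "?P w \<noteq> 0" by auto
    have "(\<integral>\<^sup>+z. G4 w z \<partial>lborel) = (\<integral>\<^sup>+v. ennreal ((1 / norm (?P w)) ^ m) *
        G4 w ((1 / norm (?P w)) *\<^sub>R ?P v + (- w $ a + 1 * v $ a) *\<^sub>R axis a 1) \<partial>lborel)"
      unfolding m_def by (rule nn_integral_perp_affine) (use w0 in \<open>auto simp: G4_def\<close>)
    also have "\<dots> = (\<integral>\<^sup>+v. G5 w v \<partial>lborel)"
      by (intro nn_integral_cong) (use w0 True in \<open>auto simp: G4_def G5_def perp_combination perp_component perp_plus_axis mult.assoc\<close>)
    finally show ?thesis .
  qed
  have S5: "(\<integral>\<^sup>+w. G5 w v \<partial>lborel) = (\<integral>\<^sup>+u. G6 u v \<partial>lborel)" for v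
  proof -
    have "(\<integral>\<^sup>+w. G5 w v \<partial>lborel) = (\<integral>\<^sup>+u. ennreal (1 ^ m) * G5 (1 *\<^sub>R ?P u + (v $ a + (-1) * u $ a) *\<^sub>R axis a 1) v \<partial>lborel)"
      unfolding m_def by (rule nn_integral_perp_affine) (auto simp: G5_def)
    also have "\<dots> = (\<integral>\<^sup>+u. G6 u v \<partial>lborel)"
      by (intro nn_integral_cong) (use perp_combination[where a = a and t = 1] in \<open>auto simp: G5_def G6_def\<close>)
    finally show ?thesis .
  qed
  have "(\<integral>\<^sup>+y. (\<integral>\<^sup>+x. (if ?P y \<noteq> 0 \<and> norm (?P y) < 1 \<and> 0 < y $ a \<and> y $ a < 1
      then f ((norm (?P x) / norm (?P y)) *\<^sub>R ?P y + x $ a *\<^sub>R axis a 1) else 0) \<partial>lborel) \<partial>lborel)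
     = (\<integral>\<^sup>+y. (\<integral>\<^sup>+x. G1 x y \<partial>lborel) \<partial>lborel)"
  proof (rule nn_integral_cong, rule nn_integral_cong_AE)
    fix y :: "real^'n"
    show "AE x in lborel. (if ?P y \<noteq> 0 \<and> norm (?P y) < 1 \<and> 0 < y $ a \<and> y $ a < 1
      then f ((norm (?P x) / norm (?P y)) *\<^sub>R ?P y + x $ a *\<^sub>R axis a 1) else 0) = G1 x y"
      using nz by eventually_elim (simp add: G1_def)
  qed
  also have "\<dots> = (\<integral>\<^sup>+x. (\<integral>\<^sup>+y. G1 x y \<partial>lborel) \<partial>lborel)" by (rule lborel_pair.Fubini'[OF M1])
  also have "\<dots> = (\<integral>\<^sup>+x. (\<integral>\<^sup>+z. G2 x z \<partial>lborel) \<partial>lborel)" by (simp only: S1)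
  also have "\<dots> = (\<integral>\<^sup>+z. (\<integral>\<^sup>+x. G2 x z \<partial>lborel) \<partial>lborel)" by (rule lborel_pair.Fubini'[OF M2, symmetric])
  also have "\<dots> = (\<integral>\<^sup>+z. (\<integral>\<^sup>+w. G4 w z \<partial>lborel) \<partial>lborel)" by (simp only: S2 S3)
  also have "\<dots> = (\<integral>\<^sup>+w. (\<integral>\<^sup>+z. G4 w z \<partial>lborel) \<partial>lborel)" by (rule lborel_pair.Fubini'[OF M4])
  also have "\<dots> = (\<integral>\<^sup>+w. (\<integral>\<^sup>+v. G5 w v \<partial>lborel) \<partial>lborel)" by (simp only: S4)
  also have "\<dots> = (\<integral>\<^sup>+v. (\<integral>\<^sup>+w. G5 w v \<partial>lborel) \<partial>lborel)" by (rule lborel_pair.Fubini'[OF M5, symmetric])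
  also have "\<dots> = (\<integral>\<^sup>+v. (\<integral>\<^sup>+u. G6 u v \<partial>lborel) \<partial>lborel)" by (simp only: S5)
  also have "\<dots> = (\<integral>\<^sup>+v. c * f v \<partial>lborel)"
  proof (rule nn_integral_cong_AE, use nz in eventually_elim)
    case (elim v)
    have "(\<integral>\<^sup>+u. G6 u v \<partial>lborel) = (\<integral>\<^sup>+u. (if 1 < norm (perp a u) \<and> 0 < u $ a \<and> u $ a < 1
      then ennreal ((1 / norm (perp a u)) ^ m) * ennreal ((1 / norm (perp a u)) ^ m) else 0) * f v \<partial>lborel)"
      by (intro nn_integral_cong) (use elim in \<open>auto simp: G6_def\<close>)
    also have "\<dots> = c * f v" unfolding c_def by (rule nn_integral_multc) measurable
    finally show ?case .
  qed
  also have "\<dots> = c * (\<integral>\<^sup>+v. f v \<partial>lborel)" by (rule nn_integral_cmult) simp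
  finally show ?thesis .
qed

text \<open>For \<open>\<delta> = 0\<close> and a unit vector \<open>\<omega>\<close> across the
  axis, points are turned about the axis into the half-plane of \<open>\<omega>\<close>, so a
  function composed with \<open>slice\<close> is axially symmetric. A nonzero
  \<open>\<delta>\<close> removes the kink at the axis. The root is a \<open>powr\<close> so that
  \<open>C_k_powr\<close> covers it.\<close>

definition slice :: "'n \<Rightarrow> real^'n \<Rightarrow> real \<Rightarrow> real^'n \<Rightarrow> real^'n" where
  "slice a \<omega> \<delta> x = ((norm (perp a x))\<^sup>2 + \<delta>\<^sup>2) powr (1 / 2) *\<^sub>R \<omega> + x $ a *\<^sub>R axis a 1"

lemma slice_0: "slice a \<omega> 0 x = norm (perp a x) *\<^sub>R \<omega> + x $ a *\<^sub>R axis a 1"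
  by (simp add: slice_def powr_half_sqrt)

lemma slice_component: "\<omega> $ a = 0 \<Longrightarrow> slice a \<omega> \<delta> x $ a = x $ a"
  by (simp add: slice_def axis_def)

lemma norm_perp: "(norm (perp a x))\<^sup>2 = (norm x)\<^sup>2 - (x $ a)\<^sup>2"
  using norm_perp_axis[of a x "x $ a"] by (simp add: perp_plus_axis)

lemma norm_slice:
  assumes "norm \<omega> = 1" "\<omega> $ a = 0"
  shows "(norm (slice a \<omega> \<delta> x))\<^sup>2 = (norm x)\<^sup>2 + \<delta>\<^sup>2"
proof -
  let ?r = "((norm (perp a x))\<^sup>2 + \<delta>\<^sup>2) powr (1 / 2)"
  have "orthogonal (?r *\<^sub>R \<omega>) (x $ a *\<^sub>R axis a 1)" using assms by (simp add: orthogonal_def inner_axis)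
  from norm_add_Pythagorean[OF this]
  have "(norm (slice a \<omega> \<delta> x))\<^sup>2 = ?r\<^sup>2 + (x $ a)\<^sup>2" using assms by (simp add: slice_def norm_axis_1)
  also have "?r\<^sup>2 = (norm (perp a x))\<^sup>2 + \<delta>\<^sup>2" by (simp add: powr_half_sqrt)
  finally show ?thesis by (simp add: norm_perp)
qed

lemma norm_le_norm_slice:
  assumes "norm \<omega> = 1" "\<omega> $ a = 0"
  shows "norm x \<le> norm (slice a \<omega> \<delta> x)"
  by (rule power2_le_imp_le) (simp_all add: norm_slice[OF assms])

lemma continuous_slice: "continuous_on UNIV (\<lambda>q. slice a \<omega> (fst q) (snd q))"
  unfolding slice_def powr_half_sqrt[OF add_nonneg_nonneg[OF zero_le_power2 zero_le_power2]]
  by (intro continuous_intros continuous_on_perp)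

lemma continuous_slice_point: "continuous_on UNIV (slice a \<omega> \<delta> :: real^'n \<Rightarrow> real^'n)"
proof -
  have "continuous_on UNIV (Pair \<delta> :: real^'n \<Rightarrow> _)" by (intro continuous_intros)
  from continuous_on_compose2[OF continuous_slice this] show ?thesis by simp
qed

text \<open>By averaging, some slice through the axis has a Rayleigh quotient not larger than the whole.\<close>

lemma exists_slice:
  fixes a :: "'n::finite" and f1 f2 :: "real^'n \<Rightarrow> real"
  assumes N: "CARD('n) \<ge> 2"
    and c: "continuous_on UNIV f1" "continuous_on UNIV f2"
    and nn: "\<And>x. f1 x \<ge> 0" "\<And>x. f2 x \<ge> 0"
    and K: "compact K" "\<And>x. x \<notin> K \<Longrightarrow> f1 x = 0" "\<And>x. x \<notin> K \<Longrightarrow> f2 x = 0"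
    and less: "(\<integral>x. f1 x \<partial>lborel) < \<mu> * (\<integral>x. f2 x \<partial>lborel)"
  obtains \<omega> where "norm \<omega> = 1" "\<omega> $ a = 0"
    "(\<integral>x. f1 (slice a \<omega> 0 x) \<partial>lborel) < \<mu> * (\<integral>x. f2 (slice a \<omega> 0 x) \<partial>lborel)"
proof -
  let ?P = "perp a"
  have i1: "integrable lborel f1" by (rule integrable_continuous_compact_support[OF c(1) K(1,2)])
  have i2: "integrable lborel f2" by (rule integrable_continuous_compact_support[OF c(2) K(1,3)])
  have [measurable]: "f1 \<in> borel_measurable borel" "f2 \<in> borel_measurable borel"
    using c by (auto intro: borel_measurable_continuous_onI)
  have \<mu>: "\<mu> > 0"
  proof -
    have "0 \<le> (\<integral>x. f1 x \<partial>lborel)" "0 \<le> (\<integral>x. f2 x \<partial>lborel)" using nn by (auto intro: integral_nonneg_AE)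
    then show ?thesis using less by (metis le_less_trans mult_nonpos_nonneg not_le)
  qed
  \<comment> \<open>The average runs over \<open>y\<close> in this cylinder of finite positive
    volume. Only the direction of \<open>perp a y\<close> matters for the slice.\<close>
  define C where "C = {y. ?P y \<noteq> 0 \<and> norm (?P y) < 1 \<and> 0 < y $ a \<and> y $ a < 1}"
  have inC: "(if ?P y \<noteq> 0 \<and> norm (?P y) < 1 \<and> 0 < y $ a \<and> y $ a < 1 then u else v) = (if y \<in> C then u else v)"
    for y and u v :: ennreal by (simp add: C_def)
  define sl where "sl y x = (norm (?P x) / norm (?P y)) *\<^sub>R ?P y + x $ a *\<^sub>R axis a 1" for x y :: "real^'n"
  define m where "m = CARD('n) - 1"
  define cc where "cc = (\<integral>\<^sup>+u. (if 1 < norm (perp a u) \<and> 0 < u $ a \<and> u $ a < 1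
      then ennreal ((1 / norm (perp a u)) ^ m) * ennreal ((1 / norm (perp a u)) ^ m) else 0) \<partial>lborel)"
  have avg: "(\<integral>\<^sup>+y. (\<integral>\<^sup>+x. (if y \<in> C then f (sl y x) else 0) \<partial>lborel) \<partial>lborel) = cc * (\<integral>\<^sup>+x. f x \<partial>lborel)"
    if "f \<in> borel_measurable borel" for f
    using nn_integral_slices[OF N that, of a] unfolding inC sl_def[symmetric] m_def[symmetric] cc_def[symmetric] .
  define V where "V = emeasure lborel C"
  have openC: "open C"
    unfolding C_def by (intro open_Collect_conj open_Collect_neq open_Collect_less continuous_intros continuous_on_perp)
  then have Cm[measurable]: "C \<in> sets borel" by simp
  obtain b where ba: "b \<noteq> a"
  proof -
    have "\<exists>b. b \<noteq> a"
    proof (rule ccontr)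
      assume "\<nexists>b. b \<noteq> a"
      then have "(UNIV :: 'n set) = {a}" by auto
      then have "CARD('n) = card {a}" by simp
      then show False using N by simp
    qed
    then show ?thesis using that by blast
  qed
  have Cne: "C \<noteq> {}"
  proof -
    let ?y = "(1/2) *\<^sub>R axis b 1 + (1/2) *\<^sub>R axis a 1 :: real^'n"
    have "?P ?y = (1/2) *\<^sub>R axis b 1" using ba by (simp add: vec_eq_iff perp_component) (simp add: axis_def)
    moreover have "?y $ a = 1/2" using ba by (simp add: axis_def)
    ultimately have "?y \<in> C" unfolding C_def by (simp add: norm_axis_1 axis_eq_0_iff)
    then show ?thesis by blast
  qed
  have V: "V \<noteq> 0" "V \<noteq> \<infinity>"
  proof -
    have "C \<notin> null_sets lborel"
      using open_not_negligible[OF openC Cne] Cm by (simp add: negligible_iff_null_sets null_sets_completion_iff)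
    then show "V \<noteq> 0" by (simp add: V_def null_sets_def)
    have "C \<subseteq> ball 0 2"
    proof
      fix y assume y: "y \<in> C"
      have "norm y = norm (?P y + y $ a *\<^sub>R axis a 1)" by (simp add: perp_plus_axis)
      also have "\<dots> \<le> norm (?P y) + norm (y $ a *\<^sub>R (axis a 1 :: real^'n))" by (rule norm_triangle_ineq)
      also have "\<dots> < 2" using y by (simp add: C_def norm_axis_1)
      finally show "y \<in> ball 0 2" by simp
    qed
    then have "V \<le> emeasure lborel (ball (0::real^'n) 2)" unfolding V_def by (intro emeasure_mono) auto
    also have "\<dots> < \<infinity>" by (rule emeasure_lborel_ball_finite)
    finally show "V \<noteq> \<infinity>" by simp
  qed
  have slP: "?P (sl y x) = (norm (?P x) / norm (?P y)) *\<^sub>R ?P y" "sl y x $ a = x $ a" for x y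
    unfolding sl_def perp_combination by simp_all
  \<comment> \<open>The constant is found by testing the formula on the cylinder itself: for
    \<open>y\<close> in \<open>C\<close>, the point \<open>sl y x\<close> lies in \<open>C\<close>
    exactly when \<open>x\<close> does, whence \<open>V * V = cc * V\<close>.\<close>
  have "cc = V"
  proof -
    have "(\<integral>\<^sup>+y. (\<integral>\<^sup>+x. (if y \<in> C then indicator C (sl y x) else 0) \<partial>lborel) \<partial>lborel) = (\<integral>\<^sup>+y. indicator C y * V \<partial>lborel)"
    proof (rule nn_integral_cong)
      fix y
      have "indicator C (sl y x) = (indicator C x :: ennreal)" if "y \<in> C" for x
        using that unfolding indicator_def C_def mem_Collect_eq slP by auto
      then show "(\<integral>\<^sup>+x. (if y \<in> C then indicator C (sl y x) else 0) \<partial>lborel) = indicator C y * V"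
        by (cases "y \<in> C") (simp_all add: V_def)
    qed
    also have "\<dots> = V * V" by (subst nn_integral_multc) (auto simp: V_def)
    finally have "V * V = cc * V" using avg[of "indicator C"] by (simp add: V_def)
    then have "V * V = V * cc" by (simp only: mult.commute)
    then show ?thesis using V ennreal_mult_cancel_left[of V V cc] by simp
  qed
  then have cc: "cc \<noteq> 0" "cc \<noteq> \<infinity>" using V by auto
  define F where "F f y = (\<integral>\<^sup>+x. ennreal (f (sl y x)) \<partial>lborel)" for f y
  \<comment> \<open>Otherwise the opposite inequality, averaged over \<open>C\<close>, would
    contradict \<open>less\<close>.\<close>
  have "\<exists>y\<in>C. F f1 y < ennreal \<mu> * F f2 y"
  proof (rule ccontr)
    assume "\<not> ?thesis"
    then have ge: "ennreal \<mu> * F f2 y \<le> F f1 y" if "y \<in> C" for y using that by (auto simp: not_less)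
    have "cc * (\<integral>\<^sup>+x. ennreal \<mu> * ennreal (f2 x) \<partial>lborel)
       = (\<integral>\<^sup>+y. (\<integral>\<^sup>+x. (if y \<in> C then ennreal \<mu> * ennreal (f2 (sl y x)) else 0) \<partial>lborel) \<partial>lborel)"
      by (rule avg[symmetric]) measurable
    also have "\<dots> \<le> (\<integral>\<^sup>+y. (\<integral>\<^sup>+x. (if y \<in> C then ennreal (f1 (sl y x)) else 0) \<partial>lborel) \<partial>lborel)"
    proof (rule nn_integral_mono)
      fix y
      have "(\<integral>\<^sup>+x. ennreal \<mu> * ennreal (f2 (sl y x)) \<partial>lborel) = ennreal \<mu> * F f2 y"
        unfolding F_def sl_def by (rule nn_integral_cmult) measurable
      then show "(\<integral>\<^sup>+x. (if y \<in> C then ennreal \<mu> * ennreal (f2 (sl y x)) else 0) \<partial>lborel)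
          \<le> (\<integral>\<^sup>+x. (if y \<in> C then ennreal (f1 (sl y x)) else 0) \<partial>lborel)"
        using ge[of y] by (cases "y \<in> C") (simp_all add: F_def)
    qed
    also have "\<dots> = cc * (\<integral>\<^sup>+x. ennreal (f1 x) \<partial>lborel)" by (rule avg) measurable
    finally have "(\<integral>\<^sup>+x. ennreal \<mu> * ennreal (f2 x) \<partial>lborel) \<le> (\<integral>\<^sup>+x. ennreal (f1 x) \<partial>lborel)"
      using cc by (simp add: ennreal_mult_le_mult_iff)
    moreover have "(\<integral>\<^sup>+x. ennreal \<mu> * ennreal (f2 x) \<partial>lborel) = ennreal \<mu> * ennreal (\<integral>x. f2 x \<partial>lborel)"
      using nn_integral_eq_integral[OF i2] nn by (subst nn_integral_cmult) auto
    moreover have "(\<integral>\<^sup>+x. ennreal (f1 x) \<partial>lborel) = ennreal (\<integral>x. f1 x \<partial>lborel)"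
      using nn_integral_eq_integral[OF i1] nn by simp
    ultimately have "ennreal (\<mu> * (\<integral>x. f2 x \<partial>lborel)) \<le> ennreal (\<integral>x. f1 x \<partial>lborel)"
      using \<mu> by (simp add: ennreal_mult')
    then have "\<mu> * (\<integral>x. f2 x \<partial>lborel) \<le> (\<integral>x. f1 x \<partial>lborel)"
      using nn by (subst (asm) ennreal_le_iff) (auto intro: integral_nonneg_AE)
    then show False using less by simp
  qed
  then obtain y where y: "y \<in> C" "F f1 y < ennreal \<mu> * F f2 y" by blast
  have Py: "?P y \<noteq> 0" using y(1) by (simp add: C_def)
  define \<omega> where "\<omega> = (1 / norm (?P y)) *\<^sub>R ?P y"
  have \<omega>: "norm \<omega> = 1" "\<omega> $ a = 0" using Py by (auto simp: \<omega>_def perp_component)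
  have sl: "sl y x = slice a \<omega> 0 x" for x by (simp add: sl_def slice_0 \<omega>_def)
  obtain R where R: "\<forall>x\<in>K. norm x \<le> R" using compact_imp_bounded[OF K(1)] by (auto simp: bounded_iff)
  have out: "slice a \<omega> 0 x \<notin> K" if "x \<notin> cball 0 R" for x
    using that norm_le_norm_slice[OF \<omega>, of x 0] R by force
  have cs: "continuous_on UNIV (\<lambda>x. f (slice a \<omega> 0 x))" if "continuous_on UNIV f" for f :: "real^'n \<Rightarrow> real"
    by (rule continuous_on_compose2[OF that continuous_slice_point]) auto
  have I1: "integrable lborel (\<lambda>x. f1 (slice a \<omega> 0 x))"
    by (rule integrable_continuous_compact_support[OF cs[OF c(1)] compact_cball[of 0 R]]) (use out K in blast)
  have I2: "integrable lborel (\<lambda>x. f2 (slice a \<omega> 0 x))"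
    by (rule integrable_continuous_compact_support[OF cs[OF c(2)] compact_cball[of 0 R]]) (use out K in blast)
  have "F f1 y = ennreal (\<integral>x. f1 (slice a \<omega> 0 x) \<partial>lborel)" "F f2 y = ennreal (\<integral>x. f2 (slice a \<omega> 0 x) \<partial>lborel)"
    unfolding F_def sl using nn_integral_eq_integral[OF I1] nn_integral_eq_integral[OF I2] nn by auto
  then have "ennreal (\<integral>x. f1 (slice a \<omega> 0 x) \<partial>lborel) < ennreal (\<mu> * (\<integral>x. f2 (slice a \<omega> 0 x) \<partial>lborel))"
    using y(2) \<mu> by (simp add: ennreal_mult')
  then have "(\<integral>x. f1 (slice a \<omega> 0 x) \<partial>lborel) < \<mu> * (\<integral>x. f2 (slice a \<omega> 0 x) \<partial>lborel)"
    using nn by (subst (asm) ennreal_less_iff) (auto intro: integral_nonneg_AE)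
  then show ?thesis by (rule that[OF \<omega>])
qed

section \<open>Smoothed slices and their derivatives\<close>

lemma has_derivative_inner_grad:
  "f differentiable (at x) \<Longrightarrow> (f has_derivative (\<lambda>h. grad f x \<bullet> h)) (at x)"
  using has_derivative_partials[of f x] by (simp add: grad_def inner_vec_def)

text \<open>The chain rule is evaluated in the direction of the gradient of the composition;
  Cauchy-Schwarz and the contraction property of \<open>D\<close> do the rest.\<close>

lemma norm_grad_compose_le:
  fixes \<phi> :: "real^'m \<Rightarrow> real" and Q :: "real^'n \<Rightarrow> real^'m"
  assumes \<phi>: "\<phi> differentiable (at (Q x))" and Q: "(Q has_derivative D) (at x)"
    and D: "\<And>h. norm (D h) \<le> norm h"
  shows "norm (grad (\<lambda>x. \<phi> (Q x)) x) \<le> norm (grad \<phi> (Q x))"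
proof -
  let ?g = "grad (\<lambda>x. \<phi> (Q x)) x"
  have c: "((\<lambda>x. \<phi> (Q x)) has_derivative (\<lambda>h. grad \<phi> (Q x) \<bullet> D h)) (at x)"
    by (rule has_derivative_compose[OF Q has_derivative_inner_grad[OF \<phi>]])
  then have "(\<lambda>x. \<phi> (Q x)) differentiable (at x)" by (rule differentiableI)
  from has_derivative_unique[OF has_derivative_inner_grad[OF this] c]
  have "?g \<bullet> ?g = grad \<phi> (Q x) \<bullet> D ?g" by (rule fun_cong)
  also have "\<dots> \<le> norm (grad \<phi> (Q x)) * norm (D ?g)" by (rule norm_cauchy_schwarz)
  also have "\<dots> \<le> norm (grad \<phi> (Q x)) * norm ?g" by (intro mult_left_mono D) simp
  finally have "norm ?g * norm ?g \<le> norm (grad \<phi> (Q x)) * norm ?g" by (simp add: power2_norm_eq_inner[symmetric] power2_eq_square)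
  then show ?thesis by (cases "?g = 0") (auto simp: mult_le_cancel_right)
qed

lemma C_k_inner: fixes v :: "real^'n" shows "C_k m (\<lambda>x. x \<bullet> v)"
  unfolding inner_vec_def inner_real_def by (intro C_k_sum C_k_mult C_k_coordinate C_k_const)

lemma C_k_norm_power2: "C_k m (\<lambda>x::real^'n. (norm x)\<^sup>2)"
proof -
  have "C_k m (\<lambda>x::real^'n. \<Sum>i\<in>UNIV. x $ i * x $ i)"
    by (intro C_k_sum C_k_mult C_k_coordinate)
  then show ?thesis by (simp add: power2_norm_eq_inner inner_vec_def)
qed

lemma C_k_norm_perp_power2: "C_k m (\<lambda>x::real^'n. (norm (perp a x))\<^sup>2)"
  unfolding norm_perp power2_eq_square[of "_ $ a"] by (intro C_k_diff C_k_norm_power2 C_k_mult C_k_coordinate)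

lemma slice_root_pos: "\<delta> \<noteq> 0 \<Longrightarrow> (norm (perp a x))\<^sup>2 + \<delta>\<^sup>2 > 0"
  by (simp add: add_nonneg_pos)

lemma C_k_slice:
  assumes "\<delta> \<noteq> 0" shows "C_k m (\<lambda>x. slice a \<omega> \<delta> x $ l)"
proof -
  have "C_k m (\<lambda>x. ((norm (perp a x))\<^sup>2 + \<delta>\<^sup>2) powr (1 / 2) * \<omega> $ l + x $ a * axis a 1 $ l)"
    by (intro C_k_add C_k_mult C_k_powr C_k_norm_perp_power2 C_k_const C_k_coordinate slice_root_pos[OF assms])
  then show ?thesis by (simp add: slice_def)
qed

lemma has_derivative_slice:
  assumes "\<delta> \<noteq> 0"
  shows "(slice a \<omega> \<delta> has_derivative (\<lambda>h. ((perp a x \<bullet> h) / sqrt ((norm (perp a x))\<^sup>2 + \<delta>\<^sup>2)) *\<^sub>R \<omega> + h $ a *\<^sub>R axis a 1)) (at x)"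
proof -
  let ?q = "\<lambda>x. (norm (perp a x))\<^sup>2 + \<delta>\<^sup>2"
  have q: "?q x > 0" by (rule slice_root_pos[OF assms])
  have coord: "((\<lambda>x::real^'a. x $ a) has_derivative (\<lambda>h. h $ a)) (at x)"
    by (rule bounded_linear_imp_has_derivative[OF bounded_linear_vec_nth])
  have "((\<lambda>x. x \<bullet> x - x $ a * x $ a + \<delta>\<^sup>2) has_derivative (\<lambda>h. 2 * (perp a x \<bullet> h))) (at x)"
  proof (rule has_derivative_eq_rhs)
    show "((\<lambda>x. x \<bullet> x - x $ a * x $ a + \<delta>\<^sup>2) has_derivative (\<lambda>h. (x \<bullet> h + h \<bullet> x) - (x $ a * h $ a + h $ a * x $ a) + 0)) (at x)"
      by (intro has_derivative_add has_derivative_diff has_derivative_mult has_derivative_inner has_derivative_const has_derivative_ident coord)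
    show "(\<lambda>h. (x \<bullet> h + h \<bullet> x) - (x $ a * h $ a + h $ a * x $ a) + 0) = (\<lambda>h. 2 * (perp a x \<bullet> h))"
    proof
      fix h :: "real^'a"
      have "perp a x \<bullet> h = x \<bullet> h - x $ a * h $ a"
        by (simp add: perp_def inner_diff_left inner_axis')
      then show "(x \<bullet> h + h \<bullet> x) - (x $ a * h $ a + h $ a * x $ a) + 0 = 2 * (perp a x \<bullet> h)"
        by (simp add: inner_commute[of h x])
    qed
  qed
  moreover have "(\<lambda>x. x \<bullet> x - x $ a * x $ a + \<delta>\<^sup>2) = ?q"
  proof
    fix x :: "real^'a"
    have "(norm (perp a x))\<^sup>2 = x \<bullet> x - x $ a * x $ a"
      unfolding norm_perp by (simp add: power2_norm_eq_inner power2_eq_square[of "x $ a"])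
    then show "x \<bullet> x - x $ a * x $ a + \<delta>\<^sup>2 = ?q x" by simp
  qed
  ultimately have dq: "(?q has_derivative (\<lambda>h. 2 * (perp a x \<bullet> h))) (at x)" by simp
  have "(sqrt has_derivative (*) (inverse (sqrt (?q x)) / 2)) (at (?q x))"
    using DERIV_real_sqrt[OF q] by (simp only: has_field_derivative_def)
  from has_derivative_compose[OF dq this]
  have "((\<lambda>x. sqrt (?q x)) has_derivative (\<lambda>h. (perp a x \<bullet> h) / sqrt (?q x))) (at x)"
    by (simp add: field_simps)
  then have "((\<lambda>x. sqrt (?q x) *\<^sub>R \<omega> + x $ a *\<^sub>R axis a 1) has_derivative
      (\<lambda>h. ((perp a x \<bullet> h) / sqrt (?q x)) *\<^sub>R \<omega> + h $ a *\<^sub>R axis a 1)) (at x)"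
    by (intro has_derivative_add has_derivative_scaleR_left coord)
  moreover have "slice a \<omega> \<delta> = (\<lambda>x. sqrt (?q x) *\<^sub>R \<omega> + x $ a *\<^sub>R axis a 1)"
    by (simp add: fun_eq_iff slice_def powr_half_sqrt)
  ultimately show ?thesis by simp
qed

text \<open>The root dominates the norm of \<open>perp a x\<close>, so by Cauchy-Schwarz the
  coefficient of \<open>\<omega>\<close> is at most the norm of \<open>perp a h\<close>; Pythagoras
  adds the axial part. Hence slicing does not increase gradients.\<close>

lemma norm_slice_derivative_le:
  fixes x h \<omega> :: "real^'n"
  assumes \<omega>: "norm \<omega> = 1" "\<omega> $ a = 0"
  shows "norm (((perp a x \<bullet> h) / sqrt ((norm (perp a x))\<^sup>2 + \<delta>\<^sup>2)) *\<^sub>R \<omega> + h $ a *\<^sub>R axis a 1) \<le> norm h"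
proof -
  let ?s = "sqrt ((norm (perp a x))\<^sup>2 + \<delta>\<^sup>2)"
  define t where "t = (perp a x \<bullet> h) / ?s"
  have eq: "perp a x \<bullet> h = perp a x \<bullet> perp a h"
    by (simp add: perp_def[of a h] inner_diff_right inner_axis perp_component)
  have "\<bar>perp a x \<bullet> h\<bar> \<le> norm (perp a x) * norm (perp a h)" unfolding eq by (rule Cauchy_Schwarz_ineq2)
  also have "\<dots> \<le> ?s * norm (perp a h)" by (intro mult_right_mono real_le_rsqrt) auto
  finally have le: "\<bar>perp a x \<bullet> h\<bar> \<le> ?s * norm (perp a h)" .
  have "\<bar>t\<bar> \<le> norm (perp a h)"
  \<comment> \<open>The root can vanish on the axis when \<open>\<delta> = 0\<close>; division by
    zero then makes \<open>t\<close> equal to 0.\<close>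
  proof (cases "?s = 0")
    case False
    moreover have "?s \<ge> 0" by (simp add: add_nonneg_nonneg)
    ultimately have "?s > 0" by linarith
    then show ?thesis unfolding t_def abs_divide using le by (simp only: abs_of_pos pos_divide_le_eq mult.commute)
  qed (simp add: t_def)
  then have t: "t\<^sup>2 \<le> (norm (perp a h))\<^sup>2" by (metis abs_le_square_iff abs_norm_cancel)
  have "orthogonal (t *\<^sub>R \<omega>) (h $ a *\<^sub>R axis a 1)" using \<omega> by (simp add: orthogonal_def inner_axis)
  from norm_add_Pythagorean[OF this]
  have "(norm (t *\<^sub>R \<omega> + h $ a *\<^sub>R axis a 1))\<^sup>2 = t\<^sup>2 + (h $ a)\<^sup>2" using \<omega> by (simp add: norm_axis_1)
  also have "\<dots> \<le> (norm h)\<^sup>2" using t by (simp add: norm_perp)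
  finally show ?thesis unfolding t_def by (rule power2_le_imp_le) simp
qed

lemma dist_slice_le:
  assumes "norm \<omega> = 1" "\<delta> \<ge> 0"
  shows "dist (slice a \<omega> \<delta> x) (slice a \<omega> 0 x) \<le> \<delta>"
proof -
  let ?r = "norm (perp a x)"
  have "slice a \<omega> \<delta> x - slice a \<omega> 0 x = (sqrt (?r\<^sup>2 + \<delta>\<^sup>2) - ?r) *\<^sub>R \<omega>"
    by (simp add: slice_def powr_half_sqrt algebra_simps)
  moreover have "sqrt (?r\<^sup>2 + \<delta>\<^sup>2) \<le> ?r + \<delta>" using assms by (intro sqrt_sum_squares_le_sum) auto
  moreover have "?r \<le> sqrt (?r\<^sup>2 + \<delta>\<^sup>2)" by (rule real_le_rsqrt) auto
  ultimately show ?thesis using assms by (simp add: dist_norm)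
qed

text \<open>Slices never bring a point closer to the origin, so all integrands are supported in one
  ball, and \<open>f\<close> is bounded. This supplies the dominating function.\<close>

lemma tendsto_integral_slice:
  fixes f :: "real^'n \<Rightarrow> real"
  assumes \<omega>: "norm \<omega> = 1" "\<omega> $ a = 0" and c: "continuous_on UNIV f"
    and K: "compact K" "\<And>x. x \<notin> K \<Longrightarrow> f x = 0" and d: "d \<longlonglongrightarrow> 0"
  shows "(\<lambda>n. \<integral>x. f (slice a \<omega> (d n) x) \<partial>lborel) \<longlonglongrightarrow> (\<integral>x. f (slice a \<omega> 0 x) \<partial>lborel)"
proof -
  obtain R where R: "\<forall>x\<in>K. norm x \<le> R" using compact_imp_bounded[OF K(1)] by (auto simp: bounded_iff)
  have "bounded (f ` K)" by (intro compact_imp_bounded compact_continuous_image K continuous_on_subset[OF c subset_UNIV])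
  then obtain B0 where B0: "\<forall>x\<in>K. \<bar>f x\<bar> \<le> B0" by (auto simp: bounded_iff)
  have B: "\<bar>f x\<bar> \<le> \<bar>B0\<bar>" for x
    using B0 K(2)[of x] by (cases "x \<in> K") force+
  have m: "(\<lambda>x. f (slice a \<omega> \<delta> x)) \<in> borel_measurable lborel" for \<delta>
  proof -
    have "continuous_on UNIV (\<lambda>x. f (slice a \<omega> \<delta> x))"
      by (rule continuous_on_compose2[OF c continuous_slice_point]) auto
    then show ?thesis by (simp add: borel_measurable_continuous_onI)
  qed
  show ?thesis
  proof (rule integral_dominated_convergence[where w = "\<lambda>x. indicator (cball 0 R) x * \<bar>B0\<bar>"])
    have "integrable lborel (\<lambda>x::real^'n. indicator (cball 0 R) x *\<^sub>R \<bar>B0\<bar>)"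
      by (rule borel_integrable_compact) auto
    then show "integrable lborel (\<lambda>x::real^'n. indicator (cball 0 R) x * \<bar>B0\<bar>)" by simp
    show "AE x in lborel. (\<lambda>n. f (slice a \<omega> (d n) x)) \<longlonglongrightarrow> f (slice a \<omega> 0 x)"
    proof (rule AE_I2)
      fix x
      have "continuous_on UNIV (\<lambda>t. f (slice a \<omega> (fst (t, x)) (snd (t, x))))"
        by (rule continuous_on_compose2[OF c], rule continuous_on_compose2[OF continuous_slice]) (auto intro: continuous_intros)
      then have "isCont (\<lambda>t. f (slice a \<omega> t x)) 0" by (simp add: continuous_on_eq_continuous_at)
      from isCont_tendsto_compose[OF this d] show "(\<lambda>n. f (slice a \<omega> (d n) x)) \<longlonglongrightarrow> f (slice a \<omega> 0 x)" .
    qed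
    show "AE x in lborel. norm (f (slice a \<omega> (d n) x)) \<le> indicator (cball 0 R) x * \<bar>B0\<bar>" for n
    proof (rule AE_I2)
      fix x
      show "norm (f (slice a \<omega> (d n) x)) \<le> indicator (cball 0 R) x * \<bar>B0\<bar>"
      proof (cases "x \<in> cball 0 R")
        case True then show ?thesis using B by simp
      next
        case False
        then have "slice a \<omega> (d n) x \<notin> K" using norm_le_norm_slice[OF \<omega>, of x "d n"] R by force
        then show ?thesis using K(2) by simp
      qed
    qed
  qed (use m in auto)
qed

text \<open>The point is the support. If \<open>slice a \<omega> \<delta> x\<close> lies in
  \<open>K\<close>, then \<open>slice a \<omega> 0 x\<close> is within \<open>\<delta>\<close> of
  \<open>K\<close>, hence in \<open>\<Omega>\<close>, and has the same norm as \<open>x\<close>;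
  radial symmetry puts \<open>x\<close> into \<open>\<Omega>\<close>. The axial coordinate is
  unchanged.\<close>

lemma test_function_slice:
  fixes \<Omega> :: "(real^'n) set"
  assumes \<Omega>: "radially_symmetric \<Omega>" and tf: "test_function {x \<in> \<Omega>. x $ a > 0} \<phi>"
    and \<omega>: "norm \<omega> = 1" "\<omega> $ a = 0" and \<delta>: "\<delta> > 0"
    and K: "compact K" "K \<subseteq> {x \<in> \<Omega>. x $ a > 0}" "\<forall>x. x \<notin> K \<longrightarrow> \<phi> x = 0"
    and near: "\<And>q z. q \<in> K \<Longrightarrow> dist q z \<le> \<delta> \<Longrightarrow> z \<in> \<Omega>"
  shows "test_function {x \<in> \<Omega>. x $ a > 0} (\<lambda>x. \<phi> (slice a \<omega> \<delta> x))"
proof (rule test_functionI)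
  show "C_k m (\<lambda>x. \<phi> (slice a \<omega> \<delta> x))" for m
    by (rule C_k_compose[OF C_k_slice test_function_C_k[OF tf]]) (use \<delta> in simp)
  let ?L = "{x. slice a \<omega> \<delta> x \<in> K}"
  show "\<phi> (slice a \<omega> \<delta> x) = 0" if "x \<notin> ?L" for x using that K(3) by simp
  obtain R where R: "\<forall>x\<in>K. norm x \<le> R" using compact_imp_bounded[OF K(1)] by (auto simp: bounded_iff)
  have "bounded ?L"
    unfolding bounded_iff using R norm_le_norm_slice[OF \<omega>, of _ \<delta>] by (intro exI[of _ R]) (auto intro: order_trans)
  moreover have "closed ?L"
    using closed_vimage[OF compact_imp_closed[OF K(1)] continuous_slice_point[of a \<omega> \<delta>]] by (simp add: vimage_def)
  ultimately show "compact ?L" by (simp add: compact_eq_bounded_closed)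
  show "?L \<subseteq> {x \<in> \<Omega>. x $ a > 0}"
  proof
    fix x assume "x \<in> ?L"
    then have q: "slice a \<omega> \<delta> x \<in> K" by simp
    have "slice a \<omega> 0 x \<in> \<Omega>" by (rule near[OF q]) (rule dist_slice_le[OF \<omega>(1) less_imp_le[OF \<delta>]])
    moreover have "norm x = norm (slice a \<omega> 0 x)"
      using norm_slice[OF \<omega>, of 0 x] by simp
    ultimately have "x \<in> \<Omega>" using \<Omega> unfolding radially_symmetric_def by blast
    moreover have "x $ a > 0" using q K(2) slice_component[OF \<omega>(2), of \<delta> x] by force
    ultimately show "x \<in> {x \<in> \<Omega>. x $ a > 0}" by simp
  qed
qed

theorem axially_symmetric_test_function:
  fixes \<Omega> :: "(real^'n) set"
  assumes N: "CARD('n) \<ge> 2" and \<Omega>: "open \<Omega>" "radially_symmetric \<Omega>" and p: "p > 1"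
    and tf: "test_function {x \<in> \<Omega>. x $ a > 0} \<phi>"
    and less: "(\<integral>x. norm (grad \<phi> x) powr p \<partial>lborel) < \<mu> * (\<integral>x. norm (\<phi> x) powr p \<partial>lborel)"
  obtains \<omega> \<delta> where "norm \<omega> = 1" "\<omega> $ a = 0" "\<delta> > 0"
    "test_function {x \<in> \<Omega>. x $ a > 0} (\<lambda>x. \<phi> (slice a \<omega> \<delta> x))"
    "(\<integral>x. norm (grad (\<lambda>x. \<phi> (slice a \<omega> \<delta> x)) x) powr p \<partial>lborel) < \<mu> * (\<integral>x. norm (\<phi> (slice a \<omega> \<delta> x)) powr p \<partial>lborel)"
proof -
  obtain K where K: "compact K" "K \<subseteq> {x \<in> \<Omega>. x $ a > 0}" "\<forall>x. x \<notin> K \<longrightarrow> \<phi> x = 0"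
    using test_function_support[OF tf] by blast
  have p0: "p > 0" using p by simp
  let ?f1 = "\<lambda>x. norm (grad \<phi> x) powr p" and ?f2 = "\<lambda>x. norm (\<phi> x) powr p"
  have c1: "continuous_on UNIV ?f1" and c2: "continuous_on UNIV ?f2"
    by (rule continuous_on_powr'[OF continuous_on_norm[OF continuous_on_grad[OF tf]] continuous_on_const],
        use p0 in simp)
       (rule continuous_on_powr'[OF continuous_on_norm[OF test_function_continuous[OF tf]] continuous_on_const],
        use p0 in simp)
  have z1: "?f1 x = 0" if "x \<notin> K" for x
    using grad_zero_outside[OF K(1) _ that, of \<phi>] K(3) by simp
  have z2: "?f2 x = 0" if "x \<notin> K" for x using K(3) that by simp
  obtain \<omega> where \<omega>: "norm \<omega> = 1" "\<omega> $ a = 0"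
    and lt: "(\<integral>x. ?f1 (slice a \<omega> 0 x) \<partial>lborel) < \<mu> * (\<integral>x. ?f2 (slice a \<omega> 0 x) \<partial>lborel)"
    by (rule exists_slice[OF N c1 c2 _ _ K(1) z1 z2 less, of a]) (auto intro: that)
  define d where "d n = 1 / (real n + 1)" for n
  have d: "d \<longlonglongrightarrow> 0" unfolding d_def using LIMSEQ_inverse_real_of_nat by (simp add: inverse_eq_divide add.commute)
  have dpos: "d n > 0" for n by (simp add: d_def)
  \<comment> \<open>The strict inequality for the unsmoothed slice survives a small
    \<open>\<delta>\<close>, since both integrals converge. A further smallness condition on
    \<open>\<delta>\<close> keeps the support inside \<open>\<Omega>\<close>.\<close>
  have "(\<lambda>n. \<mu> * (\<integral>x. ?f2 (slice a \<omega> (d n) x) \<partial>lborel) - (\<integral>x. ?f1 (slice a \<omega> (d n) x) \<partial>lborel))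
      \<longlonglongrightarrow> \<mu> * (\<integral>x. ?f2 (slice a \<omega> 0 x) \<partial>lborel) - (\<integral>x. ?f1 (slice a \<omega> 0 x) \<partial>lborel)"
    by (intro tendsto_intros tendsto_integral_slice[OF \<omega> _ K(1) _ d] c1 c2 z1 z2)
  moreover have "\<mu> * (\<integral>x. ?f2 (slice a \<omega> 0 x) \<partial>lborel) - (\<integral>x. ?f1 (slice a \<omega> 0 x) \<partial>lborel) > 0" using lt by simp
  ultimately have ev1: "eventually (\<lambda>n. \<mu> * (\<integral>x. ?f2 (slice a \<omega> (d n) x) \<partial>lborel) - (\<integral>x. ?f1 (slice a \<omega> (d n) x) \<partial>lborel) > 0) sequentially"
    by (rule order_tendstoD(1))
  have K\<Omega>: "K \<subseteq> \<Omega>" using K(2) by auto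
  obtain \<epsilon> where \<epsilon>: "\<epsilon> > 0" "(\<Union>x\<in>K. ball x \<epsilon>) \<subseteq> \<Omega>"
    by (rule compact_subset_open_imp_ball_epsilon_subset[OF K(1) \<Omega>(1) K\<Omega>]) (rule that; assumption)
  have ev2: "eventually (\<lambda>n. d n < \<epsilon>) sequentially" using d \<epsilon>(1) by (rule order_tendstoD(2))
  obtain n where n: "\<mu> * (\<integral>x. ?f2 (slice a \<omega> (d n) x) \<partial>lborel) - (\<integral>x. ?f1 (slice a \<omega> (d n) x) \<partial>lborel) > 0" "d n < \<epsilon>"
    using eventually_happens[OF eventually_conj[OF ev1 ev2]] by auto
  have near: "z \<in> \<Omega>" if "q \<in> K" "dist q z \<le> d n" for q z using that \<epsilon>(2) n(2) by (force simp: subset_iff)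
  let ?\<psi> = "\<lambda>x. \<phi> (slice a \<omega> (d n) x)"
  have tfs: "test_function {x \<in> \<Omega>. x $ a > 0} ?\<psi>"
    by (rule test_function_slice[OF \<Omega>(2) tf \<omega> dpos K]) (rule near; assumption)
  have "(\<integral>x. norm (grad ?\<psi> x) powr p \<partial>lborel) \<le> (\<integral>x. ?f1 (slice a \<omega> (d n) x) \<partial>lborel)"
  proof (rule integral_mono)
    obtain L where L: "compact L" "L \<subseteq> {x \<in> \<Omega>. x $ a > 0}" "\<forall>x. x \<notin> L \<longrightarrow> ?\<psi> x = 0"
      using test_function_support[OF tfs] by blast
    have cg: "continuous_on UNIV (\<lambda>x. norm (grad ?\<psi> x) powr p)"
      using p0 by (auto intro!: continuous_on_powr' continuous_on_norm continuous_on_grad[OF tfs])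
    show "integrable lborel (\<lambda>x. norm (grad ?\<psi> x) powr p)"
      by (rule integrable_continuous_compact_support[OF cg L(1)])
         (use grad_zero_outside[OF L(1), of ?\<psi>] L(3) in auto)
    obtain R where R: "\<forall>x\<in>K. norm x \<le> R" using compact_imp_bounded[OF K(1)] by (auto simp: bounded_iff)
    have cs: "continuous_on UNIV (\<lambda>x. ?f1 (slice a \<omega> (d n) x))"
      by (rule continuous_on_compose2[OF c1 continuous_slice_point]) auto
    show "integrable lborel (\<lambda>x. ?f1 (slice a \<omega> (d n) x))"
    proof (rule integrable_continuous_compact_support[OF cs compact_cball[of 0 R]])
      fix x :: "real^'n" assume "x \<notin> cball 0 R"
      then have "slice a \<omega> (d n) x \<notin> K" using norm_le_norm_slice[OF \<omega>, of x "d n"] R by force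
      then show "?f1 (slice a \<omega> (d n) x) = 0" by (rule z1)
    qed
    fix x :: "real^'n"
    have "norm (grad ?\<psi> x) \<le> norm (grad \<phi> (slice a \<omega> (d n) x))"
      by (rule norm_grad_compose_le[OF test_function_differentiable[OF tf] has_derivative_slice norm_slice_derivative_le[OF \<omega>]])
         (use dpos[of n] in simp)
    then show "norm (grad ?\<psi> x) powr p \<le> ?f1 (slice a \<omega> (d n) x)" using p0 by (intro powr_mono2) auto
  qed
  then have "(\<integral>x. norm (grad ?\<psi> x) powr p \<partial>lborel) < \<mu> * (\<integral>x. norm (?\<psi> x) powr p \<partial>lborel)" using n(1) by simp
  then show ?thesis by (rule that[OF \<omega> dpos tfs])
qed

section \<open>Wedges\<close>

text \<open>In spherical coordinates the last two entries of a point share a nonnegative factor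
  \<open>\<rho>\<close>, so the wedge condition concerns only the plane of \<open>P\<close> and
  \<open>Q\<close>.\<close>

definition sector :: "'n \<Rightarrow> 'n \<Rightarrow> real \<Rightarrow> (real^'n) set" where
  "sector P Q \<alpha> = {x. \<exists>\<rho> t. \<rho> > 0 \<and> 0 < t \<and> t < \<alpha> \<and> x $ P = \<rho> * cos t \<and> x $ Q = \<rho> * sin t}"

text \<open>In polar form the second inequality reads
  \<open>\<rho> * sin (\<alpha> - t) > 0\<close>. Together with \<open>sin t > 0\<close> it traps
  \<open>t\<close> between 0 and \<open>\<alpha>\<close>, as the opening is at most
  \<open>pi\<close>. This form also shows openness.\<close>

lemma sector_eq:
  fixes P Q :: "'n::finite"
  assumes \<alpha>: "0 < \<alpha>" "\<alpha> \<le> pi"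
  shows "sector P Q \<alpha> = {x. x $ Q > 0 \<and> x $ P * sin \<alpha> - x $ Q * cos \<alpha> > 0}"
proof (intro Set.set_eqI iffI)
  fix x :: "real^'n"
  assume "x \<in> sector P Q \<alpha>"
  then obtain \<rho> t where t: "\<rho> > 0" "0 < t" "t < \<alpha>" "x $ P = \<rho> * cos t" "x $ Q = \<rho> * sin t"
    unfolding sector_def by blast
  have "x $ P * sin \<alpha> - x $ Q * cos \<alpha> = \<rho> * sin (\<alpha> - t)" using t by (simp add: sin_diff algebra_simps)
  moreover have "\<rho> * sin (\<alpha> - t) > 0" "\<rho> * sin t > 0" using t \<alpha> by (auto intro!: sin_gt_zero mult_pos_pos)
  ultimately show "x \<in> {x. x $ Q > 0 \<and> x $ P * sin \<alpha> - x $ Q * cos \<alpha> > 0}" using t(5) by simp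
next
  fix x :: "real^'n"
  assume "x \<in> {x. x $ Q > 0 \<and> x $ P * sin \<alpha> - x $ Q * cos \<alpha> > 0}"
  then have x: "x $ Q > 0" "x $ P * sin \<alpha> - x $ Q * cos \<alpha> > 0" by auto
  define \<rho> where "\<rho> = sqrt ((x $ P)\<^sup>2 + (x $ Q)\<^sup>2)"
  have "(x $ P)\<^sup>2 + (x $ Q)\<^sup>2 > 0" using x(1) by (intro add_nonneg_pos) auto
  then have \<rho>: "\<rho> > 0" "\<rho>\<^sup>2 = (x $ P)\<^sup>2 + (x $ Q)\<^sup>2" by (auto simp: \<rho>_def)
  have "(x $ P / \<rho>)\<^sup>2 + (x $ Q / \<rho>)\<^sup>2 = 1"
    unfolding power_divide add_divide_distrib[symmetric] \<rho>(2)[symmetric] using \<rho>(1) by simp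
  then obtain t where t: "0 \<le> t" "t < 2 * pi" "x $ P / \<rho> = cos t" "x $ Q / \<rho> = sin t" by (rule sincos_total_2pi)
  then have PQ: "x $ P = \<rho> * cos t" "x $ Q = \<rho> * sin t" using \<rho> by (auto simp: field_simps)
  have st: "sin t > 0" using x(1) \<rho> t(4) by (metis zero_less_divide_iff)
  then have t0: "0 < t" using t(1) by (cases "t = 0") auto
  have tpi: "t < pi" using st sin_le_zero[of t] t(2) by (meson not_le)
  have "x $ P * sin \<alpha> - x $ Q * cos \<alpha> = \<rho> * sin (\<alpha> - t)" by (simp add: PQ sin_diff algebra_simps)
  then have s: "sin (\<alpha> - t) > 0" using x(2) \<rho> by (simp add: zero_less_mult_iff)
  have "t < \<alpha>"
  proof (rule ccontr)
    assume "\<not> t < \<alpha>"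
    then have "sin (t - \<alpha>) \<ge> 0" using tpi \<alpha> by (intro sin_ge_zero) auto
    moreover have "sin (t - \<alpha>) = - sin (\<alpha> - t)" by (simp add: sin_diff)
    ultimately show False using s by simp
  qed
  then show "x \<in> sector P Q \<alpha>" unfolding sector_def using \<rho> t0 PQ by blast
qed

lemma open_sector: "0 < \<alpha> \<Longrightarrow> \<alpha> \<le> pi \<Longrightarrow> open (sector P Q \<alpha>)"
  unfolding sector_eq by (intro open_Collect_conj open_Collect_less continuous_intros)

lemma wedge_eq:
  fixes e :: "nat \<Rightarrow> 'n::finite"
  assumes N: "CARD('n) \<ge> 2" and k: "k \<ge> 1"
  shows "wedge e \<Omega> k = \<Omega> \<inter> sector (e (CARD('n) - 1)) (e (CARD('n))) (pi / real k)"
    (is "_ = _ \<inter> sector ?P ?Q ?\<alpha>")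
proof (intro Set.set_eqI iffI)
  fix x
  assume x: "x \<in> wedge e \<Omega> k"
  then obtain r \<theta> where nz: "(x $ ?P, x $ ?Q) \<noteq> (0, 0)" and s: "spherical_coords e r \<theta> x"
    and t: "0 < \<theta> (CARD('n) - 1)" "\<theta> (CARD('n) - 1) < ?\<alpha>" and \<Omega>: "x \<in> \<Omega>"
    unfolding wedge_def by blast
  define \<rho> where "\<rho> = r * (\<Prod>i = 1..<CARD('n) - 1. sin (\<theta> i))"
  have "\<rho> \<ge> 0" unfolding \<rho>_def
  proof (intro mult_nonneg_nonneg prod_nonneg)
    show "r \<ge> 0" using s by (simp add: spherical_coords_def)
    fix i assume "i \<in> {1..<CARD('n) - 1}"
    then have "\<theta> i \<in> {0..pi}" using s by (auto simp: spherical_coords_def)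
    then show "sin (\<theta> i) \<ge> 0" by (auto intro: sin_ge_zero)
  qed
  moreover have P: "x $ ?P = \<rho> * cos (\<theta> (CARD('n) - 1))"
    using s N by (auto simp: spherical_coords_def \<rho>_def)
  moreover have Q: "x $ ?Q = \<rho> * sin (\<theta> (CARD('n) - 1))"
  proof -
    have "{1..CARD('n) - 1} = insert (CARD('n) - 1) {1..<CARD('n) - 1}" using N by auto
    then have "(\<Prod>i = 1..CARD('n) - 1. sin (\<theta> i)) = sin (\<theta> (CARD('n) - 1)) * (\<Prod>i = 1..<CARD('n) - 1. sin (\<theta> i))" by simp
    then show ?thesis using s by (simp add: spherical_coords_def \<rho>_def)
  qed
  moreover have "\<rho> \<noteq> 0" using nz P Q by auto
  ultimately have "x \<in> sector ?P ?Q ?\<alpha>" unfolding sector_def mem_Collect_eq using t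
    by (intro exI[of _ \<rho>] exI[of _ "\<theta> (CARD('n) - 1)"]) auto
  then show "x \<in> \<Omega> \<inter> sector ?P ?Q ?\<alpha>" using \<Omega> by simp
next
  fix x
  assume "x \<in> \<Omega> \<inter> sector ?P ?Q ?\<alpha>"
  then obtain \<rho> t where \<Omega>: "x \<in> \<Omega>" and \<rho>: "\<rho> > 0" and t: "0 < t" "t < ?\<alpha>"
    and PQ: "x $ ?P = \<rho> * cos t" "x $ ?Q = \<rho> * sin t"
    unfolding sector_def by blast
  define N where "N = CARD('n)"
  have N2: "N \<ge> 2" using N by (simp add: N_def)
  have "?\<alpha> \<le> pi" using k by (simp add: divide_le_eq)
  then have t2: "t < 2 * pi" using t pi_gt_zero by linarith
  \<comment> \<open>The tails supply the spherical coordinates: with \<open>R j = sqrt (S j)\<close>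
    the angles before the last are \<open>arccos (x $ e j / R j)\<close>, and multiplying by their
    sines passes from \<open>R j\<close> to \<open>R (Suc j)\<close>. The tail at
    \<open>N - 1\<close> is the square of \<open>\<rho>\<close>, so all these radii are
    positive.\<close>
  define S where "S j = (\<Sum>i = j..N. (x $ e i)\<^sup>2)" for j
  have S_step: "S j = (x $ e j)\<^sup>2 + S (Suc j)" if "j \<le> N" for j
    unfolding S_def using that by (rule sum.atLeast_Suc_atMost)
  have S_N: "S (N - 1) = \<rho>\<^sup>2"
  proof -
    have "S (N - 1) = (x $ ?P)\<^sup>2 + (x $ ?Q)\<^sup>2" using S_step[of "N - 1"] S_step[of N] N2 by (simp add: S_def N_def)
    also have "\<dots> = \<rho>\<^sup>2 * ((cos t)\<^sup>2 + (sin t)\<^sup>2)" by (simp only: PQ power_mult_distrib distrib_left)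
    finally show ?thesis by simp
  qed
  have S_pos: "S j > 0" if "j \<le> N - 1" for j
  proof -
    have "S (N - 1) \<le> S j" unfolding S_def using that by (intro sum_mono2) auto
    then show ?thesis using S_N \<rho> by (metis less_le_trans zero_less_power)
  qed
  define R where "R j = sqrt (S j)" for j
  have R_pos: "R j > 0" and R2: "(R j)\<^sup>2 = S j" if "j \<le> N - 1" for j
    using S_pos[OF that] by (auto simp: R_def)
  have R_N: "R (N - 1) = \<rho>" using S_N \<rho> by (simp add: R_def)
  define \<theta> where "\<theta> j = (if j = N - 1 then t else arccos (x $ e j / R j))" for j
  have le1: "-1 \<le> x $ e j / R j \<and> x $ e j / R j \<le> 1" if "j < N - 1" for j
  proof -
    have "S (Suc j) \<ge> 0" unfolding S_def by (intro sum_nonneg) auto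
    then have "(x $ e j)\<^sup>2 \<le> (R j)\<^sup>2" using S_step[of j] R2[of j] that by simp
    then have "\<bar>x $ e j\<bar> \<le> R j" using R_pos[of j] that by (simp add: abs_le_square_iff[symmetric])
    then show ?thesis using R_pos[of j] that by (simp add: divide_le_eq le_divide_eq abs_le_iff)
  qed
  have \<theta>_range: "0 \<le> \<theta> j \<and> \<theta> j \<le> pi" and cos: "cos (\<theta> j) = x $ e j / R j" and sin: "R j * sin (\<theta> j) = R (Suc j)"
    if j: "j < N - 1" for j
  proof -
    have \<theta>: "\<theta> j = arccos (x $ e j / R j)" using j by (simp add: \<theta>_def)
    show "0 \<le> \<theta> j \<and> \<theta> j \<le> pi" unfolding \<theta> using le1[OF j] by (auto intro: arccos_lbound arccos_ubound)
    show "cos (\<theta> j) = x $ e j / R j" unfolding \<theta> using le1[OF j] by (intro cos_arccos) auto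
    have "R j * sin (\<theta> j) = sqrt ((R j)\<^sup>2) * sqrt (1 - (x $ e j / R j)\<^sup>2)"
      unfolding \<theta> using le1[OF j] R_pos[of j] j by (simp add: sin_arccos)
    also have "\<dots> = sqrt ((R j)\<^sup>2 * (1 - (x $ e j / R j)\<^sup>2))" by (simp add: real_sqrt_mult)
    also have "(R j)\<^sup>2 * (1 - (x $ e j / R j)\<^sup>2) = (R j)\<^sup>2 - (x $ e j)\<^sup>2"
      using R_pos[of j] j by (simp add: right_diff_distrib power_divide)
    also have "\<dots> = S (Suc j)" using S_step[of j] R2[of j] j by simp
    finally show "R j * sin (\<theta> j) = R (Suc j)" by (simp add: R_def)
  qed
  have prod: "R 1 * (\<Prod>i = 1..<Suc j. sin (\<theta> i)) = R (Suc j)" if "Suc j \<le> N - 1" for j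
    using that
  proof (induction j)
    case (Suc j)
    then show ?case using sin[of "Suc j"] by (simp add: mult.assoc[symmetric])
  qed simp
  have prod': "R 1 * (\<Prod>i = 1..<j. sin (\<theta> i)) = R j" if "1 \<le> j" "j \<le> N - 1" for j
    using prod[of "j - 1"] that by simp
  have "spherical_coords e (R 1) \<theta> x"
    unfolding spherical_coords_def N_def[symmetric]
  proof (intro conjI ballI)
    show "0 \<le> R 1" using R_pos[of 1] N2 by (intro less_imp_le) simp
    show "\<theta> (N - 1) \<in> {0..<2 * pi}" using t t2 by (simp add: \<theta>_def)
    show "\<theta> j \<in> {0..pi}" if "j \<in> {1..N - 2}" for j using \<theta>_range[of j] that N2 by auto
    show "x $ e j = R 1 * (\<Prod>i = 1..<j. sin (\<theta> i)) * cos (\<theta> j)" if "j \<in> {1..N - 1}" for j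
    proof (cases "j = N - 1")
      case True
      then show ?thesis using prod'[of j] that PQ(1) R_N by (simp add: \<theta>_def N_def)
    next
      case False
      then show ?thesis using prod'[of j] that cos[of j] R_pos[of j] by simp
    qed
    have "{1..N - 1} = insert (N - 1) {1..<N - 1}" using N2 by auto
    then have "R 1 * (\<Prod>i = 1..N - 1. sin (\<theta> i)) = (R 1 * (\<Prod>i = 1..<N - 1. sin (\<theta> i))) * sin (\<theta> (N - 1))"
      by (simp add: mult_ac)
    also have "\<dots> = \<rho> * sin t" using prod'[of "N - 1"] N2 R_N by (simp add: \<theta>_def)
    finally show "x $ e N = R 1 * (\<Prod>i = 1..N - 1. sin (\<theta> i))" using PQ(2) by (simp add: N_def)
  qed
  moreover have "0 < \<theta> (CARD('n) - 1)" "\<theta> (CARD('n) - 1) < ?\<alpha>" using t by (simp_all add: \<theta>_def N_def)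
  moreover have "(x $ ?P, x $ ?Q) \<noteq> (0, 0)" using \<rho> PQ sin_cos_squared_add[of t] by (cases "cos t = 0") auto
  ultimately show "x \<in> wedge e \<Omega> k" unfolding wedge_def using \<Omega> by blast
qed

section \<open>Rotated and reflected test functions\<close>

lemma integral_test_function_lborel:
  assumes U: "open U" and tf: "test_function V \<phi>" "V \<subseteq> U" and p: "p > 0"
  shows "(\<integral>x. norm (\<phi> x) powr p \<partial>lebesgue_on U) = (\<integral>x. norm (\<phi> x) powr p \<partial>lborel)"
    and "(\<integral>x. norm (grad \<phi> x) powr p \<partial>lebesgue_on U) = (\<integral>x. norm (grad \<phi> x) powr p \<partial>lborel)"
    and "integrable lborel (\<lambda>x. norm (\<phi> x) powr p)"
    and "integrable lborel (\<lambda>x. norm (grad \<phi> x) powr p)"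
proof -
  obtain K where K: "compact K" "K \<subseteq> V" "\<forall>x. x \<notin> K \<longrightarrow> \<phi> x = 0"
    using test_function_support[OF tf(1)] by blast
  have c1: "continuous_on UNIV (\<lambda>x. norm (grad \<phi> x) powr p)" and c2: "continuous_on UNIV (\<lambda>x. norm (\<phi> x) powr p)"
    by (rule continuous_on_powr'[OF continuous_on_norm[OF continuous_on_grad[OF tf(1)]] continuous_on_const],
        use p in simp)
       (rule continuous_on_powr'[OF continuous_on_norm[OF test_function_continuous[OF tf(1)]] continuous_on_const],
        use p in simp)
  have z1: "norm (grad \<phi> x) powr p = 0" if "x \<notin> K" for x
    using grad_zero_outside[OF K(1) _ that, of \<phi>] K(3) by simp
  have z2: "norm (\<phi> x) powr p = 0" if "x \<notin> K" for x using K(3) that by simp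
  have sU: "U \<in> sets lebesgue" using U by simp
  have KU: "x \<notin> K" if "x \<notin> U" for x using that K(2) tf(2) by blast
  show "(\<integral>x. norm (\<phi> x) powr p \<partial>lebesgue_on U) = (\<integral>x. norm (\<phi> x) powr p \<partial>lborel)"
    by (rule lebesgue_on_eq_lborel(1)[OF sU borel_measurable_continuous_onI[OF c2] z2[OF KU]])
  show "(\<integral>x. norm (grad \<phi> x) powr p \<partial>lebesgue_on U) = (\<integral>x. norm (grad \<phi> x) powr p \<partial>lborel)"
    by (rule lebesgue_on_eq_lborel(1)[OF sU borel_measurable_continuous_onI[OF c1] z1[OF KU]])
  show "integrable lborel (\<lambda>x. norm (\<phi> x) powr p)" by (rule integrable_continuous_compact_support[OF c2 K(1) z2])
  show "integrable lborel (\<lambda>x. norm (grad \<phi> x) powr p)" by (rule integrable_continuous_compact_support[OF c1 K(1) z1])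
qed

lemma normalize_test_function:
  assumes tf: "test_function V \<phi>" and p: "p > 0"
    and less: "(\<integral>x. norm (grad \<phi> x) powr p \<partial>lborel) < \<mu> * (\<integral>x. norm (\<phi> x) powr p \<partial>lborel)"
  obtains c where "(\<integral>x. norm (c * \<phi> x) powr p \<partial>lborel) = 1"
    "(\<integral>x. norm (grad (\<lambda>x. c * \<phi> x) x) powr p \<partial>lborel) < \<mu>"
proof -
  define I where "I = (\<integral>x. norm (\<phi> x) powr p \<partial>lborel)"
  have nonneg: "I \<ge> 0" "(\<integral>x. norm (grad \<phi> x) powr p \<partial>lborel) \<ge> 0"
    unfolding I_def by (auto intro!: integral_nonneg_AE)
  have "I \<noteq> 0"
  proof
    assume "I = 0"
    with less[folded I_def] have "(\<integral>x. norm (grad \<phi> x) powr p \<partial>lborel) < 0" by (simp only: mult_zero_right)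
    with nonneg(2) show False by linarith
  qed
  with nonneg(1) have I: "I > 0" by simp
  define c where "c = I powr (- (1 / p))"
  have "c powr p = I powr - 1" unfolding c_def powr_powr using p by simp
  then have cp: "\<bar>c\<bar> powr p = 1 / I" using I by (simp add: c_def powr_minus_divide)
  have "(\<integral>x. norm (c * \<phi> x) powr p \<partial>lborel) = \<bar>c\<bar> powr p * I"
    unfolding I_def by (simp add: abs_mult powr_mult)
  then have 1: "(\<integral>x. norm (c * \<phi> x) powr p \<partial>lborel) = 1" using cp I by simp
  have "(\<integral>x. norm (grad (\<lambda>x. c * \<phi> x) x) powr p \<partial>lborel) = \<bar>c\<bar> powr p * (\<integral>x. norm (grad \<phi> x) powr p \<partial>lborel)"
    by (simp add: grad_scale[OF test_function_differentiable[OF tf]] powr_mult)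
  also have "\<dots> < \<bar>c\<bar> powr p * (\<mu> * I)" using less[folded I_def] I unfolding cp by (intro mult_strict_left_mono) auto
  also have "\<dots> = \<mu>" using cp I by simp
  finally show ?thesis by (rule that[OF 1])
qed

lemma test_function_orthogonal:
  fixes R :: "real^'n \<Rightarrow> real^'n"
  assumes R: "orthogonal_transformation R" and tf: "test_function W \<phi>"
  shows "test_function {x. R x \<in> W} (\<lambda>x. \<phi> (R x))"
proof -
  obtain K where K: "compact K" "K \<subseteq> W" "\<forall>x. x \<notin> K \<longrightarrow> \<phi> x = 0"
    using test_function_support[OF tf] by blast
  have lin: "linear R" and nR: "norm (R x) = norm x" for x
    using R by (auto simp: orthogonal_transformation_linear orthogonal_transformation_norm)
  show ?thesis
  proof (rule test_functionI)
    \<comment> \<open>Each component of \<open>R\<close> is the inner product with a fixed vector,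
      hence smooth.\<close>
    have "R x $ l = x \<bullet> adjoint R (axis l 1)" for x l
      using adjoint_works[OF lin, of x "axis l 1"] by (simp add: inner_axis)
    then show "C_k m (\<lambda>x. \<phi> (R x))" for m
      by (intro C_k_compose[OF _ test_function_C_k[OF tf]]) (simp add: C_k_inner)
    show "\<phi> (R x) = 0" if "x \<notin> {x. R x \<in> K}" for x using that K(3) by simp
    have "bounded {x. R x \<in> K}"
      using compact_imp_bounded[OF K(1)] by (auto simp: bounded_iff) (metis nR)
    moreover have "closed {x. R x \<in> K}"
      using closed_vimage[OF compact_imp_closed[OF K(1)] linear_continuous_on[of R UNIV]] lin
      by (simp add: vimage_def linear_linear)
    ultimately show "compact {x. R x \<in> K}" by (simp add: compact_eq_bounded_closed)
    show "{x. R x \<in> K} \<subseteq> {x. R x \<in> W}" using K(2) by blast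
  qed
qed

text \<open>Invariance of the measure handles the values. For the gradient an upper bound is all
  that the eigenvalue estimates ask for, and it follows from
  \<open>norm_grad_compose_le\<close>.\<close>

lemma integral_test_function_orthogonal:
  fixes R :: "real^'n \<Rightarrow> real^'n"
  assumes R: "orthogonal_transformation R" and tf: "test_function W \<phi>" and p: "p > 0"
  shows "(\<integral>x. norm (\<phi> (R x)) powr p \<partial>lborel) = (\<integral>x. norm (\<phi> x) powr p \<partial>lborel)"
    and "(\<integral>x. norm (grad (\<lambda>x. \<phi> (R x)) x) powr p \<partial>lborel) \<le> (\<integral>x. norm (grad \<phi> x) powr p \<partial>lborel)"
proof -
  have lin: "linear R" and nR: "norm (R x) = norm x" for x
    using R by (auto simp: orthogonal_transformation_linear orthogonal_transformation_norm)
  have c1: "continuous_on UNIV (\<lambda>x. norm (grad \<phi> x) powr p)" and c2: "continuous_on UNIV (\<lambda>x. norm (\<phi> x) powr p)"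
    by (rule continuous_on_powr'[OF continuous_on_norm[OF continuous_on_grad[OF tf(1)]] continuous_on_const],
        use p in simp)
       (rule continuous_on_powr'[OF continuous_on_norm[OF test_function_continuous[OF tf(1)]] continuous_on_const],
        use p in simp)
  show "(\<integral>x. norm (\<phi> (R x)) powr p \<partial>lborel) = (\<integral>x. norm (\<phi> x) powr p \<partial>lborel)"
    by (rule integral_orthogonal_transformation[OF R borel_measurable_continuous_onI[OF c2]])
  have eq: "(\<integral>x. norm (grad \<phi> (R x)) powr p \<partial>lborel) = (\<integral>x. norm (grad \<phi> x) powr p \<partial>lborel)"
    by (rule integral_orthogonal_transformation[OF R borel_measurable_continuous_onI[OF c1]])
  have cR: "continuous_on UNIV R" using lin by (simp add: linear_continuous_on linear_linear)
  obtain K where K: "compact K" "K \<subseteq> W" "\<forall>x. x \<notin> K \<longrightarrow> \<phi> x = 0"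
    using test_function_support[OF tf] by blast
  obtain B where B: "\<forall>x\<in>K. norm x \<le> B" using compact_imp_bounded[OF K(1)] by (auto simp: bounded_iff)
  have int: "integrable lborel (\<lambda>x. norm (grad \<phi> (R x)) powr p)"
  proof (rule integrable_continuous_compact_support[OF _ compact_cball[of 0 B]])
    show "continuous_on UNIV (\<lambda>x. norm (grad \<phi> (R x)) powr p)" by (rule continuous_on_compose2[OF c1 cR]) auto
    fix x :: "real^'n" assume "x \<notin> cball 0 B"
    then have "R x \<notin> K" using B nR[of x] by force
    then show "norm (grad \<phi> (R x)) powr p = 0" using grad_zero_outside[OF K(1), of \<phi> "R x"] K(3) by simp
  qed
  have "(\<integral>x. norm (grad (\<lambda>x. \<phi> (R x)) x) powr p \<partial>lborel) \<le> (\<integral>x. norm (grad \<phi> (R x)) powr p \<partial>lborel)"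
  proof (rule integral_mono[OF integral_test_function_lborel(4)[OF open_UNIV test_function_orthogonal[OF R tf] subset_UNIV p] int])
    fix x
    have "norm (grad (\<lambda>x. \<phi> (R x)) x) \<le> norm (grad \<phi> (R x))"
      by (rule norm_grad_compose_le[OF test_function_differentiable[OF tf] linear_imp_has_derivative[OF lin]]) (simp add: nR)
    then show "norm (grad (\<lambda>x. \<phi> (R x)) x) powr p \<le> norm (grad \<phi> (R x)) powr p" using p by (intro powr_mono2) auto
  qed
  then show "(\<integral>x. norm (grad (\<lambda>x. \<phi> (R x)) x) powr p \<partial>lborel) \<le> (\<integral>x. norm (grad \<phi> x) powr p \<partial>lborel)"
    by (simp only: eq)
qed

lemma lp_coord_cyc:
  assumes "m \<ge> 1" "j \<le> m"
  shows "lp_coord p m (cyc m c) j = cyc m (lp_coord p m c) j"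
proof -
  obtain l where m: "m = Suc l" using assms(1) by (cases m) auto
  have "(\<Sum>i\<le>m. \<bar>cyc m c i\<bar> powr p) = \<bar>c m\<bar> powr p + (\<Sum>i\<le>l. \<bar>c i\<bar> powr p)"
    unfolding m sum.atMost_Suc_shift by (simp add: cyc_def)
  also have "\<dots> = (\<Sum>i\<le>m. \<bar>c i\<bar> powr p)" by (simp add: m)
  finally have "(\<Sum>i\<le>m. \<bar>cyc m c i\<bar> powr p) = (\<Sum>i\<le>m. \<bar>c i\<bar> powr p)" .
  then show ?thesis using assms by (auto simp: lp_coord_def cyc_def[of m c] cyc_def[of m "\<lambda>j. c j / _"] lp_coord_def[abs_def])
qed

text \<open>Reindexing: a shift of the coefficients amounts to moving every function to the next
  index. This identifies members of a family that belong to different parameters.\<close>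

lemma sum_lp_coord_cyc:
  assumes "m \<ge> 1"
  shows "(\<Sum>j\<le>m. lp_coord p m (cyc m c) j * f j) = (\<Sum>j\<le>m. lp_coord p m c j * f (if j = m then 0 else Suc j))"
proof -
  obtain l where m: "m = Suc l" using assms by (cases m) auto
  have "(\<Sum>j\<le>m. lp_coord p m (cyc m c) j * f j) = (\<Sum>j\<le>m. cyc m (lp_coord p m c) j * f j)"
    by (intro sum.cong refl) (simp add: lp_coord_cyc[OF assms])
  also have "\<dots> = lp_coord p m c m * f 0 + (\<Sum>j\<le>l. lp_coord p m c j * f (Suc j))"
    unfolding m sum.atMost_Suc_shift by (simp add: cyc_def)
  also have "\<dots> = (\<Sum>j\<le>m. lp_coord p m c j * f (if j = m then 0 else Suc j))"
    unfolding m by (simp add: add.commute)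
  finally show ?thesis .
qed

lemma genus_family_Suc: "genus_family p U (Suc k) \<subseteq> genus_family p U k"
proof
  fix A assume A: "A \<in> genus_family p U (Suc k)"
  have "enat k \<le> enat (Suc k)" by simp
  also have "\<dots> \<le> genus p U A" using A by (simp add: genus_family_def)
  finally show "A \<in> genus_family p U k" using A by (simp add: genus_family_def)
qed

lemma variational_eigenvalue_mono: "variational_eigenvalue p U k \<le> variational_eigenvalue p U (Suc k)"
  unfolding variational_eigenvalue_def by (rule INF_superset_mono[OF genus_family_Suc order_refl])

text \<open>The infimum is approached through all \<open>\<mu>\<close> strictly above some energy,
  which is exactly what \<open>Lp_sphere_approximation\<close> can handle.\<close>

lemma le_first_eigenvalue:
  assumes "\<And>C \<mu>. C \<in> Lp_sphere p V \<Longrightarrow> energy p V C < \<mu> \<Longrightarrow> z \<le> ereal \<mu>"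
  shows "z \<le> first_eigenvalue p V"
  unfolding first_eigenvalue_def
proof (rule INF_greatest)
  fix C assume C: "C \<in> Lp_sphere p V"
  show "z \<le> ereal (energy p V C)"
  proof (rule ereal_le_epsilon)
    fix \<epsilon> :: ereal assume "0 < \<epsilon>"
    then show "z \<le> ereal (energy p V C) + \<epsilon>"
    proof (cases \<epsilon>)
      case (real r)
      then have "energy p V C < energy p V C + r" using \<open>0 < \<epsilon>\<close> by simp
      from assms[OF C this] show ?thesis using real by simp
    qed auto
  qed
qed

lemma continuous_on_compose_family:
  fixes Q :: "'b::topological_space \<Rightarrow> real^'n \<Rightarrow> real^'m"
  assumes tf: "test_function W \<phi>" and Q: "continuous_on (\<Theta> \<times> UNIV) (\<lambda>(\<theta>,x). Q \<theta> x)"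
  shows "continuous_on (\<Theta> \<times> UNIV) (\<lambda>(\<theta>,x). \<phi> (Q \<theta> x))"
  using continuous_on_compose2[OF test_function_continuous[OF tf, of UNIV] Q] by (simp add: case_prod_unfold)

lemma continuous_on_grad_compose_family:
  fixes Q :: "'b::topological_space \<Rightarrow> real^'n \<Rightarrow> real^'m"
  assumes tf: "test_function W \<phi>" and Q: "continuous_on (\<Theta> \<times> UNIV) (\<lambda>(\<theta>,x). Q \<theta> x)"
    and D: "\<And>\<theta> x. \<theta> \<in> \<Theta> \<Longrightarrow> (Q \<theta> has_derivative D \<theta> x) (at x)"
    and cD: "\<And>i l. continuous_on (\<Theta> \<times> UNIV) (\<lambda>(\<theta>,x). D \<theta> x (axis i 1) $ l)"
  shows "continuous_on (\<Theta> \<times> UNIV) (\<lambda>(\<theta>,x). grad (\<lambda>x. \<phi> (Q \<theta> x)) x)"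
proof -
  have "continuous_on (\<Theta> \<times> UNIV) (\<lambda>s. \<chi> i. \<Sum>l\<in>UNIV. partial_deriv l \<phi> (Q (fst s) (snd s)) * D (fst s) (snd s) (axis i 1) $ l)"
  proof (intro continuous_on_vec_lambda continuous_on_sum continuous_on_mult)
    show "continuous_on (\<Theta> \<times> UNIV) (\<lambda>s. D (fst s) (snd s) (axis i 1) $ l)" for i l
      using cD[of i l] by (simp add: case_prod_unfold)
    show "continuous_on (\<Theta> \<times> UNIV) (\<lambda>s. partial_deriv l \<phi> (Q (fst s) (snd s)))" for l
      using continuous_on_compose2[OF test_function_continuous_partial[OF tf, of UNIV l] Q]
      by (simp add: case_prod_unfold)
  qed
  moreover have "grad (\<lambda>x. \<phi> (Q \<theta> x)) x = (\<chi> i. \<Sum>l\<in>UNIV. partial_deriv l \<phi> (Q \<theta> x) * D \<theta> x (axis i 1) $ l)"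
    if "\<theta> \<in> \<Theta>" for \<theta> x
    unfolding grad_def
    using partial_deriv_compose(2)[where Q = "Q \<theta>", OF test_function_differentiable[OF tf] D[OF that]] by simp
  ultimately show ?thesis
    by (subst continuous_on_cong[OF refl]) (auto simp: case_prod_unfold)
qed

text \<open>Turns the plane of \<open>P\<close> and \<open>Q\<close> by the angle
  \<open>- t\<close>, so that composing a function with \<open>rot P Q t\<close> turns its support
  by \<open>t\<close>.\<close>

definition rot :: "'n \<Rightarrow> 'n \<Rightarrow> real \<Rightarrow> real^'n \<Rightarrow> real^'n" where
  "rot P Q t x = (\<chi> i. if i = P then cos t * x $ P + sin t * x $ Q
     else if i = Q then cos t * x $ Q - sin t * x $ P else x $ i)"

lemma sum_UNIV_split_two:
  fixes P Q :: "'n::finite"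
  assumes "P \<noteq> Q"
  shows "sum f UNIV = f P + (f Q + sum f (UNIV - {P, Q}))"
proof -
  have "(UNIV :: 'n set) = insert P (insert Q (UNIV - {P, Q}))" by auto
  then have "sum f UNIV = sum f (insert P (insert Q (UNIV - {P, Q})))" by (rule arg_cong)
  also have "\<dots> = f P + (f Q + sum f (UNIV - {P, Q}))" using assms by simp
  finally show ?thesis .
qed

lemma orthogonal_transformation_rot:
  fixes P Q :: "'n::finite"
  assumes PQ: "P \<noteq> Q"
  shows "orthogonal_transformation (rot P Q t)"
  unfolding orthogonal_transformation
proof (intro conjI allI)
  show "linear (rot P Q t)"
    by (rule linearI) (auto simp: rot_def vec_eq_iff algebra_simps)
  fix x
  have "(c * a + s * b)\<^sup>2 + (c * b - s * a)\<^sup>2 = (c\<^sup>2 + s\<^sup>2) * (a\<^sup>2 + b\<^sup>2)" for a b c s :: real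
    by (simp add: power2_eq_square algebra_simps)
  from this[of "cos t" "x $ P" "sin t" "x $ Q"]
  have "(cos t * x $ P + sin t * x $ Q)\<^sup>2 + (cos t * x $ Q - sin t * x $ P)\<^sup>2 = (x $ P)\<^sup>2 + (x $ Q)\<^sup>2"
    by simp
  then have "(\<Sum>i\<in>UNIV. (rot P Q t x $ i)\<^sup>2) = (\<Sum>i\<in>UNIV. (x $ i)\<^sup>2)"
    unfolding sum_UNIV_split_two[OF PQ] using PQ by (simp add: rot_def)
  then show "norm (rot P Q t x) = norm x" by (simp add: norm_vec_def L2_set_def)
qed

lemma rot_2pi: "rot P Q (2 * pi) = rot P Q 0"
  by (simp add: rot_def fun_eq_iff)

lemma continuous_on_rot:
  fixes g :: "'b::t2_space \<Rightarrow> real" and f :: "'b \<Rightarrow> real^'n"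
  assumes "continuous_on S g" "continuous_on S f"
  shows "continuous_on S (\<lambda>s. rot P Q (g s) (f s))"
  unfolding rot_def
proof (rule continuous_on_vec_lambda)
  fix i
  show "continuous_on S (\<lambda>s. if i = P then cos (g s) * f s $ P + sin (g s) * f s $ Q
     else if i = Q then cos (g s) * f s $ Q - sin (g s) * f s $ P else f s $ i)"
    by (cases "i = P"; cases "i = Q"; simp; intro continuous_intros assms)
qed

text \<open>A further turn by \<open>d\<close> moves the polar angle \<open>t\<close> to
  \<open>t - d\<close>, which modulo \<open>2 * pi\<close> lies outside the sector. The signs of the
  two half-plane functions express this without reducing angles.\<close>

lemma rotated_sectors_disjoint:
  fixes P Q :: "'n::finite"
  assumes PQ: "P \<noteq> Q" and \<alpha>: "0 < \<alpha>" "\<alpha> \<le> pi" and d: "\<alpha> \<le> d" "d \<le> 2 * pi - \<alpha>"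
    and s: "rot P Q s x \<in> sector P Q \<alpha>"
  shows "rot P Q (s + d) x \<notin> sector P Q \<alpha>"
proof
  assume z: "rot P Q (s + d) x \<in> sector P Q \<alpha>"
  from s obtain \<rho> t where t: "\<rho> > 0" "0 < t" "t < \<alpha>" "rot P Q s x $ P = \<rho> * cos t" "rot P Q s x $ Q = \<rho> * sin t"
    unfolding sector_def by blast
  have "rot P Q (s + d) x $ P = cos d * rot P Q s x $ P + sin d * rot P Q s x $ Q"
    using PQ by (simp add: rot_def cos_add sin_add algebra_simps)
  then have zP: "rot P Q (s + d) x $ P = \<rho> * cos (d - t)"
    unfolding t by (simp add: cos_diff algebra_simps)
  have "rot P Q (s + d) x $ Q = cos d * rot P Q s x $ Q - sin d * rot P Q s x $ P"
    using PQ by (simp add: rot_def cos_add sin_add algebra_simps)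
  then have zQ: "rot P Q (s + d) x $ Q = - (\<rho> * sin (d - t))"
    unfolding t by (simp add: sin_diff algebra_simps)
  have "rot P Q (s + d) x $ Q > 0" and "rot P Q (s + d) x $ P * sin \<alpha> - rot P Q (s + d) x $ Q * cos \<alpha> > 0"
    using z unfolding sector_eq[OF \<alpha>] by auto
  moreover have "\<rho> * cos (d - t) * sin \<alpha> - - (\<rho> * sin (d - t)) * cos \<alpha> = \<rho> * sin (d - t + \<alpha>)"
    unfolding sin_add by (simp add: algebra_simps)
  ultimately have sn: "sin (d - t) < 0" "sin (d - t + \<alpha>) > 0"
    unfolding zP zQ using t(1) by (auto simp: mult_less_0_iff zero_less_mult_iff)
  \<comment> \<open>The negative sine places \<open>d - t\<close> beyond \<open>pi\<close>. Then
    \<open>d - t + \<alpha>\<close> lies between \<open>pi\<close> and \<open>2 * pi\<close>,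
    against the other half-plane condition.\<close>
  have "d - t > pi"
  proof (rule ccontr)
    assume "\<not> d - t > pi"
    then have "sin (d - t) \<ge> 0" using t d by (intro sin_ge_zero) auto
    then show False using sn by simp
  qed
  then have "sin (d - t + \<alpha>) < 0" using t d \<alpha> by (intro sin_lt_zero) auto
  then show False using sn by simp
qed

theorem variational_eigenvalue_le_rotations:
  fixes \<Omega> :: "(real^'n) set"
  assumes \<Omega>: "open \<Omega>" "bounded \<Omega>" "radially_symmetric \<Omega>" and p: "p > 1" and PQ: "P \<noteq> Q" and k: "k \<ge> 1"
    and tf: "test_function (\<Omega> \<inter> sector P Q (pi / real k)) \<phi>"
    and unit: "(\<integral>x. norm (\<phi> x) powr p \<partial>lborel) = 1"
    and en: "(\<integral>x. norm (grad \<phi> x) powr p \<partial>lborel) \<le> \<mu>"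
  shows "variational_eigenvalue p \<Omega> (2 * k + 1) \<le> ereal \<mu>"
proof -
  interpret sobolev_domain \<Omega> p by unfold_locales (use \<Omega> p in auto)
  define \<alpha> where "\<alpha> = pi / real k"
  have \<alpha>: "0 < \<alpha>" "\<alpha> \<le> pi" and k\<alpha>: "real k * \<alpha> = pi" using k by (auto simp: \<alpha>_def divide_le_eq)
  \<comment> \<open>The \<open>2 * k\<close> coefficients form a sphere of dimension
    \<open>2 * k - 1\<close>, which is odd as the shift argument requires. The parameter
    \<open>\<theta>\<close> raises the genus bound by one, to \<open>m + 2\<close>.\<close>
  define m where "m = 2 * k - 1"
  have m: "odd m" "m \<ge> 1" "2 * k + 1 = m + 2" using k by (auto simp: m_def)
  have m\<alpha>: "real (Suc m) * \<alpha> = 2 * pi"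
  proof -
    have "Suc m = 2 * k" using k by (simp add: m_def)
    then show ?thesis using k\<alpha> by simp
  qed
  let ?S = "\<Omega> \<inter> sector P Q \<alpha>"
  define w where "w j \<theta> x = \<phi> (rot P Q (\<theta> + real j * \<alpha>) x)" for j \<theta> x
  define V where "V j \<theta> = {x. rot P Q (\<theta> + real j * \<alpha>) x \<in> ?S}" for j \<theta>
  note ot = orthogonal_transformation_rot[OF PQ]
  have nR: "norm (rot P Q t x) = norm x" for t x by (rule orthogonal_transformation_norm[OF ot])
  have lin: "linear (rot P Q t)" for t using ot by (rule orthogonal_transformation_linear)
  have tf\<alpha>: "test_function ?S \<phi>" using tf by (simp add: \<alpha>_def)
  have tw: "test_function (V j \<theta>) (w j \<theta>)" for j \<theta>
    unfolding V_def w_def by (rule test_function_orthogonal[OF ot tf\<alpha>])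
  have VU: "V j \<theta> \<subseteq> \<Omega>" for j \<theta>
    unfolding V_def using \<Omega>(3) nR unfolding radially_symmetric_def by (auto; metis)
  have "variational_eigenvalue p \<Omega> (m + 2) \<le> ereal \<mu>"
  proof (rule variational_eigenvalue_le_disjoint[of "{0..\<alpha>}" m V w])
    show "compact {0..\<alpha>}" "{0..\<alpha>} \<noteq> {}" using \<alpha> by auto
    show "test_function (V j \<theta>) (w j \<theta>)" for j \<theta> by (rule tw)
    show "V j \<theta> \<subseteq> \<Omega>" for j \<theta> by (rule VU)
    have disj: "V i \<theta> \<inter> V j \<theta> = {}" if "i < j" "j \<le> m" for i j \<theta>
    proof -
      define d where "d = (real j - real i) * \<alpha>"
      have "1 * \<alpha> \<le> d" unfolding d_def using that \<alpha> by (intro mult_right_mono) auto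
      moreover have "d \<le> real m * \<alpha>" unfolding d_def using that \<alpha> by (intro mult_right_mono) auto
      moreover have "real m * \<alpha> = 2 * pi - \<alpha>" using m\<alpha> by (simp add: algebra_simps)
      ultimately have d: "\<alpha> \<le> d" "d \<le> 2 * pi - \<alpha>" by auto
      have s: "\<theta> + real j * \<alpha> = (\<theta> + real i * \<alpha>) + d" by (simp add: d_def algebra_simps)
      show ?thesis unfolding V_def s using rotated_sectors_disjoint[OF PQ \<alpha> d] by blast
    qed
    show "V i \<theta> \<inter> V j \<theta> = {}" if "i \<le> m" "j \<le> m" "i \<noteq> j" for i j \<theta>
      using disj[of i j \<theta>] disj[of j i \<theta>] that by (cases "i < j") (auto simp: Int_commute)
    have cr: "continuous_on ({0..\<alpha>} \<times> UNIV) (\<lambda>(\<theta>, x). rot P Q (\<theta> + real j * \<alpha>) x)" for j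
      unfolding case_prod_unfold by (intro continuous_on_rot continuous_intros)
    show "continuous_on ({0..\<alpha>} \<times> UNIV) (\<lambda>(\<theta>, x). w j \<theta> x)" for j
      unfolding w_def by (rule continuous_on_compose_family[OF tf\<alpha> cr])
    show "continuous_on ({0..\<alpha>} \<times> UNIV) (\<lambda>(\<theta>, x). grad (w j \<theta>) x)" for j
      unfolding w_def
    proof (rule continuous_on_grad_compose_family[OF tf\<alpha> cr])
      show "(rot P Q (\<theta> + real j * \<alpha>) has_derivative rot P Q (\<theta> + real j * \<alpha>)) (at x)" for \<theta> x
        by (rule linear_imp_has_derivative[OF lin])
      show "continuous_on ({0..\<alpha>} \<times> UNIV) (\<lambda>(\<theta>, x::real^'n). rot P Q (\<theta> + real j * \<alpha>) (axis i 1) $ l)" for i l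
        unfolding case_prod_unfold by (intro bounded_linear.continuous_on[OF bounded_linear_vec_nth] continuous_on_rot continuous_intros)
    qed
    show "(\<integral>x. norm (w j \<theta> x) powr p \<partial>M) = 1" for j \<theta>
      using integral_test_function_lborel(1)[OF \<Omega>(1) tw VU p_pos, of j \<theta>]
        integral_test_function_orthogonal(1)[OF ot tf\<alpha> p_pos] unit unfolding w_def by simp
    show "(\<integral>x. norm (grad (w j \<theta>) x) powr p \<partial>M) \<le> \<mu>" for j \<theta>
      using integral_test_function_lborel(2)[OF \<Omega>(1) tw VU p_pos, of j \<theta>]
        integral_test_function_orthogonal(2)[OF ot tf\<alpha> p_pos, of "\<theta> + real j * \<alpha>"] en unfolding w_def by simp
    fix F :: "(nat \<Rightarrow> real) \<times> real \<Rightarrow> nat \<Rightarrow> real"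
    assume cont: "continuous_on (sph m \<times> {0..\<alpha>}) F"
      and im: "\<And>c \<theta>. c \<in> sph m \<Longrightarrow> \<theta> \<in> {0..\<alpha>} \<Longrightarrow> F (c, \<theta>) \<in> sph m"
      and resp: "\<And>c \<theta> c' \<theta>'. c \<in> sph m \<Longrightarrow> \<theta> \<in> {0..\<alpha>} \<Longrightarrow> c' \<in> sph m \<Longrightarrow> \<theta>' \<in> {0..\<alpha>} \<Longrightarrow>
        (\<lambda>x. \<Sum>j\<le>m. lp_coord p m (fst (c, \<theta>)) j * w j (snd (c, \<theta>)) x) =
        (\<lambda>x. \<Sum>j\<le>m. lp_coord p m (fst (c', \<theta>')) j * w j (snd (c', \<theta>')) x) \<Longrightarrow> F (c, \<theta>) = F (c', \<theta>')"
      and odd: "\<And>c \<theta>. c \<in> sph m \<Longrightarrow> \<theta> \<in> {0..\<alpha>} \<Longrightarrow> F (\<lambda>i. - c i, \<theta>) = (\<lambda>i. - F (c, \<theta>) i)"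
    show False
    proof (rule no_odd_map_with_cyclic_shift[of m \<alpha> "\<lambda>c \<theta>. F (c, \<theta>)"])
      show "odd m" by (rule m)
      show "\<alpha> \<ge> 0" using \<alpha> by simp
      show "continuous_on (sph m \<times> {0..\<alpha>}) (\<lambda>(c, \<theta>). F (c, \<theta>))" using cont by (simp add: case_prod_unfold)
      show "F (c, \<theta>) \<in> sph m" if "c \<in> sph m" "\<theta> \<in> {0..\<alpha>}" for c \<theta> by (rule im[OF that])
      show "F (\<lambda>i. - c i, \<theta>) = (\<lambda>i. - F (c, \<theta>) i)" if "c \<in> sph m" "\<theta> \<in> {0..\<alpha>}" for c \<theta> by (rule odd[OF that])
      fix c assume c: "c \<in> sph m"
      show "F (c, \<alpha>) = F (cyc m c, 0)"
      proof (rule resp[OF c _ cyc_in_sph[OF c]])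
        show "\<alpha> \<in> {0..\<alpha>}" "0 \<in> {0..\<alpha>}" using \<alpha> by auto
        \<comment> \<open>At \<open>\<theta> = \<alpha>\<close> copy \<open>j\<close> sits where
          copy \<open>j + 1\<close> is at \<open>\<theta> = 0\<close>; the last copy completes a
          full turn and becomes copy 0.\<close>
        have "w j \<alpha> x = w (if j = m then 0 else Suc j) 0 x" if "j \<le> m" for j x
        proof (cases "j = m")
          case True
          have "\<alpha> + real m * \<alpha> = 2 * pi" using m\<alpha> by (simp add: algebra_simps)
          then show ?thesis using True by (simp add: w_def rot_2pi)
        qed (simp add: w_def algebra_simps)
        then have "(\<Sum>j\<le>m. lp_coord p m c j * w j \<alpha> x) = (\<Sum>j\<le>m. lp_coord p m (cyc m c) j * w j 0 x)" for x
          unfolding sum_lp_coord_cyc[OF m(2)] by (intro sum.cong refl) simp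
        then show "(\<lambda>x. \<Sum>j\<le>m. lp_coord p m (fst (c, \<alpha>)) j * w j (snd (c, \<alpha>)) x) =
          (\<lambda>x. \<Sum>j\<le>m. lp_coord p m (fst (cyc m c, 0)) j * w j (snd (cyc m c, 0::real)) x)" by simp
      qed
    qed
  qed
  then show ?thesis by (simp only: m(3))
qed

text \<open>The closed form of \<open>slice\<close> after any orthogonal map that sends
  \<open>\<nu>\<close> to the axis. It involves \<open>\<nu>\<close> alone, so it is continuous in
  \<open>\<nu>\<close> although the orthogonal maps are chosen separately for each
  \<open>\<nu>\<close>.\<close>

definition axial :: "'n \<Rightarrow> real^'n \<Rightarrow> real \<Rightarrow> real^'n \<Rightarrow> real^'n \<Rightarrow> real^'n" where
  "axial a \<omega> \<delta> \<nu> x = sqrt ((norm x)\<^sup>2 - (x \<bullet> \<nu>)\<^sup>2 + \<delta>\<^sup>2) *\<^sub>R \<omega> + (x \<bullet> \<nu>) *\<^sub>R axis a 1"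

definition axial_derivative :: "'n \<Rightarrow> real^'n \<Rightarrow> real \<Rightarrow> real^'n \<Rightarrow> real^'n \<Rightarrow> real^'n \<Rightarrow> real^'n" where
  "axial_derivative a \<omega> \<delta> \<nu> x h =
     ((x \<bullet> h - (x \<bullet> \<nu>) * (h \<bullet> \<nu>)) / sqrt ((norm x)\<^sup>2 - (x \<bullet> \<nu>)\<^sup>2 + \<delta>\<^sup>2)) *\<^sub>R \<omega> + (h \<bullet> \<nu>) *\<^sub>R axis a 1"

lemma axial_slice:
  fixes R :: "real^'n \<Rightarrow> real^'n"
  assumes R: "orthogonal_transformation R" "R \<nu> = axis a 1"
  shows "axial a \<omega> \<delta> \<nu> x = slice a \<omega> \<delta> (R x)" and "R x $ a = x \<bullet> \<nu>"
    and "(norm (perp a (R x)))\<^sup>2 = (norm x)\<^sup>2 - (x \<bullet> \<nu>)\<^sup>2"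
proof -
  have "R x $ a = R x \<bullet> R \<nu>" using R(2) by (simp add: inner_axis)
  also have "\<dots> = x \<bullet> \<nu>" using R(1) by (simp add: orthogonal_transformation_def)
  finally show 1: "R x $ a = x \<bullet> \<nu>" .
  show 2: "(norm (perp a (R x)))\<^sup>2 = (norm x)\<^sup>2 - (x \<bullet> \<nu>)\<^sup>2"
    unfolding norm_perp 1 using orthogonal_transformation_norm[OF R(1)] by simp
  have nonneg: "(norm x)\<^sup>2 - (x \<bullet> \<nu>)\<^sup>2 + \<delta>\<^sup>2 \<ge> 0" unfolding 2[symmetric] by simp
  show "axial a \<omega> \<delta> \<nu> x = slice a \<omega> \<delta> (R x)"
    unfolding axial_def slice_def 1 2 using powr_half_sqrt[OF nonneg] by simp
qed

lemma has_derivative_axial: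
  fixes R :: "real^'n \<Rightarrow> real^'n"
  assumes R: "orthogonal_transformation R" "R \<nu> = axis a 1" and \<delta>: "\<delta> \<noteq> 0"
  shows "(axial a \<omega> \<delta> \<nu> has_derivative axial_derivative a \<omega> \<delta> \<nu> x) (at x)"
proof -
  have lin: "linear R" using R(1) by (rule orthogonal_transformation_linear)
  \<comment> \<open>Orthogonal maps preserve inner products, so \<open>R\<close> disappears from the
    derivative as well.\<close>
  have "perp a (R x) \<bullet> R h = x \<bullet> h - (x \<bullet> \<nu>) * (h \<bullet> \<nu>)" for h
  proof -
    have "perp a (R x) \<bullet> R h = R x \<bullet> R h - R x $ a * R h $ a"
      by (simp add: perp_def inner_diff_left inner_axis')
    then show ?thesis unfolding axial_slice(2)[OF R] using R(1) by (simp add: orthogonal_transformation_def)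
  qed
  then show ?thesis
    using has_derivative_compose[OF linear_imp_has_derivative[OF lin] has_derivative_slice[OF \<delta>, of a \<omega> "R x"]]
    unfolding axial_slice(2,3)[OF R] axial_slice(1)[OF R, symmetric] axial_derivative_def[abs_def]
    by simp
qed

lemma orthogonal_transformation_to_axis:
  fixes \<nu> :: "real^'n" and a :: 'n
  assumes "norm \<nu> = 1"
  shows "\<exists>R :: real^'n \<Rightarrow> real^'n. orthogonal_transformation R \<and> R \<nu> = axis a 1"
proof -
  obtain R :: "real^'n \<Rightarrow> real^'n" where "orthogonal_transformation R" "R \<nu> = axis a 1"
    by (rule orthogonal_transformation_exists_1[OF assms norm_axis_1[of a]])
  then show ?thesis by blast
qed

theorem variational_eigenvalue_le_reflections:
  fixes \<Omega> :: "(real^'n) set"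
  assumes N: "CARD('n) \<ge> 2" and \<Omega>: "open \<Omega>" "bounded \<Omega>" "radially_symmetric \<Omega>" and p: "p > 1" and \<delta>: "\<delta> > 0"
    and \<phi>: "test_function W \<phi>" and tf: "test_function {x \<in> \<Omega>. x $ a > 0} (\<lambda>x. \<phi> (slice a \<omega> \<delta> x))"
    and unit: "(\<integral>x. norm (\<phi> (slice a \<omega> \<delta> x)) powr p \<partial>lborel) = 1"
    and en: "(\<integral>x. norm (grad (\<lambda>x. \<phi> (slice a \<omega> \<delta> x)) x) powr p \<partial>lborel) \<le> \<mu>"
  shows "variational_eigenvalue p \<Omega> (CARD('n) + 1) \<le> ereal \<mu>"
proof -
  interpret sobolev_domain \<Omega> p by unfold_locales (use \<Omega> p in auto)
  \<comment> \<open>The directions \<open>\<nu>\<close> form a sphere of dimension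
    \<open>n + 1\<close>. The genus bound \<open>CARD('n) + 1 = Suc n + 2\<close> corresponds to
    maps into a sphere of that same dimension, so degrees are available.\<close>
  obtain n where n: "CARD('n) = n + 2" using N by (metis add.commute le_Suc_ex)
  obtain b where b: "bij_betw b (UNIV :: 'n set) {..Suc n}"
  proof -
    have "\<exists>b. bij_betw b (UNIV :: 'n set) {..Suc n}"
      by (rule finite_same_card_bij) (simp_all add: n)
    then show ?thesis using that by blast
  qed
  define dir :: "(nat \<Rightarrow> real) \<Rightarrow> real^'n" where "dir y = (\<chi> i. y (b i))" for y
  have norm_dir: "norm (dir y) = 1" if "y \<in> sph (Suc n)" for y
  proof -
    have "(\<Sum>i\<in>UNIV. (y (b i))\<^sup>2) = (\<Sum>j\<le>Suc n. (y j)\<^sup>2)" by (rule sum.reindex_bij_betw[OF b])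
    then show ?thesis using that by (simp add: dir_def norm_vec_def L2_set_def sph_def)
  qed
  have dir_neg: "dir (\<lambda>i. - y i) = - dir y" for y by (simp add: dir_def vec_eq_iff)
  let ?H = "\<lambda>\<nu>. {x \<in> \<Omega>. x \<bullet> \<nu> > 0}"
  let ?v = "\<lambda>\<nu> x. \<phi> (axial a \<omega> \<delta> \<nu> x)"
  have v: "test_function (?H \<nu>) (?v \<nu>)" "(\<integral>x. norm (?v \<nu> x) powr p \<partial>M) = 1"
    "(\<integral>x. norm (grad (?v \<nu>) x) powr p \<partial>M) \<le> \<mu>" if \<nu>: "norm \<nu> = 1" for \<nu>
  proof -
    obtain R :: "real^'n \<Rightarrow> real^'n" where R: "orthogonal_transformation R" "R \<nu> = axis a 1" using orthogonal_transformation_to_axis[OF \<nu>] by blast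
    have nR: "norm (R x) = norm x" for x by (rule orthogonal_transformation_norm[OF R(1)])
    have "R x \<in> \<Omega> \<longleftrightarrow> x \<in> \<Omega>" for x
      using \<Omega>(3)[unfolded radially_symmetric_def, rule_format, OF _ nR[of x]]
        \<Omega>(3)[unfolded radially_symmetric_def, rule_format, OF _ nR[of x, symmetric]] by blast
    then have H: "{x. R x \<in> {x \<in> \<Omega>. x $ a > 0}} = ?H \<nu>" by (simp add: axial_slice(2)[OF R])
    have v_eq: "?v \<nu> = (\<lambda>x. \<phi> (slice a \<omega> \<delta> (R x)))" by (simp add: axial_slice(1)[OF R])
    show tv: "test_function (?H \<nu>) (?v \<nu>)"
      using test_function_orthogonal[OF R(1) tf] unfolding H v_eq .
    have sub: "?H \<nu> \<subseteq> \<Omega>" by auto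
    show "(\<integral>x. norm (?v \<nu> x) powr p \<partial>M) = 1"
      using integral_test_function_lborel(1)[OF \<Omega>(1) tv sub p_pos]
        integral_test_function_orthogonal(1)[OF R(1) tf p_pos] unit unfolding axial_slice(1)[OF R] by simp
    show "(\<integral>x. norm (grad (?v \<nu>) x) powr p \<partial>M) \<le> \<mu>"
      using integral_test_function_lborel(2)[OF \<Omega>(1) tv sub p_pos]
        integral_test_function_orthogonal(2)[OF R(1) tf p_pos] en unfolding axial_slice(1)[OF R] by simp
  qed
  \<comment> \<open>Two copies in opposite half-spaces; only the indices 0 and 1 occur.\<close>
  define \<nu> where "\<nu> j y = (if j = 0 then dir y else - dir y)" for j :: nat and y
  have norm_\<nu>: "norm (\<nu> j y) = 1" if "y \<in> sph (Suc n)" for j y using norm_dir[OF that] by (simp add: \<nu>_def)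
  define w where "w j y = ?v (\<nu> j y)" for j :: nat and y
  have c\<nu>: "continuous_on (sph (Suc n) \<times> UNIV) (\<lambda>s::(nat \<Rightarrow> real) \<times> (real^'n). \<nu> j (fst s))" for j
  proof -
    have "continuous_on (sph (Suc n) \<times> UNIV) (\<lambda>s::(nat \<Rightarrow> real) \<times> (real^'n). dir (fst s))"
      unfolding dir_def
      by (intro continuous_on_vec_lambda continuous_on_compose2[OF continuous_on_coordinate[of UNIV] continuous_on_fst] continuous_on_id) auto
    then show ?thesis by (cases "j = 0") (auto simp: \<nu>_def intro: continuous_on_minus)
  qed
  have "variational_eigenvalue p \<Omega> (Suc n + 2) \<le> ereal \<mu>"
  proof (rule variational_eigenvalue_le_disjoint[of "sph (Suc n)" 1 "\<lambda>j y. ?H (\<nu> j y)" w])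
    show "compact (sph (Suc n))" by (rule compact_sph)
    show "sph (Suc n) \<noteq> {}" using base_in_sph by blast
    show "test_function (?H (\<nu> j y)) (w j y)" "(\<integral>x. norm (w j y x) powr p \<partial>M) = 1"
      "(\<integral>x. norm (grad (w j y) x) powr p \<partial>M) \<le> \<mu>" if "y \<in> sph (Suc n)" for j y
      unfolding w_def using v[OF norm_\<nu>[OF that, of j]] by simp_all
    show "?H (\<nu> j y) \<subseteq> \<Omega>" for j y by auto
    show "?H (\<nu> i y) \<inter> ?H (\<nu> j y) = {}" if "i \<le> 1" "j \<le> 1" "i \<noteq> j" for i j y
      using that by (auto simp: \<nu>_def)
    have ca: "continuous_on (sph (Suc n) \<times> UNIV) (\<lambda>(y, x). axial a \<omega> \<delta> (\<nu> j y) x)" for j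
      unfolding axial_def case_prod_unfold by (intro continuous_intros c\<nu>)
    show "continuous_on (sph (Suc n) \<times> UNIV) (\<lambda>(y, x). w j y x)" for j
      unfolding w_def by (rule continuous_on_compose_family[OF \<phi> ca])
    show "continuous_on (sph (Suc n) \<times> UNIV) (\<lambda>(y, x). grad (w j y) x)" for j
      unfolding w_def
    proof (rule continuous_on_grad_compose_family[OF \<phi> ca])
      show "(axial a \<omega> \<delta> (\<nu> j y) has_derivative axial_derivative a \<omega> \<delta> (\<nu> j y) x) (at x)"
        if y: "y \<in> sph (Suc n)" for y x
      proof -
        obtain R :: "real^'n \<Rightarrow> real^'n" where R: "orthogonal_transformation R" "R (\<nu> j y) = axis a 1"
          using orthogonal_transformation_to_axis[OF norm_\<nu>[OF y, of j]] by blast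
        show ?thesis by (rule has_derivative_axial[OF R]) (use \<delta> in simp)
      qed
      \<comment> \<open>By Cauchy-Schwarz the radicand is at least the square of
        \<open>\<delta>\<close>, so the quotient in the derivative is continuous.\<close>
      have pos: "sqrt ((norm (snd s))\<^sup>2 - (snd s \<bullet> \<nu> j (fst s))\<^sup>2 + \<delta>\<^sup>2) \<noteq> 0"
        if "s \<in> sph (Suc n) \<times> UNIV" for s :: "(nat \<Rightarrow> real) \<times> (real^'n)"
      proof -
        have "\<bar>snd s \<bullet> \<nu> j (fst s)\<bar> \<le> norm (snd s)"
          using Cauchy_Schwarz_ineq2[of "snd s" "\<nu> j (fst s)"] norm_\<nu>[of "fst s" j] that by auto
        then have "(snd s \<bullet> \<nu> j (fst s))\<^sup>2 \<le> (norm (snd s))\<^sup>2" by (simp add: abs_le_square_iff[symmetric])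
        moreover have "\<delta>\<^sup>2 > 0" using \<delta> by simp
        ultimately have "(norm (snd s))\<^sup>2 - (snd s \<bullet> \<nu> j (fst s))\<^sup>2 + \<delta>\<^sup>2 > 0" by linarith
        then show ?thesis by simp
      qed
      show "continuous_on (sph (Suc n) \<times> UNIV) (\<lambda>(y, x). axial_derivative a \<omega> \<delta> (\<nu> j y) x (axis i 1) $ l)" for i l
        unfolding axial_derivative_def case_prod_unfold
        by (intro bounded_linear.continuous_on[OF bounded_linear_vec_nth] continuous_on_add continuous_on_scaleR
            continuous_on_divide continuous_on_diff continuous_on_mult continuous_on_inner continuous_on_snd
            continuous_on_const continuous_on_id c\<nu> continuous_on_real_sqrt continuous_on_power continuous_on_norm)
          (use pos in blast)
    qed
    fix F :: "(nat \<Rightarrow> real) \<times> (nat \<Rightarrow> real) \<Rightarrow> nat \<Rightarrow> real"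
    let ?h = "\<lambda>c y x. \<Sum>j\<le>1. lp_coord p 1 c j * w j y x"
    assume cont: "continuous_on (sph 1 \<times> sph (Suc n)) F"
      and im: "\<And>c y. c \<in> sph 1 \<Longrightarrow> y \<in> sph (Suc n) \<Longrightarrow> F (c, y) \<in> sph (Suc n)"
      and resp: "\<And>c y c' y'. c \<in> sph 1 \<Longrightarrow> y \<in> sph (Suc n) \<Longrightarrow> c' \<in> sph 1 \<Longrightarrow> y' \<in> sph (Suc n) \<Longrightarrow>
        (\<lambda>x. \<Sum>j\<le>1. lp_coord p 1 (fst (c, y)) j * w j (snd (c, y)) x) =
        (\<lambda>x. \<Sum>j\<le>1. lp_coord p 1 (fst (c', y')) j * w j (snd (c', y')) x) \<Longrightarrow> F (c, y) = F (c', y')"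
      and odd: "\<And>c y. c \<in> sph 1 \<Longrightarrow> y \<in> sph (Suc n) \<Longrightarrow> F (\<lambda>i. - c i, y) = (\<lambda>i. - F (c, y) i)"
    show False
    proof (rule no_odd_map_with_antipodal_swap[of n "\<lambda>c y. F (c, y)"])
      show "continuous_on (sph 1 \<times> sph (Suc n)) (\<lambda>(c, y). F (c, y))" using cont by (simp add: case_prod_unfold)
      show "F (c, y) \<in> sph (Suc n)" if "c \<in> sph 1" "y \<in> sph (Suc n)" for c y by (rule im[OF that])
      show "F (\<lambda>i. - c i, y) = (\<lambda>i. - F (c, y) i)" if "c \<in> sph 1" "y \<in> sph (Suc n)" for c y by (rule odd[OF that])
      fix c y assume c: "c \<in> sph 1" and y: "y \<in> sph (Suc n)"
      show "F (cyc 1 c, \<lambda>i. - y i) = F (c, y)"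
      proof (rule resp[OF cyc_in_sph[OF c] _ c y])
        show "(\<lambda>i. - y i) \<in> sph (Suc n)" using y by (simp add: sph_neg)
        \<comment> \<open>Reversing the direction exchanges the two half-spaces, which an exchange
          of the coefficients compensates.\<close>
        have "w (if j = 1 then 0 else Suc j) (\<lambda>i. - y i) x = w j y x" if "j \<le> 1" for j x
          using that by (auto simp: w_def \<nu>_def dir_neg le_Suc_eq)
        then have "(\<Sum>j\<le>1. lp_coord p 1 (cyc 1 c) j * w j (\<lambda>i. - y i) x) = (\<Sum>j\<le>1. lp_coord p 1 c j * w j y x)" for x
          unfolding sum_lp_coord_cyc[OF order_refl] by (intro sum.cong refl) simp
        then show "(\<lambda>x. \<Sum>j\<le>1. lp_coord p 1 (fst (cyc 1 c, \<lambda>i. - y i)) j * w j (snd (cyc 1 c, \<lambda>i. - y i)) x) =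
          (\<lambda>x. \<Sum>j\<le>1. lp_coord p 1 (fst (c, y)) j * w j (snd (c, y)) x)" by simp
      qed
    qed
  qed
  then show ?thesis by (simp add: n)
qed

theorem theorem1p1:
  fixes \<Omega> :: "(real^'n) set" and e :: "nat \<Rightarrow> 'n" and p :: real and k :: nat
  assumes "CARD('n) \<ge> 2"
    and "bij_betw e {1..CARD('n)} UNIV"
    and "open \<Omega>" and "connected \<Omega>" and "\<Omega> \<noteq> {}" and "bounded \<Omega>"
    and "radially_symmetric \<Omega>"
    and "p > 1" and "k \<ge> 1"
  shows "(\<forall>j\<in>{2..CARD('n)}. variational_eigenvalue p \<Omega> j \<le> variational_eigenvalue p \<Omega> (j + 1))
    \<and> variational_eigenvalue p \<Omega> (CARD('n) + 1) \<le> symmetric_eigenvalue e p \<Omega> 1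
    \<and> variational_eigenvalue p \<Omega> (2 * k) \<le> variational_eigenvalue p \<Omega> (2 * k + 1)
    \<and> variational_eigenvalue p \<Omega> (2 * k + 1) \<le> symmetric_eigenvalue e p \<Omega> k"
proof -
  let ?P = "e (CARD('n) - 1)" and ?Q = "e (CARD('n))"
  note N = \<open>CARD('n) \<ge> 2\<close>
  have p: "p > 0" using \<open>p > 1\<close> by simp
  have PQ: "?P \<noteq> ?Q"
  proof
    assume "?P = ?Q"
    then have "CARD('n) - 1 = CARD('n)"
      by (rule inj_onD[OF bij_betw_imp_inj_on[OF assms(2)]]) (use N in auto)
    then show False using N by simp
  qed
  \<comment> \<open>Stated for every \<open>l\<close>, because the wedge of index \<open>k\<close>
    and the half-space, \<open>l = 1\<close>, both start from such a test function.\<close>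
  have test: "\<exists>\<phi>. test_function (\<Omega> \<inter> sector ?P ?Q (pi / real l)) \<phi> \<and>
      (\<integral>x. norm (grad \<phi> x) powr p \<partial>lborel) < \<mu> * (\<integral>x. norm (\<phi> x) powr p \<partial>lborel)"
    if l: "l \<ge> 1" and C: "C \<in> Lp_sphere p (wedge e \<Omega> l)" and e: "energy p (wedge e \<Omega> l) C < \<mu>" for l C \<mu>
  proof -
    have "pi / real l > 0" "pi / real l \<le> pi" using l by (auto simp: divide_le_eq)
    then have op: "open (wedge e \<Omega> l)" unfolding wedge_eq[OF N l] using \<open>open \<Omega>\<close> by (intro open_Int open_sector)
    have bd: "bounded (wedge e \<Omega> l)" unfolding wedge_eq[OF N l] using \<open>bounded \<Omega>\<close> by (intro bounded_Int disjI1)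
    interpret W: sobolev_domain "wedge e \<Omega> l" p by unfold_locales (use op bd \<open>p > 1\<close> in auto)
    obtain \<phi> where \<phi>: "test_function (wedge e \<Omega> l) \<phi>"
      "(\<integral>x. norm (grad \<phi> x) powr p \<partial>W.M) < \<mu> * (\<integral>x. norm (\<phi> x) powr p \<partial>W.M)"
      by (rule W.Lp_sphere_approximation[OF C e])
    show ?thesis using \<phi>(1) \<phi>(2)[unfolded integral_test_function_lborel(1,2)[OF op \<phi>(1) order_refl p]]
      unfolding wedge_eq[OF N l] by blast
  qed
  have k_case: "variational_eigenvalue p \<Omega> (2 * k + 1) \<le> symmetric_eigenvalue e p \<Omega> k"
    unfolding symmetric_eigenvalue_def
  proof (rule le_first_eigenvalue)
    fix C \<mu> assume "C \<in> Lp_sphere p (wedge e \<Omega> k)" "energy p (wedge e \<Omega> k) C < \<mu>"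
    from test[OF \<open>k \<ge> 1\<close> this] obtain \<phi> where \<phi>: "test_function (\<Omega> \<inter> sector ?P ?Q (pi / real k)) \<phi>"
      "(\<integral>x. norm (grad \<phi> x) powr p \<partial>lborel) < \<mu> * (\<integral>x. norm (\<phi> x) powr p \<partial>lborel)" by blast
    obtain c where c: "(\<integral>x. norm (c * \<phi> x) powr p \<partial>lborel) = 1"
      "(\<integral>x. norm (grad (\<lambda>x. c * \<phi> x) x) powr p \<partial>lborel) < \<mu>"
      by (rule normalize_test_function[OF \<phi>(1) p \<phi>(2)])
    show "variational_eigenvalue p \<Omega> (2 * k + 1) \<le> ereal \<mu>"
      by (rule variational_eigenvalue_le_rotations[OF \<open>open \<Omega>\<close> \<open>bounded \<Omega>\<close> \<open>radially_symmetric \<Omega>\<close> \<open>p > 1\<close> PQ \<open>k \<ge> 1\<close>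
            test_function_scale[OF \<phi>(1)] c(1) less_imp_le[OF c(2)]])
  qed
  have N_case: "variational_eigenvalue p \<Omega> (CARD('n) + 1) \<le> symmetric_eigenvalue e p \<Omega> 1"
    unfolding symmetric_eigenvalue_def
  proof (rule le_first_eigenvalue)
    fix C \<mu> assume C: "C \<in> Lp_sphere p (wedge e \<Omega> 1)" "energy p (wedge e \<Omega> 1) C < \<mu>"
    \<comment> \<open>For the opening \<open>pi\<close> both half-plane conditions reduce to
      positivity of the last coordinate, so \<open>?Q\<close> is the axis of the
      symmetrization.\<close>
    have half: "\<Omega> \<inter> sector ?P ?Q (pi / real 1) = {x \<in> \<Omega>. x $ ?Q > 0}"
      by (auto simp: sector_eq)
    obtain \<phi> where \<phi>: "test_function {x \<in> \<Omega>. x $ ?Q > 0} \<phi>"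
      "(\<integral>x. norm (grad \<phi> x) powr p \<partial>lborel) < \<mu> * (\<integral>x. norm (\<phi> x) powr p \<partial>lborel)"
      using test[OF order_refl C] unfolding half by blast
    obtain \<omega> \<delta> where \<omega>: "norm \<omega> = 1" "\<omega> $ ?Q = 0" "\<delta> > 0"
      and tf: "test_function {x \<in> \<Omega>. x $ ?Q > 0} (\<lambda>x. \<phi> (slice ?Q \<omega> \<delta> x))"
      and less: "(\<integral>x. norm (grad (\<lambda>x. \<phi> (slice ?Q \<omega> \<delta> x)) x) powr p \<partial>lborel)
        < \<mu> * (\<integral>x. norm (\<phi> (slice ?Q \<omega> \<delta> x)) powr p \<partial>lborel)"
      by (rule axially_symmetric_test_function[OF N \<open>open \<Omega>\<close> \<open>radially_symmetric \<Omega>\<close> \<open>p > 1\<close> \<phi>])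
    obtain c where c: "(\<integral>x. norm (c * \<phi> (slice ?Q \<omega> \<delta> x)) powr p \<partial>lborel) = 1"
      "(\<integral>x. norm (grad (\<lambda>x. c * \<phi> (slice ?Q \<omega> \<delta> x)) x) powr p \<partial>lborel) < \<mu>"
      by (rule normalize_test_function[OF tf p less])
    show "variational_eigenvalue p \<Omega> (CARD('n) + 1) \<le> ereal \<mu>"
      by (rule variational_eigenvalue_le_reflections[OF N \<open>open \<Omega>\<close> \<open>bounded \<Omega>\<close> \<open>radially_symmetric \<Omega>\<close> \<open>p > 1\<close> \<omega>(3)
            test_function_scale[OF \<phi>(1)] test_function_scale[OF tf] c(1) less_imp_le[OF c(2)]])
  qed
  \<comment> \<open>The remaining inequalities are monotonicity: a larger genus bound admits fewer
    sets.\<close>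
  show ?thesis using k_case N_case variational_eigenvalue_mono[of p \<Omega>] by simp
qed

end
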